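(* Let $(\mathfrak A,\alpha,\omega)$ be a $C^*$-dynamical system with $\mathfrak A$ separable and $s(\omega)\in Z(\mathfrak A^{**})$. Fix $k\in\mathbb Z\setminus\{-1,0\}$ and $l\in\mathbb Z\setminus\{0\}$. Suppose that $\pi_\omega(\mathfrak A)'\cap\{U_\omega^l\}'\subset\mathfrak Z_\omega$, where $\mathfrak Z_\omega=\pi_\omega(\mathfrak A)''\cap\pi_\omega(\mathfrak A)'$. Let $\mathfrak X$ be the norm closure of $\pi_\omega(\mathfrak A)''+\pi_\omega(\mathfrak A)'$ in $\mathcal B(\mathcal H_\omega)$. Then for each $X\in\mathfrak X$, $$\mathop{\rm s\text{-}lim}_{N\to+\infty}\frac1N\sum_{n=0}^{N-1}U_\omega^{nkl}XU_\omega^{nl}=V_X,$$ where the limit is in the strong operator topology and $V_X$ is the bounded linear operator on $\mathcal H_\omega$, corresponding to the unitary $U_\omega^l$ and the pair $(k,k+1)$, defined in the context.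
   Context: A (discrete) $C^*$-dynamical system $(\mathfrak A,\alpha,\omega)$ consists of a unital $C^*$-algebra $\mathfrak A$, a $*$-automorphism $\alpha$, and a state $\omega$ with $\omega\circ\alpha=\omega$. $s(\omega)$ is the support of $\omega$ in the bidual $\mathfrak A^{**}$ and $Z(\cdot)$ denotes the centre; $s(\omega)\in Z(\mathfrak A^{**})$ is equivalent to the GNS vector being separating for $\pi_\omega(\mathfrak A)''$. Inner products are linear in the first variable. $(\mathcal H_\omega,\pi_\omega,U_\omega,\Omega)$ is the covariant GNS representation: $\omega(A)=\langle\pi_\omega(A)\Omega,\Omega\rangle$, $U_\omega\Omega=\Omega$, $U_\omega\pi_\omega(A)U_\omega^*=\pi_\omega(\alpha(A))$. Decomposition. Put $\beta=\alpha^l$ and let $\partial\mathcal E$ be the set of extreme points of the set of $\beta$-invariant states of $\mathfrak A$. Let $\mathfrak Z=\pi_\omega(\mathfrak A)'\cap\{U_\omega^l\}'$ (Abelian by hypothesis), and let $\nu$ be the orthogonal measure on the state space $\mathcal S(\mathfrak A)$ associated to $\mathfrak Z$, i.e. the probability measure with barycentre $\omega$ determined by $$\int \psi(A_1)\cdots\psi(A_m)\,d\nu(\psi)=\langle\pi_\omega(A_1)P\pi_\omega(A_2)P\cdots P\pi_\omega(A_m)\Omega,\Omega\rangle,$$ $P$ being the projection onto $\overline{\mathfrak Z\Omega}$. It is supported on $\partial\mathcal E$. For $\psi\in\partial\mathcal E$ let $(\mathcal H_\psi,\pi_\psi,U_\psi,\Psi)$ be the covariant GNS representation of $(\mathfrak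 A,\beta,\psi)$. Then $\mathcal H_\omega$ is identified with $\int^\oplus_{\partial\mathcal E}\mathcal H_\psi\,d\nu(\psi)$ (measurable structure generated by the fields $\psi\mapsto\pi_\psi(A)\Psi$, $A\in\mathfrak A$), with $\pi_\omega=\int^\oplus\pi_\psi\,d\nu(\psi)$, $U_\omega^l=\int^\oplus U_\psi\,d\nu(\psi)$, $\Omega=\int^\oplus\Psi\,d\nu(\psi)$, and $\mathfrak Z$ identified with the diagonalisable operators. For $\psi$ in a measurable set $F\subset\partial\mathcal E$ of full measure, $s(\psi)\in Z(\mathfrak A^{**})$. Operators $V(\psi)$. Write $\sigma_{\rm pp}(U_\psi)$ for the set of eigenvalues of $U_\psi$. For $\psi\in F$ and $v\in\sigma_{\rm pp}(U_\psi)$ the eigenspace is one-dimensional, equal to $\mathbb CV_v\Psi=\mathbb CW_v\Psi$ with unitaries $V_v\in\pi_\psi(\mathfrak A)''$, $W_v\in\pi_\psi(\mathfrak A)'$, unique up to a phase, such that $U_\psi V_vU_\psi^*=vV_v$, $U_\psi W_vU_\psi^*=vW_v$. Define the partial isometry $V(\psi):\mathcal H_\psi\otimes\mathcal H_\psi\to\mathcal H_\psi$ by $$V(\psi)(\eta\otimes\xi)=\sum_{(v,w)\in\sigma_{\rm pp}(U_\psi)^2,\;v^{k}w^{k+1}=1}\langle\eta\otimes\xi,V_v\Psi\otimes W_w\Psi\rangle\,V_vW_w\Psi,$$ and $V(\psi)=0$ for $\psi\notin F$. The field $V(\psi)$ is measurable; put $V=\int^\oplus_{\partial\mathcal E}V(\psi)\,d\nu(\psi):\int^\oplus\mathcal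 H_\psi\otimes\mathcal H_\psi\,d\nu(\psi)\to\mathcal H_\omega$. Operator $V_X$. For $X\in\mathfrak X$ (so that $X$ is decomposable and the field $\psi\mapsto(X\Omega)(\psi)$ is essentially bounded), $$V_X\xi=V\int^\oplus_{\partial\mathcal E}(X\Omega)(\psi)\otimes\xi(\psi)\,d\nu(\psi),\qquad\xi\in\mathcal H_\omega.$$ *)

theory Defs
  imports "HOL-Probability.Probability"
begin

class complex_normed_vector = real_normed_vector +
  fixes scaleC :: "complex \<Rightarrow> 'a \<Rightarrow> 'a"  (infixr "*\<^sub>C" 75)
  assumes scaleC_add_right: "c *\<^sub>C (x + y) = c *\<^sub>C x + c *\<^sub>C y"
    and scaleC_add_left: "(c + d) *\<^sub>C x = c *\<^sub>C x + d *\<^sub>C x"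
    and scaleC_scaleC: "c *\<^sub>C d *\<^sub>C x = (c * d) *\<^sub>C x"
    and scaleC_of_real: "complex_of_real r *\<^sub>C x = r *\<^sub>R x"
    and norm_scaleC: "norm (c *\<^sub>C x) = cmod c * norm x"

text \<open>The inner product is linear in the first variable.\<close>

class complex_hilbert_space = complex_normed_vector + complete_space +
  fixes cinner :: "'a \<Rightarrow> 'a \<Rightarrow> complex"
  assumes cinner_add_left: "cinner (x + y) z = cinner x z + cinner y z"
    and cinner_scaleC_left: "cinner (c *\<^sub>C x) y = c * cinner x y"
    and cinner_commute: "cinner y x = cnj (cinner x y)"
    and cinner_self: "cinner x x = complex_of_real ((norm x)\<^sup>2)"

class unital_cstar_algebra = complex_normed_vector + real_normed_algebra_1 + complete_space +
  fixes star :: "'a \<Rightarrow> 'a"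
  assumes scaleC_mult_left: "(c *\<^sub>C a) * b = c *\<^sub>C (a * b)"
    and scaleC_mult_right: "a * (c *\<^sub>C b) = c *\<^sub>C (a * b)"
    and star_add: "star (a + b) = star a + star b"
    and star_scaleC: "star (c *\<^sub>C a) = cnj c *\<^sub>C star a"
    and star_mult: "star (a * b) = star b * star a"
    and star_star: "star (star a) = a"
    and cstar_identity: "norm (star a * a) = (norm a)\<^sup>2"


subsection \<open>States and dynamical systems\<close>

definition functional_linear :: "('a::complex_normed_vector \<Rightarrow> complex) \<Rightarrow> bool" where
  "functional_linear \<phi> \<longleftrightarrow>
     (\<forall>a b. \<phi> (a + b) = \<phi> a + \<phi> b) \<and> (\<forall>c a. \<phi> (c *\<^sub>C a) = c * \<phi> a)"

definition states :: "('a::unital_cstar_algebra \<Rightarrow> complex) set" where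
  "states = {\<phi>. functional_linear \<phi> \<and>
     (\<forall>a. \<phi> (star a * a) \<in> \<real> \<and> 0 \<le> Re (\<phi> (star a * a))) \<and> \<phi> 1 = 1}"

definition star_automorphism :: "('a::unital_cstar_algebra \<Rightarrow> 'a) \<Rightarrow> bool" where
  "star_automorphism \<alpha> \<longleftrightarrow> bij \<alpha> \<and>
     (\<forall>a b. \<alpha> (a + b) = \<alpha> a + \<alpha> b) \<and> (\<forall>c a. \<alpha> (c *\<^sub>C a) = c *\<^sub>C \<alpha> a) \<and>
     (\<forall>a b. \<alpha> (a * b) = \<alpha> a * \<alpha> b) \<and> (\<forall>a. \<alpha> (star a) = star (\<alpha> a))"

definition invariant_states :: "('a::unital_cstar_algebra \<Rightarrow> 'a) \<Rightarrow> ('a \<Rightarrow> complex) set" where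
  "invariant_states \<alpha> = {\<phi> \<in> states. \<phi> \<circ> \<alpha> = \<phi>}"

definition cstar_dynamical_system ::
  "('a::unital_cstar_algebra \<Rightarrow> 'a) \<Rightarrow> ('a \<Rightarrow> complex) \<Rightarrow> bool" where
  "cstar_dynamical_system \<alpha> \<omega> \<longleftrightarrow> star_automorphism \<alpha> \<and> \<omega> \<in> invariant_states \<alpha>"

definition ergodic_states :: "('a::unital_cstar_algebra \<Rightarrow> 'a) \<Rightarrow> ('a \<Rightarrow> complex) set" where
  "ergodic_states \<beta> = {\<psi> \<in> invariant_states \<beta>.
     \<forall>\<phi>\<^sub>1 \<in> invariant_states \<beta>. \<forall>\<phi>\<^sub>2 \<in> invariant_states \<beta>. \<forall>t. 0 < t \<and> t < 1 \<and>
       \<psi> = (\<lambda>a. complex_of_real t * \<phi>\<^sub>1 a + complex_of_real (1 - t) * \<phi>\<^sub>2 a)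
       \<longrightarrow> \<phi>\<^sub>1 = \<psi> \<and> \<phi>\<^sub>2 = \<psi>}"

definition int_iter :: "('x \<Rightarrow> 'x) \<Rightarrow> int \<Rightarrow> 'x \<Rightarrow> 'x" where
  "int_iter f m = (if 0 \<le> m then f ^^ nat m else (inv f) ^^ nat (- m))"


subsection \<open>The bidual and supports of states\<close>

definition dual :: "('a::unital_cstar_algebra \<Rightarrow> complex) set" where
  "dual = {\<phi>. functional_linear \<phi> \<and> (\<exists>K. \<forall>a. cmod (\<phi> a) \<le> K * norm a)}"

text \<open>Elements of the bidual are functionals on the dual, set to zero outside the dual so that
  equality of elements is equality of functions. The product is the (first) Arens product, for
  which the bidual of a C*-algebra is its enveloping von Neumann algebra.\<close>

definition bidual :: "(('a::unital_cstar_algebra \<Rightarrow> complex) \<Rightarrow> complex) set" where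
  "bidual = {x. (\<forall>\<phi>\<in>dual. \<forall>\<theta>\<in>dual. x (\<lambda>a. \<phi> a + \<theta> a) = x \<phi> + x \<theta>) \<and>
     (\<forall>c. \<forall>\<phi>\<in>dual. x (\<lambda>a. c * \<phi> a) = c * x \<phi>) \<and>
     (\<exists>K. \<forall>\<phi>\<in>dual. cmod (x \<phi>) \<le> K * onorm \<phi>) \<and> (\<forall>\<phi>. \<phi> \<notin> dual \<longrightarrow> x \<phi> = 0)}"

definition bidual_mult ::
  "(('a::unital_cstar_algebra \<Rightarrow> complex) \<Rightarrow> complex) \<Rightarrow> (('a \<Rightarrow> complex) \<Rightarrow> complex)
    \<Rightarrow> ('a \<Rightarrow> complex) \<Rightarrow> complex" where
  "bidual_mult x y = (\<lambda>\<phi>. if \<phi> \<in> dual then x (\<lambda>a. y (\<lambda>b. \<phi> (a * b))) else 0)"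

definition bidual_star ::
  "(('a::unital_cstar_algebra \<Rightarrow> complex) \<Rightarrow> complex) \<Rightarrow> ('a \<Rightarrow> complex) \<Rightarrow> complex" where
  "bidual_star x = (\<lambda>\<phi>. cnj (x (\<lambda>a. cnj (\<phi> (star a)))))"

definition bidual_centre :: "(('a::unital_cstar_algebra \<Rightarrow> complex) \<Rightarrow> complex) set" where
  "bidual_centre = {x \<in> bidual. \<forall>y\<in>bidual. bidual_mult x y = bidual_mult y x}"

definition bidual_projections :: "(('a::unital_cstar_algebra \<Rightarrow> complex) \<Rightarrow> complex) set" where
  "bidual_projections = {p \<in> bidual. bidual_mult p p = p \<and> bidual_star p = p}"

text \<open>The smallest projection on which the normal extension \<open>x \<mapsto> x \<omega>\<close> of the state \<open>\<omega>\<close> to the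
  bidual takes the value one; \<open>p \<le> q\<close> is expressed as \<open>p q = p\<close>.\<close>

definition state_support ::
  "('a::unital_cstar_algebra \<Rightarrow> complex) \<Rightarrow> ('a \<Rightarrow> complex) \<Rightarrow> complex" where
  "state_support \<omega> = (THE p. p \<in> bidual_projections \<and> p \<omega> = 1 \<and>
     (\<forall>q\<in>bidual_projections. q \<omega> = 1 \<longrightarrow> bidual_mult p q = p))"


subsection \<open>Operators and covariant GNS representations\<close>

text \<open>Hilbert spaces that vary with a parameter are closed subspaces of one ambient Hilbert space;
  an operator on such a subspace \<open>H\<close> is a function on the ambient space of which only the values
  on \<open>H\<close> matter.\<close>

definition closed_csubspace :: "'h::complex_hilbert_space set \<Rightarrow> bool" where
  "closed_csubspace H \<longleftrightarrow> closed H \<and> 0 \<in> H \<and> (\<forall>x\<in>H. \<forall>y\<in>H. x + y \<in> H) \<and>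
     (\<forall>c. \<forall>x\<in>H. c *\<^sub>C x \<in> H)"

definition bounded_op :: "'h::complex_hilbert_space set \<Rightarrow> ('h \<Rightarrow> 'h) \<Rightarrow> bool" where
  "bounded_op H T \<longleftrightarrow> (\<forall>x\<in>H. T x \<in> H) \<and> (\<forall>x\<in>H. \<forall>y\<in>H. T (x + y) = T x + T y) \<and>
     (\<forall>c. \<forall>x\<in>H. T (c *\<^sub>C x) = c *\<^sub>C T x) \<and> (\<exists>K. \<forall>x\<in>H. norm (T x) \<le> K * norm x)"

definition commutant ::
  "'h::complex_hilbert_space set \<Rightarrow> ('h \<Rightarrow> 'h) set \<Rightarrow> ('h \<Rightarrow> 'h) set" where
  "commutant H S = {T. bounded_op H T \<and> (\<forall>s\<in>S. \<forall>x\<in>H. T (s x) = s (T x))}"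

definition bicommutant ::
  "'h::complex_hilbert_space set \<Rightarrow> ('h \<Rightarrow> 'h) set \<Rightarrow> ('h \<Rightarrow> 'h) set" where
  "bicommutant H S = commutant H (commutant H S)"

definition unitary_on :: "'h::complex_hilbert_space set \<Rightarrow> ('h \<Rightarrow> 'h) \<Rightarrow> bool" where
  "unitary_on H U \<longleftrightarrow> bounded_op H U \<and> bij_betw U H H \<and>
     (\<forall>x\<in>H. \<forall>y\<in>H. cinner (U x) (U y) = cinner x y)"

definition conj_by ::
  "'h::complex_hilbert_space set \<Rightarrow> ('h \<Rightarrow> 'h) \<Rightarrow> ('h \<Rightarrow> 'h) \<Rightarrow> 'h \<Rightarrow> 'h" where
  "conj_by H U T = (\<lambda>x. U (T (inv_into H U x)))"

definition covariant_GNS ::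
  "('a::unital_cstar_algebra \<Rightarrow> 'a) \<Rightarrow> ('a \<Rightarrow> complex) \<Rightarrow> 'h::complex_hilbert_space set
    \<Rightarrow> ('a \<Rightarrow> 'h \<Rightarrow> 'h) \<Rightarrow> ('h \<Rightarrow> 'h) \<Rightarrow> 'h \<Rightarrow> bool" where
  "covariant_GNS \<alpha> \<omega> H \<pi> U \<Omega> \<longleftrightarrow>
     closed_csubspace H \<and>
     (\<forall>a. bounded_op H (\<pi> a)) \<and>
     (\<forall>x\<in>H. \<forall>a b. \<pi> (a + b) x = \<pi> a x + \<pi> b x) \<and>
     (\<forall>x\<in>H. \<forall>c a. \<pi> (c *\<^sub>C a) x = c *\<^sub>C \<pi> a x) \<and>
     (\<forall>x\<in>H. \<forall>a b. \<pi> (a * b) x = \<pi> a (\<pi> b x)) \<and>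
     (\<forall>x\<in>H. \<pi> 1 x = x) \<and>
     (\<forall>x\<in>H. \<forall>y\<in>H. \<forall>a. cinner (\<pi> a x) y = cinner x (\<pi> (star a) y)) \<and>
     \<Omega> \<in> H \<and> closure (range (\<lambda>a. \<pi> a \<Omega>)) = H \<and>
     (\<forall>a. \<omega> a = cinner (\<pi> a \<Omega>) \<Omega>) \<and>
     unitary_on H U \<and> U \<Omega> = \<Omega> \<and>
     (\<forall>a. \<forall>x\<in>H. conj_by H U (\<pi> a) x = \<pi> (\<alpha> a) x)"

definition eigenvalues_on :: "'h::complex_hilbert_space set \<Rightarrow> ('h \<Rightarrow> 'h) \<Rightarrow> complex set" where
  "eigenvalues_on H U = {v. \<exists>x\<in>H. x \<noteq> 0 \<and> U x = v *\<^sub>C x}"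

definition norm_closure_ops ::
  "('h::complex_hilbert_space \<Rightarrow> 'h) set \<Rightarrow> ('h \<Rightarrow> 'h) set" where
  "norm_closure_ops S = {X. bounded_op UNIV X \<and> (\<forall>e>0. \<exists>T\<in>S. onorm (\<lambda>x. X x - T x) < e)}"

definition op_set_sum ::
  "('h::complex_hilbert_space \<Rightarrow> 'h) set \<Rightarrow> ('h \<Rightarrow> 'h) set \<Rightarrow> ('h \<Rightarrow> 'h) set" where
  "op_set_sum S T = {(\<lambda>x. A x + B x) | A B. A \<in> S \<and> B \<in> T}"

definition orth_proj :: "'h::complex_hilbert_space set \<Rightarrow> 'h \<Rightarrow> 'h" where
  "orth_proj M x = (THE y. y \<in> M \<and> (\<forall>z\<in>M. cinner (x - y) z = 0))"


subsection \<open>Orthogonal measures\<close>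

fun sandwiched ::
  "('a \<Rightarrow> 'h \<Rightarrow> 'h) \<Rightarrow> ('h \<Rightarrow> 'h) \<Rightarrow> 'h \<Rightarrow> 'a list \<Rightarrow> 'h" where
  "sandwiched \<pi> P \<Omega> [] = \<Omega>"
| "sandwiched \<pi> P \<Omega> [A] = \<pi> A \<Omega>"
| "sandwiched \<pi> P \<Omega> (A # B # As) = \<pi> A (P (sandwiched \<pi> P \<Omega> (B # As)))"

text \<open>The topology of the function type is that of pointwise convergence, so the measure lives on the
  Borel sets of the weak* topology of the state space.\<close>

definition orthogonal_measure ::
  "('a::unital_cstar_algebra \<Rightarrow> complex) \<Rightarrow> ('a \<Rightarrow> 'h::complex_hilbert_space \<Rightarrow> 'h) \<Rightarrow> 'h
    \<Rightarrow> ('h \<Rightarrow> 'h) set \<Rightarrow> ('a \<Rightarrow> complex) measure \<Rightarrow> bool" where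
  "orthogonal_measure \<omega> \<pi> \<Omega> Z \<nu> \<longleftrightarrow>
     sets \<nu> = sets (restrict_space borel states) \<and> prob_space \<nu> \<and>
     (\<forall>a. \<omega> a = (\<integral>\<psi>. \<psi> a \<partial>\<nu>)) \<and>
     (\<forall>As. As \<noteq> [] \<longrightarrow>
        (\<integral>\<psi>. prod_list (map \<psi> As) \<partial>\<nu>)
        = cinner (sandwiched \<pi> (orth_proj (closure {T \<Omega> | T. T \<in> Z})) \<Omega> As) \<Omega>)"


subsection \<open>Direct integrals\<close>

text \<open>Below, \<open>H\<close> is a field of Hilbert spaces over the measure space \<open>M\<close>, and \<open>S\<close> is a set of fields
  generating the measurable structure. Vectors of the direct integral are classes of square
  integrable measurable fields modulo equality almost everywhere.\<close>

definition square_integrable_field ::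
  "'s measure \<Rightarrow> ('s \<Rightarrow> 'h::complex_hilbert_space set) \<Rightarrow> ('s \<Rightarrow> 'h) set \<Rightarrow> ('s \<Rightarrow> 'h) \<Rightarrow> bool" where
  "square_integrable_field M H S f \<longleftrightarrow> (\<forall>s\<in>space M. f s \<in> H s) \<and>
     (\<forall>g\<in>S. (\<lambda>s. cinner (f s) (g s)) \<in> borel_measurable M) \<and>
     integrable M (\<lambda>s. (norm (f s))\<^sup>2)"

definition field_class ::
  "'s measure \<Rightarrow> ('s \<Rightarrow> 'h::complex_hilbert_space set) \<Rightarrow> ('s \<Rightarrow> 'h) set \<Rightarrow> ('s \<Rightarrow> 'h)
    \<Rightarrow> ('s \<Rightarrow> 'h) set" where
  "field_class M H S f = {g. square_integrable_field M H S g \<and> (AE s in M. g s = f s)}"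

definition direct_integral ::
  "'s measure \<Rightarrow> ('s \<Rightarrow> 'h::complex_hilbert_space set) \<Rightarrow> ('s \<Rightarrow> 'h) set \<Rightarrow> ('s \<Rightarrow> 'h) set set" where
  "direct_integral M H S = {field_class M H S f | f. square_integrable_field M H S f}"

text \<open>The action of a field of operators on the class \<open>c\<close>; \<open>H\<close> and \<open>S\<close> describe the target space.\<close>

definition decomposable_apply ::
  "'s measure \<Rightarrow> ('s \<Rightarrow> 'h::complex_hilbert_space set) \<Rightarrow> ('s \<Rightarrow> 'h) set \<Rightarrow> ('s \<Rightarrow> 'x \<Rightarrow> 'h)
    \<Rightarrow> ('s \<Rightarrow> 'x) set \<Rightarrow> ('s \<Rightarrow> 'h) set" where
  "decomposable_apply M H S T c =
     {h. square_integrable_field M H S h \<and> (\<exists>f\<in>c. AE s in M. h s = T s (f s))}"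

definition unitary_onto_direct_integral ::
  "'s measure \<Rightarrow> ('s \<Rightarrow> 'k::complex_hilbert_space set) \<Rightarrow> ('s \<Rightarrow> 'k) set
    \<Rightarrow> ('h::complex_hilbert_space \<Rightarrow> ('s \<Rightarrow> 'k) set) \<Rightarrow> bool" where
  "unitary_onto_direct_integral M H S J \<longleftrightarrow> bij_betw J UNIV (direct_integral M H S) \<and>
     (\<forall>\<xi> \<eta>. \<forall>f\<in>J \<xi>. \<forall>g\<in>J \<eta>. (\<lambda>s. f s + g s) \<in> J (\<xi> + \<eta>)) \<and>
     (\<forall>c \<xi>. \<forall>f\<in>J \<xi>. (\<lambda>s. c *\<^sub>C f s) \<in> J (c *\<^sub>C \<xi>)) \<and>
     (\<forall>\<xi> \<eta>. \<forall>f\<in>J \<xi>. \<forall>g\<in>J \<eta>. cinner \<xi> \<eta> = (\<integral>s. cinner (f s) (g s) \<partial>M))"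

definition diagonalisable_ops ::
  "'s measure \<Rightarrow> ('s \<Rightarrow> 'k::complex_hilbert_space set) \<Rightarrow> ('s \<Rightarrow> 'k) set
    \<Rightarrow> ('h \<Rightarrow> ('s \<Rightarrow> 'k) set) \<Rightarrow> ('h \<Rightarrow> 'h) set" where
  "diagonalisable_ops M H S J = {T. \<exists>g\<in>borel_measurable M. (\<exists>K. AE s in M. cmod (g s) \<le> K) \<and>
     (\<forall>\<xi>. J (T \<xi>) = decomposable_apply M H S (\<lambda>s x. g s *\<^sub>C x) (J \<xi>))}"

definition GNS_fields ::
  "('s \<Rightarrow> 'a \<Rightarrow> 'k \<Rightarrow> 'k) \<Rightarrow> ('s \<Rightarrow> 'k) \<Rightarrow> ('s \<Rightarrow> 'k) set" where
  "GNS_fields \<pi>f \<Psi> = {(\<lambda>\<psi>. \<pi>f \<psi> A (\<Psi> \<psi>)) | A. True}"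

text \<open>The identification \<open>J\<close> of \<open>\<H>\<^sub>\<omega>\<close> with the direct integral of the GNS spaces, carrying
  \<open>\<pi>\<close>, \<open>Ul\<close>, \<open>\<Omega>\<close> to the direct integrals of \<open>\<pi>f\<close>, \<open>Uf\<close>, \<open>\<Psi>\<close> and \<open>Z\<close> to the diagonalisable
  operators. It is unique, since \<open>\<Omega>\<close> is cyclic for \<open>\<pi>\<close>.\<close>

definition direct_integral_identification ::
  "('a \<Rightarrow> 'h::complex_hilbert_space \<Rightarrow> 'h) \<Rightarrow> ('h \<Rightarrow> 'h) \<Rightarrow> 'h \<Rightarrow> ('h \<Rightarrow> 'h) set \<Rightarrow> 's measure
    \<Rightarrow> ('s \<Rightarrow> 'k::complex_hilbert_space set) \<Rightarrow> ('s \<Rightarrow> 'a \<Rightarrow> 'k \<Rightarrow> 'k) \<Rightarrow> ('s \<Rightarrow> 'k \<Rightarrow> 'k)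
    \<Rightarrow> ('s \<Rightarrow> 'k) \<Rightarrow> ('h \<Rightarrow> ('s \<Rightarrow> 'k) set) \<Rightarrow> bool" where
  "direct_integral_identification \<pi> Ul \<Omega> Z M H \<pi>f Uf \<Psi> J \<longleftrightarrow>
     (let S = GNS_fields \<pi>f \<Psi> in
       unitary_onto_direct_integral M H S J \<and>
       (\<forall>A \<xi>. J (\<pi> A \<xi>) = decomposable_apply M H S (\<lambda>\<psi>. \<pi>f \<psi> A) (J \<xi>)) \<and>
       (\<forall>\<xi>. J (Ul \<xi>) = decomposable_apply M H S Uf (J \<xi>)) \<and>
       J \<Omega> = field_class M H S \<Psi> \<and>
       Z = diagonalisable_ops M H S J)"


subsection \<open>Tensor products\<close>

definition cspan :: "'h::complex_normed_vector set \<Rightarrow> 'h set" where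
  "cspan B = {\<Sum>b\<in>F. c b *\<^sub>C b | F c. finite F \<and> F \<subseteq> B}"

text \<open>\<open>tens\<close> exhibits the type \<open>'t\<close> as the Hilbert space tensor product of \<open>'k\<close> with itself; this
  determines it up to a unique unitary.\<close>

definition hilbert_tensor ::
  "('k::complex_hilbert_space \<Rightarrow> 'k \<Rightarrow> 't::complex_hilbert_space) \<Rightarrow> bool" where
  "hilbert_tensor tens \<longleftrightarrow>
     (\<forall>x x' y. tens (x + x') y = tens x y + tens x' y) \<and>
     (\<forall>x y y'. tens x (y + y') = tens x y + tens x y') \<and>
     (\<forall>c x y. tens (c *\<^sub>C x) y = c *\<^sub>C tens x y \<and> tens x (c *\<^sub>C y) = c *\<^sub>C tens x y) \<and>
     (\<forall>x y x' y'. cinner (tens x y) (tens x' y') = cinner x x' * cinner y y') \<and>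
     closure (cspan {tens x y | x y. True}) = UNIV"

definition tensor_space ::
  "('k::complex_hilbert_space \<Rightarrow> 'k \<Rightarrow> 't::complex_hilbert_space) \<Rightarrow> 'k set \<Rightarrow> 't set" where
  "tensor_space tens H = closure (cspan {tens x y | x y. x \<in> H \<and> y \<in> H})"

definition tensor_fields :: "('k \<Rightarrow> 'k \<Rightarrow> 't) \<Rightarrow> ('s \<Rightarrow> 'k) set \<Rightarrow> ('s \<Rightarrow> 't) set" where
  "tensor_fields tens S = {(\<lambda>s. tens (f s) (g s)) | f g. f \<in> S \<and> g \<in> S}"

text \<open>The class of \<open>s \<mapsto> f s \<otimes> g s\<close> for \<open>f\<close> in the class \<open>c\<close> and \<open>g\<close> in the class \<open>d\<close>.\<close>

definition tensor_class ::
  "('k::complex_hilbert_space \<Rightarrow> 'k \<Rightarrow> 't::complex_hilbert_space) \<Rightarrow> 's measure \<Rightarrow> ('s \<Rightarrow> 'k set)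
    \<Rightarrow> ('s \<Rightarrow> 'k) set \<Rightarrow> ('s \<Rightarrow> 'k) set \<Rightarrow> ('s \<Rightarrow> 'k) set \<Rightarrow> ('s \<Rightarrow> 't) set" where
  "tensor_class tens M H S c d =
     {h. square_integrable_field M (\<lambda>s. tensor_space tens (H s)) (tensor_fields tens S) h \<and>
         (\<exists>f\<in>c. \<exists>g\<in>d. AE s in M. h s = tens (f s) (g s))}"


subsection \<open>The limit operators\<close>

text \<open>\<open>Ve v\<close> and \<open>We v\<close> are unitaries in the von Neumann algebra and in its commutant, with
  eigenvalue \<open>v\<close> under the adjoint action of \<open>U\<close>. Each is unique up to a phase,
  of which \<open>V_fibre\<close> below is independent.\<close>

definition eigen_unitaries ::
  "'k::complex_hilbert_space set \<Rightarrow> ('a \<Rightarrow> 'k \<Rightarrow> 'k) \<Rightarrow> ('k \<Rightarrow> 'k)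
    \<Rightarrow> (complex \<Rightarrow> 'k \<Rightarrow> 'k) \<Rightarrow> (complex \<Rightarrow> 'k \<Rightarrow> 'k) \<Rightarrow> bool" where
  "eigen_unitaries H \<pi> U Ve We \<longleftrightarrow> (\<forall>v\<in>eigenvalues_on H U.
     unitary_on H (Ve v) \<and> Ve v \<in> bicommutant H (range \<pi>) \<and>
     (\<forall>x\<in>H. conj_by H U (Ve v) x = v *\<^sub>C Ve v x) \<and>
     unitary_on H (We v) \<and> We v \<in> commutant H (range \<pi>) \<and>
     (\<forall>x\<in>H. conj_by H U (We v) x = v *\<^sub>C We v x))"

definition V_fibre ::
  "int \<Rightarrow> ('k::complex_hilbert_space \<Rightarrow> 'k \<Rightarrow> 't::complex_hilbert_space) \<Rightarrow> 'k set \<Rightarrow> ('k \<Rightarrow> 'k) \<Rightarrow> 'k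
    \<Rightarrow> (complex \<Rightarrow> 'k \<Rightarrow> 'k) \<Rightarrow> (complex \<Rightarrow> 'k \<Rightarrow> 'k) \<Rightarrow> 't \<Rightarrow> 'k" where
  "V_fibre k tens H U \<Psi> Ve We t =
     (\<Sum>\<^sub>\<infinity>(v, w) \<in> {(v, w). v \<in> eigenvalues_on H U \<and> w \<in> eigenvalues_on H U \<and>
                          v powi k * w powi (k + 1) = 1}.
        cinner t (tens (Ve v \<Psi>) (We w \<Psi>)) *\<^sub>C Ve v (We w \<Psi>))"

definition V_X ::
  "('k::complex_hilbert_space \<Rightarrow> 'k \<Rightarrow> 't::complex_hilbert_space) \<Rightarrow> 's measure \<Rightarrow> ('s \<Rightarrow> 'k set)
    \<Rightarrow> ('s \<Rightarrow> 'k) set \<Rightarrow> ('h \<Rightarrow> ('s \<Rightarrow> 'k) set) \<Rightarrow> ('s \<Rightarrow> 't \<Rightarrow> 'k) \<Rightarrow> 'h \<Rightarrow> ('h \<Rightarrow> 'h) \<Rightarrow> 'h \<Rightarrow> 'h" where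
  "V_X tens M H S J V \<Omega> X \<xi> =
     inv J (decomposable_apply M H S V (tensor_class tens M H S (J (X \<Omega>)) (J \<xi>)))"

end

theory Submission
  imports Defs "HOL-Computational_Algebra.Fundamental_Theorem_Algebra"
begin

text \<open>
 The averages are computed in the fibres. As the support of \<open>\<psi>\<close> is central, the vectors \<open>B \<Psi>\<close> with \<open>B\<close> in the
 commutant are dense: the support is the zero of the compact semigroup of all \<open>x\<close> in the unit ball of the
 bidual with \<open>x \<psi> = 1\<close>, and a vector orthogonal to these \<open>B \<Psi>\<close> would yield an element of this semigroup
 that is not fixed by the support. Let \<open>X = \<pi> a\<close>. If \<open>B \<Psi>\<close> approximates a vector orthogonal to all
 eigenvectors of \<open>U\<close>, then moving \<open>B\<close> past \<open>\<pi> a\<close> shows that the correlations of \<open>U\<^sup>n\<^sup>k \<pi> a U\<^sup>n B \<Psi>\<close> converge to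
 those of \<open>U\<^sup>h\<^sup>k \<pi> a \<Psi> \<otimes> U\<^sup>h\<^sup>(\<^sup>k\<^sup>+\<^sup>1\<^sup>) B \<Psi>\<close>, so the averages are small by van der Corput's inequality. On
 eigenvectors \<open>W\<^sub>w \<Psi>\<close> the mean ergodic theorem gives \<open>V\<close>. An \<open>X\<close> in the commutant is treated by exchanging the
 roles of the two tensor factors, which replaces \<open>(U, k)\<close> by \<open>(U\<^sup>-\<^sup>1, -(k + 1))\<close>. Dominated convergence
 integrates both results; since the graph of \<open>(\<eta>, \<xi>) \<mapsto> V (\<eta> \<otimes> \<xi>)\<close> is closed, they extend to all \<open>X\<close>.
\<close>

text \<open>The resonance condition comes from
  \<open>U^(nk) V_v U^n W_w \<Psi> = (v^k w^(k+1))^n V_v W_w \<Psi>\<close>: on eigenvectors only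
  the pairs with \<open>v^k w^(k+1) = 1\<close> survive averaging, and such a pair is determined by
  the product \<open>v w\<close>, which makes the sum defining \<open>V\<close> orthogonal. That
  \<open>k\<close> is nonzero leaves finitely many \<open>v\<close> for each \<open>w\<close>; that
  \<open>k + 1\<close> is nonzero keeps the second tensor factor moving, so that its averages vanish
  off the eigenvectors. The support of a state is a definite description in the bidual, so its
  existence must be settled before centrality can be used. This needs the involution to reverse
  Arens products, hence Arens regularity, hence that positive functionals span the dual, hence that
  every \<open>star a * a\<close> is positive. The pointwise tensor product of two square integrable
  fields need not be square integrable. The limits are therefore followed in a closed relation, and
  essential boundedness of the field of \<open>X \<Omega>\<close> enters only when
  \<open>V_X\<close> is unfolded.\<close>

lemma scaleC_one [simp]: "1 *\<^sub>C (x::'a::complex_normed_vector) = x"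
 using scaleC_of_real[of 1 x] by simp

lemma scaleC_zero_left [simp]: "0 *\<^sub>C (x::'a::complex_normed_vector) = 0"
 using scaleC_of_real[of 0 x] by simp

lemma scaleC_zero_right [simp]: "c *\<^sub>C (0::'a::complex_normed_vector) = 0"
 using scaleC_add_right[of c 0 0] by simp

lemma scaleC_minus_left [simp]: "(- c) *\<^sub>C (x::'a::complex_normed_vector) = - (c *\<^sub>C x)"
 using scaleC_add_left[of "-c" c x] by (simp add: eq_neg_iff_add_eq_0)

lemma scaleC_minus_right [simp]: "c *\<^sub>C (- x::'a::complex_normed_vector) = - (c *\<^sub>C x)"
 using scaleC_add_right[of c "-x" x] by (simp add: eq_neg_iff_add_eq_0)

lemma scaleC_diff_left: "(c - d) *\<^sub>C (x::'a::complex_normed_vector) = c *\<^sub>C x - d *\<^sub>C x"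
 using scaleC_add_left[of c "-d" x] by simp

lemma scaleC_diff_right: "c *\<^sub>C (x - y::'a::complex_normed_vector) = c *\<^sub>C x - c *\<^sub>C y"
 using scaleC_add_right[of c x "-y"] by simp

subsection \<open>Positive elements of a C*-algebra\<close>

instance unital_cstar_algebra \<subseteq> banach ..

lemma star_scaleR: "star (r *\<^sub>R a) = r *\<^sub>R star a"
 by (metis complex_cnj_complex_of_real scaleC_of_real star_scaleC)

lemma star_zero [simp]: "star 0 = 0"
 by (metis add_cancel_right_right star_add)

lemma star_one [simp]: "star 1 = 1"
 by (metis mult_1 star_mult star_star)

lemma star_minus [simp]: "star (- a) = - star a"
 using star_scaleR[of "-1" a] by simp

lemma star_diff: "star (a - b) = star a - star b"
 using star_add[of a "- b"] by simp

lemma star_power: "star (a ^ n) = star a ^ n"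
 by (induction n) (simp_all add: star_mult power_commutes)

lemma star_of_real [simp]: "star (of_real r :: 'a::unital_cstar_algebra) = of_real r"
 by (simp add: of_real_def star_scaleR)

lemma norm_star [simp]: "norm (star a) = norm a"
proof -
 have le: "norm b <= norm (star b)" for b :: 'a
 proof (cases "b = 0")
  case False
  have "norm b ^ 2 <= norm (star b) * norm b"
   using norm_mult_ineq[of "star b" b] by (simp add: cstar_identity)
  with False show ?thesis by (simp add: power2_eq_square)
 qed simp
 show ?thesis using le[of a] le[of "star a"] by (simp add: star_star)
qed

lemma bounded_linear_star: "bounded_linear (star :: 'a::unital_cstar_algebra => 'a)"
 by (rule bounded_linear_intro[of _ 1]) (simp_all add: star_add star_scaleR)

definition selfadjoint :: "'a::unital_cstar_algebra => bool" where
 "selfadjoint h \<longleftrightarrow> star h = h"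

lemma selfadjoint_intros [simp, intro]:
 "selfadjoint (0::'a::unital_cstar_algebra)" "selfadjoint (1::'a)" "selfadjoint (of_real r :: 'a)"
 "selfadjoint (star x * x)" "selfadjoint (x * star x)"
 by (simp_all add: selfadjoint_def star_mult star_star)

lemma selfadjoint_add: "selfadjoint x ==> selfadjoint y ==> selfadjoint (x + y)"
 and selfadjoint_diff: "selfadjoint x ==> selfadjoint y ==> selfadjoint (x - y)"
 and selfadjoint_scaleR: "selfadjoint x ==> selfadjoint (r *\<^sub>R x)"
 and selfadjoint_power: "selfadjoint x ==> selfadjoint (x ^ n)"
 by (simp_all add: selfadjoint_def star_add star_diff star_scaleR star_power)

text \<open>The C*-identity applied to the selfadjoint element \<open>h ^ (2 ^ n)\<close> gives the
  step from \<open>n\<close> to \<open>n + 1\<close>.\<close>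

lemma norm_selfadjoint_power:
 assumes "selfadjoint h"
 shows "norm (h ^ (2 ^ n)) = norm h ^ (2 ^ n)"
proof (induction n)
 case (Suc n)
 have "h ^ (2 ^ Suc n) = star (h ^ 2 ^ n) * h ^ 2 ^ n"
  using assms by (simp add: star_power selfadjoint_def mult_2 power_add)
 then show ?case using Suc by (simp add: cstar_identity power_mult[symmetric] mult.commute)
qed simp

text \<open>The norm of a selfadjoint element is its spectral radius, so it can be read off the growth of
 the powers.\<close>

lemma norm_selfadjoint_growth:
 assumes h: "selfadjoint h" and R: "R > 0"
  and growth: "!!m. norm (h ^ m) <= (A + B * real m) * R ^ m"
 shows "norm h <= R"
proof (rule ccontr)
 assume "\<not> norm h <= R"
 define q where "q = norm h / R"
 have q: "q > 1" using \<open>\<not> norm h <= R\<close> R by (simp add: q_def)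
 \<comment> \<open>Only exponents \<open>2 ^ n\<close> provide a lower bound for the norm of the
   power, so the contradiction is drawn along this subsequence.\<close>
 have le: "1 <= A / q ^ m + B * (real m / q ^ m)" if "m = 2 ^ n" for m n
 proof -
  have "q ^ m * R ^ m <= (A + B * real m) * R ^ m"
   using growth[of m] norm_selfadjoint_power[OF h, of n] R that
   by (simp add: q_def power_divide)
  then have "q ^ m <= A + B * real m" using R by simp
  then show ?thesis using q by (simp add: field_simps)
 qed
 have "(\<lambda>m. A / q ^ m + B * (real m / q ^ m)) \<longlonglongrightarrow> 0 + B * 0"
  using q by (intro tendsto_add tendsto_mult tendsto_const lim_n_over_pown
    tendsto_divide_0[OF tendsto_const] filterlim_realpow_sequentially_gt1) auto
 moreover have "filterlim (\<lambda>n::nat. 2 ^ n :: nat) at_top sequentially"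
  by (rule filterlim_subseq) (simp add: strict_mono_def)
 ultimately have "(\<lambda>n. A / q ^ (2 ^ n) + B * (real (2 ^ n) / q ^ (2 ^ n))) \<longlonglongrightarrow> 0"
  using filterlim_compose[of "\<lambda>m. A / q ^ m + B * (real m / q ^ m)" "nhds 0" sequentially "\<lambda>n. 2 ^ n"]
  by simp
 from LIMSEQ_le_const[OF this, of 1] le show False by simp
qed

section \<open>Square roots near the unit by the binomial series\<close>

definition sqrt_one_minus :: "'a::unital_cstar_algebra => 'a" where
 "sqrt_one_minus x = (\<Sum>n. (((1/2) gchoose n) * (-1) ^ n) *\<^sub>R x ^ n)"

text \<open>Consecutive coefficients differ by the factor \<open>(1/2 - n) / (n + 1)\<close>, of
  absolute value at most one. Comparison with the geometric series then covers all \<open>x\<close>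
  with \<open>norm x < 1\<close>.\<close>

lemma gbinomial_half_bound: "\<bar>(1/2::real) gchoose n\<bar> <= 1"
proof (induction n)
 case (Suc n)
 have "(1/2::real) gchoose Suc n = ((1/2) gchoose n) * ((1/2 - real n) / (real n + 1))"
  using gbinomial_mult_1[of "1/2::real" n] by (simp add: field_simps)
 moreover have "\<bar>(1/2 - real n) / (real n + 1)\<bar> <= 1" by simp
 ultimately show ?case using Suc
  by (metis abs_ge_zero abs_mult mult_le_one)
qed simp

lemma summable_sqrt_one_minus:
 assumes "norm (x::'a::unital_cstar_algebra) < 1"
 shows "summable (\<lambda>n. norm ((((1/2) gchoose n) * (-1) ^ n) *\<^sub>R x ^ n))"
proof (rule summable_comparison_test'[of "\<lambda>n. norm x ^ n" 0])
 show "norm (norm ((((1/2) gchoose n) * (-1) ^ n) *\<^sub>R x ^ n)) <= norm x ^ n" for n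
  using mult_mono[OF gbinomial_half_bound[of n] norm_power_ineq[of x n]] by (simp add: abs_mult)
qed (use assms in \<open>simp add: summable_geometric\<close>)

text \<open>The Cauchy product of the series with itself has the coefficients of
  \<open>(1 - x)^1\<close>, by Vandermonde's identity for \<open>1/2 + 1/2 = 1\<close>, and these
  vanish from degree two on.\<close>

lemma sqrt_one_minus_square:
 assumes x: "norm x < 1"
 shows "sqrt_one_minus x * sqrt_one_minus x = 1 - x"
proof -
 let ?c = "\<lambda>n. ((1/2::real) gchoose n) * (-1) ^ n"
 have coeff: "(\<Sum>i\<le>k. ?c i * ?c (k - i)) = (1 gchoose k) * (-1) ^ k" for k
 proof -
  have "(\<Sum>i\<le>k. ?c i * ?c (k - i)) = (\<Sum>i\<le>k. ((1/2) gchoose i) * ((1/2) gchoose (k - i))) * (-1) ^ k"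
   unfolding sum_distrib_right
   by (rule sum.cong) (simp_all add: power_add[symmetric])
  then show ?thesis using gbinomial_Vandermonde[of "1/2::real" "1/2" k] by (simp add: atMost_atLeast0)
 qed
 have "sqrt_one_minus x * sqrt_one_minus x = (\<Sum>k. \<Sum>i\<le>k. (?c i *\<^sub>R x ^ i) * (?c (k - i) *\<^sub>R x ^ (k - i)))"
  unfolding sqrt_one_minus_def by (rule Cauchy_product) (rule summable_sqrt_one_minus[OF x])+
 also have "... = (\<Sum>k. ((1 gchoose k) * (-1) ^ k) *\<^sub>R x ^ k)"
  unfolding coeff[symmetric] scaleR_sum_left
  by (rule suminf_cong, rule sum.cong) (simp_all add: power_add[symmetric])
 also have "... = (\<Sum>k\<in>{0,1}. ((1 gchoose k) * (-1) ^ k) *\<^sub>R x ^ k)"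
 proof (rule suminf_finite)
  fix k :: nat assume "k \<notin> {0, 1}"
  then have "k > 1" by auto
  then have "(1::real) gchoose k = 0"
   by (metis binomial_eq_0 binomial_gbinomial of_nat_0 of_nat_1)
  then show "((1 gchoose k) * (-1) ^ k) *\<^sub>R x ^ k = 0" by simp
 qed simp
 finally show ?thesis by simp
qed

lemma sqrt_one_minus_commute:
 assumes x: "norm x < 1" and c: "x * y = y * x"
 shows "sqrt_one_minus x * y = y * sqrt_one_minus x"
proof -
 have s: "summable (\<lambda>n. (((1/2) gchoose n) * (-1) ^ n) *\<^sub>R x ^ n)"
  by (rule summable_norm_cancel[OF summable_sqrt_one_minus[OF x]])
 have "x ^ n * y = y * x ^ n" for n using c by (rule power_commuting_commutes)
 then show ?thesis
  unfolding sqrt_one_minus_def suminf_mult[OF s, symmetric] suminf_mult2[OF s] by simp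
qed

lemma sqrt_one_minus_selfadjoint:
 assumes x: "norm x < 1" and s: "selfadjoint x"
 shows "selfadjoint (sqrt_one_minus x)"
proof -
 have "summable (\<lambda>n. (((1/2) gchoose n) * (-1) ^ n) *\<^sub>R x ^ n)"
  by (rule summable_norm_cancel[OF summable_sqrt_one_minus[OF x]])
 from bounded_linear.suminf[OF bounded_linear_star this] s show ?thesis
  by (simp add: selfadjoint_def sqrt_one_minus_def star_scaleR star_power)
qed

text \<open>With \<open>w = g + \<i>f\<close> the hypothesis says \<open>star w * w = r\<close>.\<close>

lemma norm_le_of_square_sum:
 assumes sa: "selfadjoint g" "selfadjoint f" and c: "g * f = f * g"
  and sum: "g * g + f * f = of_real r" and r: "r >= 0"
 shows "norm (g * g) <= r"
proof -
 define w where "w = g + \<i> *\<^sub>C f"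
 have sw: "star w = g + (- \<i>) *\<^sub>C f"
  using sa by (simp add: w_def star_add star_scaleC selfadjoint_def)
 have "star w * w = of_real r"
  unfolding sw using c sum
  by (simp add: w_def algebra_simps scaleC_mult_left scaleC_mult_right scaleC_scaleC scaleC_diff_right)
 then have w2: "norm w ^ 2 = \<bar>r\<bar>" using cstar_identity[of w] by simp
 have "2 *\<^sub>R g = w + star w"
  unfolding sw by (simp add: w_def scaleR_2)
 then have "2 * norm g <= norm w + norm (star w)"
  by (metis norm_scaleR norm_triangle_ineq abs_numeral)
 then have "norm g <= norm w" by simp
 then have "norm (g * g) <= norm w ^ 2"
  using mult_mono[of "norm g" "norm w" "norm g" "norm w"] norm_mult_ineq[of g g]
  by (simp add: power2_eq_square)
 then show ?thesis using w2 r by simp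
qed

text \<open>For selfadjoint \<open>h\<close> the condition says that the spectrum lies in
  \<open>[0, 2t]\<close>, that is, that \<open>h\<close> is positive. Expressed through the norm it
  is additive at once, with \<open>s + t\<close> as the new centre.\<close>

definition cpos :: "'a::unital_cstar_algebra => bool" where
 "cpos h \<longleftrightarrow> selfadjoint h \<and> (\<exists>t>0. norm (of_real t - h) <= t)"

lemma cpos_selfadjoint: "cpos h ==> selfadjoint h"
 by (simp add: cpos_def)

lemma cpos_bound_mono:
 assumes "norm (of_real t - h) <= t" "t <= s"
 shows "norm (of_real s - (h::'a::unital_cstar_algebra)) <= s"
proof -
 have "of_real s - h = (of_real t - h) + of_real (s - t)" by simp
 then have "norm (of_real s - h) <= norm (of_real t - h) + norm (of_real (s - t) :: 'a)"
  by (metis norm_triangle_ineq)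
 also have "norm (of_real (s - t) :: 'a) = s - t" using assms(2) by (simp del: of_real_diff)
 finally show ?thesis using assms by simp
qed

lemma cpos_add:
 assumes "cpos h" "cpos k"
 shows "cpos (h + k)"
proof -
 obtain s t where st: "s > 0" "t > 0" "norm (of_real s - h) <= s" "norm (of_real t - k) <= t"
  using assms by (auto simp: cpos_def)
 have "of_real (s + t) - (h + k) = (of_real s - h) + (of_real t - k)" by simp
 then have "norm (of_real (s + t) - (h + k)) <= s + t"
  using norm_triangle_ineq[of "of_real s - h" "of_real t - k"] st by (simp only:)
 then show ?thesis using st assms unfolding cpos_def
  by (meson add_pos_pos selfadjoint_add)
qed

lemma cpos_of_real: "r >= 0 ==> cpos (of_real r :: 'a::unital_cstar_algebra)"
 unfolding cpos_def by (intro conjI exI[of _ "r + 1"]) auto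

lemma cpos_zero: "cpos (0 :: 'a::unital_cstar_algebra)"
 using cpos_of_real[of 0] by simp

lemma cpos_scaleR:
 assumes "cpos h" "r >= 0"
 shows "cpos (r *\<^sub>R h)"
proof (cases "r = 0")
 case False
 obtain t where t: "t > 0" "norm (of_real t - h) <= t" using assms by (auto simp: cpos_def)
 have "of_real (r * t) - r *\<^sub>R h = r *\<^sub>R (of_real t - h)"
  by (simp add: of_real_def scaleR_diff_right)
 then have "norm (of_real (r * t) - r *\<^sub>R h) <= r * t"
  using t assms(2) by (simp add: mult_left_mono)
 moreover have "r * t > 0" using False assms t by simp
 ultimately show ?thesis using assms unfolding cpos_def by (meson selfadjoint_scaleR)
qed (simp add: cpos_zero)

lemma cpos_one_minus:
 assumes "selfadjoint e" "norm e <= 1"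
 shows "cpos (1 - e)"
 using assms unfolding cpos_def by (intro conjI exI[of _ 1] selfadjoint_diff) simp_all

lemma cpos_of_real_minus:
 assumes e: "selfadjoint e" and n: "norm e <= r"
 shows "cpos (of_real r - e)"
proof (cases "r = 0")
 case False
 with n have r: "r > 0" by (smt (verit) norm_ge_zero)
 have "cpos (r *\<^sub>R (1 - (1 / r) *\<^sub>R e))"
  using r n e by (intro cpos_scaleR cpos_one_minus selfadjoint_scaleR) auto
 then show ?thesis using r by (simp add: scaleR_diff_right of_real_def)
qed (use n in \<open>simp add: cpos_zero\<close>)

text \<open>Writing \<open>h + \<delta> = s (1 - x)\<close> with \<open>s = t + \<delta>\<close>
  gives \<open>norm x <= t / s < 1\<close>. The shift by \<open>\<delta>\<close> keeps
  \<open>x\<close> inside the open disc of convergence of the binomial series.\<close>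

lemma cpos_sqrt:
 assumes "cpos h" "\<delta> > 0"
 obtains g where "selfadjoint g" "g * g = h + of_real \<delta>" "!!y. h * y = y * h ==> g * y = y * g"
proof -
 obtain t where t: "t > 0" "norm (of_real t - h) <= t" and h: "selfadjoint h"
  using assms by (auto simp: cpos_def)
 define s where "s = t + \<delta>"
 have s: "s > 0" using t assms by (simp add: s_def)
 define x where "x = (1 / s) *\<^sub>R (of_real t - h)"
 have x: "norm x < 1" using t assms by (simp add: x_def s_def)
 have sx: "selfadjoint x" unfolding x_def by (intro selfadjoint_scaleR selfadjoint_diff h) auto
 have hx: "h = of_real t - s *\<^sub>R x" using s by (simp add: x_def)
 show ?thesis
 proof (rule that)
  show "selfadjoint (sqrt s *\<^sub>R sqrt_one_minus x)"
   by (intro selfadjoint_scaleR sqrt_one_minus_selfadjoint x sx)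
  show "sqrt s *\<^sub>R sqrt_one_minus x * sqrt s *\<^sub>R sqrt_one_minus x = h + of_real \<delta>"
   using s by (simp add: sqrt_one_minus_square[OF x] hx s_def scaleR_diff_right of_real_def scaleR_add_left)
  show "sqrt s *\<^sub>R sqrt_one_minus x * y = y * sqrt s *\<^sub>R sqrt_one_minus x" if "h * y = y * h" for y
  proof -
   have "x * y = y * x" using that by (simp add: x_def of_real_def algebra_simps)
   from sqrt_one_minus_commute[OF x this] show ?thesis by simp
  qed
 qed
qed

text \<open>After scaling to \<open>norm k < 1\<close>, the root \<open>c\<close> of
  \<open>1 - k * k\<close> commutes with \<open>k\<close> and \<open>c * c + k * k = 1\<close>.
  Hence \<open>norm (1 - k * k) = norm (c * c) <= 1\<close>, which is the defining bound of
  \<open>cpos\<close> at \<open>t = 1\<close>.\<close>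

lemma cpos_square:
 assumes h: "selfadjoint h"
 shows "cpos (h * h)"
proof -
 define s where "s = norm h + 1"
 have s: "s > 0" by (simp add: s_def add_nonneg_pos)
 define k where "k = (1 / s) *\<^sub>R h"
 have k: "selfadjoint k" using h by (simp add: k_def selfadjoint_scaleR)
 have kk: "selfadjoint (k * k)" using k by (simp add: selfadjoint_def star_mult)
 have nk: "norm k < 1" using s by (simp add: k_def) (simp add: s_def)
 have "norm k * norm k <= norm k * 1" using nk by (intro mult_left_mono) auto
 then have nkk: "norm (k * k) < 1" using norm_mult_ineq[of k k] nk by simp
 define c where "c = sqrt_one_minus (k * k)"
 have "c * k = k * c" unfolding c_def by (rule sqrt_one_minus_commute[OF nkk]) (simp add: mult.assoc)
 then have "norm (c * c) <= 1"
  by (intro norm_le_of_square_sum[of c k])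
   (simp_all add: k c_def sqrt_one_minus_selfadjoint[OF nkk kk] sqrt_one_minus_square[OF nkk])
 then have "norm (1 - k * k) <= 1" by (simp add: c_def sqrt_one_minus_square[OF nkk])
 then have "cpos (k * k)" unfolding cpos_def using kk by (intro conjI exI[of _ 1]) auto
 then have "cpos ((s * s) *\<^sub>R (k * k))" using s by (intro cpos_scaleR) auto
 then show ?thesis using s by (simp add: k_def)
qed

text \<open>Roots \<open>g\<close> of \<open>c + d\<close> and \<open>f\<close> of
  \<open>1 - c + d\<close> commute, and their squares add up to the scalar \<open>1 + 2 * d\<close>,
  which bounds \<open>norm (g * g)\<close>; then \<open>d\<close> tends to zero.\<close>

lemma cpos_norm_le_one:
 assumes c: "cpos c" and c': "cpos (1 - c)"
 shows "norm c <= 1"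
proof (rule field_le_epsilon)
 fix e :: real assume e: "e > 0"
 define d where "d = e / 3"
 have d: "d > 0" using e by (simp add: d_def)
 obtain g where g: "selfadjoint g" "g * g = c + of_real d" "!!y. c * y = y * c ==> g * y = y * g"
  using cpos_sqrt[OF c d] by metis
 obtain f where f: "selfadjoint f" "f * f = 1 - c + of_real d" "!!y. (1 - c) * y = y * (1 - c) ==> f * y = y * f"
  using cpos_sqrt[OF c' d] by metis
 have "g * c = c * g" using g(3) by simp
 then have "f * g = g * f" by (intro f(3)) (simp only: left_diff_distrib right_diff_distrib mult_1_left mult_1_right)
 then have "g * f = f * g" by simp
 moreover have "g * g + f * f = of_real (1 + 2 * d)"
 proof -
  have "of_real (1 + 2 * d) = 1 + of_real d + (of_real d :: 'a)"
   by (simp only: mult_2 of_real_add of_real_1 add.assoc)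
  then show ?thesis unfolding g(2) f(2) by (simp only:) simp
 qed
 ultimately have "norm (g * g) <= 1 + 2 * d"
  by (rule norm_le_of_square_sum[OF g(1) f(1)]) (use d in simp)
 then have "norm (c + of_real d) <= 1 + 2 * d" by (simp add: g)
 then show "norm c <= 1 + e"
  using norm_triangle_ineq4[of "c + of_real d" "of_real d"] d by (simp add: d_def)
qed

text \<open>The complement \<open>1 - h / t\<close> of a positive element below one is again
  positive and below one, so \<open>cpos_norm_le_one\<close> bounds it. Thus every positive
  \<open>t >= norm h\<close> is a witness for the positivity of \<open>h\<close>.\<close>

lemma cpos_bound_norm:
 assumes h: "cpos h" and n: "norm h <= t" and t: "t > 0"
 shows "norm (of_real t - h) <= t"
proof -
 have "cpos ((1 / t) *\<^sub>R h)" using h t by (simp add: cpos_scaleR)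
 moreover have "cpos (1 - (1 / t) *\<^sub>R h)"
  using n t by (intro cpos_one_minus selfadjoint_scaleR cpos_selfadjoint[OF h]) auto
 ultimately have "norm (1 - (1 / t) *\<^sub>R h) <= 1"
  using cpos_norm_le_one[of "1 - (1 / t) *\<^sub>R h"] by simp
 then have "norm (t *\<^sub>R (1 - (1 / t) *\<^sub>R h)) <= t" using t by simp
 then show ?thesis using t by (simp add: scaleR_diff_right of_real_def)
qed

text \<open>By \<open>cpos_bound_norm\<close> the single witness \<open>t = norm h + 1\<close> works
  for all small shifts, so the norm bound survives the limit \<open>d -> 0\<close>.\<close>

lemma cpos_closed:
 assumes h: "selfadjoint h" and "!!d. d > 0 ==> cpos (h + of_real d)"
 shows "cpos h"
proof -
 define t where "t = norm h + 1"
 have t: "t > 0" by (simp add: t_def add_nonneg_pos)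
 have "norm (of_real t - h) <= t"
 proof (rule field_le_epsilon)
  fix e :: real assume e: "e > 0"
  define d where "d = min 1 e / 2"
  have d: "d > 0" "2 * d <= e" "d <= 1" using e by (auto simp: d_def)
  have "norm (h + of_real d) <= t" using norm_triangle_ineq[of h "of_real d"] d by (simp add: t_def)
  from cpos_bound_norm[OF assms(2)[OF d(1)] this t]
  have "norm (of_real t - (h + of_real d)) <= t" .
  moreover have "of_real t - h = (of_real t - (h + of_real d)) + of_real d" by simp
  ultimately show "norm (of_real t - h) <= t + e"
   using norm_triangle_ineq[of "of_real t - (h + of_real d)" "of_real d"] d by simp
 qed
 then show ?thesis using h t unfolding cpos_def by auto
qed

text \<open>With \<open>g\<close> a root of \<open>h + r\<close> commuting with \<open>d\<close>,
  the square of the selfadjoint \<open>d * g\<close> is \<open>d * h * d + r d^2\<close>, and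
  \<open>r\<close> is chosen so that the error \<open>r d^2\<close> stays below
  \<open>e\<close>.\<close>

lemma cpos_sandwich:
 assumes h: "cpos h" and d: "selfadjoint d" and c: "h * d = d * h"
 shows "cpos (d * h * d)"
proof (rule cpos_closed)
 show "selfadjoint (d * h * d)"
  using cpos_selfadjoint[OF h] d by (simp add: selfadjoint_def star_mult mult.assoc)
 fix e :: real assume e: "e > 0"
 define r where "r = e / (norm (d * d) + 1)"
 have r: "r > 0" using e by (simp add: r_def add_nonneg_pos)
 obtain g where g: "selfadjoint g" "g * g = h + of_real r" "!!y. h * y = y * h ==> g * y = y * g"
  using cpos_sqrt[OF h r] by metis
 have gd: "g * d = d * g" by (rule g(3)[OF c])
 have "star (d * g) = g * d" using g(1) d by (simp add: selfadjoint_def star_mult)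
 then have "selfadjoint (d * g)" by (simp only: selfadjoint_def gd)
 then have "cpos ((d * g) * (d * g))" by (rule cpos_square)
 moreover have "(d * g) * (d * g) = d * h * d + r *\<^sub>R (d * d)"
 proof -
  have "(d * g) * (d * g) = (d * g) * (g * d)" by (simp only: gd)
  also have "... = d * (g * g) * d" by (simp only: mult.assoc)
  finally have "(d * g) * (d * g) = d * (g * g) * d" .
  then show ?thesis by (simp add: g of_real_def algebra_simps)
 qed
 moreover have "cpos (of_real e - r *\<^sub>R (d * d))"
 proof (rule cpos_of_real_minus)
  show "selfadjoint (r *\<^sub>R (d * d))" using d by (intro selfadjoint_scaleR) (simp add: selfadjoint_def star_mult)
  have "r * norm (d * d) <= r * (norm (d * d) + 1)" using r by simp
  also have "... = e" by (simp add: r_def add_nonneg_eq_0_iff)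
  finally show "norm (r *\<^sub>R (d * d)) <= e" using r by simp
 qed
 ultimately show "cpos (d * h * d + of_real e)"
  using cpos_add[of "(d * g) * (d * g)" "of_real e - r *\<^sub>R (d * d)"] by simp
qed

text \<open>Sandwiching by \<open>u\<close> raises the exponent by two, so the induction has the two
  base cases 0 and 1.\<close>

lemma cpos_power:
 assumes u: "cpos u"
 shows "cpos (u ^ n)"
proof (induction n rule: less_induct)
 case (less n)
 consider "n = 0" | "n = 1" | m where "n = Suc (Suc m)" by (metis One_nat_def old.nat.exhaust)
 then show ?case
 proof cases
  case 1 then show ?thesis using cpos_of_real[of 1] by simp
 next
  case 2 then show ?thesis using u by simp
 next
  case (3 m)
  have "u ^ n = u * u ^ m * u" by (simp only: 3 power_Suc mult.assoc power_commutes)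
  moreover have "cpos (u * u ^ m * u)"
   by (rule cpos_sandwich[OF _ cpos_selfadjoint[OF u] power_commutes], rule less.IH) (simp add: 3)
  ultimately show ?thesis by simp
 qed
qed

text \<open>This replaces the fact that \<open>star x * x\<close> and \<open>x * star x\<close> have
  the same spectrum apart from zero. From \<open>p x = x q\<close> the products
  \<open>p^m z = x q^m star x\<close> are of order \<open>t^m\<close>, so \<open>p^m\<close> grows
  at most linearly relative to \<open>t^m\<close>, and the growth criterion yields
  \<open>norm p <= t\<close>.\<close>

lemma cpos_one_minus_swap:
 assumes x: "cpos (1 - star x * x)"
 shows "cpos (1 - x * star x)"
proof -
 define y where "y = star x * x"
 define z where "z = x * star x"
 obtain t0 where "norm (of_real t0 - (1 - y)) <= t0"
  using x by (auto simp: cpos_def y_def)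
 \<comment> \<open>Raising the witness to at least one keeps the coefficient \<open>t - 1\<close> of
   the recursion for \<open>p ^ m\<close> nonnegative.\<close>
 then have "norm (of_real (max t0 1) - (1 - y)) <= max t0 1" by (rule cpos_bound_mono) simp
 then obtain t where t: "t >= 1" "norm (of_real t - (1 - y)) <= t"
  by (meson max.cobounded2)
 define q where "q = of_real t - (1 - y)"
 define p where "p = of_real t - (1 - z)"
 have "p * x = x * q" by (simp add: p_def q_def y_def z_def algebra_simps of_real_def)
 then have px: "p ^ m * x = x * q ^ m" for m
 proof (induction m)
  case (Suc m)
  have "p ^ Suc m * x = p * (p ^ m * x)" by (simp add: mult.assoc)
  also have "... = x * (q * q ^ m)" by (simp add: Suc mult.assoc[symmetric])
  finally show ?case by simp
 qed simp
 have pz: "norm (p ^ m * z) <= norm x ^ 2 * t ^ m" for m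
 proof -
  have "p ^ m * z = x * q ^ m * star x" by (simp add: z_def px[symmetric] mult.assoc)
  then have "norm (p ^ m * z) <= norm (x * q ^ m) * norm x"
   using norm_mult_ineq[of "x * q ^ m" "star x"] by simp
  also have "... <= (norm x * norm (q ^ m)) * norm x"
   by (intro mult_right_mono norm_mult_ineq) simp
  also have "... <= (norm x * t ^ m) * norm x"
   using norm_power_ineq[of q m] power_mono[of "norm q" t m] t
   by (intro mult_right_mono mult_left_mono) (auto simp: q_def)
  finally show ?thesis by (simp add: power2_eq_square mult_ac)
 qed
 have "norm (p ^ m) <= (1 + norm x ^ 2 * real m) * t ^ m" for m
 proof (induction m)
  case (Suc m)
  have "p ^ Suc m = (t - 1) *\<^sub>R p ^ m + p ^ m * z"
  proof -
   have "p = (t - 1) *\<^sub>R 1 + z" by (simp add: p_def of_real_def algebra_simps)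
   then have "p ^ m * p = p ^ m * ((t - 1) *\<^sub>R 1 + z)" by simp
   then show ?thesis by (simp only: power_Suc2 distrib_left mult_scaleR_right mult_1_right)
  qed
  then have "norm (p ^ Suc m) <= (t - 1) * norm (p ^ m) + norm (p ^ m * z)"
   using norm_triangle_ineq[of "(t - 1) *\<^sub>R p ^ m" "p ^ m * z"] t by simp
  also have "... <= t * ((1 + norm x ^ 2 * real m) * t ^ m) + norm x ^ 2 * t ^ m"
   using Suc pz[of m] t by (intro add_mono mult_mono) auto
  also have "... <= t * ((1 + norm x ^ 2 * real m) * t ^ m) + norm x ^ 2 * t ^ Suc m"
   using t by (simp add: mult_left_mono)
  finally show ?case by (simp add: algebra_simps)
 qed simp
 from norm_selfadjoint_growth[OF _ _ this] have "norm p <= t"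
  using t by (simp add: p_def z_def selfadjoint_diff)
 then show ?thesis unfolding cpos_def using t
  by (intro conjI exI[of _ t] selfadjoint_diff) (auto simp: p_def z_def)
qed

text \<open>Twice the sum equals \<open>g^2 + f^2\<close> for the selfadjoint elements
  \<open>g = x + star x\<close> and \<open>f = i (x - star x)\<close>.\<close>

lemma cpos_star_mult_add:
 "cpos (star x * x + x * star x)"
proof -
 define g where "g = x + star x"
 define f where "f = \<i> *\<^sub>C (x - star x)"
 have sa: "selfadjoint g" "selfadjoint f"
  by (simp_all add: g_def f_def selfadjoint_def star_add star_diff star_star star_scaleC scaleC_diff_right)
 have "g * g + f * f = 2 *\<^sub>R (star x * x + x * star x)"
  by (simp add: g_def f_def scaleC_mult_left scaleC_mult_right scaleC_scaleC scaleC_diff_right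
    algebra_simps scaleR_2)
 moreover have "cpos (g * g + f * f)" by (intro cpos_add cpos_square sa)
 ultimately have "cpos (2 *\<^sub>R (star x * x + x * star x))" by simp
 from cpos_scaleR[OF this, of "1/2"] show ?thesis by simp
qed

text \<open>Fukamiya's theorem. For \<open>b = star a * a\<close> of norm at most one, the powers of \<open>u = 1 - b\<close> grow
 linearly: \<open>x = a u\<^sup>n\<close> satisfies \<open>star x * x <= 1\<close>, hence \<open>x * star x <= 1\<close>, and then
 \<open>star x * x >= - x * star x >= -1\<close>, so that \<open>b u\<^sup>2\<^sup>n = star x * x\<close> is bounded.\<close>

lemma cpos_star_mult:
 "cpos (star a * a)"
proof -
 have main: "cpos (star a * a)" if a: "norm a <= 1" for a :: 'a
 proof -
  define b where "b = star a * a"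
  define u where "u = 1 - b"
  have b: "selfadjoint b" "norm b <= 1"
   using a by (simp_all add: b_def cstar_identity power_le_one)
  have u: "cpos u" "norm u <= 2" "selfadjoint u"
   using cpos_one_minus[OF b] norm_triangle_ineq4[of 1 b] b by (auto simp: u_def cpos_selfadjoint)
  have su: "star u = u" using u by (simp add: selfadjoint_def)
  have bu: "b * u ^ n = u ^ n * b" for n
   by (rule power_commuting_commutes[symmetric]) (simp add: u_def algebra_simps)
  \<comment> \<open>This product is \<open>(u - 1)^2\<close> times a sum of powers of the positive
    \<open>u\<close>, built up by one sandwich per step. It makes
    \<open>1 - b u^(2n) = u + (u - 1)(u^(2n) - 1)\<close> positive.\<close>
  have geo: "cpos ((u - 1) * (u ^ m - 1))" for m
  proof (induction m)
   case (Suc m)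
   have "(u - 1) * (u ^ Suc m - 1) = (u - 1) * (u ^ m - 1) + (u - 1) * u ^ m * (u - 1)"
    by (simp only: power_Suc2) (simp add: algebra_simps)
   moreover have "cpos ((u - 1) * u ^ m * (u - 1))"
   proof (rule cpos_sandwich)
    show "u ^ m * (u - 1) = (u - 1) * u ^ m"
     by (simp only: right_diff_distrib left_diff_distrib power_commutes) simp
   qed (use u in \<open>auto intro: cpos_power selfadjoint_diff\<close>)
   ultimately show ?case using Suc cpos_add by auto
  qed (simp add: cpos_zero)
  have even: "norm (b * u ^ (2 * n)) <= 3" for n
  proof -
   define x where "x = a * u ^ n"
   have y: "star x * x = b * u ^ (2 * n)"
   proof -
    have "star x * x = u ^ n * b * u ^ n"
     by (simp add: x_def star_mult star_power su b_def mult.assoc)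
    also have "... = b * (u ^ n * u ^ n)" by (simp only: bu[symmetric] mult.assoc)
    finally show ?thesis by (simp only: mult_2 power_add)
   qed
   have "1 - star x * x = u + (u - 1) * (u ^ (2 * n) - 1)"
    unfolding y by (simp add: u_def algebra_simps)
   then have 1: "cpos (1 - star x * x)" using cpos_add[OF u(1) geo] by simp
   have "cpos ((1 - x * star x) + (star x * x + x * star x))"
    by (intro cpos_add cpos_one_minus_swap 1 cpos_star_mult_add)
   then have "cpos (1 + star x * x)" by simp
   then have c: "cpos ((1/2) *\<^sub>R (1 + star x * x))" by (simp add: cpos_scaleR)
   have "cpos ((1/2) *\<^sub>R (1 - star x * x))" using 1 by (simp add: cpos_scaleR)
   also have "(1/2) *\<^sub>R (1 - star x * x) = 1 - (1/2) *\<^sub>R (1 + star x * x)"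
   proof -
    have "(1/2) *\<^sub>R (1::'a) + (1/2) *\<^sub>R 1 = 1" by (simp only: scaleR_add_left[symmetric]) simp
    then show ?thesis by (simp only: scaleR_diff_right scaleR_add_right) (simp add: algebra_simps)
   qed
   finally have "norm ((1/2) *\<^sub>R (1 + star x * x)) <= 1" by (rule cpos_norm_le_one[OF c])
   then have "norm (1 + star x * x) <= 2" by simp
   then show ?thesis
    using norm_triangle_ineq4[of "1 + star x * x" 1] by (simp add: y)
  qed
  have bound: "norm (b * u ^ m) <= 6" for m
  proof (cases "even m")
   case True
   then obtain n where "m = 2 * n" by auto
   then show ?thesis using even[of n] by simp
  next
   case False
   then obtain n where n: "m = 2 * n + 1" by (auto elim: oddE)
   have "norm (b * u ^ m) <= norm (b * u ^ (2 * n)) * norm u"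
    using norm_mult_ineq[of "b * u ^ (2 * n)" u] by (simp only: n power_add power_one_right mult.assoc)
   also have "... <= 3 * 2" using even u by (intro mult_mono) auto
   finally show ?thesis by simp
  qed
  have "norm (u ^ m) <= (1 + 6 * real m) * 1 ^ m" for m
  proof (induction m)
   case (Suc m)
   have "u ^ Suc m = u ^ m - b * u ^ m" by (simp add: u_def algebra_simps)
   then show ?case using Suc bound[of m] norm_triangle_ineq4[of "u ^ m" "b * u ^ m"] by simp
  qed simp
  from norm_selfadjoint_growth[OF u(3) _ this] have "norm u <= 1" by simp
  then show ?thesis unfolding cpos_def using b(1)
   by (intro conjI exI[of _ 1]) (simp_all add: u_def b_def)
 qed
 define s where "s = norm a + 1"
 have s: "s > 0" by (simp add: s_def add_nonneg_pos)
 have "cpos (star ((1 / s) *\<^sub>R a) * ((1 / s) *\<^sub>R a))"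
  by (rule main) (use s in \<open>simp add: s_def\<close>)
 then have "cpos ((s * s) *\<^sub>R (star ((1 / s) *\<^sub>R a) * ((1 / s) *\<^sub>R a)))"
  using s by (intro cpos_scaleR) auto
 then show ?thesis using s by (simp add: star_scaleR)
qed

text \<open>For \<open>r > norm (c + d)\<close> the element \<open>1 - c / r\<close> is the sum of
  the positive elements \<open>1 - (c + d) / r\<close> and \<open>d / r\<close>, so
  \<open>norm c <= r\<close>.\<close>

lemma cpos_norm_mono:
 assumes c: "cpos c" and d: "cpos d"
 shows "norm c <= norm (c + d)"
proof (rule field_le_epsilon)
 fix e :: real assume e: "e > 0"
 define r where "r = norm (c + d) + e"
 have r: "r > 0" using e by (simp add: r_def add_nonneg_pos)
 have "cpos (1 - (1 / r) *\<^sub>R (c + d))"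
  using c d r e by (intro cpos_one_minus selfadjoint_scaleR cpos_selfadjoint cpos_add) (auto simp: r_def)
 then have "cpos (1 - (1 / r) *\<^sub>R (c + d) + (1 / r) *\<^sub>R d)"
  using d r by (intro cpos_add cpos_scaleR) auto
 then have "cpos (1 - (1 / r) *\<^sub>R c)" by (simp add: scaleR_add_right)
 with c r have "norm ((1 / r) *\<^sub>R c) <= 1" by (intro cpos_norm_le_one cpos_scaleR) auto
 then show "norm c <= norm (c + d) + e" using r by (simp add: r_def)
qed

subsection \<open>Positive functionals\<close>

definition sublinear :: "('v::real_vector => real) => bool" where
 "sublinear p \<longleftrightarrow> (\<forall>x y. p (x + y) <= p x + p y) \<and> (\<forall>r\<ge>0. \<forall>x. p (r *\<^sub>R x) = r * p x)"

lemma sublinear_zero: "sublinear p ==> p 0 = 0"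
 unfolding sublinear_def by auto

lemma sublinear_lower: "sublinear p ==> - p (- x) <= p x"
 using sublinear_zero[of p] unfolding sublinear_def by (smt (verit) add.right_inverse)

lemma sublinearI:
 assumes "!!x y. p (x + y) <= p x + p y" "p 0 = 0" and le: "!!r x. r > 0 ==> p (r *\<^sub>R x) <= r * p x"
 shows "sublinear p"
proof -
 have "p (r *\<^sub>R x) = r * p x" if "r > 0" for r x
  using le[OF that, of x] le[of "1 / r" "r *\<^sub>R x"] that by (simp add: field_simps)
 then show ?thesis using assms unfolding sublinear_def by (metis le_less mult_zero_left scaleR_zero_left)
qed

text \<open>A minimal sublinear functional is linear; this gives the Hahn-Banach theorem.\<close>

lemma sublinear_minimal_linear:
 assumes q: "sublinear q" and min: "!!r. sublinear r ==> (!!x. r x <= q x) ==> r = q"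
 shows "linear (q :: 'v::real_vector => real)"
proof -
 have add: "q (x + y) <= q x + q y" for x y using q by (simp add: sublinear_def)
 have scale: "r >= 0 ==> q (r *\<^sub>R x) = r * q x" for r x using q by (simp add: sublinear_def)
 have additive: "q (y + x) = q y + q x" for x y
 proof -
  \<comment> \<open>Lowering \<open>q\<close> in the direction \<open>x\<close>: the infimum of
    \<open>S y\<close> is again sublinear and below \<open>q\<close>, hence equal to
    \<open>q\<close> by minimality, and its member at \<open>t = 1\<close> gives
    \<open>q y <= q (y + x) - q x\<close>.\<close>
  define S where "S y = (\<lambda>t. q (y + t *\<^sub>R x) - t * q x) ` {0..}" for y
  define r where "r y = Inf (S y)" for y
  have lower: "- q (- y) <= q (y + t *\<^sub>R x) - t * q x" if "t >= 0" for t y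
   using add[of "y + t *\<^sub>R x" "- y"] scale[OF that, of x] by simp
  have bdd: "bdd_below (S y)" for y
   by (rule bdd_belowI[of _ "- q (- y)"]) (auto simp: S_def lower)
  have ne: "S y ~= {}" for y by (auto simp: S_def)
  have mem: "t >= 0 ==> q (y + t *\<^sub>R x) - t * q x \<in> S y" for t y by (auto simp: S_def)
  have r_le: "r y <= q (y + t *\<^sub>R x) - t * q x" if "t >= 0" for t y
   unfolding r_def by (rule cInf_lower[OF mem[OF that] bdd])
  have "sublinear r"
  proof (rule sublinearI)
   fix y z
   have "r (y + z) - a <= b" if ab: "a \<in> S y" "b \<in> S z" for a b
   proof -
    obtain s t where st: "s >= 0" "t >= 0" "a = q (y + s *\<^sub>R x) - s * q x" "b = q (z + t *\<^sub>R x) - t * q x"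
     using ab by (auto simp: S_def)
    have "r (y + z) <= q (y + z + (s + t) *\<^sub>R x) - (s + t) * q x" using st by (intro r_le) simp
    also have "q (y + z + (s + t) *\<^sub>R x) <= q (y + s *\<^sub>R x) + q (z + t *\<^sub>R x)"
     using add[of "y + s *\<^sub>R x" "z + t *\<^sub>R x"] by (simp add: algebra_simps)
    finally show ?thesis using st by (simp add: algebra_simps)
   qed
   then have "r (y + z) - a <= r z" if "a \<in> S y" for a
    unfolding r_def[of z] using that by (intro cInf_greatest ne) auto
   then have "r (y + z) - r z <= r y"
    unfolding r_def[of y] by (intro cInf_greatest ne) (simp add: algebra_simps)
   then show "r (y + z) <= r y + r z" by simp
  next
   have "S 0 = {0}" using scale by (auto simp: S_def)
   then show "r 0 = 0" by (simp add: r_def)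
  next
   fix c :: real and y assume c: "c > 0"
   have "r (c *\<^sub>R y) / c <= a" if a: "a \<in> S y" for a
   proof -
    obtain t where t: "t >= 0" "a = q (y + t *\<^sub>R x) - t * q x" using a by (auto simp: S_def)
    have "r (c *\<^sub>R y) <= q (c *\<^sub>R y + (c * t) *\<^sub>R x) - (c * t) * q x" using t c by (intro r_le) simp
    also have "c *\<^sub>R y + (c * t) *\<^sub>R x = c *\<^sub>R (y + t *\<^sub>R x)" by (simp add: algebra_simps)
    also have "q ... = c * q (y + t *\<^sub>R x)" using c by (intro scale) simp
    finally show ?thesis using c by (simp add: t field_simps)
   qed
   then have "r (c *\<^sub>R y) / c <= r y" unfolding r_def[of y] by (intro cInf_greatest ne) auto
   then show "r (c *\<^sub>R y) <= c * r y" using c by (simp add: field_simps)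
  qed
  then have "r = q" using r_le[of 0] by (intro min) auto
  then have "q y <= q (y + 1 *\<^sub>R x) - 1 * q x" using r_le[of 1 y] by simp
  then show ?thesis using add[of y x] by simp
 qed
 have neg: "q (- x) = - q x" for x
  using additive[of x "- x"] sublinear_zero[OF q] by simp
 show ?thesis
 proof (rule linearI)
  show "q (c *\<^sub>R x) = c *\<^sub>R q x" for c x
  proof (cases "c >= 0")
   case False
   then have "q (c *\<^sub>R x) = - q ((- c) *\<^sub>R x)" using neg[of "(- c) *\<^sub>R x"] by simp
   then show ?thesis using False scale[of "- c" x] by simp
  qed (simp add: scale)
 qed (rule additive)
qed

text \<open>Zorn's lemma among the sublinear functionals below \<open>p\<close>, ordered downwards.
  The infimum over a chain is finite because all members are at least \<open>- p (- x)\<close>, and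
  subadditive because of two members of a chain one lies below the other.\<close>

theorem hahn_banach_sublinear:
 assumes p: "sublinear (p :: 'v::real_vector => real)"
 obtains f where "linear f" "!!x. f x <= p x"
proof -
 define A where "A = {q. sublinear q \<and> (\<forall>x. q x <= p x)}"
 define P where "P = (\<lambda>q r :: 'v => real. \<forall>x. r x <= q x)"
 have "\<exists>m\<in>A. \<forall>a\<in>A. P m a \<longrightarrow> a = m"
 proof (rule predicate_Zorn)
  show "partial_order_on A (relation_of P A)"
   by (rule partial_order_on_relation_ofI) (auto simp: P_def intro!: ext intro: order_trans antisym)
 next
  fix C assume C: "C \<in> Chains (relation_of P A)"
  then have CA: "C \<subseteq> A" and chain: "!!q r. q \<in> C ==> r \<in> C ==> P q r \<or> P r q"
   by (auto simp: Chains_def relation_of_def)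
  show "\<exists>u\<in>A. \<forall>a\<in>C. P a u"
  proof (cases "C = {}")
   case True then show ?thesis using p by (auto simp: A_def)
  next
   case False
   define u where "u x = (INF q\<in>C. q x)" for x
   have sub: "sublinear q" "q x <= p x" if "q \<in> C" for q x using CA that by (auto simp: A_def)
   have lower: "- p (- x) <= q x" if "q \<in> C" for q x
    using sub(2)[OF that, of "- x"] sublinear_lower[OF sub(1)[OF that], of x] by simp
   have bdd: "bdd_below ((\<lambda>q. q x) ` C)" for x
    by (rule bdd_belowI[of _ "- p (- x)"]) (use lower in auto)
   have u_le: "u x <= q x" if "q \<in> C" for q x
    unfolding u_def by (rule cINF_lower[OF bdd that])
   have u_ge: "a <= u x" if "!!q. q \<in> C ==> a <= q x" for a x
    unfolding u_def using False that by (intro cINF_greatest) auto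
   have "sublinear u"
   proof (rule sublinearI)
    fix x y
    have "u (x + y) - q x <= r y" if qr: "q \<in> C" "r \<in> C" for q r
    proof -
     obtain s where s: "s \<in> C" "s x <= q x" "s y <= r y"
      using chain[OF qr] qr by (auto simp: P_def)
     have "u (x + y) <= s x + s y" using u_le[OF s(1), of "x + y"] sub[OF s(1)]
      by (fastforce simp: sublinear_def intro: order_trans)
     then show ?thesis using s by simp
    qed
    then have "u (x + y) - q x <= u y" if "q \<in> C" for q using that by (intro u_ge) auto
    then have "u (x + y) - u y <= u x" by (intro u_ge) (simp add: algebra_simps)
    then show "u (x + y) <= u x + u y" by simp
   next
    have "(\<lambda>q. q (0::'v)) ` C = {0}" using False sub sublinear_zero by (force simp: image_def)
    then show "u 0 = 0" by (simp add: u_def)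
   next
    fix c :: real and x assume c: "c > 0"
    have "u (c *\<^sub>R x) / c <= u x"
     using u_le[of _ "c *\<^sub>R x"] c sub(1) by (intro u_ge) (auto simp: sublinear_def field_simps)
    then show "u (c *\<^sub>R x) <= c * u x" using c by (simp add: field_simps)
   qed
   moreover obtain q where "q \<in> C" using False by auto
   then have "u x <= p x" for x using u_le[of q x] sub(2)[of q x] by simp
   ultimately show ?thesis using u_le by (auto simp: A_def P_def)
  qed
 qed
 then obtain m where m: "m \<in> A" "!!a. a \<in> A ==> P m a ==> a = m" by auto
 have "linear m"
 proof (rule sublinear_minimal_linear)
  show "r = m" if "sublinear r" "!!x. r x <= m x" for r
   using m that by (auto simp: A_def P_def intro: order_trans)
 qed (use m in \<open>simp add: A_def\<close>)
 then show ?thesis using that m by (auto simp: A_def)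
qed

section \<open>Positive functionals, the Cauchy-Schwarz inequality and the Jordan
  decomposition\<close>

definition positive_functional :: "('a::unital_cstar_algebra => complex) => bool" where
 "positive_functional G \<longleftrightarrow> functional_linear G \<and>
  (\<forall>a. G (star a * a) \<in> \<real> \<and> 0 <= Re (G (star a * a)))"

lemma states_positive: "G \<in> states \<longleftrightarrow> positive_functional G \<and> G 1 = 1"
 by (auto simp: states_def positive_functional_def)

lemma functional_linear_simps:
 assumes "functional_linear G"
 shows "G (a + b) = G a + G b" "G (c *\<^sub>C a) = c * G a" "G 0 = 0" "G (- a) = - G a"
  "G (a - b) = G a - G b" "G (r *\<^sub>R a) = r *\<^sub>R G a"
proof -
 show add: "G (a + b) = G a + G b" for a b using assms by (simp add: functional_linear_def)
 show scale: "G (c *\<^sub>C a) = c * G a" for c a using assms by (simp add: functional_linear_def)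
 show "G 0 = 0" using scale[of 0 0] by simp
 show neg: "G (- a) = - G a" for a using scale[of "-1" a] by simp
 show "G (a - b) = G a - G b" using add[of a "- b"] neg by simp
 show "G (r *\<^sub>R a) = r *\<^sub>R G a" using scale[of "complex_of_real r" a]
  by (simp add: scaleC_of_real scaleR_conv_of_real)
qed

text \<open>With \<open>c = - t * cnj z\<close> the hypothesis becomes a real quadratic inequality
  in \<open>t\<close>; \<open>t = 1 / b\<close> minimises it, and for \<open>b = 0\<close> a large
  \<open>t\<close> forces \<open>z = 0\<close>. It serves positive functionals, the forms on the
  bidual and Hilbert spaces alike.\<close>

lemma cauchy_schwarz_discriminant:
 fixes z :: complex
 assumes "!!c. 0 <= a + 2 * Re (c * z) + (cmod c)\<^sup>2 * b" and b: "b >= 0"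
 shows "(cmod z)\<^sup>2 <= a * b"
proof -
 have zc: "- (of_real t * cnj z) * z = - of_real (t * (cmod z)\<^sup>2)" for t
  by (simp add: mult.commute[of "cnj z"] complex_norm_square[symmetric])
 have key: "0 <= a - 2 * t * (cmod z)\<^sup>2 + t\<^sup>2 * (cmod z)\<^sup>2 * b" for t
  using assms(1)[of "- (of_real t * cnj z)"] unfolding zc by (simp add: norm_mult power_mult_distrib)
 show ?thesis
 proof (cases "b > 0")
  case True
  have "0 <= a - 2 * (1 / b) * (cmod z)\<^sup>2 + (1 / b)\<^sup>2 * (cmod z)\<^sup>2 * b" by (rule key)
  also have "... = a - (cmod z)\<^sup>2 / b" by (simp add: power2_eq_square)
  finally show ?thesis using True by (simp add: field_simps)
 next
  case False
  have a: "a >= 0" using key[of 0] by simp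
  have "z = 0"
  proof (rule ccontr)
   assume z: "z ~= 0"
   have "0 <= a - 2 * t * (cmod z)\<^sup>2" if "t >= 0" for t
    using key[of t] False mult_nonneg_nonpos[of "t\<^sup>2 * (cmod z)\<^sup>2" b] by simp
   from this[of "(a + 1) / (cmod z)\<^sup>2"] show False using a z by simp
  qed
  then show ?thesis using b a by simp
 qed
qed

lemma positive_functional_linear: "positive_functional G ==> functional_linear G"
 by (simp add: positive_functional_def)

lemma positive_functional_nonneg: "positive_functional G ==> 0 <= Re (G (star a * a))"
 by (simp add: positive_functional_def)

lemma positive_functional_one: "positive_functional G ==> 0 <= Re (G 1)"
 using positive_functional_nonneg[of G 1] by simp

lemma positive_functional_add:
 "positive_functional G ==> positive_functional \<psi> ==> positive_functional (\<lambda>a. G a + \<psi> a)"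
 by (auto simp: positive_functional_def functional_linear_def algebra_simps)

text \<open>Reality of the value at \<open>star y * y\<close> compares the imaginary parts when
  \<open>y = 1 + a\<close> and the real parts when \<open>y = 1 + i a\<close>.\<close>

lemma positive_functional_star:
 assumes p: "positive_functional G"
 shows "G (star a) = cnj (G a)"
proof -
 note l = functional_linear_simps[OF positive_functional_linear[OF p]]
 have real: "Im (G (star x * x)) = 0" for x
  using p by (auto simp: positive_functional_def complex_is_Real_iff)
 have "star (1 + a) * (1 + a) = 1 + a + star a + star a * a"
  by (simp add: star_add algebra_simps)
 then have 1: "Im (G a + G (star a)) = 0"
  using real[of "1 + a"] real[of a] real[of 1] by (simp add: l)
 have "star (1 + \<i> *\<^sub>C a) * (1 + \<i> *\<^sub>C a) = 1 + \<i> *\<^sub>C a - \<i> *\<^sub>C star a + star a * a"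
  by (simp add: star_add star_scaleC algebra_simps scaleC_mult_left scaleC_mult_right scaleC_scaleC scaleC_diff_right)
 then have 2: "Re (G a - G (star a)) = 0"
  using real[of "1 + \<i> *\<^sub>C a"] real[of a] real[of 1] by (simp add: l)
 show ?thesis using 1 2 by (intro complex_eqI) auto
qed

lemma positive_functional_cauchy_schwarz:
 assumes p: "positive_functional G"
 shows "(cmod (G (star a * b)))\<^sup>2 <= Re (G (star a * a)) * Re (G (star b * b))"
proof (rule cauchy_schwarz_discriminant)
 note l = functional_linear_simps[OF positive_functional_linear[OF p]]
 fix c :: complex
 have ba: "G (star b * a) = cnj (G (star a * b))"
  using positive_functional_star[OF p, of "star a * b"] by (simp add: star_mult star_star)
 have "G (star (a + c *\<^sub>C b) * (a + c *\<^sub>C b))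
   = G (star a * a) + c * G (star a * b) + cnj (c * G (star a * b)) + (c * cnj c) * G (star b * b)"
  by (simp add: star_add star_scaleC algebra_simps scaleC_mult_left scaleC_mult_right l ba)
 then show "0 <= Re (G (star a * a)) + 2 * Re (c * G (star a * b)) + (cmod c)\<^sup>2 * Re (G (star b * b))"
  using positive_functional_nonneg[OF p, of "a + c *\<^sub>C b"]
  by (simp add: cmod_power2) (simp add: power2_eq_square)
qed (rule positive_functional_nonneg[OF p])

text \<open>Positivity is assumed only on elements \<open>star a * a\<close>; a positive
  \<open>h\<close> becomes such a square after adding \<open>d\<close>, and \<open>d\<close> tends
  to zero.\<close>

lemma positive_functional_cpos:
 assumes p: "positive_functional G" and h: "cpos h"
 shows "G h \<in> \<real>" "0 <= Re (G h)"
proof -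
 note l = functional_linear_simps[OF positive_functional_linear[OF p]]
 show "G h \<in> \<real>"
  using positive_functional_star[OF p, of h] cpos_selfadjoint[OF h]
  by (simp add: selfadjoint_def complex_is_Real_iff complex_eq_iff)
 have ge: "- (d * Re (G 1)) <= Re (G h)" if d: "d > 0" for d
 proof -
  obtain g where g: "selfadjoint g" "g * g = h + of_real d" using cpos_sqrt[OF h d] by metis
  have "0 <= Re (G (star g * g))" by (rule positive_functional_nonneg[OF p])
  also have "star g * g = h + d *\<^sub>R 1" using g by (simp add: selfadjoint_def of_real_def)
  finally show ?thesis by (simp add: l)
 qed
 show "0 <= Re (G h)"
 proof (rule field_le_epsilon)
  fix e :: real assume e: "e > 0"
  have pos: "0 <= Re (G 1)" by (rule positive_functional_one[OF p])
  define d where "d = e / (Re (G 1) + 1)"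
  have "d > 0" using e pos by (simp add: d_def)
  moreover have "d * Re (G 1) <= e" using e pos by (simp add: d_def field_simps)
  ultimately show "0 <= Re (G h) + e" using ge[of d] by simp
 qed
qed

text \<open>The difference \<open>(norm a)^2 - star a * a\<close> is a positive element.\<close>

lemma positive_functional_norm_square:
 assumes p: "positive_functional G"
 shows "Re (G (star a * a)) <= Re (G 1) * (norm a)\<^sup>2"
proof -
 note l = functional_linear_simps[OF positive_functional_linear[OF p]]
 have "cpos (of_real ((norm a)\<^sup>2) - star a * a)"
  by (rule cpos_of_real_minus) (simp_all add: cstar_identity)
 from positive_functional_cpos(2)[OF p this] show ?thesis
  by (simp only: of_real_def l) (simp add: mult.commute)
qed

lemma positive_functional_bound:
 assumes p: "positive_functional G"
 shows "cmod (G a) <= Re (G 1) * norm a"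
proof -
 have "(cmod (G a))\<^sup>2 <= Re (G 1) * Re (G (star a * a))"
  using positive_functional_cauchy_schwarz[OF p, of 1 a] by simp
 also have "... <= Re (G 1) * (Re (G 1) * (norm a)\<^sup>2)"
  by (intro mult_left_mono positive_functional_norm_square p positive_functional_one)
 finally have "(cmod (G a))\<^sup>2 <= (Re (G 1) * norm a)\<^sup>2" by (simp add: power2_eq_square mult_ac)
 then show ?thesis by (rule power2_le_imp_le) (simp add: positive_functional_one[OF p])
qed

lemma positive_functional_conj:
 assumes p: "positive_functional G"
 shows "positive_functional (\<lambda>a. G (star b * a * b))"
proof -
 note l = functional_linear_simps[OF positive_functional_linear[OF p]]
 have "star b * (star a * a) * b = star (a * b) * (a * b)" for a by (simp add: star_mult mult.assoc)
 then show ?thesis using p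
 by (auto simp: positive_functional_def functional_linear_def algebra_simps scaleC_mult_left scaleC_mult_right)
qed

lemma dualI:
 assumes "functional_linear G" "!!a. cmod (G a) <= K * norm a"
 shows "G \<in> dual"
 using assms by (auto simp: dual_def)

lemma positive_functional_dual: "positive_functional G ==> G \<in> dual"
 by (rule dualI[OF positive_functional_linear positive_functional_bound])

text \<open>The Jordan decomposition of a hermitian functional, by extending the sublinear functional
 \<open>x \<mapsto> inf \<parallel>x + c + d\<parallel> K - F c\<close> (infimum over positive \<open>c\<close>, \<open>d\<close>), which is finite because the norm is
 monotone on positive elements.\<close>

lemma hermitian_functional_decomposition:
 assumes lin: "functional_linear F" and K: "!!a. cmod (F a) <= K * norm a"
  and herm: "!!a. F (star a) = cnj (F a)"
 obtains P N where "positive_functional P" "positive_functional N" "!!a. F a = P a - N a"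
  "Re (P 1) <= K" "Re (N 1) <= 2 * K"
proof -
 note l = functional_linear_simps[OF lin]
 have K0: "K >= 0" using order_trans[OF norm_ge_zero K[of 1]] by simp
 have lb: "Re (F c) <= K * norm c" for c
  using K[of c] complex_Re_le_cmod[of "F c"] by simp
 \<comment> \<open>The slots \<open>c\<close> and \<open>d\<close> encode the two demands on a
   linear \<open>f <= p\<close>: at the vector \<open>- c\<close>, putting \<open>c\<close> into the
   first slot gives \<open>f c >= Re (F c)\<close>, and putting it into the second gives
   \<open>f c >= 0\<close>.\<close>
 define S where "S x = {K * norm (x + c + d) - Re (F c) | c d. cpos c \<and> cpos d}" for x
 define p where "p x = Inf (S x)" for x
 have lower: "- K * norm x <= K * norm (x + c + d) - Re (F c)" if "cpos c" "cpos d" for x c d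
 proof -
  have "Re (F c) <= K * norm (c + d)"
   using lb[of c] mult_left_mono[OF cpos_norm_mono[OF that] K0] by simp
  also have "norm (c + d) <= norm (x + c + d) + norm x"
   using norm_triangle_ineq4[of "x + c + d" x] by simp
  finally have "Re (F c) <= K * (norm (x + c + d) + norm x)" using K0 by (simp add: mult_left_mono)
  then show ?thesis by (simp add: algebra_simps)
 qed
 have mem: "cpos c ==> cpos d ==> K * norm (x + c + d) - Re (F c) \<in> S x" for x c d
  by (auto simp: S_def)
 have ne: "S x ~= {}" for x using mem[OF cpos_zero cpos_zero] by auto
 have bdd: "bdd_below (S x)" for x
  by (rule bdd_belowI[of _ "- K * norm x"]) (use lower in \<open>auto simp: S_def\<close>)
 have p_le: "p x <= K * norm (x + c + d) - Re (F c)" if "cpos c" "cpos d" for x c d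
  unfolding p_def by (rule cInf_lower[OF mem[OF that] bdd])
 have p_ge: "a <= p x" if "!!c d. cpos c ==> cpos d ==> a <= K * norm (x + c + d) - Re (F c)" for a x
  unfolding p_def by (intro cInf_greatest ne) (use that in \<open>auto simp: S_def\<close>)
 have "sublinear p"
 proof (rule sublinearI)
  fix x y
  have "p (x + y) - (K * norm (x + c + d) - Re (F c)) <= K * norm (y + e + f) - Re (F e)"
   if "cpos c" "cpos d" "cpos e" "cpos f" for c d e f
  proof -
   have "p (x + y) <= K * norm (x + y + (c + e) + (d + f)) - Re (F (c + e))"
    by (intro p_le cpos_add that)
   also have "norm (x + y + (c + e) + (d + f)) <= norm (x + c + d) + norm (y + e + f)"
    using norm_triangle_ineq[of "x + c + d" "y + e + f"] by (simp add: algebra_simps)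
   finally have "p (x + y) <= K * (norm (x + c + d) + norm (y + e + f)) - Re (F (c + e))"
    using K0 by (simp add: mult_left_mono)
   then show ?thesis by (simp add: l algebra_simps)
  qed
  then have "p (x + y) - (K * norm (x + c + d) - Re (F c)) <= p y" if "cpos c" "cpos d" for c d
   using that by (intro p_ge) auto
  then have "p (x + y) - p y <= p x" by (intro p_ge) (simp add: algebra_simps)
  then show "p (x + y) <= p x + p y" by simp
 next
  show "p 0 = 0"
  proof (rule antisym)
   show "p 0 <= 0" using p_le[OF cpos_zero cpos_zero, of 0] by (simp add: l)
   show "0 <= p 0" using lower[of _ _ 0] by (intro p_ge) simp
  qed
 next
  fix r :: real and x assume r: "r > 0"
  have "p (r *\<^sub>R x) / r <= p x"
  proof (rule p_ge)
   fix c d :: 'a assume cd: "cpos c" "cpos d"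
   have "p (r *\<^sub>R x) <= K * norm (r *\<^sub>R x + r *\<^sub>R c + r *\<^sub>R d) - Re (F (r *\<^sub>R c))"
    using r cd by (intro p_le cpos_scaleR) auto
   also have "norm (r *\<^sub>R x + r *\<^sub>R c + r *\<^sub>R d) = r * norm (x + c + d)"
    using r by (simp add: scaleR_add_right[symmetric])
   finally show "p (r *\<^sub>R x) / r <= K * norm (x + c + d) - Re (F c)"
    using r by (simp add: l field_simps)
  qed
  then show "p (r *\<^sub>R x) <= r * p x" using r by (simp add: field_simps)
 qed
 then obtain f where f: "linear f" "!!x. f x <= p x" by (rule hahn_banach_sublinear) blast
 have fK: "f x <= K * norm x" for x
  using f(2)[of x] p_le[OF cpos_zero cpos_zero, of x] by (simp add: l)
 have f_th: "Re (F c) <= f c" if "cpos c" for c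
  using f(2)[of "- c"] p_le[OF that cpos_zero, of "- c"] linear_neg[OF f(1), of c] by simp
 have f_pos: "0 <= f c" if "cpos c" for c
  using f(2)[of "- c"] p_le[OF cpos_zero that, of "- c"] linear_neg[OF f(1), of c] by (simp add: l)
 \<comment> \<open>\<open>f\<close> is only real linear. Averaging over \<open>star\<close> makes
   \<open>g (i h) = 0\<close> for selfadjoint \<open>h\<close>, so that the complexification
   \<open>P\<close> agrees with \<open>f\<close> there.\<close>
 define g where "g a = (f a + f (star a)) / 2" for a
 define P where "P a = complex_of_real (g a) - \<i> * complex_of_real (g (\<i> *\<^sub>C a))" for a
 note fl = linear_add[OF f(1)] linear_neg[OF f(1)] linear_cmul[OF f(1)]
 have gl: "g (a + b) = g a + g b" "g (r *\<^sub>R a) = r * g a" "g (- a) = - g a" for a b r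
  by (simp_all add: g_def star_add star_scaleR fl field_simps)
 have P_add: "P (a + b) = P a + P b" for a b by (simp add: P_def gl scaleC_add_right algebra_simps)
 have P_R: "P (r *\<^sub>R a) = of_real r * P a" for r a
 proof -
  have "\<i> *\<^sub>C r *\<^sub>R a = r *\<^sub>R \<i> *\<^sub>C a" by (simp add: scaleC_of_real[symmetric] scaleC_scaleC mult.commute)
  then show ?thesis by (simp add: P_def gl algebra_simps)
 qed
 have P_i: "P (\<i> *\<^sub>C a) = \<i> * P a" for a by (simp add: P_def scaleC_scaleC gl algebra_simps)
 have "P (c *\<^sub>C a) = c * P a" for c a
 proof -
  have "c *\<^sub>C a = Re c *\<^sub>R a + \<i> *\<^sub>C (Im c *\<^sub>R a)"
   using complex_eq[of c]
   by (metis (no_types, lifting) scaleC_add_left scaleC_of_real scaleC_scaleC)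
  then have "P (c *\<^sub>C a) = (of_real (Re c) + \<i> * of_real (Im c)) * P a"
   by (simp add: P_add P_R P_i algebra_simps)
  then show ?thesis by (simp only: complex_eq[symmetric])
 qed
 with P_add have P_lin: "functional_linear P" by (simp add: functional_linear_def)
 have P_sa: "P h = of_real (f h)" if "selfadjoint h" for h
  using that by (simp add: P_def g_def selfadjoint_def star_scaleC fl)
 have th_sa: "F h = of_real (Re (F h))" if "selfadjoint h" for h
  using herm[of h] that by (simp add: selfadjoint_def complex_eq_iff)
 have sq: "cpos (star a * a)" for a :: 'a by (rule cpos_star_mult)
 show ?thesis
 proof (rule that)
  show "positive_functional P"
   using P_lin f_pos[OF sq] by (simp add: positive_functional_def P_sa)
  show "positive_functional (\<lambda>a. P a - F a)"
   unfolding positive_functional_def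
  proof (intro conjI allI)
   show "functional_linear (\<lambda>a. P a - F a)"
    using P_lin lin by (simp add: functional_linear_def algebra_simps)
   fix a :: 'a
   have "P (star a * a) - F (star a * a) = of_real (f (star a * a) - Re (F (star a * a)))"
    using th_sa[of "star a * a"] by (simp add: P_sa)
   then show "P (star a * a) - F (star a * a) \<in> \<real>" "0 <= Re (P (star a * a) - F (star a * a))"
    using f_th[OF sq[of a]] by auto
  qed
  show "F a = P a - (P a - F a)" for a by simp
  show "Re (P 1) <= K" using fK[of 1] by (simp add: P_sa)
  show "Re (P 1 - F 1) <= 2 * K"
   using fK[of 1] K[of 1] abs_Re_le_cmod[of "F 1"] by (simp add: P_sa)
 qed
qed

text \<open>Hermitian and skew parts are each split into two positive functionals. The coefficients
  are \<open>1, -1, i, -i\<close>, and the masses at most \<open>K\<close> and \<open>2 * K\<close>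
  of the Jordan parts give the common bound \<open>2 * K\<close>.\<close>

lemma dual_decomposition:
 assumes lin: "functional_linear F" and K: "!!a. cmod (F a) <= K * norm a"
 obtains P z where "!!i. i < 4 ==> positive_functional (P i)" "!!i. i < 4 ==> Re (P i 1) <= 2 * K"
  "!!i. i < 4 ==> cmod (z i) <= 1" "F = (\<lambda>a. \<Sum>i<4::nat. z i * P i a)"
proof -
 note l = functional_linear_simps[OF lin]
 have K0: "K >= 0" using order_trans[OF norm_ge_zero K[of 1]] by simp
 define F1 where "F1 a = (F a + cnj (F (star a))) / 2" for a
 define F2 where "F2 a = (- \<i>) * (F a - cnj (F (star a))) / 2" for a
 have b: "cmod (F1 a) <= K * norm a" "cmod (F2 a) <= K * norm a" for a
  using norm_triangle_ineq[of "F a" "cnj (F (star a))"] norm_triangle_ineq4[of "F a" "cnj (F (star a))"] K[of a] K[of "star a"]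
  by (simp_all add: F1_def F2_def norm_mult)
 have lin12: "functional_linear F1" "functional_linear F2"
  by (auto simp: functional_linear_def F1_def F2_def l star_add star_scaleC algebra_simps add_divide_distrib diff_divide_distrib)
 have herm: "F1 (star a) = cnj (F1 a)" "F2 (star a) = cnj (F2 a)" for a
  by (simp_all add: F1_def F2_def star_star algebra_simps)
 obtain P N where PN: "positive_functional P" "positive_functional N" "!!a. F1 a = P a - N a"
  "Re (P 1) <= K" "Re (N 1) <= 2 * K"
  by (rule hermitian_functional_decomposition[OF lin12(1) b(1) herm(1)]) blast
 obtain P' N' where PN': "positive_functional P'" "positive_functional N'" "!!a. F2 a = P' a - N' a"
  "Re (P' 1) <= K" "Re (N' 1) <= 2 * K"
  by (rule hermitian_functional_decomposition[OF lin12(2) b(2) herm(2)]) blast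
 define Q where "Q = (\<lambda>i::nat. if i = 0 then P else if i = 1 then N else if i = 2 then P' else N')"
 define z where "z = (\<lambda>i::nat. if i = 0 then 1 else if i = 1 then - 1 else if i = 2 then \<i> else - \<i>)"
 have "F a = F1 a + \<i> * F2 a" for a
  by (simp add: F1_def F2_def field_simps)
 then have "F a = (\<Sum>i<4. z i * Q i a)" for a
  by (simp add: Q_def z_def PN PN' eval_nat_numeral algebra_simps)
 then show ?thesis
  using PN PN' K0 by (intro that[of Q z]) (auto simp: Q_def z_def)
qed

subsection \<open>Supports of states in the bidual\<close>

lemma dualD: "G \<in> dual ==> functional_linear G"
 by (simp add: dual_def)

lemma dual_bounded_linear: "G \<in> dual ==> bounded_linear G"
proof -
 assume "G \<in> dual"
 then obtain K where l: "functional_linear G" and K: "!!a. cmod (G a) <= K * norm a"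
  by (auto simp: dual_def)
 show ?thesis
  by (rule bounded_linear_intro[of _ K]) (use K in \<open>simp_all add: functional_linear_simps[OF l] mult.commute\<close>)
qed

lemma dual_onorm: "G \<in> dual ==> cmod (G a) <= onorm G * norm a"
 by (rule onorm[OF dual_bounded_linear])

lemma onorm_le:
 assumes "!!a. cmod (G a) <= K * norm (a::'a::unital_cstar_algebra)"
 shows "onorm G <= K"
 using order_trans[OF norm_ge_zero assms[of 1]] assms by (intro onorm_bound) auto

lemma dual_iff: "G \<in> dual \<longleftrightarrow> functional_linear G \<and> bounded_linear G"
proof -
 have "G \<in> dual" if "functional_linear G" "bounded_linear G"
  using that bounded_linear.bounded[of G] by (auto simp: dual_def mult.commute)
 then show ?thesis using dualD dual_bounded_linear by blast
qed

lemma dual_add: "G \<in> dual ==> F \<in> dual ==> (\<lambda>a. G a + F a) \<in> dual"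
 by (auto simp: dual_iff functional_linear_def algebra_simps intro: bounded_linear_add)

lemma dual_scale: "G \<in> dual ==> (\<lambda>a. c * G a) \<in> dual"
 by (auto simp: dual_iff functional_linear_def algebra_simps intro: bounded_linear_compose[OF bounded_linear_mult_right])

lemma dual_diff: "G \<in> dual ==> F \<in> dual ==> (\<lambda>a. G a - F a) \<in> dual"
 using dual_add[OF _ dual_scale[of F "-1"]] by simp

lemma dual_zero: "(\<lambda>a. 0) \<in> dual"
 by (rule dualI[of _ 0]) (simp_all add: functional_linear_def)

lemma dual_sum: "(!!i. i \<in> I ==> G i \<in> dual) ==> (\<lambda>a. \<Sum>i\<in>I. G i a) \<in> dual"
 by (induction I rule: infinite_finite_induct) (simp_all add: dual_zero dual_add)

lemma dual_mult_left: "G \<in> dual ==> (\<lambda>b. G (a * b)) \<in> dual"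
 and dual_mult_right: "G \<in> dual ==> (\<lambda>b. G (b * a)) \<in> dual"
 by (auto simp: dual_iff functional_linear_def distrib_left distrib_right scaleC_mult_left scaleC_mult_right
   intro: bounded_linear_compose[OF _ bounded_linear_mult_right] bounded_linear_compose[OF _ bounded_linear_mult_left])

lemma dual_star: "G \<in> dual ==> (\<lambda>a. cnj (G (star a))) \<in> dual"
proof -
 assume d: "G \<in> dual"
 note l = functional_linear_simps[OF dualD[OF d]]
 show ?thesis
  by (rule dualI[of _ "onorm G"])
   (use dual_onorm[OF d, of "star _"] in \<open>simp_all add: functional_linear_def l star_add star_scaleC\<close>)
qed

lemma dual_star_iff: "(\<lambda>a. cnj (G (star a))) \<in> dual \<longleftrightarrow> G \<in> dual"
 using dual_star[of G] dual_star[of "\<lambda>a. cnj (G (star a))"] by (auto simp: star_star)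

lemma bidualE:
 assumes "x \<in> bidual"
 obtains K where "K >= 0" "!!G. G \<in> dual ==> cmod (x G) <= K * onorm G"
proof -
 obtain K where K: "\<forall>G\<in>dual. cmod (x G) <= K * onorm G"
  using assms by (auto simp: bidual_def)
 have "cmod (x G) <= \<bar>K\<bar> * onorm G" if "G \<in> dual" for G
  using bspec[OF K that] mult_right_mono[OF abs_ge_self[of K] onorm_pos_le[OF dual_bounded_linear[OF that]]]
  by simp
 then show ?thesis using that[of "\<bar>K\<bar>"] by simp
qed

lemma bidual_bound:
 assumes x: "!!G. G \<in> dual ==> cmod (x G) <= K * onorm G" "K >= 0"
  and p: "G \<in> dual" and c: "!!a. cmod (G a) <= c * norm a"
 shows "cmod (x G) <= K * c"
 using x(1)[OF p] mult_left_mono[OF onorm_le[OF c] x(2)] by simp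

lemma bidual_apply:
 assumes "x \<in> bidual"
 shows "G \<in> dual ==> F \<in> dual ==> x (\<lambda>a. G a + F a) = x G + x F"
  and "G \<in> dual ==> x (\<lambda>a. c * G a) = c * x G"
  and "G \<notin> dual ==> x G = 0"
 using assms by (auto simp: bidual_def)

lemma bidual_apply_diff:
 assumes x: "x \<in> bidual" and d: "G \<in> dual" "F \<in> dual"
 shows "x (\<lambda>a. G a - F a) = x G - x F"
 using bidual_apply(1)[OF x d(1) dual_scale[OF d(2), of "-1"]] bidual_apply(2)[OF x d(2), of "-1"] by simp

lemma bidual_apply_sum:
 assumes x: "x \<in> bidual" and d: "!!i. i \<in> I ==> G i \<in> dual"
 shows "x (\<lambda>a. \<Sum>i\<in>I. G i a) = (\<Sum>i\<in>I. x (G i))"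
 using d
proof (induction I rule: infinite_finite_induct)
 case (insert i I)
 then show ?case by (simp add: bidual_apply(1)[OF x] dual_sum)
qed (use bidual_apply(2)[OF x dual_zero, of 0] in simp_all)

lemma bidualI:
 assumes "!!G F. G \<in> dual ==> F \<in> dual ==> x (\<lambda>a. G a + F a) = x G + x F"
  "!!c G. G \<in> dual ==> x (\<lambda>a. c * G a) = c * x G"
  "!!G. G \<in> dual ==> cmod (x G) <= K * onorm G"
  "!!G. G \<notin> dual ==> x G = 0"
 shows "x \<in> bidual"
 using assms unfolding bidual_def by blast

lemma bidual_left_dual:
 assumes x: "x \<in> bidual" and d: "F \<in> dual"
 shows "(\<lambda>a. x (\<lambda>b. F (a * b))) \<in> dual"
proof -
 obtain K where K: "K >= 0" "!!G. G \<in> dual ==> cmod (x G) <= K * onorm G" by (rule bidualE[OF x]) blast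
 note l = functional_linear_simps[OF dualD[OF d]]
 show ?thesis
 proof (rule dualI)
  show "functional_linear (\<lambda>a. x (\<lambda>b. F (a * b)))"
   by (simp add: functional_linear_def distrib_right l scaleC_mult_left bidual_apply[OF x] dual_mult_left d)
  fix a
  have "cmod (F (a * b)) <= (onorm F * norm a) * norm b" for b
   using dual_onorm[OF d, of "a * b"] mult_left_mono[OF norm_mult_ineq[of a b], of "onorm F"] onorm_pos_le[OF dual_bounded_linear[OF d]]
   by simp
  from bidual_bound[OF K(2,1) dual_mult_left[OF d] this]
  show "cmod (x (\<lambda>b. F (a * b))) <= (K * onorm F) * norm a" by simp
 qed
qed

lemma bidual_right_dual:
 assumes x: "x \<in> bidual" and d: "F \<in> dual"
 shows "(\<lambda>b. x (\<lambda>a. F (a * b))) \<in> dual"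
proof -
 obtain K where K: "K >= 0" "!!G. G \<in> dual ==> cmod (x G) <= K * onorm G" by (rule bidualE[OF x]) blast
 note l = functional_linear_simps[OF dualD[OF d]]
 show ?thesis
 proof (rule dualI)
  show "functional_linear (\<lambda>b. x (\<lambda>a. F (a * b)))"
   by (simp add: functional_linear_def distrib_left l scaleC_mult_right bidual_apply[OF x] dual_mult_right d)
  fix b
  have "cmod (F (a * b)) <= (onorm F * norm b) * norm a" for a
   using dual_onorm[OF d, of "a * b"] mult_left_mono[OF norm_mult_ineq[of a b], of "onorm F"]
    onorm_pos_le[OF dual_bounded_linear[OF d]] by (simp add: mult_ac)
  from bidual_bound[OF K(2,1) dual_mult_right[OF d] this]
  show "cmod (x (\<lambda>a. F (a * b))) <= (K * onorm F) * norm b" by simp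
 qed
qed

lemma bidual_mult_apply: "F \<in> dual ==> bidual_mult x y F = x (\<lambda>a. y (\<lambda>b. F (a * b)))"
 by (simp add: bidual_mult_def)

lemma bidual_mult_closed:
 assumes x: "x \<in> bidual" and y: "y \<in> bidual"
 shows "bidual_mult x y \<in> bidual"
proof -
 obtain K where K: "K >= 0" "!!G. G \<in> dual ==> cmod (x G) <= K * onorm G" by (rule bidualE[OF x]) blast
 obtain L where L: "L >= 0" "!!G. G \<in> dual ==> cmod (y G) <= L * onorm G" by (rule bidualE[OF y]) blast
 show ?thesis
 proof (rule bidualI)
  fix G :: "'a => complex" assume p: "G \<in> dual"
  have "cmod (y (\<lambda>b. G (a * b))) <= (L * onorm G) * norm a" for a
  proof -
   have "cmod (G (a * b)) <= (onorm G * norm a) * norm b" for b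
    using dual_onorm[OF p, of "a * b"] mult_left_mono[OF norm_mult_ineq[of a b], of "onorm G"] onorm_pos_le[OF dual_bounded_linear[OF p]]
    by simp
   from bidual_bound[OF L(2,1) dual_mult_left[OF p] this] show ?thesis by simp
  qed
  from bidual_bound[OF K(2,1) bidual_left_dual[OF y p] this]
  show "cmod (bidual_mult x y G) <= (K * L) * onorm G" by (simp add: bidual_mult_apply p)
 qed (simp_all add: bidual_mult_def dual_add dual_scale bidual_apply[OF y] bidual_apply[OF x]
   dual_mult_left bidual_left_dual[OF y])
qed

lemma bidual_star_closed:
 assumes x: "x \<in> bidual"
 shows "bidual_star x \<in> bidual"
proof -
 obtain K where K: "K >= 0" "!!G. G \<in> dual ==> cmod (x G) <= K * onorm G" by (rule bidualE[OF x]) blast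
 show ?thesis
 proof (rule bidualI)
  fix G :: "'a => complex" assume p: "G \<in> dual"
  show "cmod (bidual_star x G) <= K * onorm G"
   unfolding bidual_star_def complex_mod_cnj
   by (rule bidual_bound[OF K(2,1) dual_star[OF p]]) (use dual_onorm[OF p, of "star _"] in simp_all)
 qed (simp_all add: bidual_star_def bidual_apply[OF x] dual_star dual_star_iff)
qed

lemma bidual_star_star: "bidual_star (bidual_star x) = x"
 by (simp add: bidual_star_def star_star)

lemma bidual_star_positive: "positive_functional F ==> bidual_star x F = cnj (x F)"
 by (simp add: bidual_star_def positive_functional_star)

lemma bidual_mult_assoc:
 assumes z: "z \<in> bidual"
 shows "bidual_mult (bidual_mult x y) z = bidual_mult x (bidual_mult y z)"
proof
 fix F :: "'a => complex"
 show "bidual_mult (bidual_mult x y) z F = bidual_mult x (bidual_mult y z) F"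
 proof (cases "F \<in> dual")
  case True
  then show ?thesis
   by (simp add: bidual_mult_apply bidual_left_dual[OF z] dual_mult_left mult.assoc)
 qed (simp add: bidual_mult_def)
qed

lemma bidual_lincomb:
 assumes x: "x \<in> bidual" and y: "y \<in> bidual"
 shows "(\<lambda>G. c * x G + d * y G) \<in> bidual"
proof -
 obtain K where K: "K >= 0" "!!G. G \<in> dual ==> cmod (x G) <= K * onorm G" by (rule bidualE[OF x]) blast
 obtain L where L: "L >= 0" "!!G. G \<in> dual ==> cmod (y G) <= L * onorm G" by (rule bidualE[OF y]) blast
 show ?thesis
 proof (rule bidualI)
  fix G :: "'a => complex" assume p: "G \<in> dual"
  show "cmod (c * x G + d * y G) <= (cmod c * K + cmod d * L) * onorm G"
   using norm_triangle_ineq[of "c * x G" "d * y G"] mult_left_mono[OF K(2)[OF p], of "cmod c"]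
    mult_left_mono[OF L(2)[OF p], of "cmod d"] by (simp add: norm_mult algebra_simps)
 qed (simp_all add: bidual_apply[OF x] bidual_apply[OF y] algebra_simps)
qed

definition bidual_of :: "'a::unital_cstar_algebra => ('a => complex) => complex" where
 "bidual_of a = (\<lambda>G. if G \<in> dual then G a else 0)"

lemma bidual_of_closed: "bidual_of a \<in> bidual"
 by (rule bidualI[of _ "norm a"])
  (use dual_onorm in \<open>simp_all add: bidual_of_def dual_add dual_scale mult.commute\<close>)

lemma bidual_of_apply: "G \<in> dual ==> bidual_of a G = G a"
 by (simp add: bidual_of_def)

lemma bidual_star_of: "bidual_star (bidual_of a) = bidual_of (star a)"
 by (auto simp: bidual_star_def bidual_of_def dual_star_iff)

lemma bidual_mult_of: "bidual_mult (bidual_of a) (bidual_of b) = bidual_of (a * b)"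
 by (auto simp: bidual_mult_def bidual_of_def dual_mult_left dual_mult_right)

lemma bidual_of_one_mult: "x \<in> bidual ==> bidual_mult (bidual_of 1) x = x"
 using bidual_left_dual[of x] by (auto simp: bidual_mult_def bidual_of_def bidual_apply(3))

section \<open>Hilbert space approximation and Arens regularity\<close>

lemma unit_rotation:
 fixes z :: complex
 obtains c where "cmod c = 1" "c * z = of_real (cmod z)"
proof (cases "z = 0")
 case False
 show ?thesis
 proof (rule that)
  show "cmod (cnj z / of_real (cmod z)) = 1" using False by (simp add: norm_divide)
  show "cnj z / of_real (cmod z) * z = of_real (cmod z)"
   using False complex_norm_square[of z] by (simp add: field_simps power2_eq_square)
 qed
qed (use that[of 1] in simp)

text \<open>An approximate Riesz representation in the pre-Hilbert space of a positive functional: the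
 element \<open>b\<close> is a multiple of the adjoint of a near-maximiser of \<open>f\<close> on the unit ball.\<close>

lemma approximate_riesz:
 assumes p: "positive_functional F" and f: "functional_linear f"
  and K: "!!a. cmod (f a) <= K * sqrt (Re (F (a * star a)))" and e: "e > 0"
 obtains b where "!!a. cmod (f a - F (a * b)) <= e * sqrt (Re (F (a * star a)))"
proof -
 note l = functional_linear_simps[OF positive_functional_linear[OF p]]
 note fl = functional_linear_simps[OF f]
 define n where "n a = sqrt (Re (F (a * star a)))" for a
 have n0: "n a >= 0" and n2: "(n a)\<^sup>2 = Re (F (a * star a))" for a
  using positive_functional_nonneg[OF p, of "star a"] by (simp_all add: n_def star_star)
 have n_scale: "n (c *\<^sub>C a) = cmod c * n a" for c a
 proof -
  have "F (c *\<^sub>C a * star (c *\<^sub>C a)) = (c * cnj c) * F (a * star a)"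
   by (simp add: star_scaleC scaleC_mult_left scaleC_mult_right l)
  also have "Re ... = (cmod c)\<^sup>2 * Re (F (a * star a))"
   by (simp only: complex_norm_square[symmetric]) simp
  finally show ?thesis by (simp add: n_def real_sqrt_mult)
 qed
 have KK: "cmod (f a) <= \<bar>K\<bar> * n a" for a
  using K[of a] mult_right_mono[OF abs_ge_self[of K] n0[of a]] by (simp add: n_def)
 define S where "S = {cmod (f a) | a. n a <= 1}"
 have bdd: "bdd_above S"
 proof (rule bdd_aboveI)
  fix r assume "r \<in> S"
  then obtain a where a: "r = cmod (f a)" "n a <= 1" by (auto simp: S_def)
  then show "r <= \<bar>K\<bar>" using KK[of a] mult_left_mono[OF a(2), of "\<bar>K\<bar>"] by simp
 qed
 have "n 0 = 0" by (simp add: n_def l)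
 then have zS: "0 \<in> S" unfolding S_def by (auto intro!: exI[of _ 0] simp: fl)
 define L where "L = Sup S"
 have L0: "L >= 0" unfolding L_def by (rule cSup_upper[OF zS bdd])
 have scale_bound: "cmod (g a) <= M * n a"
  if g: "functional_linear g" and M: "!!a. n a <= 1 ==> cmod (g a) <= M" for g M a
 proof (cases "n a = 0")
  case True
  have "real k * cmod (g a) <= M" for k
   using M[of "of_nat k *\<^sub>C a"] True by (simp add: n_scale functional_linear_simps[OF g] norm_mult)
  then have "g a = 0"
   by (metis norm_le_zero_iff not_le reals_Archimedean3)
  then show ?thesis using True by simp
 next
  case False
  then have pos: "n a > 0" using n0[of a] by simp
  have "n (of_real (1 / n a) *\<^sub>C a) <= 1" using pos unfolding n_scale by (simp add: norm_divide)
  from M[OF this] show ?thesis using pos by (simp add: functional_linear_simps[OF g] norm_divide field_simps)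
 qed
 have fL: "cmod (f a) <= L * n a" for a
  by (rule scale_bound[OF f]) (auto simp: L_def S_def intro!: cSup_upper[OF _ bdd[unfolded S_def]])
 \<comment> \<open>The supremum is missed by less than \<open>s^2\<close>, the order of the
   second-order term of the variation \<open>u + s *\<^sub>R w\<close>; after division by
   \<open>s\<close> the total error is \<open>s * (1 + L / 2) = e\<close>.\<close>
 define s where "s = e / (1 + L / 2)"
 have s: "s > 0" "s * (1 + L / 2) = e" using e L0 by (simp_all add: s_def)
 have "L - s\<^sup>2 < Sup S" using s by (simp add: L_def)
 then obtain r where "r \<in> S" "L - s\<^sup>2 < r" using less_cSup_iff[OF _ bdd, of "L - s\<^sup>2"] zS by auto
 then obtain u0 where u0: "n u0 <= 1" "L - s\<^sup>2 < cmod (f u0)" by (auto simp: S_def)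
 obtain c where c: "cmod c = 1" "c * f u0 = of_real (cmod (f u0))" by (rule unit_rotation)
 define u where "u = c *\<^sub>C u0"
 have u: "n u <= 1" "f u = of_real (cmod (f u0))" using u0 c by (simp_all add: u_def n_scale fl)
 define b where "b = L *\<^sub>R star u"
 have g: "functional_linear (\<lambda>a. f a - F (a * b))"
  by (simp add: functional_linear_def l fl algebra_simps scaleC_mult_left)
 have re: "Re (f w - F (w * b)) <= e" if w: "n w <= 1" for w
 proof -
  have "(n (u + s *\<^sub>R w))\<^sup>2 = (n u)\<^sup>2 + 2 * s * Re (F (w * star u)) + s\<^sup>2 * (n w)\<^sup>2"
  proof -
   have "F (u * star w) = cnj (F (w * star u))"
    using positive_functional_star[OF p, of "w * star u"] by (simp add: star_mult star_star)
   then show ?thesis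
    unfolding n2 by (simp add: star_add star_scaleR algebra_simps l power2_eq_square)
  qed
  also have "... <= 1 + 2 * s * Re (F (w * star u)) + s\<^sup>2"
   using power_mono[OF u(1) n0, of 2] power_mono[OF w n0, of 2] mult_left_mono[of "(n w)\<^sup>2" 1 "s\<^sup>2"] by simp
  finally have le: "(n (u + s *\<^sub>R w))\<^sup>2 <= 1 + 2 * s * Re (F (w * star u)) + s\<^sup>2" .
  have "L - s\<^sup>2 + s * Re (f w) <= Re (f (u + s *\<^sub>R w))" using u0 u by (simp add: fl)
  also have "... <= L * n (u + s *\<^sub>R w)" using fL complex_Re_le_cmod order_trans by blast
  also have "... <= L * ((1 + (n (u + s *\<^sub>R w))\<^sup>2) / 2)"
   using sum_squares_bound[of "n (u + s *\<^sub>R w)" 1] L0 by (intro mult_left_mono) auto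
  also have "... <= L * ((1 + (1 + 2 * s * Re (F (w * star u)) + s\<^sup>2)) / 2)"
   using le L0 by (intro mult_left_mono) auto
  finally have "s * (Re (f w) - L * Re (F (w * star u))) <= s * (s * (1 + L / 2))"
   by (simp add: power2_eq_square algebra_simps)
  then have "Re (f w) - L * Re (F (w * star u)) <= e" using s by simp
  then show ?thesis by (simp add: b_def l)
 qed
 have "cmod (f w - F (w * b)) <= e" if w: "n w <= 1" for w
 proof -
  obtain c where c: "cmod c = 1" "c * (f w - F (w * b)) = of_real (cmod (f w - F (w * b)))"
   by (rule unit_rotation)
  have "n (c *\<^sub>C w) <= 1" using w c by (simp add: n_scale)
  from re[OF this] show ?thesis
   using arg_cong[OF c(2), of Re] by (simp add: fl l scaleC_mult_left right_diff_distrib)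
 qed
 from scale_bound[OF g this] show ?thesis by (intro that[of b]) (simp add: n_def)
qed

text \<open>Arens regularity: a functional \<open>a \<mapsto> y (b \<mapsto> F (a b))\<close> is approximated by \<open>a \<mapsto> F (a b\<^sub>0)\<close> in the
 Hilbert norm of the positive functional \<open>F\<close>.\<close>

lemma bidual_left_bound:
 assumes p: "positive_functional F" and K: "K >= 0" "!!G. G \<in> dual ==> cmod (x G) <= K * onorm G"
 shows "cmod (x (\<lambda>b. F (a * b))) <= K * sqrt (Re (F 1)) * sqrt (Re (F (a * star a)))"
proof -
 have "cmod (F (a * b)) <= sqrt (Re (F 1)) * sqrt (Re (F (a * star a))) * norm b" for b
 proof -
  have "(cmod (F (a * b)))\<^sup>2 <= Re (F (a * star a)) * Re (F (star b * b))"
   using positive_functional_cauchy_schwarz[OF p, of "star a" b] by (simp add: star_star)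
  also have "... <= Re (F (a * star a)) * (Re (F 1) * (norm b)\<^sup>2)"
   using positive_functional_nonneg[OF p, of "star a"]
   by (intro mult_left_mono positive_functional_norm_square[OF p]) (simp add: star_star)
  finally have "cmod (F (a * b)) <= sqrt (Re (F (a * star a)) * (Re (F 1) * (norm b)\<^sup>2))"
   using real_le_rsqrt by simp
  then show ?thesis by (simp add: real_sqrt_mult mult_ac)
 qed
 from bidual_bound[OF K(2,1) dual_mult_left[OF positive_functional_dual[OF p]] this]
 show ?thesis by simp
qed

lemma sqrt_positive_functional_bound:
 assumes p: "positive_functional F"
 shows "sqrt (Re (F (star b * b))) <= sqrt (Re (F 1)) * norm b"
  and "sqrt (Re (F (a * star a))) <= sqrt (Re (F 1)) * norm a"
proof -
 have "sqrt (Re (F (star b * b))) <= sqrt (Re (F 1)) * norm b" for b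
  using real_sqrt_le_mono[OF positive_functional_norm_square[OF p, of b]] by (simp add: real_sqrt_mult)
 from this[of b] this[of "star a"]
 show "sqrt (Re (F (star b * b))) <= sqrt (Re (F 1)) * norm b"
  "sqrt (Re (F (a * star a))) <= sqrt (Re (F 1)) * norm a" by (simp_all add: star_star)
qed

text \<open>Testing the approximation at \<open>a = star b\<close> gives
  \<open>m * m <= (L + 1) * m\<close> for the seminorm \<open>m\<close> of \<open>b\<close>, so the
  approximants stay bounded while \<open>e\<close> shrinks.\<close>

lemma bidual_left_approx:
 assumes p: "positive_functional F" and x: "x \<in> bidual"
 obtains M where "M >= 0"
  "!!e. e > 0 ==> e <= 1 ==> \<exists>b. (\<forall>a. cmod (x (\<lambda>c. F (a * c)) - F (a * b)) <= e * sqrt (Re (F (a * star a))))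
    \<and> sqrt (Re (F (star b * b))) <= M"
proof -
 obtain K where K: "K >= 0" "!!G. G \<in> dual ==> cmod (x G) <= K * onorm G" by (rule bidualE[OF x]) blast
 define L where "L = K * sqrt (Re (F 1))"
 have L: "cmod (x (\<lambda>b. F (a * b))) <= L * sqrt (Re (F (a * star a)))" for a
  unfolding L_def by (rule bidual_left_bound[OF p K])
 have f: "functional_linear (\<lambda>a. x (\<lambda>b. F (a * b)))"
  by (rule dualD[OF bidual_left_dual[OF x positive_functional_dual[OF p]]])
 have L0: "L >= 0" using K positive_functional_one[OF p] by (simp add: L_def)
 show ?thesis
 proof (rule that)
  show "L + 1 >= 0" using L0 by simp
  fix e :: real assume e: "e > 0" "e <= 1"
  from approximate_riesz[OF p f L e(1)]
  obtain b where b: "!!a. cmod (x (\<lambda>c. F (a * c)) - F (a * b)) <= e * sqrt (Re (F (a * star a)))" by auto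
  define m where "m = sqrt (Re (F (star b * b)))"
  have m0: "m >= 0" and m2: "m * m = Re (F (star b * b))"
   using positive_functional_nonneg[OF p, of b] by (simp_all add: m_def)
  have "m * m <= cmod (F (star b * b))" unfolding m2 by (rule complex_Re_le_cmod)
  also have "... <= cmod (x (\<lambda>c. F (star b * c))) + e * m"
   using b[of "star b"] norm_triangle_ineq4[of "x (\<lambda>c. F (star b * c))" "x (\<lambda>c. F (star b * c)) - F (star b * b)"]
   by (simp add: m_def star_star)
  also have "... <= L * m + 1 * m"
   using L[of "star b"] m0 e by (intro add_mono mult_right_mono) (auto simp: m_def star_star)
  finally have "m * m <= (L + 1) * m" by (simp add: algebra_simps)
  then have "m <= L + 1" using m0 L0 by (cases "m = 0") auto
  then show "\<exists>b. (\<forall>a. cmod (x (\<lambda>c. F (a * c)) - F (a * b)) <= e * sqrt (Re (F (a * star a))))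
    \<and> sqrt (Re (F (star b * b))) <= L + 1"
   using b by (auto simp: m_def)
 qed
qed

lemma norm_le_epsilon_zero:
 fixes z :: "'v::real_normed_vector"
 assumes "!!e. e > 0 ==> e <= 1 ==> norm z <= C * e"
 shows "z = 0"
proof (rule ccontr)
 assume "z ~= 0"
 define e where "e = min 1 (norm z / (2 * (\<bar>C\<bar> + 1)))"
 have e: "e > 0" "e <= 1" using \<open>z ~= 0\<close> by (auto simp: e_def)
 have "norm z <= \<bar>C\<bar> * e" using assms[OF e] mult_right_mono[OF abs_ge_self[of C], of e] e by linarith
 also have "... <= \<bar>C\<bar> * (norm z / (2 * (\<bar>C\<bar> + 1)))" by (intro mult_left_mono) (auto simp: e_def)
 also have "... < norm z" using \<open>z ~= 0\<close> by (simp add: field_simps add_nonneg_pos)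
 finally show False by simp
qed

text \<open>Approximants \<open>b0\<close> for \<open>y\<close> and \<open>b1\<close> for the
  adjoint of \<open>x\<close> bring both iterated expressions within order \<open>e\<close> of the
  single number \<open>F (star b1 * b0)\<close>.\<close>

lemma arens_regular_positive:
 assumes x: "x \<in> bidual" and y: "y \<in> bidual" and p: "positive_functional F"
 shows "x (\<lambda>a. y (\<lambda>b. F (a * b))) = y (\<lambda>b. x (\<lambda>a. F (a * b)))"
proof -
 note d = positive_functional_dual[OF p]
 note l = functional_linear_simps[OF positive_functional_linear[OF p]]
 obtain K where K: "K >= 0" "!!G. G \<in> dual ==> cmod (x G) <= K * onorm G" by (rule bidualE[OF x]) blast
 obtain L where L: "L >= 0" "!!G. G \<in> dual ==> cmod (y G) <= L * onorm G" by (rule bidualE[OF y]) blast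
 define s where "s = sqrt (Re (F 1))"
 have s0: "s >= 0" using positive_functional_one[OF p] by (simp add: s_def)
 define f where "f a = y (\<lambda>b. F (a * b))" for a
 define g where "g b = x (\<lambda>a. F (a * b))" for b
 have fd: "f \<in> dual" unfolding f_def by (rule bidual_left_dual[OF y d])
 have gd: "g \<in> dual" unfolding g_def by (rule bidual_right_dual[OF x d])
 obtain M where M: "M >= 0" "!!e. e > 0 ==> e <= 1 ==>
   \<exists>b. (\<forall>a. cmod (f a - F (a * b)) <= e * sqrt (Re (F (a * star a)))) \<and> sqrt (Re (F (star b * b))) <= M"
  using bidual_left_approx[OF p y] unfolding f_def by auto
 obtain N where N: "N >= 0" "!!e. e > 0 ==> e <= 1 ==>
   \<exists>b. (\<forall>a. cmod (bidual_star x (\<lambda>c. F (a * c)) - F (a * b)) <= e * sqrt (Re (F (a * star a)))) \<and> sqrt (Re (F (star b * b))) <= N"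
  using bidual_left_approx[OF p bidual_star_closed[OF x]] by auto
 have star_g: "bidual_star x (\<lambda>c. F (star b * c)) = cnj (g b)" for b
  by (simp add: bidual_star_def g_def star_mult star_star flip: positive_functional_star[OF p])
 have "x f - y g = 0"
 proof (rule norm_le_epsilon_zero)
  fix e :: real assume e: "e > 0" "e <= 1"
  obtain b0 where b0: "!!a. cmod (f a - F (a * b0)) <= e * sqrt (Re (F (a * star a)))"
   "sqrt (Re (F (star b0 * b0))) <= M" using M(2)[OF e] by auto
  obtain b1 where b1: "!!a. cmod (bidual_star x (\<lambda>c. F (a * c)) - F (a * b1)) <= e * sqrt (Re (F (a * star a)))"
   "sqrt (Re (F (star b1 * b1))) <= N" using N(2)[OF e] by auto
  have gb: "cmod (g b - F (star b1 * b)) <= e * sqrt (Re (F (star b * b)))" for b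
  proof -
   have "F (star b * b1) = cnj (F (star b1 * b))"
    using positive_functional_star[OF p, of "star b1 * b"] by (simp add: star_mult star_star)
   then show ?thesis using b1(1)[of "star b"] unfolding star_g
    by (metis complex_cnj_diff complex_mod_cnj star_star)
  qed
  have 1: "cmod (x f - g b0) <= K * (e * s)"
  proof -
   have "x f - g b0 = x (\<lambda>a. f a - F (a * b0))"
    by (simp add: g_def bidual_apply_diff[OF x fd dual_mult_right[OF d]])
   also have "cmod ... <= K * (e * s)"
   proof (rule bidual_bound[OF K(2,1)])
    show "(\<lambda>a. f a - F (a * b0)) \<in> dual" by (intro dual_diff fd dual_mult_right d)
    show "cmod (f a - F (a * b0)) <= e * s * norm a" for a
     using order_trans[OF b0(1)[of a] mult_left_mono[OF sqrt_positive_functional_bound(2)[OF p, of a]]] e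
     by (simp add: s_def)
   qed
   finally show ?thesis .
  qed
  have 2: "cmod (y g - f (star b1)) <= L * (e * s)"
  proof -
   have "y g - f (star b1) = y (\<lambda>b. g b - F (star b1 * b))"
    by (simp add: f_def bidual_apply_diff[OF y gd dual_mult_left[OF d]])
   also have "cmod ... <= L * (e * s)"
   proof (rule bidual_bound[OF L(2,1)])
    show "(\<lambda>b. g b - F (star b1 * b)) \<in> dual" by (intro dual_diff gd dual_mult_left d)
    show "cmod (g b - F (star b1 * b)) <= e * s * norm b" for b
     using order_trans[OF gb[of b] mult_left_mono[OF sqrt_positive_functional_bound(1)[OF p, of b]]] e
     by (simp add: s_def)
   qed
   finally show ?thesis .
  qed
  have 3: "cmod (g b0 - F (star b1 * b0)) <= e * M"
   using order_trans[OF gb[of b0] mult_left_mono[OF b0(2)]] e by simp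
  have 4: "cmod (f (star b1) - F (star b1 * b0)) <= e * N"
   using order_trans[OF b0(1)[of "star b1"]] mult_left_mono[OF b1(2), of e] e by (simp add: star_star)
  have "x f - y g = (x f - g b0) + (g b0 - F (star b1 * b0)) - (f (star b1) - F (star b1 * b0)) - (y g - f (star b1))"
   by simp
  also have "cmod ... <= K * (e * s) + e * M + e * N + L * (e * s)"
   by (intro order_trans[OF norm_triangle_ineq4] add_mono order_trans[OF norm_triangle_ineq] 1 2 3 4)
  finally show "cmod (x f - y g) <= (K * s + M + N + L * s) * e" by (simp add: algebra_simps)
 qed
 then show ?thesis by (simp add: f_def[abs_def] g_def[abs_def])
qed

lemma dual_decomposition':
 assumes d: "F \<in> dual"
 obtains P z where "!!i. i < 4 ==> positive_functional (P i)" "!!i. i < 4 ==> Re (P i 1) <= 2 * onorm F"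
  "!!i. i < 4 ==> cmod (z i) <= 1" "F = (\<lambda>a. \<Sum>i<4::nat. z i * P i a)"
 using dual_decomposition[OF dualD[OF d] dual_onorm[OF d]] by auto

lemma bidual_decomposition:
 assumes x: "x \<in> bidual" and P: "!!i. i < (4::nat) ==> positive_functional (P i)"
 shows "x (\<lambda>a. \<Sum>i<4. z i * P i a) = (\<Sum>i<4. z i * x (P i))"
proof -
 have "x (\<lambda>a. \<Sum>i<4. z i * P i a) = (\<Sum>i<4. x (\<lambda>a. z i * P i a))"
  by (rule bidual_apply_sum[OF x]) (simp add: dual_scale positive_functional_dual P)
 also have "... = (\<Sum>i<4. z i * x (P i))"
  by (intro sum.cong refl bidual_apply(2)[OF x] positive_functional_dual P) simp
 finally show ?thesis .
qed

text \<open>Every bounded functional is a combination of four positive ones.\<close>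

lemma bidual_eqI:
 assumes "x \<in> bidual" "y \<in> bidual" "!!F. positive_functional F ==> x F = y F"
 shows "x = y"
proof
 fix F
 show "x F = y F"
 proof (cases "F \<in> dual")
  case True
  from dual_decomposition'[OF this]
  obtain P z where P: "!!i. i < 4 ==> positive_functional (P i)" "F = (\<lambda>a. \<Sum>i<4::nat. z i * P i a)"
   by metis
  have "x (\<lambda>a. \<Sum>i<4. z i * P i a) = y (\<lambda>a. \<Sum>i<4. z i * P i a)"
   by (simp add: bidual_decomposition[OF assms(1) P(1)] bidual_decomposition[OF assms(2) P(1)] assms(3) P(1))
  then show ?thesis by (simp only: P(2))
 qed (simp add: bidual_apply(3)[OF assms(1)] bidual_apply(3)[OF assms(2)])
qed

text \<open>The right-hand side defines, as a function of the functional, an element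
  \<open>r\<close> of the bidual; it agrees with \<open>bidual_mult x y\<close> on positive
  functionals and hence everywhere.\<close>

lemma arens_regular:
 assumes x: "x \<in> bidual" and y: "y \<in> bidual" and d: "F \<in> dual"
 shows "x (\<lambda>a. y (\<lambda>b. F (a * b))) = y (\<lambda>b. x (\<lambda>a. F (a * b)))"
proof -
 define r where "r = (\<lambda>G. if G \<in> dual then y (\<lambda>b. x (\<lambda>a. G (a * b))) else 0)"
 obtain K where K: "K >= 0" "!!G. G \<in> dual ==> cmod (x G) <= K * onorm G" by (rule bidualE[OF x]) blast
 obtain L where L: "L >= 0" "!!G. G \<in> dual ==> cmod (y G) <= L * onorm G" by (rule bidualE[OF y]) blast
 have r: "r \<in> bidual"
 proof (rule bidualI)
  fix G :: "'a => complex" assume p: "G \<in> dual"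
  have "cmod (x (\<lambda>a. G (a * b))) <= (K * onorm G) * norm b" for b
  proof -
   have "cmod (G (a * b)) <= (onorm G * norm b) * norm a" for a
    using dual_onorm[OF p, of "a * b"] mult_left_mono[OF norm_mult_ineq[of a b], of "onorm G"]
     onorm_pos_le[OF dual_bounded_linear[OF p]] by (simp add: mult_ac)
   from bidual_bound[OF K(2,1) dual_mult_right[OF p] this] show ?thesis by simp
  qed
  from bidual_bound[OF L(2,1) bidual_right_dual[OF x p] this]
  show "cmod (r G) <= (L * K) * onorm G" by (simp add: r_def p)
 qed (simp_all add: r_def dual_add dual_scale bidual_apply[OF y] bidual_apply[OF x]
   dual_mult_right bidual_right_dual[OF x])
 have "bidual_mult x y = r"
  by (rule bidual_eqI[OF bidual_mult_closed[OF x y] r])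
   (simp add: bidual_mult_def r_def arens_regular_positive[OF x y])
 from fun_cong[OF this, of F] show ?thesis using d by (simp add: bidual_mult_def r_def)
qed

text \<open>Taking adjoints exchanges the order of the two evaluations in the Arens product, and
  Arens regularity restores it.\<close>

lemma bidual_star_mult:
 assumes x: "x \<in> bidual" and y: "y \<in> bidual"
 shows "bidual_star (bidual_mult x y) = bidual_mult (bidual_star y) (bidual_star x)"
proof
 fix G :: "'a => complex"
 show "bidual_star (bidual_mult x y) G = bidual_mult (bidual_star y) (bidual_star x) G"
 proof (cases "G \<in> dual")
  case True
  from arens_regular[OF x y dual_star[OF True]] True show ?thesis
   by (simp add: bidual_star_def bidual_mult_def dual_star_iff star_mult)
 qed (simp add: bidual_star_def bidual_mult_def dual_star_iff)
qed

text \<open>For the GNS vector \<open>\<xi>\<close> of \<open>F\<close>, the \<open>b n\<close> are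
  chosen with \<open>b n \<xi>\<close> tending to \<open>x \<xi>\<close>, and the claim is
  convergence of the vector functionals. The right factor is replaced directly, the left one after
  passing to adjoints, where Arens regularity applies.\<close>

lemma bidual_sandwich_limit:
 fixes F :: "'a::unital_cstar_algebra => complex"
 assumes p: "positive_functional F" and x: "x \<in> bidual"
 obtains b where
  "!!n a. cmod (x (\<lambda>c. F (a * c)) - F (a * b n)) <= inverse (real (Suc n)) * sqrt (Re (F (a * star a)))"
  "!!z. z \<in> bidual ==> (\<lambda>n. z (\<lambda>c. F (star (b n) * c * b n)))
    \<longlonglongrightarrow> bidual_mult (bidual_star x) (bidual_mult z x) F"
proof -
 note d = positive_functional_dual[OF p]
 obtain M where M: "M >= 0" "!!e. e > 0 ==> e <= 1 ==>
   \<exists>b. (\<forall>a. cmod (x (\<lambda>c. F (a * c)) - F (a * b)) <= e * sqrt (Re (F (a * star a)))) \<and> sqrt (Re (F (star b * b))) <= M"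
  using bidual_left_approx[OF p x] by auto
 have "\<exists>b. (\<forall>a. cmod (x (\<lambda>c. F (a * c)) - F (a * b)) <= inverse (real (Suc n)) * sqrt (Re (F (a * star a))))
   \<and> sqrt (Re (F (star b * b))) <= M" for n
  by (rule M(2)) (simp_all add: field_simps)
 then obtain b where b: "!!n a. cmod (x (\<lambda>c. F (a * c)) - F (a * b n)) <= inverse (real (Suc n)) * sqrt (Re (F (a * star a)))"
  and bM: "!!n. sqrt (Re (F (star (b n) * b n))) <= M" by metis
 define f where "f a = x (\<lambda>c. F (a * c))" for a
 have fd: "f \<in> dual" unfolding f_def by (rule bidual_left_dual[OF x d])
 define s where "s = sqrt (Re (F 1))"
 have s0: "s >= 0" using positive_functional_one[OF p] by (simp add: s_def)
 have n_mult: "sqrt (Re (F ((a * c) * star (a * c)))) <= sqrt (Re (F (a * star a))) * norm c" for a c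
  using sqrt_positive_functional_bound(2)[OF positive_functional_conj[OF p, of "star a"], of c]
  by (simp add: star_star star_mult mult.assoc)
 show ?thesis
 proof (rule that[of b])
  fix z :: "('a => complex) => complex" assume z: "z \<in> bidual"
  note sz = bidual_star_closed[OF z] and sx = bidual_star_closed[OF x]
  obtain K where K: "K >= 0" "!!\<phi>. \<phi> \<in> dual ==> cmod (bidual_star x \<phi>) <= K * onorm \<phi>"
   by (rule bidualE[OF sx]) blast
  obtain L where L: "L >= 0" "!!\<phi>. \<phi> \<in> dual ==> cmod (z \<phi>) <= L * onorm \<phi>"
   by (rule bidualE[OF z]) blast
  obtain L' where L': "L' >= 0" "!!\<phi>. \<phi> \<in> dual ==> cmod (bidual_star z \<phi>) <= L' * onorm \<phi>"
   by (rule bidualE[OF sz]) blast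
  define T where "T = bidual_mult (bidual_star x) (bidual_mult z x) F"
  have T: "T = bidual_star x (\<lambda>a. z (\<lambda>c. f (a * c)))"
   by (simp add: T_def bidual_mult_apply d dual_mult_left f_def mult.assoc)
  have bound: "cmod (z (\<lambda>c. F (star (b n) * c * b n)) - T) <= (K * L * s + L' * M) * inverse (real (Suc n))" for n
  proof -
   define e where "e = inverse (real (Suc n))"
   have e: "e > 0" by (simp add: e_def)
   \<comment> \<open>The intermediate stage: the right factor \<open>x\<close> has been replaced by
     \<open>b n\<close>, the left one has not.\<close>
   define h where "h a = z (\<lambda>c. F (a * c * b n))" for a
   have hd: "h \<in> dual"
    unfolding h_def using bidual_left_dual[OF z dual_mult_right[OF d]] by simp
   have zf: "(\<lambda>a. z (\<lambda>c. f (a * c))) \<in> dual" by (rule bidual_left_dual[OF z fd])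
   have fe: "cmod (f (a * c) - F (a * c * b n)) <= e * sqrt (Re (F (a * star a))) * norm c" for a c
    using order_trans[OF b[of "a * c" n] mult_left_mono[OF n_mult[of a c]]] by (simp add: f_def e_def)
   have 1: "cmod (T - bidual_star x h) <= K * (L * (e * s))"
   proof -
    have "cmod (bidual_star x (\<lambda>a. z (\<lambda>c. f (a * c)) - h a)) <= K * (L * (e * s))"
    proof (rule bidual_bound[OF K(2,1) dual_diff[OF zf hd]])
     fix a
     have "z (\<lambda>c. f (a * c)) - h a = z (\<lambda>c. f (a * c) - F (a * c * b n))"
      unfolding h_def
      using bidual_apply_diff[OF z dual_mult_left[OF fd] dual_mult_left[OF dual_mult_right[OF d]], of a a]
      by simp
     also have "cmod ... <= L * (e * s * norm a)"
     proof (rule bidual_bound[OF L(2,1)])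
      show "(\<lambda>c. f (a * c) - F (a * c * b n)) \<in> dual"
       using dual_diff[OF dual_mult_left[OF fd] dual_mult_left[OF dual_mult_right[OF d]], of a a] by simp
      show "cmod (f (a * c) - F (a * c * b n)) <= e * s * norm a * norm c" for c
      proof -
       have "e * sqrt (Re (F (a * star a))) * norm c <= e * (s * norm a) * norm c"
        using sqrt_positive_functional_bound(2)[OF p, of a] e unfolding s_def
        by (intro mult_right_mono mult_left_mono) auto
       then show ?thesis using fe[of a c] by simp
      qed
     qed
     finally show "cmod (z (\<lambda>c. f (a * c)) - h a) <= L * (e * s) * norm a" by simp
    qed
    then show ?thesis unfolding T by (simp add: bidual_apply_diff[OF sx zf hd])
   qed
   have h_star: "cnj (h (star a)) = bidual_star z (\<lambda>c. F (star (b n) * (c * a)))" for a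
   proof -
    have "cnj (F (star (b n) * (star c * a))) = F (star a * c * b n)" for c
     using positive_functional_star[OF p, of "star (b n) * (star c * a)"] by (simp add: star_mult star_star)
    then show ?thesis by (simp add: h_def bidual_star_def)
   qed
   have x_h: "bidual_star x h = cnj (bidual_star z (\<lambda>c. f (star (b n) * c)))"
    using arens_regular[OF sz x dual_mult_left[OF d], of "star (b n)"]
    by (simp add: bidual_star_def[of x] h_star f_def mult.assoc)
   have sf: "(\<lambda>c. f (star (b n) * c)) \<in> dual" by (rule dual_mult_left[OF fd])
   have pc: "positive_functional (\<lambda>c. F (star (b n) * c * b n))" by (rule positive_functional_conj[OF p])
   have "cmod (bidual_star z (\<lambda>c. f (star (b n) * c) - F (star (b n) * c * b n))) <= L' * (e * M)"
   proof (rule bidual_bound[OF L'(2,1) dual_diff[OF sf positive_functional_dual[OF pc]]])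
    fix c :: 'a
    have "e * sqrt (Re (F (star (b n) * b n))) * norm c <= e * M * norm c"
     using bM[of n] e by (intro mult_right_mono mult_left_mono) auto
    then show "cmod (f (star (b n) * c) - F (star (b n) * c * b n)) <= e * M * norm c"
     using fe[of "star (b n)" c] by (simp add: star_star)
   qed
   then have "cmod (bidual_star z (\<lambda>c. f (star (b n) * c)) - bidual_star z (\<lambda>c. F (star (b n) * c * b n))) <= L' * (e * M)"
    by (simp add: bidual_apply_diff[OF sz sf positive_functional_dual[OF pc]])
   then have 2: "cmod (bidual_star x h - z (\<lambda>c. F (star (b n) * c * b n))) <= L' * (e * M)"
    unfolding x_h bidual_star_positive[OF pc] by (metis complex_cnj_cnj complex_cnj_diff complex_mod_cnj)
   have "cmod (T - z (\<lambda>c. F (star (b n) * c * b n))) <= K * (L * (e * s)) + L' * (e * M)"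
    using norm_triangle_ineq[of "T - bidual_star x h" "bidual_star x h - z (\<lambda>c. F (star (b n) * c * b n))"] 1 2
    by simp
   then show ?thesis unfolding e_def[symmetric] by (simp add: norm_minus_commute algebra_simps)
  qed
  have "(\<lambda>n. z (\<lambda>c. F (star (b n) * c * b n)) - T) \<longlonglongrightarrow> 0"
  proof (rule Lim_null_comparison[OF always_eventually[OF allI[OF bound]]])
   show "(\<lambda>n. (K * L * s + L' * M) * inverse (real (Suc n))) \<longlonglongrightarrow> 0"
    using tendsto_mult_right_zero[OF LIMSEQ_inverse_real_of_nat] by simp
  qed
  then show "(\<lambda>n. z (\<lambda>c. F (star (b n) * c * b n))) \<longlonglongrightarrow> bidual_mult (bidual_star x) (bidual_mult z x) F"
   unfolding T_def by (simp add: LIM_zero_iff)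
 qed (rule b)
qed

section \<open>The Hilbert seminorm of a positive functional on the bidual\<close>

definition bidual_form where
 "bidual_form F x y = bidual_mult (bidual_star y) x F"

lemma bidual_form_apply: "F \<in> dual ==> bidual_form F x y = bidual_star y (\<lambda>a. x (\<lambda>b. F (a * b)))"
 by (simp add: bidual_form_def bidual_mult_apply)

text \<open>\<open>bidual_form F x y\<close> is the inner product of \<open>x \<xi>\<close> and
  \<open>y \<xi>\<close> for the GNS vector \<open>\<xi>\<close> of \<open>F\<close>. Approximating
  \<open>x \<xi>\<close> by \<open>b n \<xi>\<close> reduces the form at \<open>F\<close> to the
  conjugated functionals \<open>F (star (b n) * c * b n)\<close>.\<close>

lemma bidual_form_limit:
 fixes F :: "'a::unital_cstar_algebra => complex"
 assumes p: "positive_functional F" and x: "x \<in> bidual"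
 obtains b where
  "!!n a. cmod (x (\<lambda>c. F (a * c)) - F (a * b n)) <= inverse (real (Suc n)) * sqrt (Re (F (a * star a)))"
  "(\<lambda>n. F (star (b n) * b n)) \<longlonglongrightarrow> bidual_form F x x"
  "!!y. y \<in> bidual ==> (\<lambda>n. bidual_form (\<lambda>c. F (star (b n) * c * b n)) y y)
    \<longlonglongrightarrow> bidual_form F (bidual_mult y x) (bidual_mult y x)"
proof -
 from bidual_sandwich_limit[OF p x] obtain b where b:
  "!!n a. cmod (x (\<lambda>c. F (a * c)) - F (a * b n)) <= inverse (real (Suc n)) * sqrt (Re (F (a * star a)))"
  "!!z. z \<in> bidual ==> (\<lambda>n. z (\<lambda>c. F (star (b n) * c * b n)))
    \<longlonglongrightarrow> bidual_mult (bidual_star x) (bidual_mult z x) F" by auto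
 show ?thesis
 proof (rule that[of b])
  show "(\<lambda>n. F (star (b n) * b n)) \<longlonglongrightarrow> bidual_form F x x"
   using b(2)[OF bidual_of_closed[of 1]] positive_functional_dual[OF positive_functional_conj[OF p]]
   by (simp add: bidual_of_one_mult x bidual_of_apply bidual_form_def)
  fix y :: "('a => complex) => complex" assume y: "y \<in> bidual"
  have "bidual_mult (bidual_star (bidual_mult y x)) (bidual_mult y x)
    = bidual_mult (bidual_star x) (bidual_mult (bidual_mult (bidual_star y) y) x)"
   by (simp add: bidual_star_mult[OF y x] bidual_mult_assoc x y bidual_mult_closed)
  then show "(\<lambda>n. bidual_form (\<lambda>c. F (star (b n) * c * b n)) y y)
    \<longlonglongrightarrow> bidual_form F (bidual_mult y x) (bidual_mult y x)"
   using b(2)[OF bidual_mult_closed[OF bidual_star_closed[OF y] y]] by (simp add: bidual_form_def)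
 qed (rule b(1))
qed

text \<open>The value is a limit of the numbers \<open>F (star (b n) * b n)\<close>.\<close>

lemma bidual_form_nonneg:
 assumes p: "positive_functional F" and x: "x \<in> bidual"
 shows "0 <= Re (bidual_form F x x)"
proof -
 obtain b where "(\<lambda>n. F (star (b n) * b n)) \<longlonglongrightarrow> bidual_form F x x"
  by (rule bidual_form_limit[OF p x]) simp
 from tendsto_Re[OF this] show ?thesis
  by (rule LIMSEQ_le_const) (auto intro!: positive_functional_nonneg[OF p])
qed

lemma bidual_form_commute:
 assumes p: "positive_functional F" and x: "x \<in> bidual" and y: "y \<in> bidual"
 shows "bidual_form F y x = cnj (bidual_form F x y)"
 using bidual_star_positive[OF p, of "bidual_mult (bidual_star y) x"]
 by (simp add: bidual_form_def bidual_star_mult[OF bidual_star_closed[OF y] x] bidual_star_star)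

lemma bidual_form_lincomb:
 assumes d: "F \<in> dual" and x: "x \<in> bidual" and y: "y \<in> bidual" and z: "z \<in> bidual"
 shows "bidual_form F (\<lambda>\<phi>. c * x \<phi> + e * y \<phi>) z = c * bidual_form F x z + e * bidual_form F y z"
  and "bidual_form F z (\<lambda>\<phi>. c * x \<phi> + e * y \<phi>) = cnj c * bidual_form F z x + cnj e * bidual_form F z y"
 by (simp_all add: bidual_form_apply d bidual_apply[OF bidual_star_closed[OF z]] dual_scale
   bidual_left_dual[OF x d] bidual_left_dual[OF y d])
  (simp add: bidual_star_def)

lemma bidual_form_square_lincomb:
 assumes p: "positive_functional F" and x: "x \<in> bidual" and y: "y \<in> bidual"
 shows "Re (bidual_form F (\<lambda>\<phi>. c * x \<phi> + e * y \<phi>) (\<lambda>\<phi>. c * x \<phi> + e * y \<phi>))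
  = (cmod c)\<^sup>2 * Re (bidual_form F x x) + (cmod e)\<^sup>2 * Re (bidual_form F y y)
   + 2 * Re (e * cnj c * bidual_form F y x)"
proof -
 note d = positive_functional_dual[OF p]
 note w = bidual_lincomb[OF x y]
 have sq: "Re (c * cnj c * t) = (cmod c)\<^sup>2 * Re t" for c t
  by (simp only: complex_norm_square[symmetric]) simp
 show ?thesis
  unfolding bidual_form_lincomb(1)[OF d x y w] bidual_form_lincomb(2)[OF d x y x] bidual_form_lincomb(2)[OF d x y y]
   bidual_form_commute[OF p y x]
  using sq[of c "bidual_form F x x"] sq[of e "bidual_form F y y"] by (simp add: algebra_simps)
qed

lemma bidual_form_cauchy_schwarz:
 assumes p: "positive_functional F" and x: "x \<in> bidual" and y: "y \<in> bidual"
 shows "(cmod (bidual_form F x y))\<^sup>2 <= Re (bidual_form F x x) * Re (bidual_form F y y)"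
proof -
 have "(cmod (bidual_form F y x))\<^sup>2 <= Re (bidual_form F x x) * Re (bidual_form F y y)"
 proof (rule cauchy_schwarz_discriminant)
  show "0 <= Re (bidual_form F x x) + 2 * Re (c * bidual_form F y x) + (cmod c)\<^sup>2 * Re (bidual_form F y y)" for c
   using bidual_form_nonneg[OF p bidual_lincomb[OF x y, of 1 c]] bidual_form_square_lincomb[OF p x y, of 1 c]
   by simp
 qed (rule bidual_form_nonneg[OF p y])
 then show ?thesis by (simp add: bidual_form_commute[OF p x y])
qed

text \<open>The contractions for all Hilbert seminorms, that is, the unit ball of the enveloping von
  Neumann algebra. This form is adapted to products; \<open>bidual_ball_iff\<close> supplies the
  linear conditions from which compactness is read off.\<close>

definition bidual_ball :: "(('a::unital_cstar_algebra => complex) => complex) set" where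
 "bidual_ball = {x \<in> bidual. \<forall>F. positive_functional F \<longrightarrow> Re (bidual_form F x x) <= Re (F 1)}"

lemma bidual_form_of:
 assumes d: "F \<in> dual"
 shows "bidual_form F x (bidual_of a) = bidual_mult (bidual_of (star a)) x F"
  and "bidual_form F (bidual_of b) (bidual_of a) = F (star a * b)"
 by (simp_all add: bidual_form_def bidual_star_of bidual_mult_of bidual_of_apply d)

lemma bidual_form_one:
 assumes x: "x \<in> bidual" and d: "F \<in> dual"
 shows "bidual_form F x (bidual_of 1) = x F"
 by (simp add: bidual_form_of d bidual_of_one_mult x)

lemma bidual_ball_of:
 assumes "norm a <= 1"
 shows "bidual_of a \<in> bidual_ball"
proof -
 have "Re (F (star a * a)) <= Re (F 1)" if p: "positive_functional F" for F
 proof -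
  have "Re (F (star a * a)) <= Re (F 1) * (norm a)\<^sup>2" by (rule positive_functional_norm_square[OF p])
  also have "... <= Re (F 1) * 1"
   using assms positive_functional_one[OF p] by (intro mult_left_mono) (auto simp: power_le_one)
  finally show ?thesis by simp
 qed
 then show ?thesis
  by (simp add: bidual_ball_def bidual_of_closed bidual_form_of(2) positive_functional_dual)
qed

text \<open>Once \<open>x\<close> is replaced by the approximating \<open>b n\<close>, the seminorm
  of \<open>y\<close> is taken at the positive functional \<open>F (star (b n) * c * b n)\<close>,
  whose mass is \<open>F (star (b n) * b n)\<close>.\<close>

lemma bidual_ball_form_mult:
 assumes y: "y \<in> bidual_ball" and x: "x \<in> bidual" and p: "positive_functional F"
 shows "Re (bidual_form F (bidual_mult y x) (bidual_mult y x)) <= Re (bidual_form F x x)"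
proof -
 from y have yb: "y \<in> bidual" and ball: "!!F. positive_functional F ==> Re (bidual_form F y y) <= Re (F 1)"
  by (auto simp: bidual_ball_def)
 obtain b where
  "!!n a. cmod (x (\<lambda>c. F (a * c)) - F (a * b n)) <= inverse (real (Suc n)) * sqrt (Re (F (a * star a)))"
  and b: "(\<lambda>n. F (star (b n) * b n)) \<longlonglongrightarrow> bidual_form F x x"
  "!!y. y \<in> bidual ==> (\<lambda>n. bidual_form (\<lambda>c. F (star (b n) * c * b n)) y y)
    \<longlonglongrightarrow> bidual_form F (bidual_mult y x) (bidual_mult y x)"
  by (rule bidual_form_limit[OF p x]) (rule that)
 show ?thesis
 proof (rule LIMSEQ_le[OF tendsto_Re[OF b(2)[OF yb]] tendsto_Re[OF b(1)]])
  show "\<exists>N. \<forall>n\<ge>N. Re (bidual_form (\<lambda>c. F (star (b n) * c * b n)) y y) <= Re (F (star (b n) * b n))"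
   using ball[OF positive_functional_conj[OF p]] by simp
 qed
qed

lemma bidual_ball_mult:
 assumes "x \<in> bidual_ball" "y \<in> bidual_ball"
 shows "bidual_mult x y \<in> bidual_ball"
 using bidual_ball_form_mult[OF assms(1)] assms(2) bidual_mult_closed assms(1)
 unfolding bidual_ball_def by fastforce

lemma square_le_imp_le:
 fixes a b :: real
 assumes "a * a <= a * b" "a >= 0" "b >= 0"
 shows "a <= b"
 using assms by (cases "a = 0") auto

text \<open>Let \<open>t\<close> be the value at \<open>F\<close> of \<open>x\<close> times its
  adjoint. Cauchy-Schwarz against the unit and contractivity of \<open>x\<close> give
  \<open>t * t <= t * Re (F 1)\<close>.\<close>

lemma bidual_ball_star:
 assumes x: "x \<in> bidual_ball"
 shows "bidual_star x \<in> bidual_ball"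
proof -
 from x have xb: "x \<in> bidual" by (simp add: bidual_ball_def)
 note sx = bidual_star_closed[OF xb]
 have "Re (bidual_form F (bidual_star x) (bidual_star x)) <= Re (F 1)" if p: "positive_functional F" for F
 proof -
  note d = positive_functional_dual[OF p]
  define h where "h = bidual_mult x (bidual_star x)"
  define t where "t = Re (bidual_form F (bidual_star x) (bidual_star x))"
  have h: "h \<in> bidual" unfolding h_def by (rule bidual_mult_closed[OF xb sx])
  have t: "t = Re (bidual_form F h (bidual_of 1))" "t >= 0"
   using bidual_form_nonneg[OF p sx] by (simp_all add: t_def h_def bidual_form_one[OF h[unfolded h_def] d])
    (simp add: bidual_form_def bidual_star_star)
  have "t * t <= (cmod (bidual_form F h (bidual_of 1)))\<^sup>2"
   unfolding power2_eq_square using t complex_Re_le_cmod[of "bidual_form F h (bidual_of 1)"]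
   by (intro mult_mono) auto
  also have "... <= Re (bidual_form F h h) * Re (F 1)"
   using bidual_form_cauchy_schwarz[OF p h bidual_of_closed[of 1]] by (simp add: bidual_form_of(2) d)
  also have "... <= t * Re (F 1)"
   using bidual_ball_form_mult[OF x sx p] positive_functional_one[OF p]
   by (intro mult_right_mono) (simp_all add: t_def h_def)
  finally show ?thesis using square_le_imp_le[of t "Re (F 1)"] t positive_functional_one[OF p] by (simp add: t_def)
 qed
 then show ?thesis by (simp add: bidual_ball_def sx)
qed

text \<open>As \<open>q\<close> equals its adjoint times itself, its squared seminorm
  \<open>t\<close> is also its value at \<open>F\<close>, and Cauchy-Schwarz against the unit gives
  \<open>t * t <= t * Re (F 1)\<close>.\<close>

lemma bidual_projection_ball:
 assumes q: "q \<in> bidual_projections"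
 shows "q \<in> bidual_ball"
proof -
 from q have qb: "q \<in> bidual" and qq: "bidual_mult q q = q" "bidual_star q = q"
  by (auto simp: bidual_projections_def)
 have "Re (bidual_form F q q) <= Re (F 1)" if p: "positive_functional F" for F
 proof -
  note d = positive_functional_dual[OF p]
  define t where "t = Re (bidual_form F q q)"
  have t: "t = Re (bidual_form F q (bidual_of 1))" "t >= 0"
   using bidual_form_nonneg[OF p qb] by (simp_all add: t_def bidual_form_one[OF qb d])
    (simp add: bidual_form_def qq)
  have "t * t <= (cmod (bidual_form F q (bidual_of 1)))\<^sup>2"
   unfolding power2_eq_square using t complex_Re_le_cmod[of "bidual_form F q (bidual_of 1)"]
   by (intro mult_mono) auto
  also have "... <= t * Re (F 1)"
   using bidual_form_cauchy_schwarz[OF p qb bidual_of_closed[of 1]] by (simp add: bidual_form_of(2) d t_def)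
  finally show ?thesis using square_le_imp_le[of t "Re (F 1)"] t positive_functional_one[OF p] by (simp add: t_def)
 qed
 then show ?thesis by (simp add: bidual_ball_def qb)
qed

text \<open>The defining inequality of \<open>bidual_ball\<close> is quadratic in \<open>x\<close>;
  the right-hand side bounds single evaluations of \<open>x\<close> and so is preserved under
  pointwise limits. The converse is obtained by inserting \<open>a = star (b n)\<close> for the
  approximants \<open>b n\<close> of \<open>x\<close>.\<close>

lemma bidual_ball_iff:
 assumes x: "x \<in> bidual"
 shows "x \<in> bidual_ball \<longleftrightarrow> (\<forall>F. positive_functional F \<longrightarrow>
  (\<forall>a. cmod (x (\<lambda>c. F (a * c))) <= sqrt (Re (F 1)) * sqrt (Re (F (a * star a)))))"
proof (intro iffI allI impI)
 fix F :: "'a => complex" and a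
 assume xb: "x \<in> bidual_ball" and p: "positive_functional F"
 note d = positive_functional_dual[OF p]
 have "x (\<lambda>c. F (a * c)) = bidual_form F x (bidual_of (star a))"
  by (simp add: bidual_form_of d star_star bidual_mult_apply bidual_of_apply bidual_left_dual[OF x d])
 then have "(cmod (x (\<lambda>c. F (a * c))))\<^sup>2 <= Re (bidual_form F x x) * Re (F (a * star a))"
  using bidual_form_cauchy_schwarz[OF p x bidual_of_closed[of "star a"]]
  by (simp add: bidual_form_of(2) d star_star)
 also have "... <= Re (F 1) * Re (F (a * star a))"
  using xb p positive_functional_nonneg[OF p, of "star a"]
  by (intro mult_right_mono) (auto simp: bidual_ball_def star_star)
 finally show "cmod (x (\<lambda>c. F (a * c))) <= sqrt (Re (F 1)) * sqrt (Re (F (a * star a)))"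
  using real_le_rsqrt by (fastforce simp: real_sqrt_mult)
next
 assume R: "\<forall>F. positive_functional F \<longrightarrow>
  (\<forall>a. cmod (x (\<lambda>c. F (a * c))) <= sqrt (Re (F 1)) * sqrt (Re (F (a * star a))))"
 have "Re (bidual_form F x x) <= Re (F 1)" if p: "positive_functional F" for F
 proof -
  obtain b where b: "!!n a. cmod (x (\<lambda>c. F (a * c)) - F (a * b n)) <= inverse (real (Suc n)) * sqrt (Re (F (a * star a)))"
   "(\<lambda>n. F (star (b n) * b n)) \<longlonglongrightarrow> bidual_form F x x"
   by (rule bidual_form_limit[OF p x]) (rule that)
  have le: "Re (F (star (b n) * b n)) <= (sqrt (Re (F 1)) + inverse (real (Suc n)))\<^sup>2" for n
  proof -
   define m where "m = sqrt (Re (F (star (b n) * b n)))"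
   have m0: "m >= 0" and m2: "m * m = Re (F (star (b n) * b n))"
    using positive_functional_nonneg[OF p, of "b n"] by (simp_all add: m_def)
   have "m * m <= cmod (F (star (b n) * b n))" unfolding m2 by (rule complex_Re_le_cmod)
   also have "... <= cmod (x (\<lambda>c. F (star (b n) * c))) + inverse (real (Suc n)) * m"
    using b(1)[of "star (b n)" n] norm_triangle_ineq4[of "x (\<lambda>c. F (star (b n) * c))"
      "x (\<lambda>c. F (star (b n) * c)) - F (star (b n) * b n)"]
    by (simp add: m_def star_star)
   also have "... <= sqrt (Re (F 1)) * m + inverse (real (Suc n)) * m"
    using R[rule_format, OF p, of "star (b n)"] by (simp add: m_def star_star)
   finally have "m * m <= m * (sqrt (Re (F 1)) + inverse (real (Suc n)))" by (simp add: algebra_simps)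
   moreover have "0 <= sqrt (Re (F 1)) + inverse (real (Suc n))"
    using positive_functional_one[OF p] by simp
   ultimately have "m <= sqrt (Re (F 1)) + inverse (real (Suc n))"
    using m0 square_le_imp_le by blast
   then show ?thesis using m0 unfolding m2[symmetric] power2_eq_square by (intro mult_mono) auto
  qed
  have "(\<lambda>n. (sqrt (Re (F 1)) + inverse (real (Suc n)))\<^sup>2) \<longlonglongrightarrow> (sqrt (Re (F 1)) + 0)\<^sup>2"
   by (intro tendsto_intros LIMSEQ_inverse_real_of_nat)
  from LIMSEQ_le[OF tendsto_Re[OF b(2)] this] le show ?thesis
   using positive_functional_one[OF p] by auto
 qed
 then show "x \<in> bidual_ball" by (simp add: bidual_ball_def x)
qed

lemma bidual_ball_closed: "x \<in> bidual_ball ==> x \<in> bidual"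
 by (simp add: bidual_ball_def)

lemma bidual_ball_bound_positive:
 assumes x: "x \<in> bidual_ball" and p: "positive_functional F"
 shows "cmod (x F) <= Re (F 1)"
proof -
 have "cmod (x (\<lambda>c. F (1 * c))) <= sqrt (Re (F 1)) * sqrt (Re (F (1 * star 1)))"
  using x p bidual_ball_iff[OF bidual_ball_closed[OF x]] by blast
 then show ?thesis using positive_functional_one[OF p] by simp
qed

text \<open>Four positive parts of mass at most \<open>2 * onorm F\<close> give the factor 8; the
  resulting radius depends on \<open>F\<close> alone.\<close>

lemma bidual_ball_bound:
 assumes x: "x \<in> bidual_ball" and d: "F \<in> dual"
 shows "cmod (x F) <= 8 * onorm F"
proof -
 obtain P z where P: "!!i. i < 4 ==> positive_functional (P i)" "!!i. i < 4 ==> Re (P i 1) <= 2 * onorm F"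
  "!!i. i < 4 ==> cmod (z i) <= 1" and F: "F = (\<lambda>a. \<Sum>i<4::nat. z i * P i a)"
  by (rule dual_decomposition'[OF d]) (rule that)
 have "x F = (\<Sum>i<4. z i * x (P i))"
  unfolding F by (rule bidual_decomposition[OF bidual_ball_closed[OF x] P(1)])
 also have "cmod ... <= (\<Sum>i<4::nat. 2 * onorm F)"
 proof (rule sum_norm_le)
  fix i :: nat assume "i \<in> {..<4}"
  then have i: "i < 4" by simp
  have "cmod (z i * x (P i)) <= 1 * Re (P i 1)"
   unfolding norm_mult by (intro mult_mono P(3) bidual_ball_bound_positive x P(1) i) auto
  then show "cmod (z i * x (P i)) <= 2 * onorm F" using P(2)[OF i] by simp
 qed
 finally show ?thesis by simp
qed

text \<open>Banach-Alaoglu: a product of discs is compact by Tychonoff's theorem, and linearity and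
  the ball condition are closed conditions on evaluations. Outside the dual the disc has radius
  zero, in agreement with the encoding of bidual elements.\<close>

lemma bidual_ball_compact: "compact (bidual_ball :: (('a::unital_cstar_algebra => complex) => complex) set)"
proof -
 define B where "B \<psi> = cball (0::complex) (if \<psi> \<in> dual then 8 * onorm \<psi> else 0)" for \<psi> :: "'a => complex"
 define C0 where "C0 = PiE UNIV B"
 define C1 where "C1 = (\<Inter>\<phi>\<in>dual. \<Inter>F\<in>dual. {x. x (\<lambda>a::'a. \<phi> a + F a) = (x \<phi> + x F :: complex)})"
 define C2 where "C2 = (\<Inter>c. \<Inter>\<phi>\<in>dual. {x. x (\<lambda>a::'a. c * \<phi> a) = (c * x \<phi> :: complex)})"
 define C3 where "C3 = (\<Inter>F\<in>Collect positive_functional. \<Inter>a::'a.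
  {x. cmod (x (\<lambda>c. F (a * c))) <= sqrt (Re (F 1)) * sqrt (Re (F (a * star a)))})"
 have "compactin (product_topology (\<lambda>i. euclidean) UNIV) C0"
  unfolding C0_def compactin_PiE by (simp add: B_def)
 then have "compact C0" by (simp add: euclidean_product_topology)
 moreover have "closed C1" "closed C2" "closed C3"
  unfolding C1_def C2_def C3_def
  by (intro closed_INT ballI closed_Collect_eq closed_Collect_le continuous_intros
    continuous_on_product_coordinates)+
 ultimately have "compact (C0 \<inter> C1 \<inter> C2 \<inter> C3)"
  by auto
 also have "C0 \<inter> C1 \<inter> C2 \<inter> C3 = bidual_ball"
 proof (intro equalityI subsetI)
  fix x assume x: "x \<in> C0 \<inter> C1 \<inter> C2 \<inter> C3"
  have "x \<in> bidual"
  proof (rule bidualI)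
   show "cmod (x \<phi>) <= 8 * onorm \<phi>" if "\<phi> \<in> dual" for \<phi>
    using x that by (auto simp: C0_def B_def PiE_iff dest!: spec[of _ \<phi>])
   show "x \<phi> = 0" if "\<phi> \<notin> dual" for \<phi>
    using x that by (auto simp: C0_def B_def PiE_iff dest!: spec[of _ \<phi>])
  qed (use x in \<open>auto simp: C1_def C2_def\<close>)
  then show "x \<in> bidual_ball" using x by (auto simp: bidual_ball_iff C3_def)
 next
  fix x :: "('a => complex) => complex" assume x: "x \<in> bidual_ball"
  note xb = bidual_ball_closed[OF x]
  have "x \<in> C0" using bidual_ball_bound[OF x] bidual_apply(3)[OF xb] by (auto simp: C0_def B_def)
  moreover have "x \<in> C1" "x \<in> C2" using bidual_apply[OF xb] by (auto simp: C1_def C2_def)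
  moreover have "x \<in> C3" using x by (auto simp: bidual_ball_iff[OF xb] C3_def)
  ultimately show "x \<in> C0 \<inter> C1 \<inter> C2 \<inter> C3" by simp
 qed
 finally show ?thesis .
qed

section \<open>The face of a state and its support projection\<close>

lemma bidual_form_sum:
 assumes x: "x \<in> bidual" and y: "y \<in> bidual" and d: "!!i. i \<in> I ==> F i \<in> dual"
 shows "bidual_form (\<lambda>a. \<Sum>i\<in>I. F i a) x y = (\<Sum>i\<in>I. bidual_form (F i) x y)"
 unfolding bidual_form_def
 by (rule bidual_apply_sum[OF bidual_mult_closed[OF bidual_star_closed[OF y] x] d])

lemma positive_functional_sum:
 "(!!i. i \<in> I ==> positive_functional (F i)) ==> positive_functional (\<lambda>a. \<Sum>i\<in>I. F i a)"
proof (induction I rule: infinite_finite_induct)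
 case (insert i I)
 then show ?case by (simp add: positive_functional_add)
qed (simp_all add: positive_functional_def functional_linear_def)

definition state_face :: "('a::unital_cstar_algebra => complex) => (('a => complex) => complex) set" where
 "state_face \<phi> = {x \<in> bidual_ball. x \<phi> = 1}"

lemma state_face_compact: "compact (state_face \<phi>)"
proof -
 have "closed {x::('a => complex) => complex. x \<phi> = 1}"
  by (intro closed_Collect_eq continuous_on_product_coordinates continuous_on_const)
 then have "compact (bidual_ball \<inter> {x. x \<phi> = 1})" using bidual_ball_compact by auto
 then show ?thesis by (simp add: state_face_def Collect_conj_eq)
qed

context
 fixes \<phi> :: "'a::unital_cstar_algebra => complex"
 assumes state: "\<phi> \<in> states"
begin

lemma state_positive: "positive_functional \<phi>" and state_one: "\<phi> 1 = 1"
 using state by (simp_all add: states_positive)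

text \<open>Since \<open>x \<phi> = 1\<close> and \<open>x\<close> is contractive, the squared
  seminorm of \<open>x - 1\<close> is at most \<open>1 - 2 + 1 = 0\<close>, so \<open>x\<close>
  fixes the GNS vector of \<open>\<phi>\<close>; Cauchy-Schwarz carries this to all
  \<open>a\<close>.\<close>

lemma state_face_apply:
 assumes x: "x \<in> state_face \<phi>"
 shows "x (\<lambda>b. \<phi> (a * b)) = \<phi> a"
proof -
 note p = state_positive and d = positive_functional_dual[OF state_positive]
 from x have xb: "x \<in> bidual" and x1: "x \<phi> = 1" and ball: "Re (bidual_form \<phi> x x) <= 1"
  using p state_one by (auto simp: state_face_def bidual_ball_def)
 note one = bidual_of_closed[of "1::'a"]
 define w where "w = (\<lambda>\<psi>. 1 * x \<psi> + (-1) * bidual_of 1 \<psi>)"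
 have w: "w \<in> bidual" unfolding w_def by (rule bidual_lincomb[OF xb one])
 have "bidual_form \<phi> (bidual_of 1) x = 1"
  using bidual_form_commute[OF p xb one] by (simp add: bidual_form_one xb d x1)
 then have "Re (bidual_form \<phi> w w) <= 0"
  unfolding w_def bidual_form_square_lincomb[OF p xb one] using ball
  by (simp add: bidual_form_of(2) d state_one)
 moreover have "(cmod (bidual_form \<phi> w (bidual_of (star a))))\<^sup>2
   <= Re (bidual_form \<phi> w w) * Re (bidual_form \<phi> (bidual_of (star a)) (bidual_of (star a)))"
  by (rule bidual_form_cauchy_schwarz[OF p w bidual_of_closed])
 ultimately have "(cmod (bidual_form \<phi> w (bidual_of (star a))))\<^sup>2 <= 0"
  using bidual_form_nonneg[OF p bidual_of_closed[of "star a"]] mult_nonpos_nonneg order_trans by blast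
 then have "bidual_form \<phi> w (bidual_of (star a)) = 0" by simp
 then show ?thesis
  unfolding w_def bidual_form_lincomb(1)[OF d xb one bidual_of_closed]
  by (simp add: bidual_form_of(2) d star_star)
   (simp add: bidual_form_of d star_star bidual_mult_apply bidual_of_apply bidual_left_dual[OF xb d])
qed

lemma state_face_mult:
 assumes x: "x \<in> state_face \<phi>" and y: "y \<in> state_face \<phi>"
 shows "bidual_mult x y \<in> state_face \<phi>"
 using assms state_face_apply[OF y]
 by (simp add: state_face_def bidual_mult_apply positive_functional_dual[OF state_positive] bidual_ball_mult)

lemma state_face_star:
 assumes x: "x \<in> state_face \<phi>"
 shows "bidual_star x \<in> state_face \<phi>"
 using assms by (simp add: state_face_def bidual_ball_star bidual_star_positive[OF state_positive])

lemma state_face_one: "bidual_of 1 \<in> state_face \<phi>"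
 by (simp add: state_face_def bidual_ball_of bidual_of_apply positive_functional_dual[OF state_positive] state_one)

text \<open>Convexity is visible in the linear description \<open>bidual_ball_iff\<close>; midpoints
  are what the parallelogram law is applied to.\<close>

lemma state_face_midpoint:
 assumes x: "x \<in> state_face \<phi>" and y: "y \<in> state_face \<phi>"
 shows "(\<lambda>\<psi>. (1/2) * x \<psi> + (1/2) * y \<psi>) \<in> state_face \<phi>"
proof -
 from x y have xb: "x \<in> bidual" and yb: "y \<in> bidual" by (auto simp: state_face_def bidual_ball_def)
 have "cmod ((1/2) * x (\<lambda>c. F (a * c)) + (1/2) * y (\<lambda>c. F (a * c))) <= sqrt (Re (F 1)) * sqrt (Re (F (a * star a)))"
  if "positive_functional F" for F a
 proof -
  have "cmod (x (\<lambda>c. F (a * c))) <= sqrt (Re (F 1)) * sqrt (Re (F (a * star a)))"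
   "cmod (y (\<lambda>c. F (a * c))) <= sqrt (Re (F 1)) * sqrt (Re (F (a * star a)))"
   using x y that by (auto simp: state_face_def bidual_ball_iff[OF xb] bidual_ball_iff[OF yb])
  then show ?thesis
   using norm_triangle_ineq[of "(1/2) * x (\<lambda>c. F (a * c))" "(1/2) * y (\<lambda>c. F (a * c))"]
   by simp
 qed
 then have "(\<lambda>\<psi>. (1/2) * x \<psi> + (1/2) * y \<psi>) \<in> bidual_ball"
  by (intro iffD2[OF bidual_ball_iff[OF bidual_lincomb[OF xb yb]]]) blast
 then show ?thesis using x y by (simp add: state_face_def)
qed

text \<open>By the parallelogram law, an element of the face that nearly minimises the Hilbert seminorm of
 \<open>F\<close> is nearly fixed under multiplication from the left by the face, since that does not increase
 the seminorm.\<close>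

lemma state_face_almost_fixed:
 assumes p: "positive_functional F" and e: "e > 0"
 obtains x where "x \<in> state_face \<phi>"
  "!!y. y \<in> state_face \<phi> ==> Re (bidual_form F (\<lambda>\<psi>. x \<psi> - bidual_mult y x \<psi>) (\<lambda>\<psi>. x \<psi> - bidual_mult y x \<psi>)) <= e"
proof -
 define S where "S = (\<lambda>x. Re (bidual_form F x x)) ` state_face \<phi>"
 have face: "x \<in> bidual" if "x \<in> state_face \<phi>" for x using that by (auto simp: state_face_def bidual_ball_def)
 have bdd: "bdd_below S" by (rule bdd_belowI[of _ 0]) (auto simp: S_def bidual_form_nonneg[OF p] face)
 have ne: "S ~= {}" using state_face_one by (auto simp: S_def)
 define m where "m = Inf S"
 have "Inf S < m + e / 4" using e by (simp add: m_def)
 then obtain x where x: "x \<in> state_face \<phi>" "Re (bidual_form F x x) < m + e / 4"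
  unfolding S_def cInf_less_iff[OF ne[unfolded S_def] bdd[unfolded S_def]] by auto
 have m_le: "m <= Re (bidual_form F z z)" if "z \<in> state_face \<phi>" for z
  unfolding m_def by (rule cInf_lower[OF _ bdd]) (use that in \<open>auto simp: S_def\<close>)
 show ?thesis
 proof (rule that[OF x(1)])
  fix y assume y: "y \<in> state_face \<phi>"
  note xb = face[OF x(1)] and yxb = face[OF state_face_mult[OF y x(1)]]
  have yx: "Re (bidual_form F (bidual_mult y x) (bidual_mult y x)) <= Re (bidual_form F x x)"
   using y by (intro bidual_ball_form_mult xb p) (simp add: state_face_def)
  have "m <= Re (bidual_form F (\<lambda>\<psi>. (1/2) * x \<psi> + (1/2) * bidual_mult y x \<psi>) (\<lambda>\<psi>. (1/2) * x \<psi> + (1/2) * bidual_mult y x \<psi>))"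
   by (intro m_le state_face_midpoint x(1) state_face_mult y)
  then have "4 * m <= Re (bidual_form F x x) + Re (bidual_form F (bidual_mult y x) (bidual_mult y x))
    + 2 * Re (bidual_form F (bidual_mult y x) x)"
   unfolding bidual_form_square_lincomb[OF p xb yxb] by (simp add: power2_eq_square)
  moreover have "Re (bidual_form F (\<lambda>\<psi>. x \<psi> - bidual_mult y x \<psi>) (\<lambda>\<psi>. x \<psi> - bidual_mult y x \<psi>))
   = Re (bidual_form F x x) + Re (bidual_form F (bidual_mult y x) (bidual_mult y x))
    - 2 * Re (bidual_form F (bidual_mult y x) x)"
   using bidual_form_square_lincomb[OF p xb yxb, of 1 "-1"] by simp
  ultimately show "Re (bidual_form F (\<lambda>\<psi>. x \<psi> - bidual_mult y x \<psi>) (\<lambda>\<psi>. x \<psi> - bidual_mult y x \<psi>)) <= e"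
   using yx x(2) by simp
 qed
qed

text \<open>Nearly fixed elements exist for one positive functional. The sum of finitely many
  functionals handles finitely many conditions at once, and compactness of the face yields an
  element that satisfies all of them exactly.\<close>

lemma state_face_absorbing_element:
 obtains p where "p \<in> state_face \<phi>" "!!y. y \<in> state_face \<phi> ==> bidual_mult y p = p"
proof -
 have face: "x \<in> bidual" if "x \<in> state_face \<phi>" for x using that by (auto simp: state_face_def bidual_ball_def)
 define I where "I = {(y, F, e). y \<in> state_face \<phi> \<and> positive_functional (F :: 'a => complex) \<and> e > (0::real)}"
 \<comment> \<open>By Arens regularity the value of \<open>bidual_mult y x\<close> at
   \<open>F\<close> is an evaluation of \<open>x\<close>; written in this order, the condition is
   closed under pointwise limits.\<close>
 define T where "T = (\<lambda>(y, F, e). {x :: ('a => complex) => complex. cmod (x (\<lambda>b. y (\<lambda>a. F (a * b))) - x F) <= e})"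
 have "state_face \<phi> \<inter> (\<Inter>i\<in>I. T i) ~= {}"
 proof (rule compact_imp_fip_image[OF state_face_compact])
  show "closed (T i)" if "i \<in> I" for i
   unfolding T_def by (cases i) (auto intro!: closed_Collect_le continuous_intros)
 next
  fix I' assume I': "finite I'" "I' \<subseteq> I"
  show "state_face \<phi> \<inter> (\<Inter>i\<in>I'. T i) ~= {}"
  proof (cases "I' = {}")
   case True then show ?thesis using state_face_one by auto
  next
   case False
   define \<Theta> where "\<Theta> = (\<lambda>a. \<Sum>i\<in>I'. fst (snd i) a)"
   have pos: "positive_functional (fst (snd i))" if "i \<in> I'" for i using that I' by (auto simp: I_def)
   have \<Theta>: "positive_functional \<Theta>" unfolding \<Theta>_def by (rule positive_functional_sum[OF pos])
   define e0 where "e0 = Min ((snd \<circ> snd) ` I')"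
   have e0: "e0 > 0" "!!i. i \<in> I' ==> e0 <= snd (snd i)"
    using I' False by (auto simp: e0_def I_def)
   \<comment> \<open>Chosen so that Cauchy-Schwarz against the unit ends in
     \<open>\<delta> * Re (\<Theta> 1) <= e0^2\<close>.\<close>
   define \<delta> where "\<delta> = e0\<^sup>2 / (Re (\<Theta> 1) + 1)"
   have \<delta>: "\<delta> > 0" using e0 positive_functional_one[OF \<Theta>] by (simp add: \<delta>_def)
   obtain x where x: "x \<in> state_face \<phi>"
    "!!y. y \<in> state_face \<phi> ==> Re (bidual_form \<Theta> (\<lambda>\<psi>. x \<psi> - bidual_mult y x \<psi>) (\<lambda>\<psi>. x \<psi> - bidual_mult y x \<psi>)) <= \<delta>"
    by (rule state_face_almost_fixed[OF \<Theta> \<delta>]) (rule that)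
   have "x \<in> T i" if i: "i \<in> I'" for i
   proof -
    obtain y F e where iy: "i = (y, F, e)" by (cases i) auto
    have y: "y \<in> state_face \<phi>" and F: "positive_functional F" and e: "e0 <= e"
     using i I' e0(2)[OF i] by (auto simp: iy I_def)
    note d = positive_functional_dual[OF F]
    define w where "w = (\<lambda>\<psi>. x \<psi> - bidual_mult y x \<psi>)"
    have w: "w \<in> bidual"
     using bidual_lincomb[OF face[OF x(1)] face[OF state_face_mult[OF y x(1)]], of 1 "-1"] by (simp add: w_def)
    have "Re (bidual_form F w w) <= (\<Sum>j\<in>I'. Re (bidual_form (fst (snd j)) w w))"
     using member_le_sum[OF i, of "\<lambda>j. Re (bidual_form (fst (snd j)) w w)"] I' pos
     by (simp add: iy bidual_form_nonneg[OF _ w])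
    also have "... = Re (bidual_form \<Theta> w w)"
     using bidual_form_sum[OF w w, of I' "\<lambda>j. fst (snd j)"] pos by (simp add: \<Theta>_def positive_functional_dual)
    also have "... <= \<delta>" unfolding w_def by (rule x(2)[OF y])
    finally have 1: "Re (bidual_form F w w) <= \<delta>" .
    have 2: "Re (F 1) <= Re (\<Theta> 1)"
     using member_le_sum[OF i, of "\<lambda>j. Re (fst (snd j) 1)"] I' pos
     by (simp add: iy \<Theta>_def positive_functional_one)
    have "(cmod (w F))\<^sup>2 <= Re (bidual_form F w w) * Re (F 1)"
     using bidual_form_cauchy_schwarz[OF F w bidual_of_closed[of 1]]
     by (simp add: bidual_form_one[OF w d] bidual_form_of(2)[OF d])
    also have "... <= \<delta> * Re (\<Theta> 1)"
     using 1 2 positive_functional_one[OF F] \<delta> by (intro mult_mono) auto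
    also have "... <= e0\<^sup>2"
    proof -
     have "Re (\<Theta> 1) / (Re (\<Theta> 1) + 1) <= 1" using positive_functional_one[OF \<Theta>] by simp
     from mult_left_mono[OF this, of "e0\<^sup>2"] show ?thesis by (simp add: \<delta>_def)
    qed
    finally have "cmod (w F) <= e0" by (rule power2_le_imp_le) (use e0(1) in simp)
    moreover have "w F = x F - x (\<lambda>b. y (\<lambda>a. F (a * b)))"
     using arens_regular[OF face[OF y] face[OF x(1)] d] by (simp add: w_def bidual_mult_apply d)
    ultimately show ?thesis using e by (simp add: T_def iy norm_minus_commute)
   qed
   then show ?thesis using x(1) by auto
  qed
 qed
 then obtain p where p: "p \<in> state_face \<phi>" "!!i. i \<in> I ==> p \<in> T i" by auto
 have "bidual_mult y p = p" if y: "y \<in> state_face \<phi>" for y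
 proof (rule bidual_eqI)
  fix F :: "'a => complex" assume F: "positive_functional F"
  note d = positive_functional_dual[OF F]
  have "cmod (p (\<lambda>b. y (\<lambda>a. F (a * b))) - p F) <= 0"
  proof (rule field_le_epsilon)
   fix e :: real assume "e > 0"
   then have "(y, F, e) \<in> I" using y F by (simp add: I_def)
   from p(2)[OF this] show "cmod (p (\<lambda>b. y (\<lambda>a. F (a * b))) - p F) <= 0 + e" by (simp add: T_def)
  qed
  then show "bidual_mult y p F = p F"
   using arens_regular[OF face[OF y] face[OF p(1)] d] by (simp add: bidual_mult_apply d)
 qed (use y p(1) in \<open>simp_all add: face bidual_mult_closed\<close>)
 with p(1) show ?thesis by (rule that)
qed

text \<open>The adjoint of an absorbing element \<open>p\<close> times \<open>p\<close> is
  \<open>p\<close>, so \<open>p\<close> is selfadjoint and idempotent. A projection \<open>q\<close>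
  with \<open>q \<phi> = 1\<close> lies in the face, hence \<open>q p = p\<close>, and by taking
  adjoints \<open>p q = p\<close>. So \<open>p\<close> is the smallest such projection and the
  definite description denotes it.\<close>

lemma state_support_face: "state_support \<phi> \<in> state_face \<phi>"
 and state_support_absorbs: "y \<in> state_face \<phi> ==> bidual_mult y (state_support \<phi>) = state_support \<phi>"
proof -
 obtain p where p: "p \<in> state_face \<phi>" and abs: "!!y. y \<in> state_face \<phi> ==> bidual_mult y p = p"
  by (rule state_face_absorbing_element) (rule that)
 have pb: "p \<in> bidual" using p by (auto simp: state_face_def bidual_ball_def)
 have sp: "bidual_mult (bidual_star p) p = p" by (rule abs[OF state_face_star[OF p]])
 have star: "bidual_star p = p"
  using bidual_star_mult[OF bidual_star_closed[OF pb] pb] by (simp add: sp bidual_star_star)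
 have proj: "p \<in> bidual_projections"
  using pb star sp by (simp add: bidual_projections_def)
 have "state_support \<phi> = p"
  unfolding state_support_def
 proof (rule the_equality)
  have "bidual_mult p q = p" if q: "q \<in> bidual_projections" "q \<phi> = 1" for q
  proof -
   have "bidual_mult q p = p" using q by (intro abs) (simp add: state_face_def bidual_projection_ball)
   moreover have "q \<in> bidual" "bidual_star q = q" using q by (auto simp: bidual_projections_def)
   ultimately show ?thesis using bidual_star_mult[of q p] pb star by simp
  qed
  then show "p \<in> bidual_projections \<and> p \<phi> = 1 \<and> (\<forall>q\<in>bidual_projections. q \<phi> = 1 \<longrightarrow> bidual_mult p q = p)"
   using proj p by (simp add: state_face_def)
  fix r assume r: "r \<in> bidual_projections \<and> r \<phi> = 1 \<and> (\<forall>q\<in>bidual_projections. q \<phi> = 1 \<longrightarrow> bidual_mult r q = r)"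
  then have "bidual_mult r p = r" using proj p by (auto simp: state_face_def)
  moreover have "bidual_mult r p = p"
   using r by (intro abs) (simp add: state_face_def bidual_projection_ball)
  ultimately show "r = p" by simp
 qed
 then show "state_support \<phi> \<in> state_face \<phi>"
  "y \<in> state_face \<phi> ==> bidual_mult y (state_support \<phi>) = state_support \<phi>"
  using p abs by auto
qed

end

subsection \<open>Hilbert spaces\<close>

lemma cinner_add_right: "cinner x (y + z) = cinner x y + cinner x (z::'h::complex_hilbert_space)"
 by (metis cinner_add_left cinner_commute complex_cnj_add)

lemma cinner_scaleC_right: "cinner x (c *\<^sub>C y) = cnj c * cinner x (y::'h::complex_hilbert_space)"
 by (metis cinner_scaleC_left cinner_commute complex_cnj_mult)

lemma cinner_zero [simp]: "cinner 0 (x::'h::complex_hilbert_space) = 0" "cinner (x::'h) 0 = 0"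
 using cinner_scaleC_left[of 0 0 x] cinner_scaleC_right[of x 0 0] by auto

lemma cinner_minus [simp]:
 "cinner (- x) (y::'h::complex_hilbert_space) = - cinner x y" "cinner x (- y) = - cinner x (y::'h)"
 using cinner_scaleC_left[of "-1" x y] cinner_scaleC_right[of x "-1" y] by auto

lemma cinner_diff_left: "cinner (x - y) z = cinner x z - cinner y (z::'h::complex_hilbert_space)"
 using cinner_add_left[of x "- y" z] by simp

lemma cinner_diff_right: "cinner x (y - z) = cinner x y - cinner x (z::'h::complex_hilbert_space)"
 using cinner_add_right[of x y "- z"] by simp

lemma cinner_scaleR_left: "cinner (r *\<^sub>R x) y = of_real r * cinner x (y::'h::complex_hilbert_space)"
 using cinner_scaleC_left[of "of_real r" x y] by (simp add: scaleC_of_real)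

lemma cinner_scaleR_right: "cinner x (r *\<^sub>R y) = of_real r * cinner x (y::'h::complex_hilbert_space)"
 using cinner_scaleC_right[of x "of_real r" y] by (simp add: scaleC_of_real)

lemma cinner_sum_left: "cinner (\<Sum>i\<in>I. f i) y = (\<Sum>i\<in>I. cinner (f i) (y::'h::complex_hilbert_space))"
 by (induction I rule: infinite_finite_induct) (simp_all add: cinner_add_left)

lemma cinner_sum_right: "cinner x (\<Sum>i\<in>I. f i) = (\<Sum>i\<in>I. cinner x (f i ::'h::complex_hilbert_space))"
 by (induction I rule: infinite_finite_induct) (simp_all add: cinner_add_right)

lemmas cinner_simps = cinner_add_left cinner_add_right cinner_diff_left cinner_diff_right
 cinner_scaleC_left cinner_scaleC_right cinner_scaleR_left cinner_scaleR_right

lemma cinner_self_Re: "Re (cinner x x) = (norm (x::'h::complex_hilbert_space))\<^sup>2"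
 by (simp add: cinner_self)

lemma cinner_eq_0_iff [simp]: "cinner x x = 0 \<longleftrightarrow> x = (0::'h::complex_hilbert_space)"
 by (simp add: cinner_self)

lemma Re_cinner_commute: "Re (cinner y x) = Re (cinner x (y::'h::complex_hilbert_space))"
 by (subst cinner_commute) simp

lemma norm_add_square:
 "(norm (x + y))\<^sup>2 = (norm x)\<^sup>2 + 2 * Re (cinner x y) + (norm (y::'h::complex_hilbert_space))\<^sup>2"
 using Re_cinner_commute[of y x] by (simp add: cinner_self_Re[symmetric] cinner_simps)

lemma norm_diff_square:
 "(norm (x - y))\<^sup>2 = (norm x)\<^sup>2 - 2 * Re (cinner x y) + (norm (y::'h::complex_hilbert_space))\<^sup>2"
 using norm_add_square[of x "- y"] by simp

lemma parallelogram:
 "(norm (x + y))\<^sup>2 + (norm (x - y))\<^sup>2 = 2 * (norm x)\<^sup>2 + 2 * (norm (y::'h::complex_hilbert_space))\<^sup>2"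
 by (simp add: norm_add_square norm_diff_square)

lemma cinner_cauchy_schwarz: "cmod (cinner x y) <= norm x * norm (y::'h::complex_hilbert_space)"
proof -
 have "(cmod (cinner y x))\<^sup>2 <= (norm x)\<^sup>2 * (norm y)\<^sup>2"
 proof (rule cauchy_schwarz_discriminant)
  fix c
  have "(norm (x + c *\<^sub>C y))\<^sup>2 = (norm x)\<^sup>2 + 2 * Re (cinner (c *\<^sub>C y) x) + (norm (c *\<^sub>C y))\<^sup>2"
   using norm_add_square[of x "c *\<^sub>C y"] Re_cinner_commute[of x "c *\<^sub>C y"] by simp
  then show "0 <= (norm x)\<^sup>2 + 2 * Re (c * cinner y x) + (cmod c)\<^sup>2 * (norm y)\<^sup>2"
   by (simp add: cinner_simps norm_scaleC power_mult_distrib) (metis zero_le_power2)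
 qed simp
 then have "(cmod (cinner x y))\<^sup>2 <= (norm x * norm y)\<^sup>2"
  by (metis cinner_commute complex_mod_cnj power_mult_distrib)
 then show ?thesis by (rule power2_le_imp_le) simp
qed

lemma bounded_bilinear_cinner: "bounded_bilinear (cinner :: 'h::complex_hilbert_space => 'h => complex)"
proof (rule bounded_bilinear.intro)
 show "\<exists>K. \<forall>a b. cmod (cinner a b) <= norm a * norm (b::'h) * K"
  by (rule exI[of _ 1]) (simp add: cinner_cauchy_schwarz)
qed (simp_all add: cinner_simps scaleR_conv_of_real)

lemmas tendsto_cinner = bounded_bilinear.tendsto[OF bounded_bilinear_cinner]
lemmas continuous_on_cinner = bounded_bilinear.continuous_on[OF bounded_bilinear_cinner]

lemma bounded_linear_scaleC: "bounded_linear (\<lambda>x::'h::complex_normed_vector. c *\<^sub>C x)"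
 by (rule bounded_linear_intro[of _ "cmod c"])
  (simp_all add: scaleC_add_right norm_scaleC scaleC_of_real[symmetric] scaleC_scaleC mult.commute)

lemmas tendsto_scaleC = bounded_linear.tendsto[OF bounded_linear_scaleC]

text \<open>Minimising sequences are Cauchy by the parallelogram law. The real version is applied as
  such to the real subspace obtained from selfadjoint elements acting on two vectors; complex
  projections follow from it.\<close>

lemma real_projection:
 fixes E :: "'h::complex_hilbert_space set"
 assumes E: "closed E" and sub: "subspace E"
 obtains y where "y \<in> E" "!!z. z \<in> E ==> Re (cinner (x - y) z) = 0"
proof -
 define S where "S = (\<lambda>y. (norm (x - y))\<^sup>2) ` E"
 have bdd: "bdd_below S" by (rule bdd_belowI[of _ 0]) (auto simp: S_def)
 have ne: "S ~= {}" using subspace_0[OF sub] by (auto simp: S_def)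
 define m where "m = Inf S"
 have m_le: "m <= (norm (x - y))\<^sup>2" if "y \<in> E" for y
  unfolding m_def by (rule cInf_lower[OF _ bdd]) (use that in \<open>auto simp: S_def\<close>)
 have "\<exists>y\<in>E. (norm (x - y))\<^sup>2 < m + inverse (real (Suc n))" for n
 proof -
  have "Inf S < m + inverse (real (Suc n))" by (simp add: m_def)
  then show ?thesis unfolding cInf_less_iff[OF ne bdd] by (auto simp: S_def)
 qed
 then obtain y where y: "!!n. y n \<in> E" "!!n. (norm (x - y n))\<^sup>2 < m + inverse (real (Suc n))" by metis
 have diff: "(norm (y i - y j))\<^sup>2 <= 2 * inverse (real (Suc i)) + 2 * inverse (real (Suc j))" for i j
 proof -
  have mid: "(1/2) *\<^sub>R (y i + y j) \<in> E" by (intro subspace_scale subspace_add sub y)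
  have "4 * m <= 4 * (norm (x - (1/2) *\<^sub>R (y i + y j)))\<^sup>2" using m_le[OF mid] by simp
  also have "... = (norm (2 *\<^sub>R (x - (1/2) *\<^sub>R (y i + y j))))\<^sup>2" by simp
  also have "2 *\<^sub>R (x - (1/2) *\<^sub>R (y i + y j)) = (x - y i) + (x - y j)"
   by (simp add: algebra_simps scaleR_2)
  finally have 1: "4 * m <= (norm ((x - y i) + (x - y j)))\<^sup>2" .
  have "norm (y i - y j) = norm ((x - y i) - (x - y j))" by (simp add: norm_minus_commute)
  then show ?thesis
   using parallelogram[of "x - y i" "x - y j"] 1 y(2)[of i] y(2)[of j] by simp
 qed
 have "Cauchy y"
 proof (rule CauchyI)
  fix e :: real assume e: "e > 0"
  obtain N where N: "inverse (real (Suc N)) < e\<^sup>2 / 4"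
   using reals_Archimedean[of "e\<^sup>2 / 4"] e by auto
  show "\<exists>M. \<forall>i\<ge>M. \<forall>j\<ge>M. norm (y i - y j) < e"
  proof (intro exI allI impI)
   fix i j assume "N <= i" "N <= j"
   then have "inverse (real (Suc i)) <= inverse (real (Suc N))" "inverse (real (Suc j)) <= inverse (real (Suc N))"
    by auto
   then have "(norm (y i - y j))\<^sup>2 < e\<^sup>2" using diff[of i j] N by linarith
   then show "norm (y i - y j) < e" by (rule power2_less_imp_less) (use e in simp)
  qed
 qed
 then obtain l where l: "y \<longlonglongrightarrow> l" using Cauchy_convergent convergent_def by auto
 have lE: "l \<in> E" using closed_sequentially[OF E] y(1) l by auto
 have "(norm (x - l))\<^sup>2 <= m"
 proof (rule LIMSEQ_le)
  show "(\<lambda>n. (norm (x - y n))\<^sup>2) \<longlonglongrightarrow> (norm (x - l))\<^sup>2" by (intro tendsto_intros l)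
  show "(\<lambda>n. m + inverse (real (Suc n))) \<longlonglongrightarrow> m"
   using tendsto_add[OF tendsto_const[of m] LIMSEQ_inverse_real_of_nat] by simp
 qed (use y(2) in \<open>auto intro: less_imp_le\<close>)
 have "Re (cinner (x - l) z) = 0" if z: "z \<in> E" for z
 proof -
  have key: "0 <= - (2 * t * Re (cinner (x - l) z)) + t\<^sup>2 * (norm z)\<^sup>2" for t
  proof -
   have "l + t *\<^sub>R z \<in> E" by (intro subspace_add subspace_scale sub lE z)
   from m_le[OF this] \<open>(norm (x - l))\<^sup>2 <= m\<close> have "(norm (x - l))\<^sup>2 <= (norm ((x - l) - t *\<^sub>R z))\<^sup>2"
    unfolding diff_diff_eq by (rule order_trans[rotated])
   then show ?thesis by (simp add: norm_diff_square cinner_simps power_mult_distrib)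
  qed
  define r where "r = Re (cinner (x - l) z)"
  show ?thesis
  proof (cases "z = 0")
   case False
   have "0 <= - (2 * (r / (norm z)\<^sup>2) * r) + (r / (norm z)\<^sup>2)\<^sup>2 * (norm z)\<^sup>2"
    using key[of "r / (norm z)\<^sup>2"] by (simp add: r_def)
   also have "... = - (r\<^sup>2 / (norm z)\<^sup>2)" by (simp add: power2_eq_square)
   finally have "r\<^sup>2 <= 0" using False by (simp add: field_simps)
   then show ?thesis by (simp add: r_def)
  qed simp
 qed
 with lE show ?thesis by (rule that)
qed

section \<open>Closed subspaces and orthogonal projections\<close>

lemma closed_csubspaceD:
 assumes "closed_csubspace H"
 shows "closed H" "0 \<in> H" "x \<in> H ==> y \<in> H ==> x + y \<in> H" "x \<in> H ==> c *\<^sub>C x \<in> H"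
  "x \<in> H ==> - x \<in> H" "x \<in> H ==> y \<in> H ==> x - y \<in> H" "x \<in> H ==> r *\<^sub>R x \<in> H"
proof -
 show a: "closed H" "0 \<in> H" "!!x y. x \<in> H ==> y \<in> H ==> x + y \<in> H" "!!c x. x \<in> H ==> c *\<^sub>C x \<in> H"
  using assms by (auto simp: closed_csubspace_def)
 show m: "x \<in> H ==> - x \<in> H" for x using a(4)[of x "-1"] by simp
 show "x \<in> H ==> y \<in> H ==> x - y \<in> H" for x y using a(3)[OF _ m] by simp
 show "x \<in> H ==> r *\<^sub>R x \<in> H" for x r using a(4)[of x "of_real r"] by (simp add: scaleC_of_real)
qed

lemma closed_csubspace_sum:
 "closed_csubspace H ==> (!!i. i \<in> I ==> f i \<in> H) ==> (\<Sum>i\<in>I. f i) \<in> H"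
 by (induction I rule: infinite_finite_induct) (simp_all add: closed_csubspaceD)

lemma closed_csubspace_UNIV: "closed_csubspace UNIV"
 by (simp add: closed_csubspace_def)

lemma closed_csubspace_closure:
 assumes "0 \<in> S" "!!x y. x \<in> S ==> y \<in> S ==> x + y \<in> S" "!!c x. x \<in> S ==> c *\<^sub>C x \<in> S"
 shows "closed_csubspace (closure (S::'h::complex_hilbert_space set))"
 unfolding closed_csubspace_def
proof (intro conjI ballI allI)
 show "closed (closure S)" "0 \<in> closure S" using assms(1) closure_subset by auto
 fix x assume x: "x \<in> closure S"
 then obtain f where f: "!!n. f n \<in> S" "f \<longlonglongrightarrow> x" unfolding closure_sequential by auto
 show "c *\<^sub>C x \<in> closure S" for c
  unfolding closure_sequential
  by (rule exI[of _ "\<lambda>n. c *\<^sub>C f n"]) (simp add: f(1) assms(3) tendsto_scaleC[OF f(2)])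
 fix y assume "y \<in> closure S"
 then obtain g where g: "!!n. g n \<in> S" "g \<longlonglongrightarrow> y" unfolding closure_sequential by auto
 show "x + y \<in> closure S"
  unfolding closure_sequential
  by (rule exI[of _ "\<lambda>n. f n + g n"]) (simp add: f(1) g(1) assms(2) tendsto_add[OF f(2) g(2)])
qed

lemma complex_projection:
 fixes E :: "'h::complex_hilbert_space set"
 assumes E: "closed_csubspace E"
 obtains y where "y \<in> E" "!!z. z \<in> E ==> cinner (x - y) z = 0"
proof -
 have "subspace E" by (simp add: subspace_def closed_csubspaceD[OF E])
 then obtain y where y: "y \<in> E" "!!z. z \<in> E ==> Re (cinner (x - y) z) = 0"
  by (rule real_projection[OF closed_csubspaceD(1)[OF E]]) (rule that)
 have "cinner (x - y) z = 0" if "z \<in> E" for z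
  using y(2)[OF that] y(2)[OF closed_csubspaceD(4)[OF E that, of \<i>]]
  by (simp add: cinner_scaleC_right complex_eq_iff)
 with y(1) show ?thesis by (rule that)
qed

lemma orth_proj_eqI:
 assumes E: "closed_csubspace E" and y: "y \<in> E" "!!z. z \<in> E ==> cinner (x - y) z = 0"
 shows "orth_proj E x = y"
 unfolding orth_proj_def
proof (rule the_equality)
 fix y' assume y': "y' \<in> E \<and> (\<forall>z\<in>E. cinner (x - y') z = 0)"
 have d: "y - y' \<in> E" using y y' closed_csubspaceD(6)[OF E] by simp
 have "cinner (y - y') (y - y') = cinner (x - y') (y - y') - cinner (x - y) (y - y')"
  by (simp add: cinner_diff_left)
 then show "y' = y" using y(2)[OF d] y' d by simp
qed (use y in blast)

lemma orth_proj:
 assumes E: "closed_csubspace E"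
 shows "orth_proj E x \<in> E" "z \<in> E ==> cinner (x - orth_proj E x) z = 0"
proof -
 obtain y where "y \<in> E" "!!z. z \<in> E ==> cinner (x - y) z = 0"
  by (rule complex_projection[OF E]) (rule that)
 moreover from this have "orth_proj E x = y" by (rule orth_proj_eqI[OF E])
 ultimately show "orth_proj E x \<in> E" "z \<in> E ==> cinner (x - orth_proj E x) z = 0" by auto
qed

lemma orth_proj_ident: "closed_csubspace E ==> x \<in> E ==> orth_proj E x = x"
 by (rule orth_proj_eqI) auto

lemma orth_proj_zero:
 assumes E: "closed_csubspace E" and "!!z. z \<in> E ==> cinner x z = 0"
 shows "orth_proj E x = 0"
 by (rule orth_proj_eqI[OF E]) (use assms(2) closed_csubspaceD(2)[OF E] in auto)

lemma orth_proj_add: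
 assumes E: "closed_csubspace E"
 shows "orth_proj E (x + y) = orth_proj E x + orth_proj E y"
proof (rule orth_proj_eqI[OF E])
 show "cinner (x + y - (orth_proj E x + orth_proj E y)) z = 0" if "z \<in> E" for z
  using orth_proj(2)[OF E that, of x] orth_proj(2)[OF E that, of y] by (simp add: cinner_simps)
qed (intro closed_csubspaceD[OF E] orth_proj[OF E])

lemma orth_proj_scaleC:
 assumes E: "closed_csubspace E"
 shows "orth_proj E (c *\<^sub>C x) = c *\<^sub>C orth_proj E x"
proof (rule orth_proj_eqI[OF E])
 show "cinner (c *\<^sub>C x - c *\<^sub>C orth_proj E x) z = 0" if "z \<in> E" for z
  using orth_proj(2)[OF E that, of x] by (simp add: cinner_simps)
qed (intro closed_csubspaceD[OF E] orth_proj[OF E])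

lemma norm_orth_proj:
 assumes E: "closed_csubspace E"
 shows "norm (orth_proj E x) <= norm x"
proof -
 have "(norm x)\<^sup>2 = (norm (x - orth_proj E x))\<^sup>2 + (norm (orth_proj E x))\<^sup>2"
  using norm_add_square[of "x - orth_proj E x" "orth_proj E x"] orth_proj[OF E, where x = x] by simp
 then have "(norm (orth_proj E x))\<^sup>2 <= (norm x)\<^sup>2" by simp
 then show ?thesis by (rule power2_le_imp_le) simp
qed

lemma orth_proj_symmetric:
 assumes E: "closed_csubspace E"
 shows "cinner (orth_proj E x) y = cinner x (orth_proj E y)"
proof -
 have "cinner (x - orth_proj E x) (orth_proj E y) = 0" by (intro orth_proj E)
 moreover have "cinner (orth_proj E x) (y - orth_proj E y) = 0"
  by (subst cinner_commute) (simp add: orth_proj E)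
 ultimately show ?thesis by (simp add: cinner_simps)
qed

lemma closed_csubspace_eqI:
 assumes H: "closed_csubspace H" and E: "closed_csubspace E" "E \<subseteq> H"
  and orth: "!!z. z \<in> H ==> (!!e. e \<in> E ==> cinner z e = 0) ==> z = 0"
 shows "E = H"
proof (intro equalityI subsetI)
 fix x assume "x \<in> H"
 then have "x - orth_proj E x = 0"
  using orth_proj[OF E(1)] E(2) by (intro orth closed_csubspaceD[OF H]) auto
 then show "x \<in> E" using orth_proj(1)[OF E(1), of x] by simp
qed (use E in auto)

section \<open>Bounded operators, the Riesz representation theorem and adjoints\<close>

lemma bounded_opD:
 assumes T: "bounded_op H T"
 shows "x \<in> H ==> T x \<in> H" "x \<in> H ==> y \<in> H ==> T (x + y) = T x + T y"
  "x \<in> H ==> T (c *\<^sub>C x) = c *\<^sub>C T x"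
 using T by (auto simp: bounded_op_def)

lemma bounded_op_more:
 assumes T: "bounded_op H T" and H: "closed_csubspace H"
 shows "T 0 = 0" "x \<in> H ==> T (- x) = - T x" "x \<in> H ==> y \<in> H ==> T (x - y) = T x - T y"
  "x \<in> H ==> T (r *\<^sub>R x) = r *\<^sub>R T x" "(!!i. i \<in> I ==> f i \<in> H) ==> T (\<Sum>i\<in>I. f i) = (\<Sum>i\<in>I. T (f i))"
proof -
 note t = bounded_opD[OF T] and h = closed_csubspaceD[OF H]
 show z: "T 0 = 0" using t(3)[OF h(2), of 0] by simp
 show m: "x \<in> H ==> T (- x) = - T x" for x using t(3)[of x "-1"] by simp
 show "x \<in> H ==> y \<in> H ==> T (x - y) = T x - T y" using t(2)[of x "- y"] m h(5) by simp
 show "x \<in> H ==> T (r *\<^sub>R x) = r *\<^sub>R T x" using t(3)[of x "of_real r"] by (simp add: scaleC_of_real)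
 show "(!!i. i \<in> I ==> f i \<in> H) ==> T (\<Sum>i\<in>I. f i) = (\<Sum>i\<in>I. T (f i))"
  by (induction I rule: infinite_finite_induct) (simp_all add: z t(2) closed_csubspace_sum[OF H])
qed

lemma bounded_opE:
 assumes "bounded_op H T"
 obtains K where "K > 0" "!!x. x \<in> H ==> norm (T x) <= K * norm x"
proof -
 obtain K where K: "\<forall>x\<in>H. norm (T x) <= K * norm x" using assms by (auto simp: bounded_op_def)
 have "norm (T x) <= (\<bar>K\<bar> + 1) * norm x" if "x \<in> H" for x
  using bspec[OF K that] mult_right_mono[of K "\<bar>K\<bar> + 1" "norm x"] by (auto intro: order_trans)
 then show ?thesis using that[of "\<bar>K\<bar> + 1"] by simp
qed

lemma bounded_opI:
 assumes "!!x. x \<in> H ==> T x \<in> H" "!!x y. x \<in> H ==> y \<in> H ==> T (x + y) = T x + T y"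
  "!!c x. x \<in> H ==> T (c *\<^sub>C x) = c *\<^sub>C T x" "!!x. x \<in> H ==> norm (T x) <= K * norm x"
 shows "bounded_op H T"
 unfolding bounded_op_def using assms(1-3) assms(4) by (intro conjI exI[of _ K]) auto

lemma bounded_op_compose:
 assumes S: "bounded_op H S" and T: "bounded_op H T"
 shows "bounded_op H (\<lambda>x. S (T x))"
proof -
 obtain K where K: "K > 0" "!!x. x \<in> H ==> norm (S x) <= K * norm x" by (rule bounded_opE[OF S]) (rule that)
 obtain L where L: "L > 0" "!!x. x \<in> H ==> norm (T x) <= L * norm x" by (rule bounded_opE[OF T]) (rule that)
 show ?thesis
 proof (rule bounded_opI)
  fix x assume x: "x \<in> H"
  have "norm (S (T x)) <= K * norm (T x)" by (intro K bounded_opD[OF T] x)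
  also have "... <= K * (L * norm x)" using K(1) by (intro mult_left_mono L x) simp
  finally show "norm (S (T x)) <= (K * L) * norm x" by simp
 qed (simp_all add: bounded_opD[OF S] bounded_opD[OF T])
qed

lemma bounded_op_tendsto:
 assumes T: "bounded_op H T" and H: "closed_csubspace H" and f: "!!n. f n \<in> H" "f \<longlonglongrightarrow> x"
 shows "(\<lambda>n. T (f n)) \<longlonglongrightarrow> T x"
proof -
 obtain K where K: "K > 0" "!!x. x \<in> H ==> norm (T x) <= K * norm x" by (rule bounded_opE[OF T]) (rule that)
 have x: "x \<in> H" using closed_sequentially[OF closed_csubspaceD(1)[OF H]] f by auto
 have "norm (T (f n) - T x) <= K * norm (f n - x)" for n
  using K(2)[OF closed_csubspaceD(6)[OF H f(1)[of n] x]] by (simp add: bounded_op_more[OF T H] f x)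
 moreover have "(\<lambda>n. K * norm (f n - x)) \<longlonglongrightarrow> 0"
  using tendsto_mult_right_zero[OF tendsto_norm_zero[OF LIM_zero[OF f(2)]]] .
 ultimately have "(\<lambda>n. T (f n) - T x) \<longlonglongrightarrow> 0"
  by (intro Lim_null_comparison[of "\<lambda>n. T (f n) - T x", OF always_eventually]) auto
 then show ?thesis by (rule LIM_zero_cancel)
qed

text \<open>A multiple of the component \<open>z\<close> of \<open>x0\<close> orthogonal to the
  kernel of \<open>f\<close> represents \<open>f\<close>, because \<open>x - (f x / f z) z\<close>
  lies in the kernel.\<close>

lemma riesz_representation:
 assumes H: "closed_csubspace H" and f: "!!x y. x \<in> H ==> y \<in> H ==> f (x + y) = f x + f y"
  "!!c x. x \<in> H ==> f (c *\<^sub>C x) = c * f x" "!!x. x \<in> H ==> cmod (f x) <= K * norm (x::'h::complex_hilbert_space)"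
 obtains y where "y \<in> H" "!!x. x \<in> H ==> f x = cinner x y"
proof (cases "\<forall>x\<in>H. f x = 0")
 case True then show ?thesis using that[of 0] closed_csubspaceD(2)[OF H] by simp
next
 case False
 then obtain x0 where x0: "x0 \<in> H" "f x0 ~= 0" by auto
 note h = closed_csubspaceD[OF H]
 have fd: "f (x - y) = f x - f y" if "x \<in> H" "y \<in> H" for x y
  using f(1)[OF that(1) h(4)[OF that(2), of "-1"]] f(2)[OF that(2), of "-1"] by simp
 define E where "E = {x \<in> H. f x = 0}"
 have E: "closed_csubspace E"
  unfolding closed_csubspace_def
 proof (intro conjI ballI allI)
  show "closed E"
  proof (rule closed_sequential_limits[THEN iffD2], intro allI impI, elim conjE)
   fix u l assume u: "\<forall>n. u n \<in> E" "u \<longlonglongrightarrow> l"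
   have uH: "u n \<in> H" for n using u by (auto simp: E_def)
   have l: "l \<in> H" using closed_sequentially[OF h(1)] uH u(2) by auto
   have "cmod (f l) <= K * norm (u n - l)" for n
    using f(3)[OF h(6)[OF uH[of n] l]] fd[OF uH[of n] l] u(1) by (simp add: E_def)
   moreover have "(\<lambda>n. K * norm (u n - l)) \<longlonglongrightarrow> 0"
    using tendsto_mult_right_zero[OF tendsto_norm_zero[OF LIM_zero[OF u(2)]]] .
   ultimately have "cmod (f l) <= 0" using LIMSEQ_le_const by blast
   then show "l \<in> E" using l by (simp add: E_def)
  qed
 qed (use h f f(2)[of 0 0] in \<open>auto simp: E_def\<close>)
 define z where "z = x0 - orth_proj E x0"
 have pE: "orth_proj E x0 \<in> E" by (rule orth_proj(1)[OF E])
 have zH: "z \<in> H" and fz: "f z = f x0" using pE x0 by (auto simp: z_def E_def h fd)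
 have z0: "z ~= 0" using fz x0 f(2)[OF h(2), of 0] by auto
 show ?thesis
 proof (rule that)
  show "(cnj (f z) / of_real ((norm z)\<^sup>2)) *\<^sub>C z \<in> H" by (rule h(4)[OF zH])
  fix x assume x: "x \<in> H"
  have "x - (f x / f z) *\<^sub>C z \<in> E"
   using x zH fz x0 by (simp add: E_def h fd f(2))
  then have "cinner z (x - (f x / f z) *\<^sub>C z) = 0"
   unfolding z_def using orth_proj(2)[OF E] by simp
  then have "cinner (x - (f x / f z) *\<^sub>C z) z = 0"
   by (subst cinner_commute) simp
  then have "cinner x z = (f x / f z) * of_real ((norm z)\<^sup>2)"
   by (simp add: cinner_simps cinner_self)
  then show "f x = cinner x ((cnj (f z) / of_real ((norm z)\<^sup>2)) *\<^sub>C z)"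
   using z0 fz x0 by (simp add: cinner_scaleC_right)
 qed
qed

lemma adjoint_exists:
 assumes H: "closed_csubspace H" and T: "bounded_op H (T::'h::complex_hilbert_space => 'h)"
 obtains S where "bounded_op H S" "!!x y. x \<in> H ==> y \<in> H ==> cinner (T x) y = cinner x (S y)"
proof -
 note h = closed_csubspaceD[OF H] and t = bounded_opD[OF T]
 obtain K where K: "K > 0" "!!x. x \<in> H ==> norm (T x) <= K * norm x" by (rule bounded_opE[OF T]) (rule that)
 have "\<exists>z. z \<in> H \<and> (\<forall>x\<in>H. cinner (T x) y = cinner x z)" if y: "y \<in> H" for y
 proof -
  have bound: "cmod (cinner (T x) y) <= (K * norm y) * norm x" if "x \<in> H" for x
  proof -
   have "cmod (cinner (T x) y) <= norm (T x) * norm y" by (rule cinner_cauchy_schwarz)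
   also have "... <= (K * norm x) * norm y" by (intro mult_right_mono K that) simp
   finally show ?thesis by (simp add: mult_ac)
  qed
  show ?thesis
  proof (rule riesz_representation[of H "\<lambda>x. cinner (T x) y", OF H _ _ bound])
   fix z assume "z \<in> H" "!!x. x \<in> H ==> cinner (T x) y = cinner x z"
   then show ?thesis by (intro exI[of _ z] conjI ballI)
  qed (simp_all add: t cinner_add_left cinner_scaleC_left)
 qed
 then obtain S where S: "!!y. y \<in> H ==> S y \<in> H" "!!x y. x \<in> H ==> y \<in> H ==> cinner (T x) y = cinner x (S y)"
  by metis
 have uniq: "u = v" if uv: "u \<in> H" "v \<in> H" "!!x. x \<in> H ==> cinner x u = cinner x v" for u v
 proof -
  have "cinner (u - v) (u - v) = 0" using uv(3)[OF h(6)[OF uv(1,2)]] by (simp add: cinner_diff_right)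
  then show ?thesis by simp
 qed
 show ?thesis
 proof (rule that)
  show "bounded_op H S"
  proof (rule bounded_opI)
   show "S (x + y) = S x + S y" if "x \<in> H" "y \<in> H" for x y
    using that by (intro uniq) (simp_all add: S(1) h cinner_add_right S(2)[symmetric])
   show "S (c *\<^sub>C x) = c *\<^sub>C S x" if "x \<in> H" for c x
    using that by (intro uniq) (simp_all add: S(1) h cinner_scaleC_right S(2)[symmetric])
   fix y assume y: "y \<in> H"
   have "(norm (S y))\<^sup>2 = Re (cinner (T (S y)) y)" using S y by (simp add: cinner_self)
   also have "... <= norm (T (S y)) * norm y"
    using complex_Re_le_cmod cinner_cauchy_schwarz order_trans by blast
   also have "... <= (K * norm (S y)) * norm y" by (intro mult_right_mono K S y) simp
   finally have "norm (S y) * norm (S y) <= norm (S y) * (K * norm y)"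
    by (simp add: power2_eq_square mult_ac)
   then show "norm (S y) <= K * norm y" by (rule square_le_imp_le) (use K(1) in auto)
  qed (rule S(1))
 qed (rule S(2))
qed

subsection \<open>Central supports and cyclic vectors for the commutant\<close>

text \<open>Pairs of vectors carry the twofold amplification of a representation; used twice, they
  carry the fourfold one.\<close>

instantiation prod :: (complex_hilbert_space, complex_hilbert_space) complex_hilbert_space
begin

definition "c *\<^sub>C x = (c *\<^sub>C fst x, c *\<^sub>C snd x)"
definition "cinner x y = cinner (fst x) (fst y) + cinner (snd x) (snd y)"

instance
proof
 fix x y z :: "'a \<times> 'b" and c d :: complex and r :: real
 show "c *\<^sub>C (x + y) = c *\<^sub>C x + c *\<^sub>C y" "(c + d) *\<^sub>C x = c *\<^sub>C x + d *\<^sub>C x"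
  "c *\<^sub>C d *\<^sub>C x = (c * d) *\<^sub>C x" "complex_of_real r *\<^sub>C x = r *\<^sub>R x"
  by (simp_all add: scaleC_prod_def scaleC_add_right scaleC_add_left scaleC_scaleC scaleC_of_real
    prod_eq_iff)
 show "norm (c *\<^sub>C x) = cmod c * norm x"
  by (simp add: scaleC_prod_def norm_prod_def norm_scaleC power_mult_distrib distrib_left[symmetric]
    real_sqrt_mult)
 show "cinner (x + y) z = cinner x z + cinner y z" "cinner (c *\<^sub>C x) y = c * cinner x y"
  by (simp_all add: cinner_prod_def scaleC_prod_def cinner_simps algebra_simps)
 show "cinner y x = cnj (cinner x y)"
  by (simp add: cinner_prod_def cinner_commute[symmetric])
 show "cinner x x = complex_of_real ((norm x)\<^sup>2)"
  by (simp add: cinner_prod_def cinner_self norm_prod_def)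
qed

end

section \<open>Representations and their commutants\<close>

definition star_representation ::
 "'h::complex_hilbert_space set => ('a::unital_cstar_algebra => 'h => 'h) => bool" where
 "star_representation H \<pi> \<longleftrightarrow> closed_csubspace H \<and> (\<forall>a. bounded_op H (\<pi> a)) \<and>
  (\<forall>x\<in>H. \<forall>a b. \<pi> (a + b) x = \<pi> a x + \<pi> b x) \<and>
  (\<forall>x\<in>H. \<forall>c a. \<pi> (c *\<^sub>C a) x = c *\<^sub>C \<pi> a x) \<and>
  (\<forall>x\<in>H. \<forall>a b. \<pi> (a * b) x = \<pi> a (\<pi> b x)) \<and> (\<forall>x\<in>H. \<pi> 1 x = x) \<and>
  (\<forall>x\<in>H. \<forall>y\<in>H. \<forall>a. cinner (\<pi> a x) y = cinner x (\<pi> (star a) y))"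

lemma star_representationD:
 assumes "star_representation H \<pi>"
 shows "closed_csubspace H" "bounded_op H (\<pi> a)" "x \<in> H ==> \<pi> (a + b) x = \<pi> a x + \<pi> b x"
  "x \<in> H ==> \<pi> (c *\<^sub>C a) x = c *\<^sub>C \<pi> a x" "x \<in> H ==> \<pi> (a * b) x = \<pi> a (\<pi> b x)" "x \<in> H ==> \<pi> 1 x = x"
  "x \<in> H ==> y \<in> H ==> cinner (\<pi> a x) y = cinner x (\<pi> (star a) y)" "x \<in> H ==> \<pi> a x \<in> H"
  "x \<in> H ==> \<pi> (- a) x = - \<pi> a x" "x \<in> H ==> \<pi> (a - b) x = \<pi> a x - \<pi> b x" "x \<in> H ==> \<pi> 0 x = 0"
proof -
 have *: "\<forall>x\<in>H. \<forall>a b. \<pi> (a + b) x = \<pi> a x + \<pi> b x" "\<forall>x\<in>H. \<forall>c a. \<pi> (c *\<^sub>C a) x = c *\<^sub>C \<pi> a x"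
  using assms by (auto simp: star_representation_def)
 show b: "closed_csubspace H" "!!a. bounded_op H (\<pi> a)" "x \<in> H ==> \<pi> (a * b) x = \<pi> a (\<pi> b x)" "x \<in> H ==> \<pi> 1 x = x"
  "x \<in> H ==> y \<in> H ==> cinner (\<pi> a x) y = cinner x (\<pi> (star a) y)"
  using assms by (auto simp: star_representation_def)
 show "x \<in> H ==> \<pi> a x \<in> H" by (rule bounded_opD(1)[OF b(2)])
 show add: "x \<in> H ==> \<pi> (a + b) x = \<pi> a x + \<pi> b x" for a b using *(1) by simp
 show scale: "x \<in> H ==> \<pi> (c *\<^sub>C a) x = c *\<^sub>C \<pi> a x" for a c using *(2) by simp
 show m: "x \<in> H ==> \<pi> (- a) x = - \<pi> a x" for a using scale[of "-1" a] by simp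
 show "x \<in> H ==> \<pi> (a - b) x = \<pi> a x - \<pi> b x" using add[of a "- b"] m by simp
 show "x \<in> H ==> \<pi> 0 x = 0" using scale[of 0 0] by simp
qed

lemma vector_functional_positive:
 assumes r: "star_representation H \<pi>" and x: "x \<in> H"
 shows "positive_functional (\<lambda>a. cinner (\<pi> a x) x)"
 unfolding positive_functional_def
proof (intro conjI allI)
 note r = star_representationD[OF r]
 show "functional_linear (\<lambda>a. cinner (\<pi> a x) x)"
  using x by (simp add: functional_linear_def r(3,4) cinner_simps)
 have "cinner (\<pi> (star a * a) x) x = cinner (\<pi> a x) (\<pi> a x)" for a
  using x by (simp add: r star_star)
 then show "cinner (\<pi> (star a * a) x) x \<in> \<real>" "0 <= Re (cinner (\<pi> (star a * a) x) x)" for a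
  by (simp_all add: cinner_self)
qed

text \<open>The vector functional of \<open>x\<close> is positive, which bounds its value at
  \<open>star a * a\<close>; contractivity is therefore automatic.\<close>

lemma star_representation_contractive:
 assumes r: "star_representation H \<pi>" and x: "x \<in> H"
 shows "norm (\<pi> a x) <= norm a * norm x"
proof -
 note rep = star_representationD[OF r]
 have "(norm (\<pi> a x))\<^sup>2 = Re (cinner (\<pi> (star a * a) x) x)"
  using x by (simp add: rep star_star cinner_self)
 also have "... <= Re (cinner (\<pi> 1 x) x) * (norm a)\<^sup>2"
  by (rule positive_functional_norm_square[OF vector_functional_positive[OF r x]])
 also have "... = (norm a * norm x)\<^sup>2" using x by (simp add: rep cinner_self power_mult_distrib)
 finally show ?thesis by (rule power2_le_imp_le) simp
qed

lemma commutantD: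
 assumes "T \<in> commutant H S"
 shows "bounded_op H T" "s \<in> S ==> x \<in> H ==> T (s x) = s (T x)"
 using assms by (auto simp: commutant_def)

lemma commutant_adjoint:
 assumes r: "star_representation H \<pi>" and T: "T \<in> commutant H (range \<pi>)" and S: "bounded_op H S"
  and adj: "!!x y. x \<in> H ==> y \<in> H ==> cinner (T x) y = cinner x (S y)"
 shows "S \<in> commutant H (range \<pi>)"
proof -
 note rep = star_representationD[OF r]
 have "S (\<pi> a y) = \<pi> a (S y)" if y: "y \<in> H" for a y
 proof -
  let ?d = "S (\<pi> a y) - \<pi> a (S y)"
  have d: "?d \<in> H" using y by (intro closed_csubspaceD[OF rep(1)] rep bounded_opD[OF S])
  have "cinner ?d x = 0" if x: "x \<in> H" for x
  proof -
   have "cinner x (S (\<pi> a y)) = cinner (T x) (\<pi> a y)" using x y by (simp add: adj rep)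
   also have "... = cinner (\<pi> (star a) (T x)) y"
    using rep(7)[of "T x" y "star a"] x y bounded_opD(1)[OF commutantD(1)[OF T]] by (simp add: star_star)
   also have "... = cinner (T (\<pi> (star a) x)) y" using commutantD(2)[OF T _ x, of "\<pi> (star a)"] by simp
   also have "... = cinner x (\<pi> a (S y))"
    using x y bounded_opD(1)[OF S] by (simp add: adj rep star_star)
   finally have "cinner x ?d = 0" by (simp add: cinner_diff_right)
   then show ?thesis by (subst cinner_commute) simp
  qed
  from this[OF d] show ?thesis by simp
 qed
 then show ?thesis using S by (auto simp: commutant_def)
qed

lemma commutant_adjoint_exists:
 assumes r: "star_representation H \<pi>" and T: "T \<in> commutant H (range \<pi>)"
 obtains S where "S \<in> commutant H (range \<pi>)" "!!x y. x \<in> H ==> y \<in> H ==> cinner (T x) y = cinner x (S y)"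
 using adjoint_exists[OF star_representationD(1)[OF r] commutantD(1)[OF T]] commutant_adjoint[OF r T] by metis

text \<open>An invariant subspace of a selfadjoint family is reducing: the adjoint of
  \<open>\<pi> a\<close> is \<open>\<pi> (star a)\<close>, so the complement is invariant as
  well.\<close>

lemma orth_proj_commutant:
 assumes r: "star_representation H \<pi>" and E: "closed_csubspace E" "E \<subseteq> H"
  and inv: "!!a x. x \<in> E ==> \<pi> a x \<in> E"
 shows "orth_proj E \<in> commutant H (range \<pi>)"
proof -
 note rep = star_representationD[OF r]
 have "bounded_op H (orth_proj E)"
  by (rule bounded_opI[of _ _ 1])
   (use orth_proj(1)[OF E(1)] E(2) norm_orth_proj[OF E(1)] in \<open>auto simp: orth_proj_add[OF E(1)] orth_proj_scaleC[OF E(1)]\<close>)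
 moreover have "orth_proj E (\<pi> a x) = \<pi> a (orth_proj E x)" if x: "x \<in> H" for a x
 proof (rule orth_proj_eqI[OF E(1)])
  have p: "orth_proj E x \<in> E" by (rule orth_proj(1)[OF E(1)])
  show "\<pi> a (orth_proj E x) \<in> E" by (rule inv[OF p])
  fix z assume z: "z \<in> E"
  have d: "x - orth_proj E x \<in> H" using x p E(2) by (intro closed_csubspaceD[OF rep(1)]) auto
  have "cinner (\<pi> a x - \<pi> a (orth_proj E x)) z = cinner (\<pi> a (x - orth_proj E x)) z"
   using x p E(2) by (auto simp: bounded_op_more[OF rep(2) rep(1)])
  also have "... = cinner (x - orth_proj E x) (\<pi> (star a) z)" using d z E(2) by (intro rep(7)) auto
  also have "... = 0" by (rule orth_proj(2)[OF E(1) inv[OF z]])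
  finally show "cinner (\<pi> a x - \<pi> a (orth_proj E x)) z = 0" .
 qed
 ultimately show ?thesis by (auto simp: commutant_def)
qed

text \<open>The projection onto the cyclic subspace of \<open>x\<close> lies in the commutant, hence
  commutes with \<open>T\<close>, and it fixes \<open>x\<close>. Applied to amplifications this is
  von Neumann's density theorem for several vectors.\<close>

lemma bicommutant_vector_density:
 assumes r: "star_representation H \<pi>" and T: "T \<in> bicommutant H (range \<pi>)" and x: "x \<in> H"
 shows "T x \<in> closure (range (\<lambda>a. \<pi> a x))"
proof -
 note rep = star_representationD[OF r]
 define E where "E = closure (range (\<lambda>a. \<pi> a x))"
 have E: "closed_csubspace E"
  unfolding E_def
 proof (rule closed_csubspace_closure)
  show "0 \<in> range (\<lambda>a. \<pi> a x)" using rep(11)[OF x] by simp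
  show "y + z \<in> range (\<lambda>a. \<pi> a x)" if "y \<in> range (\<lambda>a. \<pi> a x)" "z \<in> range (\<lambda>a. \<pi> a x)" for y z
   using that rep(3)[OF x] by (auto simp flip: rep(3)[OF x])
  show "c *\<^sub>C y \<in> range (\<lambda>a. \<pi> a x)" if "y \<in> range (\<lambda>a. \<pi> a x)" for c y
   using that by (auto simp flip: rep(4)[OF x])
 qed
 have EH: "E \<subseteq> H"
  unfolding E_def by (rule closure_minimal) (use rep(8)[OF x] closed_csubspaceD(1)[OF rep(1)] in auto)
 have inv: "\<pi> a y \<in> E" if y: "y \<in> E" for a y
 proof -
  obtain f where f: "!!n. f n \<in> range (\<lambda>a. \<pi> a x)" "f \<longlonglongrightarrow> y"
   using y unfolding E_def closure_sequential by auto
  have fH: "f n \<in> H" for n using f(1)[of n] rep(8)[OF x] by auto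
  have "\<pi> a (f n) \<in> E" for n
  proof -
   obtain b where "f n = \<pi> b x" using f(1)[of n] by auto
   then have "\<pi> a (f n) = \<pi> (a * b) x" by (simp add: rep(5)[OF x])
   then show ?thesis unfolding E_def by (auto intro: subsetD[OF closure_subset])
  qed
  then show ?thesis
   by (rule closed_sequentially[OF closed_csubspaceD(1)[OF E] _ bounded_op_tendsto[OF rep(2) rep(1) fH f(2)]])
 qed
 have "x \<in> E" unfolding E_def using rep(6)[OF x] closure_subset by (metis rangeI subsetD)
 then have "T x = T (orth_proj E x)" by (simp add: orth_proj_ident[OF E])
 also have "... = orth_proj E (T x)"
  using T orth_proj_commutant[OF r E EH inv] x unfolding bicommutant_def by (blast dest: commutantD(2))
 finally show ?thesis using orth_proj(1)[OF E, of "T x"] by (simp add: E_def)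
qed

section \<open>Amplification\<close>

definition amplify :: "('h => 'h) => 'h \<times> 'h => 'h \<times> 'h" where
 "amplify T = (\<lambda>(x, y). (T x, T y))"

lemma amplify_apply [simp]: "amplify T (x, y) = (T x, T y)"
 by (simp add: amplify_def)

lemma closed_csubspace_times:
 assumes "closed_csubspace H"
 shows "closed_csubspace (H \<times> H)"
 unfolding closed_csubspace_def
 using closed_csubspaceD[OF assms] by (auto simp: closed_Times zero_prod_def scaleC_prod_def)

lemma bounded_op_amplify:
 assumes T: "bounded_op H T"
 shows "bounded_op (H \<times> H) (amplify T)"
proof -
 obtain K where K: "K > 0" "!!x. x \<in> H ==> norm (T x) <= K * norm x" by (rule bounded_opE[OF T]) (rule that)
 show ?thesis
 proof (rule bounded_opI)
  fix x assume "x \<in> H \<times> H"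
  then obtain a b where x: "x = (a, b)" "a \<in> H" "b \<in> H" by auto
  have "(norm (T a))\<^sup>2 + (norm (T b))\<^sup>2 <= (K * norm a)\<^sup>2 + (K * norm b)\<^sup>2"
   using x by (intro add_mono power_mono K) auto
  also have "... = K\<^sup>2 * ((norm a)\<^sup>2 + (norm b)\<^sup>2)" by (simp add: algebra_simps)
  finally show "norm (amplify T x) <= K * norm x"
   using K(1) real_sqrt_le_mono by (fastforce simp: x norm_Pair real_sqrt_mult)
 qed (auto simp: scaleC_prod_def bounded_opD[OF T])
qed

lemma star_representation_amplify:
 assumes r: "star_representation H \<pi>"
 shows "star_representation (H \<times> H) (\<lambda>a. amplify (\<pi> a))"
 unfolding star_representation_def
 using star_representationD[OF r]
 by (auto simp: closed_csubspace_times bounded_op_amplify scaleC_prod_def cinner_prod_def)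

text \<open>An operator commuting with the amplified representation is a 2 by 2 matrix with entries
  in the commutant, and \<open>T\<close> commutes with each entry.\<close>

lemma bicommutant_amplify:
 assumes r: "star_representation H \<pi>" and T: "T \<in> bicommutant H (range \<pi>)"
 shows "amplify T \<in> bicommutant (H \<times> H) (range (\<lambda>a. amplify (\<pi> a)))"
proof -
 note rep = star_representationD[OF r]
 note h = closed_csubspaceD[OF rep(1)]
 have Tb: "bounded_op H T" using T by (auto simp: bicommutant_def dest: commutantD(1))
 have "amplify T (S p) = S (amplify T p)"
  if S: "S \<in> commutant (H \<times> H) (range (\<lambda>a. amplify (\<pi> a)))" and p: "p \<in> H \<times> H" for S p
 proof -
  note Sb = bounded_opD[OF commutantD(1)[OF S]]
  have comm: "S (\<pi> a u, \<pi> a v) = amplify (\<pi> a) (S (u, v))" if "u \<in> H" "v \<in> H" for a u v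
   using commutantD(2)[OF S, of "amplify (\<pi> a)" "(u, v)"] that by auto
  obtain K where K: "K > 0" "!!x. x \<in> H \<times> H ==> norm (S x) <= K * norm x"
   by (rule bounded_opE[OF commutantD(1)[OF S]]) (rule that)
  have S1: "S (u + v, 0) = S (u, 0) + S (v, 0)" "S (0, u + v) = S (0, u) + S (0, v)"
   "S (c *\<^sub>C u, 0) = c *\<^sub>C S (u, 0)" "S (0, c *\<^sub>C u) = c *\<^sub>C S (0, u)"
   if "u \<in> H" "v \<in> H" for u v c
   using Sb(2)[of "(u, 0)" "(v, 0)"] Sb(2)[of "(0, u)" "(0, v)"] Sb(3)[of "(u, 0)" c] Sb(3)[of "(0, u)" c] that h(2)
   by (simp_all add: scaleC_prod_def)
  have mem: "fst (S (u, v)) \<in> H" "snd (S (u, v)) \<in> H" if "u \<in> H" "v \<in> H" for u v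
   using Sb(1)[of "(u, v)"] that by auto
  have bound: "norm (fst (S (u, 0))) <= K * norm u" "norm (snd (S (u, 0))) <= K * norm u"
   "norm (fst (S (0, u))) <= K * norm u" "norm (snd (S (0, u))) <= K * norm u" if "u \<in> H" for u
   using K(2)[of "(u, 0)"] K(2)[of "(0, u)"] that h(2) norm_fst_le[of "fst (S (u, 0))" "snd (S (u, 0))"] norm_snd_le[of "snd (S (u, 0))" "fst (S (u, 0))"] norm_fst_le[of "fst (S (0, u))" "snd (S (0, u))"] norm_snd_le[of "snd (S (0, u))" "fst (S (0, u))"]
   by auto
  have entries: "(\<lambda>u. fst (S (u, 0))) \<in> commutant H (range \<pi>)" "(\<lambda>u. snd (S (u, 0))) \<in> commutant H (range \<pi>)"
   "(\<lambda>u. fst (S (0, u))) \<in> commutant H (range \<pi>)" "(\<lambda>u. snd (S (0, u))) \<in> commutant H (range \<pi>)"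
   unfolding commutant_def mem_Collect_eq
  proof (safe intro!: bounded_opI)
   fix a u assume u: "u \<in> H"
   have z: "\<pi> a 0 = 0" by (rule bounded_op_more(1)[OF rep(2) rep(1)])
   show "fst (S (\<pi> a u, 0)) = \<pi> a (fst (S (u, 0)))" "snd (S (\<pi> a u, 0)) = \<pi> a (snd (S (u, 0)))"
    using comm[OF u h(2), of a] unfolding z by (simp_all add: amplify_def split_beta)
   show "fst (S (0, \<pi> a u)) = \<pi> a (fst (S (0, u)))" "snd (S (0, \<pi> a u)) = \<pi> a (snd (S (0, u)))"
    using comm[OF h(2) u, of a] unfolding z by (simp_all add: amplify_def split_beta)
  qed (use mem h(2) bound in \<open>auto simp: S1 scaleC_prod_def\<close>)
  have Tc: "T (X u) = X (T u)" if "X \<in> commutant H (range \<pi>)" "u \<in> H" for X u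
   using T that unfolding bicommutant_def by (blast dest: commutantD(2))
  obtain u v where uv: "p = (u, v)" "u \<in> H" "v \<in> H" using p by auto
  have split: "S (u, v) = S (u, 0) + S (0, v)" if "u \<in> H" "v \<in> H" for u v
   using Sb(2)[of "(u, 0)" "(0, v)"] that h(2) by simp
  have "amplify T (S (u, v)) = (T (fst (S (u, 0))) + T (fst (S (0, v))), T (snd (S (u, 0))) + T (snd (S (0, v))))"
   unfolding split[OF uv(2,3)] using uv mem h(2) by (simp add: amplify_def split_beta bounded_opD[OF Tb])
  also have "... = S (T u, 0) + S (0, T v)"
   using Tc[OF entries(1) uv(2)] Tc[OF entries(2) uv(2)] Tc[OF entries(3) uv(3)] Tc[OF entries(4) uv(3)]
   by (simp add: prod_eq_iff)
  also have "... = S (T u, T v)" using uv by (intro split[symmetric] bounded_opD[OF Tb])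
  finally show ?thesis by (simp add: uv)
 qed
 then show ?thesis
  using bounded_op_amplify[OF Tb] by (auto simp: bicommutant_def commutant_def)
qed

text \<open>Neumann series: \<open>1 + a * a = (1 + t)(1 - w)\<close> with
  \<open>norm w <= t / (1 + t)\<close>, so the inverse of \<open>1 - w\<close> has norm at most
  \<open>1 + t\<close>, and the factor \<open>1 / (1 + t)\<close> brings the inverse of
  \<open>1 + a * a\<close> down to norm one.\<close>

lemma one_plus_square_inverse:
 assumes a: "selfadjoint a"
 obtains g where "g * (1 + a * a) = 1" "selfadjoint g" "norm g <= 1" "g * a = a * g"
proof -
 have aa: "selfadjoint (a * a)" using a by (simp add: selfadjoint_def star_mult)
 define t where "t = norm (a * a) + 1"
 have t: "t > 0" by (simp add: t_def add_nonneg_pos)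
 have nt: "norm (of_real t - a * a) <= t"
  by (rule cpos_bound_norm[OF cpos_square[OF a] _ t]) (simp add: t_def)
 define w where "w = (1 / (1 + t)) *\<^sub>R (of_real t - a * a)"
 have nw: "norm w <= t / (1 + t)" using nt t by (simp add: w_def divide_right_mono)
 also have "... < 1" using t by simp
 finally have nw1: "norm w < 1" .
 have sw: "selfadjoint w" unfolding w_def by (intro selfadjoint_scaleR selfadjoint_diff aa) simp
 have summ: "summable (\<lambda>n. norm (w ^ n))"
  by (rule summable_comparison_test'[of "\<lambda>n. norm w ^ n" 0]) (use nw1 norm_power_ineq in \<open>auto simp:\<close>)
 note summ' = summable_norm_cancel[OF summ]
 define N where "N = (\<Sum>n. w ^ n)"
 have "(\<Sum>n. w ^ Suc n) = N * w"
  unfolding N_def suminf_mult2[OF summ'] by (simp add: power_commutes)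
 then have Nw: "N - N * w = 1" using suminf_split_head[OF summ'] by (simp add: N_def)
 have "a * w = w * a" by (simp add: w_def algebra_simps of_real_def)
 then have "w ^ n * a = a * w ^ n" for n by (intro power_commuting_commutes) simp
 then have Na: "N * a = a * N"
  unfolding N_def suminf_mult[OF summ', symmetric] suminf_mult2[OF summ'] by simp
 have sN: "selfadjoint N"
  using bounded_linear.suminf[OF bounded_linear_star summ'] sw by (simp add: selfadjoint_def N_def star_power)
 have "norm N <= (\<Sum>n. norm (w ^ n))" unfolding N_def by (rule summable_norm[OF summ])
 also have "... <= (\<Sum>n. norm w ^ n)"
  by (rule suminf_le[OF _ summ]) (use nw1 norm_power_ineq in \<open>auto simp:\<close>)
 also have "... = 1 / (1 - norm w)" using nw1 by (simp add: suminf_geometric)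
 also have "... <= 1 / (1 - t / (1 + t))" using nw t nw1 by (intro divide_left_mono) auto
 also have "... = 1 + t" using t by (simp add: field_simps)
 finally have nN: "norm N <= 1 + t" .
 show ?thesis
 proof (rule that)
  have w: "(1 + t) *\<^sub>R w = of_real t - a * a" using t by (simp add: w_def)
  have "1 + a * a = (1 + t) *\<^sub>R (1 - w)" unfolding scaleR_diff_right w by (simp add: of_real_def scaleR_add_left)
  then have "((1 / (1 + t)) *\<^sub>R N) * (1 + a * a) = N - N * w" using t by (simp add: right_diff_distrib scaleR_diff_right)
  then show "((1 / (1 + t)) *\<^sub>R N) * (1 + a * a) = 1" using Nw by simp
  show "selfadjoint ((1 / (1 + t)) *\<^sub>R N)" by (rule selfadjoint_scaleR[OF sN])
  show "norm ((1 / (1 + t)) *\<^sub>R N) <= 1" using nN t by simp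
  show "(1 / (1 + t)) *\<^sub>R N * a = a * (1 / (1 + t)) *\<^sub>R N" by (simp add: Na)
 qed
qed

lemma subspace_closure:
 fixes S :: "'v::real_normed_vector set"
 assumes S: "subspace S"
 shows "subspace (closure S)"
 unfolding subspace_def
proof (intro conjI ballI allI)
 show "0 \<in> closure S" using subspace_0[OF S] by (rule subsetD[OF closure_subset])
 fix x assume "x \<in> closure S"
 then obtain f where f: "!!n. f n \<in> S" "f \<longlonglongrightarrow> x" unfolding closure_sequential by auto
 show "c *\<^sub>R x \<in> closure S" for c
  unfolding closure_sequential
  by (rule exI[of _ "\<lambda>n. c *\<^sub>R f n"]) (simp add: f(1) subspace_scale[OF S] tendsto_scaleR[OF tendsto_const f(2)])
 fix y assume "y \<in> closure S"
 then obtain g where g: "!!n. g n \<in> S" "g \<longlonglongrightarrow> y" unfolding closure_sequential by auto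
 show "x + y \<in> closure S"
  unfolding closure_sequential
  by (rule exI[of _ "\<lambda>n. f n + g n"]) (simp add: f(1) g(1) subspace_add[OF S] tendsto_add[OF f(2) g(2)])
qed

lemma selfadjoint_decomposition:
 obtains h k where "selfadjoint h" "selfadjoint k" "a = h + \<i> *\<^sub>C k"
proof (rule that)
 define h where "h = (1/2) *\<^sub>R (a + star a)"
 define k where "k = (1/2) *\<^sub>R ((- \<i>) *\<^sub>C (a - star a))"
 show "selfadjoint h" "selfadjoint k"
  by (simp_all add: h_def k_def selfadjoint_def star_scaleR star_add star_diff star_star star_scaleC scaleC_diff_right)
 have "\<i> *\<^sub>C k = (1/2) *\<^sub>R (a - star a)"
  by (simp add: k_def scaleC_of_real[symmetric] scaleC_scaleC)
 then show "a = h + \<i> *\<^sub>C k" by (simp add: h_def scaleR_add_right[symmetric])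
qed

lemma commutant_closed:
 assumes H: "closed_csubspace H" and S: "!!s. s \<in> S ==> bounded_op H s"
  and A: "A \<in> commutant H S" and B: "B \<in> commutant H S"
 shows "(\<lambda>x. A x + B x) \<in> commutant H S" "(\<lambda>x. c *\<^sub>C A x) \<in> commutant H S" "(\<lambda>x. A (B x)) \<in> commutant H S"
  "(\<lambda>x. x) \<in> commutant H S"
proof -
 note Ab = commutantD(1)[OF A] and Bb = commutantD(1)[OF B]
 note h = closed_csubspaceD[OF H] and a = bounded_opD[OF Ab] and b = bounded_opD[OF Bb]
 note s = bounded_opD[OF S]
 obtain K where K: "K > 0" "!!x. x \<in> H ==> norm (A x) <= K * norm x" by (rule bounded_opE[OF Ab]) (rule that)
 obtain L where L: "L > 0" "!!x. x \<in> H ==> norm (B x) <= L * norm x" by (rule bounded_opE[OF Bb]) (rule that)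
 have "bounded_op H (\<lambda>x. A x + B x)"
 proof (rule bounded_opI)
  show "norm (A x + B x) <= (K + L) * norm x" if "x \<in> H" for x
   using norm_triangle_ineq[of "A x" "B x"] K(2)[OF that] L(2)[OF that] by (simp add: algebra_simps)
 qed (simp_all add: h a b scaleC_add_right)
 then show "(\<lambda>x. A x + B x) \<in> commutant H S"
  using commutantD(2)[OF A] commutantD(2)[OF B] by (simp add: commutant_def a b s)
 have "bounded_op H (\<lambda>x. c *\<^sub>C A x)"
 proof (rule bounded_opI)
  show "norm (c *\<^sub>C A x) <= (cmod c * K) * norm x" if "x \<in> H" for x
   using mult_left_mono[OF K(2)[OF that], of "cmod c"] by (simp add: norm_scaleC)
 qed (simp_all add: h a scaleC_add_right scaleC_scaleC mult.commute)
 then show "(\<lambda>x. c *\<^sub>C A x) \<in> commutant H S"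
  using commutantD(2)[OF A] by (simp add: commutant_def a s)
 show "(\<lambda>x. A (B x)) \<in> commutant H S"
  using commutantD(2)[OF A] commutantD(2)[OF B] bounded_op_compose[OF Ab Bb] by (simp add: commutant_def b)
 show "(\<lambda>x. x) \<in> commutant H S"
  by (auto simp: commutant_def intro!: bounded_opI[of _ _ 1])
qed

section \<open>The orbit of a vector under the commutant\<close>

context
 fixes H :: "'h::complex_hilbert_space set" and \<pi> :: "'a::unital_cstar_algebra => 'h => 'h" and \<Psi> :: 'h
 assumes rep: "star_representation H \<pi>" and \<Psi>: "\<Psi> \<in> H"
begin

abbreviation "M' \<equiv> commutant H (range \<pi>)"

lemma commutant_orbitI: "B \<in> M' ==> B \<Psi> \<in> {B \<Psi> |B. B \<in> M'}"
 by auto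

lemma commutant_orbit_subspace:
 "closed_csubspace (closure {B \<Psi> |B. B \<in> M'})"
 "closure {B \<Psi> |B. B \<in> M'} \<subseteq> H"
proof -
 note r = star_representationD[OF rep]
 have cl: "(\<lambda>x. A x + B x) \<in> M'" "(\<lambda>x. c *\<^sub>C A x) \<in> M'"
   if "A \<in> M'" "B \<in> M'" for A B c
  by (rule commutant_closed[OF r(1) _ that]; use r(2) in auto)+
 have z: "(\<lambda>x. 0) \<in> M'"
  using closed_csubspaceD(2)[OF r(1)] bounded_op_more(1)[OF r(2) r(1)]
  by (auto simp: commutant_def intro!: bounded_opI[of _ _ 0])
 show "closed_csubspace (closure {B \<Psi> |B. B \<in> M'})"
 proof (rule closed_csubspace_closure)
  show "0 \<in> {B \<Psi> |B. B \<in> M'}" using commutant_orbitI[OF z] .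
  show "x + y \<in> {B \<Psi> |B. B \<in> M'}"
   if xy: "x \<in> {B \<Psi> |B. B \<in> M'}" "y \<in> {B \<Psi> |B. B \<in> M'}" for x y
  proof -
   obtain A B where "x = A \<Psi>" "A \<in> M'" "y = B \<Psi>" "B \<in> M'"
    using xy by auto
   then show ?thesis using commutant_orbitI[OF cl(1)] by simp
  qed
  show "c *\<^sub>C x \<in> {B \<Psi> |B. B \<in> M'}" if x: "x \<in> {B \<Psi> |B. B \<in> M'}" for c x
  proof -
   obtain A where "x = A \<Psi>" "A \<in> M'" using x by auto
   then show ?thesis using commutant_orbitI[OF cl(2)] by simp
  qed
 qed
 show "closure {B \<Psi> |B. B \<in> M'} \<subseteq> H"
  by (rule closure_minimal)
   (use closed_csubspaceD(1)[OF r(1)] bounded_opD(1)[OF commutantD(1) \<Psi>] in auto)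
qed

text \<open>The orbit closure is invariant under the commutant, which is closed under adjoints;
  hence it is reducing, and its projection commutes with the commutant.\<close>

lemma commutant_orbit_projection:
 "orth_proj (closure {B \<Psi> |B. B \<in> M'}) \<in> bicommutant H (range \<pi>)"
proof -
 note r = star_representationD[OF rep]
 define E where "E = closure {B \<Psi> |B. B \<in> M'}"
 have E: "closed_csubspace E" "E \<subseteq> H" using commutant_orbit_subspace by (simp_all add: E_def)
 have b: "bounded_op H (orth_proj E)"
  by (rule bounded_opI[of _ _ 1])
   (use orth_proj(1)[OF E(1)] E(2) norm_orth_proj[OF E(1)] in \<open>auto simp: orth_proj_add[OF E(1)] orth_proj_scaleC[OF E(1)]\<close>)
 have inv: "B x \<in> E" if B: "B \<in> M'" and x: "x \<in> E" for B x
 proof -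
  obtain f where f: "!!n. f n \<in> {B \<Psi> |B. B \<in> M'}" "f \<longlonglongrightarrow> x"
   using x unfolding E_def closure_sequential by auto
  have fE: "f n \<in> E" for n using f(1)[of n] unfolding E_def by (rule subsetD[OF closure_subset])
  have "B (f n) \<in> E" for n
  proof -
   obtain A where A: "f n = A \<Psi>" "A \<in> M'" using f(1)[of n] by auto
   have "(\<lambda>x. B (A x)) \<in> M'"
    by (rule commutant_closed(3)[OF r(1) _ B A(2)]) (use r(2) in auto)
   then have "B (A \<Psi>) \<in> {B \<Psi> |B. B \<in> M'}" by auto
   then show ?thesis unfolding A E_def by (rule subsetD[OF closure_subset])
  qed
  moreover have "(\<lambda>n. B (f n)) \<longlonglongrightarrow> B x"
   by (rule bounded_op_tendsto[OF commutantD(1)[OF B] r(1) _ f(2)]) (use fE E(2) in blast)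
  ultimately show ?thesis by (rule closed_sequentially[OF closed_csubspaceD(1)[OF E(1)]])
 qed
 have "orth_proj E (B x) = B (orth_proj E x)" if B: "B \<in> M'" and x: "x \<in> H" for B x
 proof (rule orth_proj_eqI[OF E(1)])
  obtain S where S: "S \<in> M'" "!!x y. x \<in> H ==> y \<in> H ==> cinner (B x) y = cinner x (S y)"
   by (rule commutant_adjoint_exists[OF rep B]) (rule that)
  have p: "orth_proj E x \<in> E" by (rule orth_proj(1)[OF E(1)])
  show "B (orth_proj E x) \<in> E" by (rule inv[OF B p])
  fix z assume z: "z \<in> E"
  have pH: "orth_proj E x \<in> H" and zH: "z \<in> H" using p z E(2) by auto
  have "cinner (B x - B (orth_proj E x)) z = cinner (B (x - orth_proj E x)) z"
   using x pH by (simp add: bounded_op_more[OF commutantD(1)[OF B] r(1)])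
  also have "... = cinner (x - orth_proj E x) (S z)" by (intro S closed_csubspaceD[OF r(1)] x pH zH)
  also have "... = 0" by (rule orth_proj(2)[OF E(1) inv[OF S(1) z]])
  finally show "cinner (B x - B (orth_proj E x)) z = 0" .
 qed
 then show ?thesis using b unfolding bicommutant_def E_def[symmetric] by (auto simp: commutant_def)
qed

text \<open>If \<open>\<zeta>\<close> is orthogonal to the orbit of \<open>\<Psi>\<close> under the commutant, then the projection onto the closure
 of this orbit fixes \<open>\<Psi>\<close> and annihilates \<open>\<zeta>\<close>. It is approximated on the pair by selfadjoint elements of
 the algebra: otherwise some \<open>(x, y)\<close> would separate, and the density of the fourfold amplification at
 \<open>((\<Psi>, \<zeta>), (x, y))\<close> would be contradicted.\<close>

lemma selfadjoint_approximation:
 assumes \<zeta>: "\<zeta> \<in> H" and orth: "!!B. B \<in> M' ==> cinner \<zeta> (B \<Psi>) = 0" and e: "e > 0"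
 obtains a where "selfadjoint a" "norm (\<pi> a \<Psi> - \<Psi>) < e" "norm (\<pi> a \<zeta>) < e"
proof -
 note r = star_representationD[OF rep]
 note h = closed_csubspaceD[OF r(1)]
 define E where "E = closure {B \<Psi> |B. B \<in> M'}"
 have E: "closed_csubspace E" "E \<subseteq> H" using commutant_orbit_subspace by (simp_all add: E_def)
 have q: "orth_proj E \<in> bicommutant H (range \<pi>)" unfolding E_def by (rule commutant_orbit_projection)
 have "(\<lambda>x. x) \<in> M'"
  by (auto simp: commutant_def intro!: bounded_opI[of _ _ 1])
 then have "\<Psi> \<in> {B \<Psi> |B. B \<in> M'}" by auto
 then have "\<Psi> \<in> E" unfolding E_def by (rule subsetD[OF closure_subset])
 then have q\<Psi>: "orth_proj E \<Psi> = \<Psi>" by (rule orth_proj_ident[OF E(1)])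
 have q\<zeta>: "orth_proj E \<zeta> = 0"
 proof (rule orth_proj_zero[OF E(1)])
  fix z assume "z \<in> E"
  then obtain f where f: "!!n. f n \<in> {B \<Psi> |B. B \<in> M'}" "f \<longlonglongrightarrow> z"
   unfolding E_def closure_sequential by auto
  have "cinner \<zeta> (f n) = 0" for n using f(1)[of n] orth by auto
  then show "cinner \<zeta> z = 0" using tendsto_cinner[OF tendsto_const f(2), of \<zeta>] LIMSEQ_unique[OF _ tendsto_const] by simp
 qed
 define G where "G = {(\<pi> a \<Psi>, \<pi> a \<zeta>) |a. selfadjoint a}"
 have scaleR: "\<pi> (c *\<^sub>R a) x = c *\<^sub>R \<pi> a x" if "x \<in> H" for c a x
  using r(4)[OF that, of "of_real c" a] by (simp add: scaleC_of_real)
 have Gsub: "subspace G"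
  unfolding subspace_def
 proof (intro conjI ballI allI)
  show "0 \<in> G" unfolding G_def using r(11)[OF \<Psi>] r(11)[OF \<zeta>]
   by (intro CollectI exI[of _ 0]) (simp add: zero_prod_def)
  show "x + y \<in> G" if "x \<in> G" "y \<in> G" for x y
  proof -
   obtain a b where "x = (\<pi> a \<Psi>, \<pi> a \<zeta>)" "y = (\<pi> b \<Psi>, \<pi> b \<zeta>)" "selfadjoint a" "selfadjoint b"
    using \<open>x \<in> G\<close> \<open>y \<in> G\<close> by (auto simp: G_def)
   then show ?thesis unfolding G_def
    by (intro CollectI exI[of _ "a + b"]) (simp add: r(3) \<Psi> \<zeta> selfadjoint_add)
  qed
  show "c *\<^sub>R x \<in> G" if "x \<in> G" for c x
  proof -
   obtain a where "x = (\<pi> a \<Psi>, \<pi> a \<zeta>)" "selfadjoint a" using \<open>x \<in> G\<close> by (auto simp: G_def)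
   then show ?thesis unfolding G_def
    by (intro CollectI exI[of _ "c *\<^sub>R a"]) (simp add: scaleR \<Psi> \<zeta> selfadjoint_scaleR)
  qed
 qed
 have "(\<Psi>, 0) \<in> closure G"
 proof (rule ccontr)
  assume notin: "(\<Psi>, 0) \<notin> closure G"
  have "subspace (closure G)" by (rule subspace_closure[OF Gsub])
  then obtain g where g: "g \<in> closure G" "!!z. z \<in> closure G ==> Re (cinner ((\<Psi>, 0) - g) z) = 0"
   by (rule real_projection[OF closed_closure]) (rule that)
  obtain x y where xy: "(\<Psi>, 0) - g = (x, y)" by (cases "(\<Psi>, 0) - g")
  have "closure G \<subseteq> H \<times> H"
   by (rule closure_minimal) (use r(8) \<Psi> \<zeta> h(1) in \<open>auto simp: G_def closed_Times\<close>)
  then have "(\<Psi>, 0) - g \<in> H \<times> H"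
   using g(1) \<Psi> h(2) closed_csubspaceD(6)[OF closed_csubspace_times[OF r(1)], of "(\<Psi>, 0)" g] by auto
  then have xyH: "x \<in> H" "y \<in> H" by (simp_all add: xy)
  have "Re (cinner (x, y) (\<Psi>, 0)) = Re (cinner (x, y) ((x, y) + g))" by (simp flip: xy)
  also have "... = (norm (x, y))\<^sup>2" using g(2)[OF g(1)] by (simp add: cinner_add_right xy cinner_self)
  finally have pos: "Re (cinner x \<Psi>) > 0" using notin g(1) xy by (auto simp: cinner_prod_def)
  have sa: "Re (cinner x (\<pi> a \<Psi>) + cinner y (\<pi> a \<zeta>)) = 0" if "selfadjoint a" for a
  proof -
   have "(\<pi> a \<Psi>, \<pi> a \<zeta>) \<in> G" using that by (auto simp: G_def)
   then have "(\<pi> a \<Psi>, \<pi> a \<zeta>) \<in> closure G" by (rule subsetD[OF closure_subset])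
   from g(2)[OF this] show ?thesis by (simp add: xy cinner_prod_def)
  qed
  \<comment> \<open>The pairing of the amplified \<open>\<pi> a\<close> at \<open>v\<close> with the
    crossed vector \<open>w\<close> is complex linear in \<open>a\<close> and, for selfadjoint
    \<open>a\<close>, equals twice the real part that vanishes on \<open>G\<close>. It therefore
    vanishes for all \<open>a\<close>, and bicommutant density carries this to the
    projection.\<close>
  define v where "v = ((\<Psi>, \<zeta>), (x, y))"
  define w where "w = ((x, y), (\<Psi>, \<zeta>))"
  have vH: "v \<in> (H \<times> H) \<times> (H \<times> H)" using \<Psi> \<zeta> xyH by (simp add: v_def)
  have van_sa: "cinner (amplify (amplify (\<pi> a)) v) w = 0" if "selfadjoint a" for a
  proof -
   have sw: "cinner (\<pi> a u) z = cnj (cinner (\<pi> a z) u)" if "u \<in> H" "z \<in> H" for u z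
    using r(7)[OF that, of a] \<open>selfadjoint a\<close> by (simp add: selfadjoint_def flip: cinner_commute)
   have "cinner (amplify (amplify (\<pi> a)) v) w
     = cinner (\<pi> a \<Psi>) x + cinner (\<pi> a \<zeta>) y + cnj (cinner (\<pi> a \<Psi>) x) + cnj (cinner (\<pi> a \<zeta>) y)"
    using sw[OF xyH(1) \<Psi>] sw[OF xyH(2) \<zeta>] by (simp add: v_def w_def cinner_prod_def)
   also have "... = of_real (2 * Re (cinner (\<pi> a \<Psi>) x + cinner (\<pi> a \<zeta>) y))"
    by (simp add: complex_eq_iff)
   also have "Re (cinner (\<pi> a \<Psi>) x + cinner (\<pi> a \<zeta>) y) = 0"
    using sa[OF that] Re_cinner_commute[of x "\<pi> a \<Psi>"] Re_cinner_commute[of y "\<pi> a \<zeta>"] by simp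
   finally show ?thesis by simp
  qed
  note rep4 = star_representation_amplify[OF star_representation_amplify[OF rep]]
  have van: "cinner (amplify (amplify (\<pi> a)) v) w = 0" for a
  proof -
   obtain b c where "selfadjoint b" "selfadjoint c" "a = b + \<i> *\<^sub>C c" by (rule selfadjoint_decomposition)
   then show ?thesis
    using van_sa star_representationD(3,4)[OF rep4 vH] by (simp add: cinner_simps)
  qed
  have "amplify (amplify (orth_proj E)) v \<in> closure (range (\<lambda>a. amplify (amplify (\<pi> a)) v))"
   by (rule bicommutant_vector_density[OF rep4 _ vH])
    (rule bicommutant_amplify[OF star_representation_amplify[OF rep] bicommutant_amplify[OF rep q]])
  then obtain f where f: "!!n. f n \<in> range (\<lambda>a. amplify (amplify (\<pi> a)) v)"
   "f \<longlonglongrightarrow> amplify (amplify (orth_proj E)) v"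
   unfolding closure_sequential by auto
  have "cinner (f n) w = 0" for n using f(1)[of n] van by auto
  then have "cinner (amplify (amplify (orth_proj E)) v) w = 0"
   using tendsto_cinner[OF f(2) tendsto_const, of w] LIMSEQ_unique[OF _ tendsto_const] by simp
  then have "cinner \<Psi> x + (cinner x \<Psi> + cinner y 0) = 0"
   using orth_proj_symmetric[OF E(1), of x \<Psi>] orth_proj_symmetric[OF E(1), of y \<zeta>]
   by (simp add: v_def w_def cinner_prod_def q\<Psi> q\<zeta>)
  then have "Re (cinner \<Psi> x) + Re (cinner x \<Psi>) = 0" by (simp add: complex_eq_iff)
  then show False using pos Re_cinner_commute[of x \<Psi>] by simp
 qed
 then obtain g where g: "g \<in> G" "dist g (\<Psi>, 0) < e" using e unfolding closure_approachable by auto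
 then obtain a where a: "selfadjoint a" "g = (\<pi> a \<Psi>, \<pi> a \<zeta>)" by (auto simp: G_def)
 have "norm (\<pi> a \<Psi> - \<Psi>, \<pi> a \<zeta>) < e" using g(2) by (simp add: a dist_norm)
 then have "norm (\<pi> a \<Psi> - \<Psi>) < e" "norm (\<pi> a \<zeta>) < e"
  using norm_fst_le[of "\<pi> a \<Psi> - \<Psi>" "\<pi> a \<zeta>"] norm_snd_le[of "\<pi> a \<zeta>" "\<pi> a \<Psi> - \<Psi>"]
  by auto
 with a(1) show ?thesis by (rule that)
qed

text \<open>As in Kaplansky's density theorem, \<open>a\<close> is replaced by \<open>2a/(1 + a\<^sup>2)\<close>.\<close>

lemma contraction_approximation:
 assumes \<zeta>: "\<zeta> \<in> H" and orth: "!!B. B \<in> M' ==> cinner \<zeta> (B \<Psi>) = 0" and e: "e > 0"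
 obtains y where "norm y <= 1" "norm (\<pi> y \<Psi> - \<Psi>) < e" "norm (\<pi> y \<zeta>) < e"
proof -
 note r = star_representationD[OF rep]
 note h = closed_csubspaceD[OF r(1)]
 obtain a where a: "selfadjoint a" "norm (\<pi> a \<Psi> - \<Psi>) < e / 2" "norm (\<pi> a \<zeta>) < e / 2"
  by (rule selfadjoint_approximation[where \<zeta> = \<zeta> and e = "e / 2"])
   (rule \<zeta>, erule orth, rule half_gt_zero[OF e], rule that)
 obtain g where g: "g * (1 + a * a) = 1" "selfadjoint g" "norm g <= 1" "g * a = a * g"
  by (rule one_plus_square_inverse[OF a(1)]) simp
 define y where "y = 2 *\<^sub>R (g * a)"
 have gaa: "g * a * a = 1 - g" using g(1) by (simp add: distrib_left mult.assoc eq_diff_eq add.commute)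
 have sq: "selfadjoint (g * a)" using g a(1) by (simp add: selfadjoint_def star_mult)
 have y: "selfadjoint y" unfolding y_def by (rule selfadjoint_scaleR[OF sq])
 have norm_y: "norm y <= 1"
 proof -
  \<comment> \<open>The identity behind the bound is
    \<open>1 - y^2 = ((1 - a^2) / (1 + a^2))^2\<close>.\<close>
  have w: "selfadjoint (g - g * a * a)" unfolding gaa using g by (intro selfadjoint_diff) auto
  have gg: "(g * a) * (g * a) = g - g * g"
  proof -
   have "(g * a) * (g * a) = g * (g * a * a)" by (metis g(4) mult.assoc)
   then show ?thesis by (simp add: gaa right_diff_distrib)
  qed
  have "(g - g * a * a) * (g - g * a * a) = 1 - y * y"
   unfolding gaa using gg by (simp add: y_def algebra_simps scaleR_2)
  then have "cpos (1 - y * y)" using cpos_square[OF w] by simp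
  then have "norm (y * y) <= 1" by (rule cpos_norm_le_one[OF cpos_square[OF y]])
  then have "(norm y)\<^sup>2 <= 1\<^sup>2" using cstar_identity[of y] y by (simp add: selfadjoint_def)
  then show ?thesis by (rule power2_le_imp_le) simp
 qed
 have "\<pi> y \<zeta> = \<pi> (2 *\<^sub>R g) (\<pi> a \<zeta>)" using r(5)[OF \<zeta>, of "2 *\<^sub>R g" a] by (simp add: y_def)
 also have "norm ... <= norm (2 *\<^sub>R g) * norm (\<pi> a \<zeta>)"
  by (intro star_representation_contractive[OF rep] r(8) \<zeta>)
 also have "... <= 2 * norm (\<pi> a \<zeta>)" using g(3) by (intro mult_right_mono) auto
 also have "... < e" using a(3) by simp
 finally have 1: "norm (\<pi> y \<zeta>) < e" .
 \<comment> \<open>The factor \<open>a - 1\<close> on the right turns smallness of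
   \<open>\<pi> a \<Psi> - \<Psi>\<close> into smallness of
   \<open>\<pi> y \<Psi> - \<Psi>\<close>.\<close>
 have "y - 1 = (g - g * a) * (a - 1)"
 proof -
  have "(g - g * a) * (a - 1) = g * a + g * a - g * a * a - g" by (simp add: algebra_simps)
  then show ?thesis by (simp add: y_def gaa scaleR_2)
 qed
 then have "\<pi> y \<Psi> - \<Psi> = \<pi> (g - g * a) (\<pi> a \<Psi> - \<Psi>)"
  using r(10)[OF \<Psi>, of y 1] r(10)[OF \<Psi>, of a 1] r(5)[OF \<Psi>, of "g - g * a" "a - 1"] r(6)[OF \<Psi>] by simp
 also have "norm ... <= norm (g - g * a) * norm (\<pi> a \<Psi> - \<Psi>)"
  by (intro star_representation_contractive[OF rep] h r \<Psi>)
 also have "... <= 2 * norm (\<pi> a \<Psi> - \<Psi>)"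
 proof (intro mult_right_mono)
  have "norm (g * a) <= 1" using norm_y by (simp add: y_def)
  then show "norm (g - g * a) <= 2" using norm_triangle_ineq4[of g "g * a"] g(3) by simp
 qed simp
 also have "... < e" using a(2) by simp
 finally show ?thesis using norm_y 1 by (intro that[of y])
qed

text \<open>The support acts as the identity of \<open>H\<close>: it fixes \<open>\<Psi>\<close>,
  and being central it can be moved past \<open>\<pi> c\<close>, so it fixes the dense set of
  vectors \<open>\<pi> c \<Psi>\<close>. Boundedness of the form \<open>F\<close> extends this to
  all vectors.\<close>

lemma central_support_action:
 assumes cyc: "closure (range (\<lambda>a. \<pi> a \<Psi>)) = H" and \<phi>: "\<phi> \<in> states" "!!a. \<phi> a = cinner (\<pi> a \<Psi>) \<Psi>"
  and central: "state_support \<phi> \<in> bidual_centre" and \<xi>: "\<xi> \<in> H" and \<eta>: "\<eta> \<in> H"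
 shows "state_support \<phi> (\<lambda>a. cinner (\<pi> a \<xi>) \<eta>) = cinner \<xi> \<eta>"
proof -
 note r = star_representationD[OF rep]
 note h = closed_csubspaceD[OF r(1)]
 define p where "p = state_support \<phi>"
 have pb: "p \<in> bidual" and comm: "!!y. y \<in> bidual ==> bidual_mult p y = bidual_mult y p"
  using central by (auto simp: p_def bidual_centre_def)
 have pQ: "p \<in> state_face \<phi>" unfolding p_def by (rule state_support_face[OF \<phi>(1)])
 have \<phi>d: "\<phi> \<in> dual" using \<phi>(1) by (simp add: states_positive positive_functional_dual)
 have dl: "(\<lambda>a. cinner (\<pi> a u) v) \<in> dual" if "u \<in> H" "v \<in> H" for u v
 proof (rule dualI)
  show "functional_linear (\<lambda>a. cinner (\<pi> a u) v)"
   using that by (simp add: functional_linear_def r(3,4) cinner_simps)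
  show "cmod (cinner (\<pi> a u) v) <= (norm u * norm v) * norm a" for a
   using order_trans[OF cinner_cauchy_schwarz mult_right_mono[OF star_representation_contractive[OF rep that(1), of a], of "norm v"]]
   by (simp add: mult_ac)
 qed
 obtain K where K: "K >= 0" "!!\<phi>. \<phi> \<in> dual ==> cmod (p \<phi>) <= K * onorm \<phi>" by (rule bidualE[OF pb]) blast
 define F where "F u v = p (\<lambda>a. cinner (\<pi> a u) v)" for u v
 have bound: "cmod (F u v) <= K * (norm u * norm v)" if "u \<in> H" "v \<in> H" for u v
  unfolding F_def
 proof (rule bidual_bound[OF K(2,1) dl[OF that]])
  show "cmod (cinner (\<pi> a u) v) <= (norm u * norm v) * norm a" for a
   using order_trans[OF cinner_cauchy_schwarz mult_right_mono[OF star_representation_contractive[OF rep that(1), of a], of "norm v"]]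
   by (simp add: mult_ac)
 qed
 have diff: "F (u - u') v = F u v - F u' v" "F u (v - v') = F u v - F u v'"
  if "u \<in> H" "u' \<in> H" "v \<in> H" "v' \<in> H" for u u' v v'
  unfolding F_def using that bidual_apply_diff[OF pb dl dl]
  by (simp_all add: bounded_op_more[OF r(2) r(1)] cinner_simps)
 have dense: "F (\<pi> c \<Psi>) (\<pi> d \<Psi>) = cinner (\<pi> c \<Psi>) (\<pi> d \<Psi>)" for c d
 proof -
  have mv: "cinner (\<pi> a (\<pi> c \<Psi>)) (\<pi> d \<Psi>) = \<phi> (star d * (a * c))" for a
   using \<Psi> by (simp add: \<phi>(2) r star_star)
  have "F (\<pi> c \<Psi>) (\<pi> d \<Psi>) = p (\<lambda>a. \<phi> (star d * (a * c)))" by (simp add: F_def mv)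
  also have "... = bidual_mult p (bidual_of c) (\<lambda>a. \<phi> (star d * a))"
   by (simp add: bidual_mult_apply dual_mult_left[OF \<phi>d] bidual_of_apply dual_mult_left[OF dual_mult_left[OF \<phi>d]])
  also have "... = bidual_mult (bidual_of c) p (\<lambda>a. \<phi> (star d * a))" by (simp add: comm bidual_of_closed)
  also have "... = p (\<lambda>b. \<phi> ((star d * c) * b))"
   by (simp add: bidual_mult_apply dual_mult_left[OF \<phi>d] bidual_of_apply bidual_left_dual[OF pb dual_mult_left[OF \<phi>d]] mult.assoc)
  also have "... = \<phi> (star d * c)" by (rule state_face_apply[OF \<phi>(1) pQ])
  also have "... = cinner (\<pi> c \<Psi>) (\<pi> d \<Psi>)" using mv[of 1] \<Psi> by (simp add: r)
  finally show ?thesis .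
 qed
 have seq: "\<exists>c. (\<lambda>n. \<pi> (c n) \<Psi>) \<longlonglongrightarrow> u" if "u \<in> H" for u
 proof -
  from that have "u \<in> closure (range (\<lambda>a. \<pi> a \<Psi>))" by (simp add: cyc)
  then obtain f where f: "!!n. f n \<in> range (\<lambda>a. \<pi> a \<Psi>)" "f \<longlonglongrightarrow> u"
   unfolding closure_sequential by auto
  then have "\<forall>n. \<exists>a. f n = \<pi> a \<Psi>" by auto
  then obtain c where "!!n. f n = \<pi> (c n) \<Psi>" by metis
  then have "f = (\<lambda>n. \<pi> (c n) \<Psi>)" by auto
  then show ?thesis using f(2) by auto
 qed
 have cont: "(\<lambda>n. F (f n) v) \<longlonglongrightarrow> F u v" "(\<lambda>n. F v (f n)) \<longlonglongrightarrow> F v u"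
  if "!!n. f n \<in> H" "u \<in> H" "v \<in> H" "f \<longlonglongrightarrow> u" for f u v
 proof -
  have z: "(\<lambda>n. K * (norm (f n - u) * norm v)) \<longlonglongrightarrow> 0"
   using tendsto_mult_right_zero[OF tendsto_mult_left_zero[OF tendsto_norm_zero[OF LIM_zero[OF that(4)]]]] .
  have "cmod (F (f n) v - F u v) <= K * (norm (f n - u) * norm v)"
   "cmod (F v (f n) - F v u) <= K * (norm (f n - u) * norm v)" for n
   using bound[OF h(6)[OF that(1)[of n] that(2)] that(3)] bound[OF that(3) h(6)[OF that(1)[of n] that(2)]]
    diff[of "f n" u v v] diff[of v v "f n" u] that
   by (simp_all add: mult.commute[of "norm v"])
  then have "(\<lambda>n. F (f n) v - F u v) \<longlonglongrightarrow> 0" "(\<lambda>n. F v (f n) - F v u) \<longlonglongrightarrow> 0"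
   by (auto intro: Lim_null_comparison[OF always_eventually z])
  then show "(\<lambda>n. F (f n) v) \<longlonglongrightarrow> F u v" "(\<lambda>n. F v (f n)) \<longlonglongrightarrow> F v u" by (auto dest: LIM_zero_cancel)
 qed
 obtain c where c: "(\<lambda>n. \<pi> (c n) \<Psi>) \<longlonglongrightarrow> \<xi>" using seq[OF \<xi>] by auto
 obtain d where d: "(\<lambda>n. \<pi> (d n) \<Psi>) \<longlonglongrightarrow> \<eta>" using seq[OF \<eta>]
 by auto
 have "F \<xi> (\<pi> b \<Psi>) = cinner \<xi> (\<pi> b \<Psi>)" for b
 proof -
  have "(\<lambda>n. F (\<pi> (c n) \<Psi>) (\<pi> b \<Psi>)) \<longlonglongrightarrow> F \<xi> (\<pi> b \<Psi>)" by (rule cont(1)[OF _ \<xi> _ c]) (rule r(8)[OF \<Psi>])+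
  then show ?thesis unfolding dense by (rule LIMSEQ_unique[OF _ tendsto_cinner[OF c tendsto_const]])
 qed
 then have *: "F \<xi> (\<pi> b \<Psi>) = cinner \<xi> (\<pi> b \<Psi>)" for b .
 have "(\<lambda>n. F \<xi> (\<pi> (d n) \<Psi>)) \<longlonglongrightarrow> F \<xi> \<eta>" by (rule cont(2)[OF _ \<eta> \<xi> d]) (rule r(8)[OF \<Psi>])
 then have "F \<xi> \<eta> = cinner \<xi> \<eta>"
  unfolding * by (rule LIMSEQ_unique[OF _ tendsto_cinner[OF tendsto_const d]])
 then show ?thesis by (simp add: F_def p_def)
qed

text \<open>Contractions that nearly fix \<open>\<Psi>\<close> and nearly annihilate
  \<open>\<zeta>\<close> accumulate at some \<open>y\<close> in the face of \<open>\<phi>\<close>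
  with \<open>y \<theta> = 0\<close>, where \<open>\<theta>\<close> is the vector functional of
  \<open>\<zeta>\<close>. Since \<open>y\<close> times the support is the support, and the support
  acts as the identity on \<open>H\<close>, also
  \<open>y \<theta> = (norm \<zeta>)^2\<close>.\<close>

theorem central_support_cyclic_commutant:
 assumes cyc: "closure (range (\<lambda>a. \<pi> a \<Psi>)) = H" and \<phi>: "\<phi> \<in> states" "!!a. \<phi> a = cinner (\<pi> a \<Psi>) \<Psi>"
  and central: "state_support \<phi> \<in> bidual_centre"
 shows "closure {B \<Psi> |B. B \<in> M'} = H"
proof (rule closed_csubspace_eqI[OF star_representationD(1)[OF rep] commutant_orbit_subspace])
 note r = star_representationD[OF rep]
 fix \<zeta> assume \<zeta>: "\<zeta> \<in> H" and orth0: "!!e. e \<in> closure {B \<Psi> |B. B \<in> M'} ==> cinner \<zeta> e = 0"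
 have orth: "cinner \<zeta> (B \<Psi>) = 0" if "B \<in> M'" for B
  by (intro orth0 subsetD[OF closure_subset]) (use that in blast)
 have n\<Psi>: "norm \<Psi> = 1"
 proof -
  have "complex_of_real ((norm \<Psi>)\<^sup>2) = 1"
   using \<phi>(2)[of 1] \<phi>(1) \<Psi> by (simp add: states_positive r cinner_self del: of_real_power)
  then have "(norm \<Psi>)\<^sup>2 = 1" by (simp only: of_real_eq_1_iff)
  then show ?thesis using norm_ge_zero[of \<Psi>] by (auto simp: power2_eq_1_iff)
 qed
 define \<theta> where "\<theta> a = cinner (\<pi> a \<zeta>) \<zeta>" for a
 have \<theta>: "positive_functional \<theta>" unfolding \<theta>_def by (rule vector_functional_positive[OF rep \<zeta>])
 note \<theta>d = positive_functional_dual[OF \<theta>]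
 have \<phi>d: "\<phi> \<in> dual" using \<phi>(1) by (simp add: states_positive positive_functional_dual)
 define G where "G = (\<lambda>n. {x :: ('a => complex) => complex. cmod (x \<phi> - 1) <= inverse (real (Suc n)) \<and> cmod (x \<theta>) <= inverse (real (Suc n))})"
 have "bidual_ball \<inter> (\<Inter>n\<in>UNIV. G n) ~= {}"
 proof (rule compact_imp_fip_image[OF bidual_ball_compact])
  show "closed (G n)" for n
   unfolding G_def by (intro closed_Collect_conj closed_Collect_le continuous_intros continuous_on_product_coordinates)
  fix I :: "nat set" assume I: "finite I"
  define m where "m = Max (insert 0 I)"
  \<comment> \<open>The denominator makes both \<open>e\<close> and \<open>e * norm \<zeta>\<close>
    at most \<open>1 / (m + 1)\<close>.\<close>
  define e where "e = inverse (real (Suc m)) / (norm \<zeta> + 1)"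
  have e: "e > 0" by (simp add: e_def add_nonneg_pos)
  have e1: "e <= inverse (real (Suc m))" "e * norm \<zeta> <= inverse (real (Suc m))"
  proof -
   define i where "i = inverse (real (Suc m))"
   have i: "i > 0" by (simp add: i_def)
   have "i / (norm \<zeta> + 1) <= i / 1" using i by (intro divide_left_mono) (auto simp: add_nonneg_pos)
   then show "e <= inverse (real (Suc m))" by (simp add: e_def i_def)
   have "i * (norm \<zeta> / (norm \<zeta> + 1)) <= i * 1"
    using i by (intro mult_left_mono) (auto simp: add_nonneg_pos)
   then show "e * norm \<zeta> <= inverse (real (Suc m))" by (simp add: e_def i_def)
  qed
  obtain y where y: "norm y <= 1" "norm (\<pi> y \<Psi> - \<Psi>) < e" "norm (\<pi> y \<zeta>) < e"
   by (rule contraction_approximation[where \<zeta> = \<zeta> and e = e])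
    (rule \<zeta>, erule orth, rule e, rule that)
  have "\<phi> y - 1 = cinner (\<pi> y \<Psi> - \<Psi>) \<Psi>" by (simp add: \<phi>(2) cinner_simps cinner_self n\<Psi>)
  also have "cmod ... <= norm (\<pi> y \<Psi> - \<Psi>) * norm \<Psi>" by (rule cinner_cauchy_schwarz)
  finally have 1: "cmod (\<phi> y - 1) <= inverse (real (Suc m))" using y(2) e1 n\<Psi> by simp
  have "cmod (\<theta> y) <= norm (\<pi> y \<zeta>) * norm \<zeta>" unfolding \<theta>_def by (rule cinner_cauchy_schwarz)
  also have "... <= e * norm \<zeta>" using y(3) by (intro mult_right_mono) auto
  finally have 2: "cmod (\<theta> y) <= inverse (real (Suc m))" using e1 by simp
  have "bidual_of y \<in> G n" if "n \<in> I" for n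
  proof -
   have "n <= m" using that I by (simp add: m_def)
   then have "inverse (real (Suc m)) <= inverse (real (Suc n))" by simp
   with 1 2 have "cmod (\<phi> y - 1) <= inverse (real (Suc n))" "cmod (\<theta> y) <= inverse (real (Suc n))" by linarith+
   then show ?thesis by (simp add: G_def bidual_of_apply \<phi>d \<theta>d del: of_nat_Suc)
  qed
  then show "bidual_ball \<inter> (\<Inter>n\<in>I. G n) ~= {}" using bidual_ball_of[OF y(1)] by auto
 qed
 then obtain y where y: "y \<in> bidual_ball" "!!n. y \<in> G n" by auto
 have zero: "z = 0" if "!!n. cmod z <= inverse (real (Suc n))" for z
 proof -
  have "cmod z <= 0" using LIMSEQ_le_const[OF LIMSEQ_inverse_real_of_nat] that by blast
  then show ?thesis by simp
 qed
 have "y \<phi> - 1 = 0" "y \<theta> = 0" using y(2) unfolding G_def by (blast intro: zero)+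
 then have face: "y \<in> state_face \<phi>" using y(1) by (simp add: state_face_def)
 have "(\<lambda>a. state_support \<phi> (\<lambda>b. \<theta> (a * b))) = \<theta>"
 proof
  fix a
  have sw: "\<theta> (a * b) = cinner (\<pi> b \<zeta>) (\<pi> (star a) \<zeta>)" for b
   using \<zeta> by (simp add: \<theta>_def r)
  show "state_support \<phi> (\<lambda>b. \<theta> (a * b)) = \<theta> a"
   unfolding sw using central_support_action[OF cyc \<phi> central \<zeta> r(8)[OF \<zeta>, of "star a"]] r(7)[OF \<zeta> \<zeta>, of a]
   by (simp add: \<theta>_def)
 qed
 then have "y \<theta> = bidual_mult y (state_support \<phi>) \<theta>" by (simp add: bidual_mult_apply \<theta>d)
 also have "... = state_support \<phi> \<theta>" by (simp add: state_support_absorbs[OF \<phi>(1) face])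
 also have "... = cinner \<zeta> \<zeta>"
  unfolding \<theta>_def by (rule central_support_action[OF cyc \<phi> central \<zeta> \<zeta>])
 finally show "\<zeta> = 0" using \<open>y \<theta> = 0\<close> by simp
qed

end

subsection \<open>Ergodic averages\<close>

text \<open>At \<open>N = 0\<close> the value is 0, so norm bounds on averages hold for every
  \<open>N\<close>.\<close>

definition average :: "(nat => 'v::real_normed_vector) => nat => 'v" where
 "average x N = (1 / real N) *\<^sub>R (\<Sum>n<N. x n)"

lemma average_add: "average (\<lambda>n. x n + y n) N = average x N + average y N"
 by (simp add: average_def sum.distrib scaleR_add_right)

lemma average_diff: "average (\<lambda>n. x n - y n) N = average x N - average y N"
 by (simp add: average_def sum_subtractf scaleR_diff_right)

lemma norm_average_le:
 assumes "!!n. norm (x n) <= C" "C >= 0"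
 shows "norm (average x N) <= C"
proof -
 have "norm (average x N) <= (1 / real N) * (real N * C)"
  unfolding average_def norm_scaleR abs_of_nonneg[OF zero_le_divide_1_iff[THEN iffD2, OF of_nat_0_le_iff]]
  using sum_norm_bound[of "{..<N}" x C] assms(1) by (intro mult_left_mono) auto
 also have "... <= C" using assms(2) by simp
 finally show ?thesis .
qed

text \<open>Telescoping: a shift by one exchanges one term at each end of the sum.\<close>

lemma norm_sum_shift:
 fixes x :: "nat => 'v::real_normed_vector"
 assumes C: "!!n. norm (x n) <= C"
 shows "norm ((\<Sum>n<N. x (n + h)) - (\<Sum>n<N. x n)) <= 2 * real h * C"
proof (induction h)
 case (Suc h)
 have "(\<Sum>n<N. x (n + Suc h)) = (x (N + h) - x h) + (\<Sum>n<N. x (n + h))"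
  by (induction N) simp_all
 then have "(\<Sum>n<N. x (n + Suc h)) - (\<Sum>n<N. x n)
   = (x (N + h) - x h) + ((\<Sum>n<N. x (n + h)) - (\<Sum>n<N. x n))" by simp
 also have "norm ... <= (C + C) + 2 * real h * C"
  by (intro order_trans[OF norm_triangle_ineq] add_mono order_trans[OF norm_triangle_ineq4] C Suc)
 finally show ?case by (simp add: algebra_simps)
qed simp

lemma norm_average_shift:
 fixes x :: "nat => 'v::real_normed_vector"
 assumes C: "!!n. norm (x n) <= C"
 shows "norm (average (\<lambda>n. x (n + h)) N - average x N) <= 2 * real h * C * inverse (real N)"
proof -
 have "average (\<lambda>n. x (n + h)) N - average x N = (1 / real N) *\<^sub>R ((\<Sum>n<N. x (n + h)) - (\<Sum>n<N. x n))"
  by (simp add: average_def scaleR_diff_right)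
 then have "norm (average (\<lambda>n. x (n + h)) N - average x N)
   = inverse (real N) * norm ((\<Sum>n<N. x (n + h)) - (\<Sum>n<N. x n))" by (simp add: divide_inverse)
 also have "... <= inverse (real N) * (2 * real h * C)"
  by (intro mult_left_mono norm_sum_shift C) simp
 finally show ?thesis by (simp add: mult_ac)
qed

lemma average_shift_tendsto:
 fixes x :: "nat => 'v::real_normed_vector"
 assumes C: "!!n. norm (x n) <= C"
 shows "(\<lambda>N. average (\<lambda>n. x (n + h)) N - average x N) \<longlonglongrightarrow> 0"
proof (rule Lim_null_comparison[OF always_eventually[OF allI[OF norm_average_shift[OF C]]]])
 show "(\<lambda>N. 2 * real h * C * inverse (real N)) \<longlonglongrightarrow> 0"
  by (rule tendsto_mult_right_zero[OF lim_inverse_n])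
qed

lemma cinner_sum_sum:
 "cinner (\<Sum>i\<in>I. x i) (\<Sum>j\<in>J. y j) = (\<Sum>i\<in>I. \<Sum>j\<in>J. cinner (x i) (y j :: 'h::complex_hilbert_space))"
 unfolding cinner_sum_left by (simp only: cinner_sum_right)

lemma cinner_double_sum:
 "cinner (\<Sum>i\<in>I. u i *\<^sub>R x i) (\<Sum>j\<in>J. v j *\<^sub>R y j)
  = (\<Sum>i\<in>I. \<Sum>j\<in>J. of_real (u i * v j) * cinner (x i) (y j :: 'h::complex_hilbert_space))"
 unfolding cinner_sum_sum by (intro sum.cong refl) (simp add: cinner_simps)

text \<open>The mean ergodic theorem, stated for sequences with a shift-invariant Gram matrix: the averages
 minimise the norm on the convex hull asymptotically, hence form a Cauchy sequence.\<close>

lemma stationary_mean_ergodic: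
 fixes z :: "nat => 'h::complex_hilbert_space"
 assumes stat: "!!i j. cinner (z (Suc i)) (z (Suc j)) = cinner (z i) (z j)"
 shows "convergent (average z)"
proof -
 have shift: "cinner (z (i + k)) (z (j + k)) = cinner (z i) (z j)" for i j k
  by (induction k) (simp_all add: stat)
 define C where "C = norm (z 0)"
 have C: "norm (z n) <= C" for n
 proof -
  have "(norm (z n))\<^sup>2 = C\<^sup>2" using shift[of 0 n 0] cinner_self_Re[of "z n"] cinner_self_Re[of "z 0"] by (simp add: C_def)
  then show ?thesis by (simp add: C_def)
 qed
 define S where "S = (\<lambda>y. (norm y)\<^sup>2) ` (convex hull (range z))"
 define d where "d = Inf S"
 have bdd: "bdd_below S" by (rule bdd_belowI[of _ 0]) (auto simp: S_def)
 have ne: "S ~= {}" by (auto simp: S_def)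
 have d_le: "d <= (norm y)\<^sup>2" if "y \<in> convex hull (range z)" for y
  unfolding d_def by (rule cInf_lower[OF _ bdd]) (use that in \<open>auto simp: S_def\<close>)
 have A_mem: "average z N \<in> convex hull (range z)" if N: "N > 0" for N
 proof -
  have "(\<Sum>n<N. (1 / real N) *\<^sub>R z n) \<in> convex hull (range z)"
   by (rule convex_sum[OF _ convex_convex_hull]) (use N in \<open>auto intro: hull_inc\<close>)
  then show ?thesis by (simp add: average_def scaleR_sum_right)
 qed
 have bound: "\<exists>M. \<forall>N\<ge>M. (norm (average z N))\<^sup>2 < d + e" if e: "e > 0" for e
 proof -
  have "Inf S < d + e" using e by (simp add: d_def)
  then obtain y where y: "y \<in> convex hull (range z)" "(norm y)\<^sup>2 < d + e"
   unfolding cInf_less_iff[OF ne bdd] by (auto simp: S_def)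
  from y(1) obtain k u x where "\<forall>i\<in>{1::nat..k}. 0 <= u i \<and> x i \<in> range z" and su: "sum u {1..k} = 1"
   and y': "(\<Sum>i = 1..k. u i *\<^sub>R x i) = y"
   unfolding convex_hull_indexed by auto
  then have u0: "!!i. i \<in> {1..k} ==> 0 <= u i" and "\<forall>i\<in>{1..k}. \<exists>n. x i = z n" by auto
  then obtain n where n: "!!i. i \<in> {1..k} ==> x i = z (n i)" by metis
  \<comment> \<open>The near-minimal convex combination is moved along the sequence. Its norm stays
    constant by stationarity, and its averages differ from those of \<open>z\<close> by finitely
    many shifts, which disappear in the limit.\<close>
  define Y where "Y j = (\<Sum>i = 1..k. u i *\<^sub>R z (n i + j))" for j
  have Y0: "Y 0 = y" unfolding Y_def y'[symmetric] by (rule sum.cong) (simp_all add: n)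
  have nY: "norm (Y j) = norm y" for j
  proof -
   have "cinner (Y j) (Y j) = cinner (Y 0) (Y 0)"
    unfolding Y_def cinner_double_sum by (simp add: shift)
   then have "(norm (Y j))\<^sup>2 = (norm y)\<^sup>2" using cinner_self_Re[of "Y j"] cinner_self_Re[of "Y 0"] by (simp add: Y0)
   then show ?thesis by simp
  qed
  have avg: "average Y N - average z N = (\<Sum>i = 1..k. u i *\<^sub>R (average (\<lambda>j. z (j + n i)) N - average z N))" for N
  proof -
   have "(\<Sum>i = 1..k. u i *\<^sub>R (average (\<lambda>j. z (j + n i)) N - average z N))
     = (\<Sum>i = 1..k. u i *\<^sub>R average (\<lambda>j. z (j + n i)) N) - (\<Sum>i = 1..k. u i) *\<^sub>R average z N"
    by (simp add: scaleR_diff_right sum_subtractf scaleR_sum_left)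
   also have "(\<Sum>i = 1..k. u i *\<^sub>R average (\<lambda>j. z (j + n i)) N) = average Y N"
    unfolding average_def Y_def scaleR_sum_right
    by (subst sum.swap) (simp add: add.commute)
   finally show ?thesis by (simp only: su scaleR_one)
  qed
  have "(\<lambda>N. \<Sum>i = 1..k. u i *\<^sub>R (average (\<lambda>j. z (j + n i)) N - average z N)) \<longlonglongrightarrow> (\<Sum>i = 1..k. u i *\<^sub>R 0)"
   by (intro tendsto_sum tendsto_scaleR tendsto_const average_shift_tendsto[OF C])
  then have lim: "(\<lambda>N. norm (average Y N - average z N)) \<longlonglongrightarrow> 0"
   unfolding avg by (simp add: tendsto_norm_zero)
  have "(\<lambda>N. (norm y + norm (average Y N - average z N))\<^sup>2) \<longlonglongrightarrow> (norm y + 0)\<^sup>2"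
   by (intro tendsto_intros lim)
  then have "eventually (\<lambda>N. (norm y + norm (average Y N - average z N))\<^sup>2 < d + e) sequentially"
   using y(2) by (simp add: order_tendstoD)
  then obtain M where M: "!!N. N >= M ==> (norm y + norm (average Y N - average z N))\<^sup>2 < d + e"
   unfolding eventually_sequentially by auto
  have "(norm (average z N))\<^sup>2 < d + e" if "N >= M" for N
  proof -
   have "norm (average z N) <= norm (average Y N) + norm (average Y N - average z N)"
    using norm_triangle_ineq4[of "average Y N" "average Y N - average z N"] by simp
   also have "norm (average Y N) <= norm y" by (rule norm_average_le) (simp_all add: nY)
   finally have "(norm (average z N))\<^sup>2 <= (norm y + norm (average Y N - average z N))\<^sup>2"
    by (intro power_mono) auto
   then show ?thesis using M[OF that] by linarith
  qed
  then show ?thesis by auto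
 qed
 have "Cauchy (average z)"
 proof (rule CauchyI)
  fix e :: real assume e: "e > 0"
  obtain M where M: "!!N. N >= M ==> (norm (average z N))\<^sup>2 < d + e\<^sup>2 / 4"
   using bound[of "e\<^sup>2 / 4"] e by auto
  show "\<exists>M. \<forall>i\<ge>M. \<forall>j\<ge>M. norm (average z i - average z j) < e"
  proof (intro exI allI impI)
   fix i j assume ij: "max 1 M <= i" "max 1 M <= j"
   have "(1/2) *\<^sub>R average z i + (1/2) *\<^sub>R average z j \<in> convex hull (range z)"
    using ij by (intro convexD[OF convex_convex_hull] A_mem) auto
   from d_le[OF this] have "4 * d <= (norm (average z i + average z j))\<^sup>2"
    by (simp add: scaleR_add_right[symmetric] power_divide)
   then have "(norm (average z i - average z j))\<^sup>2 < e\<^sup>2"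
    using parallelogram[of "average z i" "average z j"] M[of i] M[of j] ij by simp
   then show "norm (average z i - average z j) < e" by (rule power2_less_imp_less) (use e in simp)
  qed
 qed
 then show ?thesis by (rule Cauchy_convergent)
qed

lemma norm_average_square:
 "(norm (average x N))\<^sup>2 <= average (\<lambda>n. (norm (x n))\<^sup>2) N"
proof -
 have "norm (average x N) <= (1 / real N) * (\<Sum>n<N. norm (x n))"
  by (simp add: average_def divide_right_mono norm_sum)
 then have "(norm (average x N))\<^sup>2 <= ((1 / real N) * (\<Sum>n<N. norm (x n)))\<^sup>2" by (intro power_mono) auto
 also have "... = (1 / real N)\<^sup>2 * (\<Sum>n<N. norm (x n))\<^sup>2" by (simp only: power_mult_distrib)
 also have "... <= (1 / real N)\<^sup>2 * (real N * (\<Sum>n<N. (norm (x n))\<^sup>2))"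
  using sum_squared_le_sum_of_squares[of "\<lambda>n. norm (x n)" "{..<N}"]
  by (intro mult_left_mono) (auto simp: mult.commute)
 also have "... = average (\<lambda>n. (norm (x n))\<^sup>2) N"
  by (simp add: average_def power2_eq_square)
 finally show ?thesis .
qed

text \<open>Replacing \<open>x\<close> by means over \<open>L\<close> consecutive terms changes the
  averages by a vanishing amount, and the averaged squared norms of these means converge to
  \<open>(norm (average z L))^2\<close>. The limiting correlations enter as the Gram matrix of a
  second sequence, so that decay is asked only of the averages of \<open>z\<close>.\<close>

lemma van_der_corput:
 fixes x :: "nat => 'h::complex_hilbert_space" and z :: "nat => 't::complex_hilbert_space"
 assumes C: "!!n. norm (x n) <= C"
  and corr: "!!h k. (\<lambda>N. average (\<lambda>n. cinner (x (n + h)) (x (n + k))) N) \<longlonglongrightarrow> cinner (z h) (z k)"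
  and L: "L > 0" and e: "e > 0"
 shows "eventually (\<lambda>N. norm (average x N) < norm (average z L) + e) sequentially"
proof -
 define y where "y n = (1 / real L) *\<^sub>R (\<Sum>h<L. x (n + h))" for n
 have y_avg: "average y N - average x N = (1 / real L) *\<^sub>R (\<Sum>h<L. average (\<lambda>n. x (n + h)) N - average x N)" for N
 proof -
  have "average y N = (1 / real L) *\<^sub>R (\<Sum>h<L. average (\<lambda>n. x (n + h)) N)"
   unfolding average_def y_def scaleR_sum_right by (subst sum.swap) (simp add: mult.commute)
  moreover have "average x N = (1 / real L) *\<^sub>R (\<Sum>h<L. average x N)"
   using L by (simp add: sum_constant_scaleR)
  ultimately show ?thesis by (simp only: sum_subtractf scaleR_diff_right)
 qed
 have "(\<lambda>N. average y N - average x N) \<longlonglongrightarrow> (1 / real L) *\<^sub>R (\<Sum>h<L. 0)"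
  unfolding y_avg by (intro tendsto_scaleR tendsto_const tendsto_sum average_shift_tendsto[OF C])
 then have lim1: "(\<lambda>N. norm (average y N - average x N)) \<longlonglongrightarrow> 0" by (simp add: tendsto_norm_zero)
 have ny: "(norm (y n))\<^sup>2 = (1 / real L)\<^sup>2 * (\<Sum>h<L. \<Sum>k<L. Re (cinner (x (n + h)) (x (n + k))))" for n
 proof -
  have "cinner (y n) (y n) = of_real ((1 / real L)\<^sup>2) * (\<Sum>h<L. \<Sum>k<L. cinner (x (n + h)) (x (n + k)))"
   by (simp add: y_def cinner_simps cinner_sum_sum power2_eq_square)
  from arg_cong[OF this, of Re] show ?thesis by (simp add: cinner_self_Re)
 qed
 have avg_ny: "average (\<lambda>n. (norm (y n))\<^sup>2) N
   = (1 / real L)\<^sup>2 * (\<Sum>h<L. \<Sum>k<L. Re (average (\<lambda>n. cinner (x (n + h)) (x (n + k))) N))" for N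
  unfolding ny average_def
  by (simp add: sum_distrib_left sum_divide_distrib) (subst sum.swap, simp add: sum.swap[of _ _ "{..<N}"])
 have "(\<lambda>N. average (\<lambda>n. (norm (y n))\<^sup>2) N) \<longlonglongrightarrow> (1 / real L)\<^sup>2 * (\<Sum>h<L. \<Sum>k<L. Re (cinner (z h) (z k)))"
  unfolding avg_ny by (intro tendsto_mult tendsto_const tendsto_sum tendsto_Re corr)
 also have "(1 / real L)\<^sup>2 * (\<Sum>h<L. \<Sum>k<L. Re (cinner (z h) (z k))) = (norm (average z L))\<^sup>2"
 proof -
  have "cinner (average z L) (average z L) = of_real ((1 / real L)\<^sup>2) * (\<Sum>h<L. \<Sum>k<L. cinner (z h) (z k))"
   by (simp add: average_def cinner_simps cinner_sum_sum power2_eq_square)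
  from arg_cong[OF this, of Re] show ?thesis by (simp add: cinner_self_Re)
 qed
 finally have lim2: "(\<lambda>N. average (\<lambda>n. (norm (y n))\<^sup>2) N) \<longlonglongrightarrow> (norm (average z L))\<^sup>2" .
 have "(\<lambda>N. sqrt (average (\<lambda>n. (norm (y n))\<^sup>2) N) + norm (average y N - average x N)) \<longlonglongrightarrow> sqrt ((norm (average z L))\<^sup>2) + 0"
  by (intro tendsto_add tendsto_real_sqrt lim1 lim2)
 then have "eventually (\<lambda>N. sqrt (average (\<lambda>n. (norm (y n))\<^sup>2) N) + norm (average y N - average x N)
   < norm (average z L) + e) sequentially"
  using e by (simp add: order_tendstoD)
 then show ?thesis
 proof eventually_elim
  case (elim N)
  have "norm (average x N) <= norm (average y N) + norm (average y N - average x N)"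
   using norm_triangle_ineq4[of "average y N" "average y N - average x N"] by simp
  also have "norm (average y N) <= sqrt (average (\<lambda>n. (norm (y n))\<^sup>2) N)"
   by (rule real_le_rsqrt[OF norm_average_square])
  finally show ?case using elim by simp
 qed
qed

lemma bessel_inequality:
 fixes e :: "'i => 'h::complex_hilbert_space"
 assumes F: "finite F" and on: "!!i j. i \<in> F ==> j \<in> F ==> cinner (e i) (e j) = (if i = j then 1 else 0)"
 shows "(\<Sum>i\<in>F. (cmod (cinner x (e i)))\<^sup>2) <= (norm x)\<^sup>2"
proof -
 define p where "p = (\<Sum>i\<in>F. cinner x (e i) *\<^sub>C e i)"
 have px: "cinner p x = of_real (\<Sum>i\<in>F. (cmod (cinner x (e i)))\<^sup>2)"
 proof -
  have "cinner x (e i) * cinner (e i) x = of_real ((cmod (cinner x (e i)))\<^sup>2)" for i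
   using complex_norm_square[of "cinner x (e i)"] by (simp flip: cinner_commute)
  then show ?thesis by (simp add: p_def cinner_sum_left cinner_simps)
 qed
 have pe: "cinner p (e j) = cinner x (e j)" if "j \<in> F" for j
 proof -
  have "cinner p (e j) = (\<Sum>i\<in>F. if i = j then cinner x (e i) else 0)"
   unfolding p_def cinner_sum_left using on that by (intro sum.cong refl) (simp add: cinner_simps)
  then show ?thesis using F that by simp
 qed
 have "cinner p p = (\<Sum>i\<in>F. cnj (cinner x (e i)) * cinner p (e i))"
  by (subst (2) p_def) (simp add: cinner_sum_right cinner_simps)
 also have "... = of_real (\<Sum>i\<in>F. (cmod (cinner x (e i)))\<^sup>2)"
  unfolding of_real_sum using complex_norm_square
  by (intro sum.cong refl) (simp add: pe del: of_real_power)
 finally have "(norm p)\<^sup>2 = (\<Sum>i\<in>F. (cmod (cinner x (e i)))\<^sup>2)"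
  using cinner_self_Re[of p] by simp
 moreover have "Re (cinner x p) = (\<Sum>i\<in>F. (cmod (cinner x (e i)))\<^sup>2)"
  using px Re_cinner_commute[of x p] by simp
 ultimately show ?thesis using norm_diff_square[of x p] zero_le_power2[of "norm (x - p)"] by simp
qed

text \<open>Negative powers use \<open>inv_into H U\<close>, since only the values of
  \<open>U\<close> on \<open>H\<close> matter and \<open>U\<close> need not be injective
  outside.\<close>

definition upow :: "'h::complex_hilbert_space set => ('h => 'h) => int => 'h => 'h" where
 "upow H U m = (if 0 <= m then U ^^ nat m else (inv_into H U) ^^ nat (- m))"

locale unitary_on_subspace =
 fixes H :: "'h::complex_hilbert_space set" and U :: "'h => 'h"
 assumes closed_H: "closed_csubspace H" and unitary: "unitary_on H U"
begin

abbreviation "Up \<equiv> upow H U"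

lemmas H = closed_csubspaceD[OF closed_H]

lemma U_op: "bounded_op H U" and U_bij: "bij_betw U H H"
 and U_cinner: "x \<in> H ==> y \<in> H ==> cinner (U x) (U y) = cinner x y"
 using unitary by (auto simp: unitary_on_def)

lemmas U_H = bounded_opD(1)[OF U_op]

lemma inv_H: "x \<in> H ==> inv_into H U x \<in> H"
 by (metis U_bij bij_betw_def inv_into_into)

lemma U_inv: "x \<in> H ==> U (inv_into H U x) = x" and inv_U: "x \<in> H ==> inv_into H U (U x) = x"
 using U_bij by (simp_all add: bij_betw_inv_into_right bij_betw_inv_into_left)

lemma upow_0 [simp]: "Up 0 = id" by (simp add: upow_def)

lemma upow_mem: "x \<in> H ==> Up m x \<in> H"
proof -
 have "x \<in> H ==> (U ^^ n) x \<in> H" "x \<in> H ==> (inv_into H U ^^ n) x \<in> H" for n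
  by (induction n) (simp_all add: U_H inv_H)
 then show "x \<in> H ==> Up m x \<in> H" by (simp add: upow_def)
qed

lemma upow_succ: "x \<in> H ==> Up (m + 1) x = U (Up m x)"
proof (cases "0 <= m")
 case True then show ?thesis by (simp add: upow_def nat_add_distrib)
next
 case False
 assume x: "x \<in> H"
 define n where "n = nat (- m) - 1"
 have m: "m = - int (Suc n)" using False by (simp add: n_def)
 have "(inv_into H U ^^ n) x \<in> H" using x by (induction n) (simp_all add: inv_H)
 then show ?thesis by (cases "n = 0") (simp_all add: m upow_def U_inv nat_add_distrib)
qed

lemma upow_pred: "x \<in> H ==> Up (m - 1) x = inv_into H U (Up m x)"
 using upow_succ[of x "m - 1"] inv_U[OF upow_mem[of x "m - 1"]] by simp

lemma upow_1: "x \<in> H ==> Up 1 x = U x"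
 using upow_succ[of x 0] by simp

lemma upow_add: "x \<in> H ==> Up (m + n) x = Up m (Up n x)"
proof (induction m rule: int_induct[where k = 0])
 case (step1 i)
 have "Up (i + 1 + n) x = U (Up (i + n) x)"
  using upow_succ[OF step1(3), of "i + n"] by (simp add: algebra_simps)
 then show ?case using step1 upow_succ[OF upow_mem[of x n], of i] by simp
next
 case (step2 i)
 have "Up (i - 1 + n) x = inv_into H U (Up (i + n) x)"
  using upow_pred[OF step2(3), of "i + n"] by (simp add: algebra_simps)
 then show ?case using step2 upow_pred[OF upow_mem[of x n], of i] by simp
qed simp

lemma upow_inverse: "x \<in> H ==> Up (- m) (Up m x) = x"
 using upow_add[of x "- m" m] by simp

lemma inv_op: "bounded_op H (inv_into H U)"
proof (rule bounded_opI[of _ _ 1])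
 fix x y c assume x: "x \<in> H"
 show "inv_into H U x \<in> H" by (rule inv_H[OF x])
 show "inv_into H U (c *\<^sub>C x) = c *\<^sub>C inv_into H U x"
  using inv_U[OF H(4)[OF inv_H[OF x], of c]] bounded_opD(3)[OF U_op inv_H[OF x], of c] by (simp add: U_inv x)
 have "(norm (inv_into H U x))\<^sup>2 = (norm x)\<^sup>2"
  using U_cinner[OF inv_H[OF x] inv_H[OF x]] by (simp add: U_inv x cinner_self_Re[symmetric])
 then show "norm (inv_into H U x) <= 1 * norm x" by simp
 assume y: "y \<in> H"
 show "inv_into H U (x + y) = inv_into H U x + inv_into H U y"
  using inv_U[OF H(3)[OF inv_H[OF x] inv_H[OF y]]] bounded_opD(2)[OF U_op inv_H[OF x] inv_H[OF y]]
  by (simp add: U_inv x y)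
qed

lemma upow_op: "bounded_op H (Up m)"
proof (induction m rule: int_induct[where k = 0])
 case base show ?case by (rule bounded_opI[of _ _ 1]) simp_all
next
 case (step1 i)
 from bounded_op_compose[OF U_op step1(2)] show ?case
  unfolding bounded_op_def by (simp add: upow_succ H)
next
 case (step2 i)
 from bounded_op_compose[OF inv_op step2(2)] show ?case
  unfolding bounded_op_def by (simp add: upow_pred H)
qed

lemmas upow_linear = bounded_opD(2,3)[OF upow_op] bounded_op_more[OF upow_op closed_H]

lemma upow_cinner: "x \<in> H ==> y \<in> H ==> cinner (Up m x) (Up m y) = cinner x y"
proof (induction m rule: int_induct[where k = 0])
 case (step1 i) then show ?case by (simp add: upow_succ U_cinner upow_mem)
next
 case (step2 i)
 then show ?case
  using U_cinner[OF inv_H[OF upow_mem[of x i]] inv_H[OF upow_mem[of y i]]] by (simp add: upow_pred U_inv upow_mem)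
qed simp

lemma upow_norm: "x \<in> H ==> norm (Up m x) = norm x"
 using upow_cinner[of x x m] cinner_self_Re[of "Up m x"] cinner_self_Re[of x] by simp

lemma upow_cinner_adjoint: "x \<in> H ==> y \<in> H ==> cinner (Up m x) y = cinner x (Up (- m) y)"
 using upow_cinner[of x "Up (- m) y" m] upow_add[of y m "- m"] by (simp add: upow_mem)

lemma upow_unitary: "unitary_on H (Up m)"
 unfolding unitary_on_def
proof (intro conjI ballI upow_op upow_cinner)
 have right: "Up m (Up (- m) x) = x" if "x \<in> H" for x
  using upow_add[OF that, of m "- m"] by simp
 show "bij_betw (Up m) H H"
  by (rule bij_betw_byWitness[of _ "Up (- m)"]) (auto simp: upow_inverse upow_mem right)
qed

lemma upow_eigen:
 assumes x: "x \<in> H" and e: "U x = v *\<^sub>C x" and v: "cmod v = 1"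
 shows "Up m x = (v powi m) *\<^sub>C x"
proof (induction m rule: int_induct[where k = 0])
 case (step1 i)
 have v0: "v ~= 0" using v by auto
 from step1 have "Up (i + 1) x = (v powi i * v) *\<^sub>C x"
  by (simp add: upow_succ x bounded_opD(3)[OF U_op] e scaleC_scaleC)
 then show ?case using v0 by (simp add: power_int_add)
next
 case (step2 i)
 have v0: "v ~= 0" using v by auto
 have "inv_into H U x = inverse v *\<^sub>C x"
 proof -
  have "U (inverse v *\<^sub>C x) = x" using v0 by (simp add: bounded_opD(3)[OF U_op x] e scaleC_scaleC)
  then show ?thesis using inv_U[OF H(4)[OF x, of "inverse v"]] by simp
 qed
 with step2 have "Up (i - 1) x = (v powi i * inverse v) *\<^sub>C x"
  by (simp add: upow_pred x bounded_opD(3)[OF inv_op] scaleC_scaleC)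
 then show ?case using v0 by (simp add: power_int_diff divide_inverse)
qed simp

lemma eigenvalue_norm:
 assumes x: "x \<in> H" "x ~= 0" and e: "U x = v *\<^sub>C x"
 shows "cmod v = 1"
proof -
 have "norm (U x) = norm x" using upow_norm[OF x(1), of 1] by (simp add: upow_1 x)
 then show ?thesis using x(2) by (simp add: e norm_scaleC)
qed

lemma unitary_on_subspace_upow: "unitary_on_subspace H (Up m)"
 by unfold_locales (rule closed_H, rule upow_unitary)

end

section \<open>Polynomials in an operator and Krylov sequences\<close>

definition poly_action :: "('h::complex_normed_vector => 'h) => complex poly => 'h => 'h" where
 "poly_action T p z = fold_coeffs (\<lambda>a v. a *\<^sub>C z + T v) p 0"

context
 fixes H :: "'h::complex_hilbert_space set" and T :: "'h => 'h" and z :: 'h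
 assumes H: "closed_csubspace H" and T: "bounded_op H T" and z: "z \<in> H"
begin

lemma poly_action_0 [simp]: "poly_action T 0 z = 0"
 by (simp add: poly_action_def)

lemma poly_action_pCons: "poly_action T (pCons a p) z = a *\<^sub>C z + T (poly_action T p z)"
 using bounded_op_more(1)[OF T H]
 by (cases "p = 0 \<and> a = 0") (auto simp: poly_action_def)

lemma poly_action_mem: "poly_action T p z \<in> H"
 by (induction p) (simp_all add: poly_action_pCons closed_csubspaceD[OF H] z bounded_opD(1)[OF T])

lemma poly_action_invariant:
 assumes "closed_csubspace K" "z \<in> K" "!!x. x \<in> K ==> T x \<in> K"
 shows "poly_action T p z \<in> K"
 by (induction p) (simp_all add: poly_action_pCons closed_csubspaceD[OF assms(1)] assms)

lemma poly_action_add: "poly_action T (p + q) z = poly_action T p z + poly_action T q z"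
 by (induction p q rule: poly_induct2)
  (simp_all add: poly_action_pCons scaleC_add_left bounded_opD(2)[OF T] poly_action_mem)

lemma poly_action_smult: "poly_action T (smult c p) z = c *\<^sub>C poly_action T p z"
 by (induction p)
  (simp_all add: poly_action_pCons scaleC_add_right scaleC_scaleC bounded_opD(3)[OF T] poly_action_mem)

lemma poly_action_diff: "poly_action T (p - q) z = poly_action T p z - poly_action T q z"
 using poly_action_add[of p "smult (- 1) q"] poly_action_smult[of "- 1" q] by simp

lemma poly_action_sum: "poly_action T (\<Sum>i\<in>I. p i) z = (\<Sum>i\<in>I. poly_action T (p i) z)"
 by (induction I rule: infinite_finite_induct) (simp_all add: poly_action_add)

lemma poly_action_monom: "poly_action T (monom 1 n) z = (T ^^ n) z"
 by (induction n) (simp_all add: monom_0 monom_Suc poly_action_pCons bounded_op_more(1)[OF T H])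

text \<open>Split off a root, \<open>p = (t - v) q\<close>. Either \<open>q\<close> also annihilates
  \<open>z\<close> and has smaller degree, or its value at \<open>z\<close> is an
  eigenvector.\<close>

lemma poly_action_eigenvector:
 assumes p: "p ~= 0" "poly_action T p z = 0" and z0: "z ~= 0"
 obtains q v where "poly_action T q z ~= 0" "T (poly_action T q z) = v *\<^sub>C poly_action T q z"
 using p
proof (induction "degree p" arbitrary: p thesis)
 case 0
 then obtain c where c: "p = [:c:]" by (metis degree_eq_zeroE)
 with 0 z0 show ?case by (simp add: poly_action_pCons bounded_op_more(1)[OF T H]) (metis norm_eq_zero norm_scaleC no_zero_divisors)
next
 case (Suc n)
 then have "\<not> constant (poly p)" by (simp add: constant_degree)
 then obtain v where "poly p v = 0" using fundamental_theorem_of_algebra by auto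
 then obtain q where q: "p = [:- v, 1:] * q" using poly_eq_0_iff_dvd by blast
 have q0: "q ~= 0" using Suc.prems q by auto
 have "poly_action T p z = T (poly_action T q z) - v *\<^sub>C poly_action T q z"
  unfolding q by (simp add: poly_action_diff poly_action_smult poly_action_pCons)
 then have eq: "T (poly_action T q z) = v *\<^sub>C poly_action T q z" using Suc.prems by simp
 show ?case
 proof (cases "poly_action T q z = 0")
  case True
  have "degree p = degree [:- v, 1:] + degree q" unfolding q by (rule degree_mult_eq) (use q0 in auto)
  then have "n = degree q" using Suc.hyps(2) by simp
  from Suc.hyps(1)[OF this _ q0 True] Suc.prems(1) show ?thesis by auto
 qed (use eq Suc.prems(1) in blast)
qed

text \<open>Gram-Schmidt on the Krylov sequence \<open>z, Tz, T\<^sup>2z, ...\<close>.\<close>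

lemma krylov_annihilator:
 fixes D :: nat
 assumes E: "!!n. (T ^^ n) z \<in> E" "closed_csubspace E"
  and bound: "!!n e. (!!i. i < n ==> e i \<in> E) ==>
   (!!i j. i < n ==> j < n ==> cinner (e i) (e j) = (if i = j then 1 else 0)) ==> n <= D"
 obtains p where "p ~= 0" "poly_action T p z = 0"
proof (rule ccontr)
 assume "\<not> thesis"
 then have none: "p ~= 0 ==> poly_action T p z ~= 0" for p using that by auto
 have memE: "poly_action T p z \<in> E" for p
 proof -
  have "poly_action T p z = (\<Sum>i\<le>degree p. coeff p i *\<^sub>C (T ^^ i) z)"
   by (subst poly_as_sum_of_monoms[symmetric])
    (simp add: poly_action_sum flip: poly_action_monom poly_action_smult, simp add: smult_monom)
  then show ?thesis by (simp add: closed_csubspace_sum[OF E(2)] closed_csubspaceD[OF E(2)] E(1))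
 qed
 have "\<exists>q. (\<forall>i<n. degree (q i) <= i) \<and> (\<forall>i<n. \<forall>j<n.
  cinner (poly_action T (q i) z) (poly_action T (q j) z) = (if i = j then 1 else 0))" for n
 proof (induction n)
  case (Suc n)
  then obtain q where q: "!!i. i < n ==> degree (q i) <= i" "!!i j. i < n ==> j < n ==>
   cinner (poly_action T (q i) z) (poly_action T (q j) z) = (if i = j then 1 else 0)" by auto
  let ?e = "\<lambda>i. poly_action T (q i) z"
  define u where "u = (T ^^ n) z"
  \<comment> \<open>\<open>r\<close> has leading coefficient one, so it is nonzero, and
    \<open>poly_action T r z\<close> is nonzero under the assumption that no polynomial annihilates
    \<open>z\<close>.\<close>
  define r where "r = monom 1 n - (\<Sum>i<n. smult (cinner u (?e i)) (q i))"
  have "coeff (q i) n = 0" if "i < n" for i using q(1)[OF that] that by (simp add: coeff_eq_0)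
  then have "coeff r n = 1" by (simp add: r_def coeff_sum)
  then have "r ~= 0" by auto
  then have r0: "poly_action T r z ~= 0" by (rule none)
  have dr: "degree r <= n"
  proof -
   have "degree (\<Sum>i<n. smult (cinner u (?e i)) (q i)) <= n"
    by (rule degree_sum_le) (use q(1) in \<open>auto intro: dest: less_imp_le order_trans\<close>)
   then show ?thesis unfolding r_def by (intro degree_diff_le degree_monom_le)
  qed
  have ar: "poly_action T r z = u - (\<Sum>i<n. cinner u (?e i) *\<^sub>C ?e i)"
   by (simp add: r_def poly_action_diff poly_action_sum poly_action_smult poly_action_monom u_def)
  have orth: "cinner (poly_action T r z) (?e j) = 0" if "j < n" for j
  proof -
   have "(\<Sum>i<n. cinner u (?e i) * cinner (?e i) (?e j)) = (\<Sum>i<n. if i = j then cinner u (?e i) else 0)"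
    by (rule sum.cong) (use q(2) that in auto)
   then show ?thesis using that by (simp add: ar cinner_simps cinner_sum_left)
  qed
  define c where "c = complex_of_real (1 / norm (poly_action T r z))"
  define q' where "q' = q(n := smult c r)"
  have norm1: "cinner (poly_action T (smult c r) z) (poly_action T (smult c r) z) = 1"
   using r0 by (simp add: poly_action_smult cinner_self norm_scaleC c_def norm_divide)
  have orth1: "cinner (poly_action T (smult c r) z) (?e j) = 0" "cinner (?e j) (poly_action T (smult c r) z) = 0" if "j < n" for j
  proof -
   show *: "cinner (poly_action T (smult c r) z) (?e j) = 0" using orth[OF that] by (simp add: poly_action_smult cinner_simps)
   show "cinner (?e j) (poly_action T (smult c r) z) = 0" by (subst cinner_commute) (simp add: *)
  qed
  show ?case
  proof (intro exI[of _ q'] conjI allI impI)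
   show "degree (q' i) <= i" if "i < Suc n" for i
    using that q(1)[of i] order_trans[OF degree_smult_le dr, of c] by (auto simp: q'_def)
   show "cinner (poly_action T (q' i) z) (poly_action T (q' j) z) = (if i = j then 1 else 0)"
    if "i < Suc n" "j < Suc n" for i j
    using that q(2)[of i j] norm1 orth1[of i] orth1[of j] by (auto simp: q'_def)
  qed
 qed simp
 then obtain q where "\<forall>i<Suc D. \<forall>j<Suc D.
  cinner (poly_action T (q i) z) (poly_action T (q j) z) = (if i = j then 1 else 0)" by blast
 then have "Suc D <= D" by (intro bound[of "Suc D" "\<lambda>i. poly_action T (q i) z"] memE) auto
 then show False by simp
qed

end

section \<open>The orthogonal complement of the eigenvectors\<close>

context unitary_on_subspace
begin

definition continuous_part :: "'h set" where
 "continuous_part = {y \<in> H. \<forall>e\<in>H. \<forall>v. U e = v *\<^sub>C e \<longrightarrow> cinner y e = 0}"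

lemma continuous_part_closed: "closed_csubspace continuous_part"
 unfolding closed_csubspace_def
proof (intro conjI ballI allI)
 show "closed continuous_part"
 proof (rule closed_sequential_limits[THEN iffD2], intro allI impI, elim conjE)
  fix f l assume f: "\<forall>n. f n \<in> continuous_part" "f \<longlonglongrightarrow> l"
  have "l \<in> H" by (rule closed_sequentially[OF H(1) _ f(2)]) (use f(1) in \<open>simp add: continuous_part_def\<close>)
  moreover have "cinner l e = 0" if "e \<in> H" "U e = v *\<^sub>C e" for e v
  proof -
   have "cinner (f n) e = 0" for n using f(1) that by (auto simp: continuous_part_def)
   then show ?thesis using tendsto_cinner[OF f(2) tendsto_const, of e] LIMSEQ_unique[OF _ tendsto_const] by simp
  qed
  ultimately show "l \<in> continuous_part" by (auto simp: continuous_part_def)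
 qed
qed (auto simp: continuous_part_def H cinner_simps)

lemma continuous_part_sub: "continuous_part \<subseteq> H"
 by (auto simp: continuous_part_def)

lemma continuous_part_upow:
 assumes y: "y \<in> continuous_part"
 shows "Up m y \<in> continuous_part"
proof -
 have "cinner (Up m y) e = 0" if e: "e \<in> H" "U e = v *\<^sub>C e" for e v
 proof (cases "e = 0")
  case False
  have "cmod v = 1" by (rule eigenvalue_norm[OF e(1) False e(2)])
  then have "Up (- m) e = (v powi (- m)) *\<^sub>C e" by (rule upow_eigen[OF e])
  then have "cinner (Up m y) e = cnj (v powi (- m)) * cinner y e"
   using upow_cinner_adjoint[of y e m] y e by (simp add: continuous_part_def cinner_simps)
  then show ?thesis using y e by (auto simp: continuous_part_def)
 qed simp
 then show ?thesis using y by (auto simp: continuous_part_def upow_mem)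
qed

lemma continuous_part_no_eigenvector:
 assumes e: "e \<in> continuous_part" "U e = v *\<^sub>C e"
 shows "e = 0"
 using assms by (auto simp: continuous_part_def)

text \<open>If \<open>e\<close> were nonzero, it would be annihilated by \<open>t^n - w\<close> in
  \<open>U\<close>, so some polynomial in \<open>U\<close> would take it to an eigenvector of
  \<open>U\<close>; this stays in the continuous part, which contains none.\<close>

lemma continuous_part_no_power_eigenvector:
 assumes e: "e \<in> continuous_part" "Up m e = v *\<^sub>C e" and m: "m ~= 0"
 shows "e = 0"
proof (rule ccontr)
 assume e0: "e ~= 0"
 have eH: "e \<in> H" using e(1) continuous_part_sub by auto
 have v: "cmod v = 1"
  using upow_norm[OF eH, of m] e0 e(2) by (simp add: norm_scaleC)
 \<comment> \<open>Polynomials require nonnegative exponents; a negative \<open>m\<close> is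
   exchanged for its opposite, with the inverse eigenvalue.\<close>
 obtain n w where n: "n > 0" "Up (int n) e = w *\<^sub>C e"
 proof (cases "m > 0")
  case True
  then show ?thesis using that[of "nat m" v] e(2) by simp
 next
  case False
  have "e = Up (- m) (Up m e)" by (simp add: upow_inverse eH)
  also have "... = v *\<^sub>C Up (- m) e" by (simp add: e(2) upow_linear eH)
  finally have "inverse v *\<^sub>C e = Up (- m) e"
   using v by (metis scaleC_scaleC scaleC_one left_inverse norm_zero zero_neq_one)
  then show ?thesis using that[of "nat (- m)" "inverse v"] False m by simp
 qed
 define p where "p = monom 1 n - [:w:]"
 have "coeff p n = 1" using n(1) by (cases n) (simp_all add: p_def)
 then have p: "p ~= 0" by auto
 have Un: "(U ^^ n) e = Up (int n) e" by (simp add: upow_def)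
 have "poly_action U p e = 0"
  by (simp add: p_def poly_action_diff[OF closed_H U_op eH] poly_action_monom[OF closed_H U_op eH]
    poly_action_pCons[OF closed_H U_op eH] poly_action_0[OF closed_H U_op eH] bounded_op_more(1)[OF U_op closed_H] Un n(2))
 then obtain q u where q: "poly_action U q e ~= 0" "U (poly_action U q e) = u *\<^sub>C poly_action U q e"
  using poly_action_eigenvector[OF closed_H U_op eH p _ e0] by auto
 have "poly_action U q e \<in> continuous_part"
 proof (rule poly_action_invariant[OF closed_H U_op eH continuous_part_closed e(1)])
  show "U x \<in> continuous_part" if "x \<in> continuous_part" for x
   using continuous_part_upow[OF that, of 1] upow_1[of x] that continuous_part_sub by auto
 qed
 then show False using q continuous_part_no_eigenvector by simp
qed

end

text \<open>A countable product of discs is compact and first countable, hence sequentially compact;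
  this takes the place of a diagonal argument.\<close>

lemma bounded_complex_family_subsequence:
 fixes f :: "nat => nat => complex"
 assumes "!!n h. cmod (f n h) <= B h"
 obtains s where "strict_mono s" "!!h. convergent (\<lambda>n. f (s n) h)"
proof -
 define C where "C = PiE UNIV (\<lambda>h. cball (0::complex) (B h))"
 have "compactin (product_topology (\<lambda>i. euclidean) UNIV) C"
  unfolding C_def compactin_PiE by simp
 then have "compact C" by (simp add: euclidean_product_topology)
 then have "seq_compact C" by (rule compact_imp_seq_compact)
 moreover have "\<forall>n. f n \<in> C" using assms by (simp add: C_def PiE_iff)
 ultimately obtain l s where "strict_mono s" "(f \<circ> s) \<longlonglongrightarrow> l" unfolding seq_compact_def by metis
 have "(\<lambda>n. f (s n) h) \<longlonglongrightarrow> l h" for h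
 proof -
  have "continuous_on UNIV (\<lambda>x::nat => complex. x h)" by simp
  from continuous_on_tendsto_compose[OF this \<open>(f \<circ> s) \<longlonglongrightarrow> l\<close>] show ?thesis by simp
 qed
 with \<open>strict_mono s\<close> show ?thesis by (intro that) (auto simp: convergent_def)
qed

section \<open>Averages of tensor products\<close>

lemma hilbert_tensorD:
 assumes "hilbert_tensor tens"
 shows "tens (x + x') y = tens x y + tens x' y" "tens x (y + y') = tens x y + tens x y'"
  "tens (c *\<^sub>C x) y = c *\<^sub>C tens x y" "tens x (c *\<^sub>C y) = c *\<^sub>C tens x y"
  "cinner (tens x y) (tens x' y') = cinner x x' * cinner y y'"
  "norm (tens x y) = norm x * norm y" "tens (x - x') y = tens x y - tens x' y" "tens x (y - y') = tens x y - tens x y'"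
proof -
 have t: "!!x x' y. tens (x + x') y = tens x y + tens x' y" "!!x y y'. tens x (y + y') = tens x y + tens x y'"
  "!!c x y. tens (c *\<^sub>C x) y = c *\<^sub>C tens x y" "!!c x y. tens x (c *\<^sub>C y) = c *\<^sub>C tens x y"
  "!!x y x' y'. cinner (tens x y) (tens x' y') = cinner x x' * cinner y y'"
  using assms unfolding hilbert_tensor_def by blast+
 then show "tens (x + x') y = tens x y + tens x' y" "tens x (y + y') = tens x y + tens x y'"
  "tens (c *\<^sub>C x) y = c *\<^sub>C tens x y" "tens x (c *\<^sub>C y) = c *\<^sub>C tens x y"
  "cinner (tens x y) (tens x' y') = cinner x x' * cinner y y'" by blast+
 have "(norm (tens x y))\<^sup>2 = (norm x * norm y)\<^sup>2"
  using arg_cong[OF t(5)[of x y x y], of Re] by (simp add: cinner_self power_mult_distrib)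
 then show "norm (tens x y) = norm x * norm y" by simp
 show "tens (x - x') y = tens x y - tens x' y" using t(1)[of x "- x'" y] t(3)[of "-1" x' y] by simp
 show "tens x (y - y') = tens x y - tens x y'" using t(2)[of x y "- y'"] t(4)[of x "-1" y'] by simp
qed

lemma cinner_average_left: "cinner (average z N) v = average (\<lambda>h. cinner (z h) v) N"
 by (simp add: average_def cinner_simps cinner_sum_left scaleR_conv_of_real)

lemma cinner_average_right: "cinner v (average z N) = average (\<lambda>h. cinner v (z h)) N"
 by (simp add: average_def cinner_simps cinner_sum_right scaleR_conv_of_real)

context unitary_on_subspace
begin

text \<open>The averages converge to some \<open>t\<close>, whose slices define a compact antilinear operator \<open>r\<close>
 intertwining powers of \<open>U\<close>. If \<open>t ~= 0\<close>, the eigenspace of \<open>r\<^sup>* r\<close> for its largest eigenvalue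
 is finite-dimensional, invariant and contained in the continuous part, and therefore contains an eigenvector
 of a power of \<open>U\<close>.\<close>

lemma tensor_average_tendsto_zero:
 fixes tens :: "'h => 'h => 't::complex_hilbert_space"
 assumes tens: "hilbert_tensor tens" and x: "x \<in> H" and y: "y \<in> continuous_part" and q: "q ~= 0"
 shows "average (\<lambda>h. tens (Up (int h * p) x) (Up (int h * q) y)) \<longlonglongrightarrow> 0"
proof -
 note te = hilbert_tensorD[OF tens]
 define W1 where "W1 = Up p"
 define W2 where "W2 = Up q"
 define xs where "xs h = Up (int h * p) x" for h
 define ys where "ys h = Up (int h * q) y" for h
 define z where "z h = tens (xs h) (ys h)" for h
 have yH: "y \<in> H" using y continuous_part_sub by auto
 have xsH: "xs h \<in> H" and ysH: "ys h \<in> H" and ysK: "ys h \<in> continuous_part" for h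
  by (simp_all add: xs_def ys_def upow_mem x yH continuous_part_upow y)
 have xs_Suc: "xs (Suc h) = W1 (xs h)" and ys_Suc: "ys (Suc h) = W2 (ys h)" for h
  using upow_add[OF x, of p "int h * p"] upow_add[OF yH, of q "int h * q"]
  by (simp_all add: xs_def ys_def W1_def W2_def algebra_simps)
 have W1: "cinner (W1 a) (W1 b) = cinner a b" "W1 a \<in> H" and W2: "cinner (W2 a) (W2 b) = cinner a b" "W2 a \<in> H"
  if "a \<in> H" "b \<in> H" for a b
  using that by (simp_all add: W1_def W2_def upow_cinner upow_mem)
 have surj: "\<exists>a'\<in>H. a = W1 a'" "\<exists>a'\<in>H. a = W2 a'" if "a \<in> H" for a
  unfolding W1_def W2_def
  using upow_add[OF that, of p "- p"] upow_add[OF that, of q "- q"] that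
  by (auto intro!: bexI[OF _ upow_mem])
 have "convergent (average z)"
  by (rule stationary_mean_ergodic) (simp add: z_def te xs_Suc ys_Suc W1 W2 xsH ysH)
 then obtain t where t: "average z \<longlonglongrightarrow> t" by (auto simp: convergent_def)
 have "t = 0"
 proof (rule ccontr)
  assume t0: "t ~= 0"
  have z_bound: "norm (z n) <= norm x * norm y" for n
   by (simp add: z_def te xs_def ys_def upow_norm x yH)
  have t_inv: "cinner (tens (W1 a) (W2 b)) t = cinner (tens a b) t" if ab: "a \<in> H" "b \<in> H" for a b
  proof -
   have "(\<lambda>N. average (\<lambda>n. z (n + 1)) N - average z N + average z N) \<longlonglongrightarrow> 0 + t"
    by (intro tendsto_add average_shift_tendsto[OF z_bound] t)
   then have "(\<lambda>N. cinner (tens (W1 a) (W2 b)) (average (\<lambda>n. z (n + 1)) N)) \<longlonglongrightarrow> cinner (tens (W1 a) (W2 b)) t"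
    by (intro tendsto_cinner tendsto_const) simp
   moreover have "cinner (tens (W1 a) (W2 b)) (average (\<lambda>n. z (n + 1)) N) = cinner (tens a b) (average z N)" for N
    using ab by (simp add: cinner_average_right z_def te xs_Suc ys_Suc W1 W2 xsH ysH)
   ultimately show ?thesis using LIMSEQ_unique tendsto_cinner[OF tendsto_const t, of "tens a b"] by simp
  qed
  have uniq: "u = v" if "u \<in> H" "v \<in> H" "!!a. a \<in> H ==> cinner a u = cinner a v" for u v
  proof -
   have "cinner (u - v) (u - v) = 0" using that(3)[OF H(6)[OF that(1,2)]] by (simp add: cinner_diff_right)
   then show ?thesis by simp
  qed
  have cs: "cmod (cinner (tens a b) u) <= norm a * norm b * norm u" for a b u
   using cinner_cauchy_schwarz[of "tens a b" u] by (simp add: te)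
  \<comment> \<open>\<open>r\<close> and \<open>s\<close> are the two antilinear slices of
    \<open>t\<close>, adjoint to each other in the antilinear sense; \<open>s\<close> after
    \<open>r\<close> is the positive operator whose largest eigenvalue is sought.\<close>
  have "\<exists>u\<in>H. \<forall>a\<in>H. cinner (tens a b) t = cinner a u" if "b \<in> H" for b
  proof (rule riesz_representation[OF closed_H, of "\<lambda>a. cinner (tens a b) t" "norm b * norm t"])
   show "cmod (cinner (tens a b) t) <= norm b * norm t * norm a" for a using cs[of a b t] by (simp add: mult_ac)
  qed (auto simp: te cinner_simps)
  then obtain r where r: "!!b. b \<in> H ==> r b \<in> H" "!!a b. a \<in> H ==> b \<in> H ==> cinner (tens a b) t = cinner a (r b)"
   by metis
  have "\<exists>u\<in>H. \<forall>b\<in>H. cinner (tens a b) t = cinner b u" if "a \<in> H" for a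
  proof (rule riesz_representation[OF closed_H, of "\<lambda>b. cinner (tens a b) t" "norm a * norm t"])
   show "cmod (cinner (tens a b) t) <= norm a * norm t * norm b" for b using cs[of a b t] by (simp add: mult_ac)
  qed (auto simp: te cinner_simps)
  then obtain s where s: "!!a. a \<in> H ==> s a \<in> H" "!!a b. a \<in> H ==> b \<in> H ==> cinner (tens a b) t = cinner b (s a)"
   by metis
  have r_lin: "r (b + b') = r b + r b'" "r (c *\<^sub>C b) = cnj c *\<^sub>C r b" if "b \<in> H" "b' \<in> H" for b b' c
   by (rule uniq; use that in \<open>simp add: r H cinner_simps te flip: r(2)\<close>)+
  have s_lin: "s (b + b') = s b + s b'" "s (c *\<^sub>C b) = cnj c *\<^sub>C s b" if "b \<in> H" "b' \<in> H" for b b' c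
   by (rule uniq; use that in \<open>simp add: s H cinner_simps te flip: s(2)\<close>)+
  have r_diff: "r (b - b') = r b - r b'" and s_diff: "s (b - b') = s b - s b'" if "b \<in> H" "b' \<in> H" for b b'
   using r_lin(1)[OF that(1) H(4)[OF that(2), of "-1"]] r_lin(2)[OF that(2) that(2), of "-1"] s_lin(1)[OF that(1) H(4)[OF that(2), of "-1"]] s_lin(2)[OF that(2) that(2), of "-1"]
   by auto
  have r_bound: "norm (r b) <= norm t * norm b" if "b \<in> H" for b
  proof -
   have "(norm (r b))\<^sup>2 = Re (cinner (tens (r b) b) t)" using that by (simp add: r cinner_self)
   also have "... <= norm (r b) * norm b * norm t" using complex_Re_le_cmod cs order_trans by blast
   finally have "norm (r b) * norm (r b) <= norm (r b) * (norm t * norm b)" by (simp add: power2_eq_square mult_ac)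
   then show ?thesis by (rule square_le_imp_le) auto
  qed
  have s_bound: "norm (s b) <= norm t * norm b" if "b \<in> H" for b
  proof -
   have "(norm (s b))\<^sup>2 = Re (cinner (tens b (s b)) t)" using that by (simp add: s cinner_self)
   also have "... <= norm b * norm (s b) * norm t" using complex_Re_le_cmod cs order_trans by blast
   finally have "norm (s b) * norm (s b) <= norm (s b) * (norm t * norm b)" by (simp add: power2_eq_square mult_ac)
   then show ?thesis by (rule square_le_imp_le) auto
  qed
  have r_W: "r (W2 b) = W1 (r b)" if b: "b \<in> H" for b
  proof (rule uniq)
   fix a assume "a \<in> H"
   then obtain a' where a': "a' \<in> H" "a = W1 a'" using surj(1) by auto
   then show "cinner a (r (W2 b)) = cinner a (W1 (r b))"
    using t_inv[OF a'(1) b] b by (simp add: r W1 W2)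
  qed (use b in \<open>simp_all add: r W1 W2\<close>)
  have s_W: "s (W1 a) = W2 (s a)" if a: "a \<in> H" for a
  proof (rule uniq)
   fix b assume "b \<in> H"
   then obtain b' where b': "b' \<in> H" "b = W2 b'" using surj(2) by auto
   then show "cinner b (s (W1 a)) = cinner b (W2 (s a))"
    using t_inv[OF a b'(1)] a by (simp add: s W1 W2)
  qed (use a in \<open>simp_all add: s W1 W2\<close>)
  have sK: "s a \<in> continuous_part" if a: "a \<in> H" for a
  proof -
   have "cinner (s a) e = 0" if e: "e \<in> H" "U e = v *\<^sub>C e" for e v
   proof -
    have "cinner (tens a e) (z h) = 0" for h
    proof -
     have "cinner (ys h) e = 0" using ysK e by (auto simp: continuous_part_def)
     then have "cinner e (ys h) = 0" by (subst cinner_commute) simp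
     then show ?thesis by (simp add: z_def te)
    qed
    then have "cinner (tens a e) (average z N) = 0" for N unfolding cinner_average_right by (simp add: average_def)
    then have "cinner (tens a e) t = 0"
     using tendsto_cinner[OF tendsto_const t, of "tens a e"] LIMSEQ_unique[OF _ tendsto_const] by simp
    then have "cinner e (s a) = 0" using s(2)[OF a e(1)] by simp
    then show ?thesis by (subst cinner_commute) simp
   qed
   then show ?thesis using s(1)[OF a] by (auto simp: continuous_part_def)
  qed
  have sr: "cinner b' (s (r b)) = cinner (r b) (r b')" if "b \<in> H" "b' \<in> H" for b b'
   using s(2)[of "r b" b'] r(2)[of "r b" b'] that r(1) by simp
  have compact: "\<exists>f. strict_mono f \<and> convergent (\<lambda>n. r (b (f n)))" if b: "!!n. b n \<in> H" "!!n. norm (b n) <= 1" for b :: "nat => 'h"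
  proof -
   have "cmod (cinner (ys h) (b n)) <= norm y" for n h
   proof -
    have "cmod (cinner (ys h) (b n)) <= norm (ys h) * norm (b n)" by (rule cinner_cauchy_schwarz)
    also have "... <= norm y * 1" using b by (intro mult_mono) (auto simp: ys_def upow_norm yH)
    finally show ?thesis by simp
   qed
   then obtain f where f: "strict_mono f" "!!h. convergent (\<lambda>n. cinner (ys h) (b (f n)))"
    using bounded_complex_family_subsequence[of "\<lambda>n h. cinner (ys h) (b n)" "\<lambda>h. norm y"]
    by auto
   \<comment> \<open>The slices of the finite averages have finite rank and approximate
     \<open>r\<close> in norm, because the averages converge to \<open>t\<close>.\<close>
   define rN where "rN N b = average (\<lambda>h. cinner (ys h) b *\<^sub>C xs h) N" for N b
   have rNH: "rN N b \<in> H" for N b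
    unfolding rN_def average_def by (intro H(7) closed_csubspace_sum closed_H H(4) xsH)
   have approx: "norm (r b - rN N b) <= norm (t - average z N)" if b: "b \<in> H" "norm b <= 1" for N b
   proof -
    define u where "u = r b - rN N b"
    have u: "u \<in> H" unfolding u_def by (intro H(6) r rNH b)
    have "cinner u (rN N b) = cinner (tens u b) (average z N)"
    proof -
     have "cinner u (cinner (ys h) b *\<^sub>C xs h) = cinner (tens u b) (z h)" for h
      by (simp add: cinner_simps z_def te flip: cinner_commute)
     then show ?thesis unfolding rN_def cinner_average_right by simp
    qed
    then have "cinner u u = cinner (tens u b) (t - average z N)"
     by (subst (2) u_def) (simp add: cinner_diff_right r(2)[OF u b(1)])
    then have "(norm u)\<^sup>2 = Re (cinner (tens u b) (t - average z N))" by (metis cinner_self_Re)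
    also have "... <= norm u * norm b * norm (t - average z N)" using complex_Re_le_cmod cs order_trans by blast
    also have "... <= norm u * 1 * norm (t - average z N)"
     using b(2) by (intro mult_right_mono mult_left_mono) auto
    finally have "norm u * norm u <= norm u * norm (t - average z N)" by (simp add: power2_eq_square)
    then have "norm u <= norm (t - average z N)" by (rule square_le_imp_le) auto
    then show ?thesis by (simp add: u_def)
   qed
   have rN_conv: "convergent (\<lambda>n. rN N (b (f n)))" for N
   proof -
    obtain l where l: "!!h. (\<lambda>n. cinner (ys h) (b (f n))) \<longlonglongrightarrow> l h" using f(2) unfolding convergent_def by metis
    have lx: "(\<lambda>n. cinner (ys h) (b (f n)) *\<^sub>C xs h) \<longlonglongrightarrow> l h *\<^sub>C xs h" for h
    proof -
     have "(\<lambda>n. norm (cinner (ys h) (b (f n)) - l h) * norm (xs h)) \<longlonglongrightarrow> 0"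
      by (rule tendsto_mult_left_zero[OF tendsto_norm_zero[OF LIM_zero[OF l]]])
     then have "(\<lambda>n. cinner (ys h) (b (f n)) *\<^sub>C xs h - l h *\<^sub>C xs h) \<longlonglongrightarrow> 0"
      by - (rule tendsto_norm_zero_cancel, simp add: scaleC_diff_left[symmetric] norm_scaleC)
     then show ?thesis by (rule LIM_zero_cancel)
    qed
    have "(\<lambda>n. rN N (b (f n))) \<longlonglongrightarrow> average (\<lambda>h. l h *\<^sub>C xs h) N"
     unfolding rN_def average_def by (rule tendsto_scaleR[OF tendsto_const tendsto_sum[OF lx]])
    then show ?thesis by (auto simp: convergent_def)
   qed
   have "Cauchy (\<lambda>n. r (b (f n)))"
   proof (rule CauchyI)
    fix e :: real assume e: "e > 0"
    have "(\<lambda>N. norm (t - average z N)) \<longlonglongrightarrow> 0"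
     using tendsto_norm_zero[OF LIM_zero[OF t]] by (simp add: norm_minus_commute)
    from order_tendstoD(2)[OF this, of "e / 3"]
    have "eventually (\<lambda>N. norm (t - average z N) < e / 3) sequentially" using e by simp
    then obtain N where N: "norm (t - average z N) < e / 3" by (auto simp: eventually_sequentially)
    have "Cauchy (\<lambda>n. rN N (b (f n)))" using rN_conv by (rule convergent_Cauchy)
    then obtain M where M: "!!i j. i >= M ==> j >= M ==> norm (rN N (b (f i)) - rN N (b (f j))) < e / 3"
     using CauchyD[of "\<lambda>n. rN N (b (f n))" "e / 3"] e by auto
    show "\<exists>M. \<forall>i\<ge>M. \<forall>j\<ge>M. norm (r (b (f i)) - r (b (f j))) < e"
    proof (intro exI allI impI)
     fix i j assume ij: "M <= i" "M <= j"
     have "r (b (f i)) - r (b (f j)) = (r (b (f i)) - rN N (b (f i))) + (rN N (b (f i)) - rN N (b (f j)))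
       - (r (b (f j)) - rN N (b (f j)))" by simp
     also have "norm ... <= norm (r (b (f i)) - rN N (b (f i))) + norm (rN N (b (f i)) - rN N (b (f j)))
       + norm (r (b (f j)) - rN N (b (f j)))"
      by (intro order_trans[OF norm_triangle_ineq4] add_mono order_refl norm_triangle_ineq)
     also have "... < e"
      using approx[OF b, of "f i" N] approx[OF b, of "f j" N] M[OF ij] N by simp
     finally show "norm (r (b (f i)) - r (b (f j))) < e" .
    qed
   qed
   then show ?thesis using f(1) Cauchy_convergent by auto
  qed
  define S where "S = {(norm (r b))\<^sup>2 |b. b \<in> H \<and> norm b <= 1}"
  have S_le: "(norm (r b))\<^sup>2 <= (norm t)\<^sup>2" if "b \<in> H" "norm b <= 1" for b
  proof -
   have "norm (r b) <= norm t * 1" using r_bound[OF that(1)] mult_left_mono[OF that(2), of "norm t"] by simp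
   then show ?thesis by (intro power_mono) auto
  qed
  have bdd: "bdd_above S" by (rule bdd_aboveI[of _ "(norm t)\<^sup>2"]) (use S_le in \<open>auto simp: S_def\<close>)
  have S0: "(norm (r 0))\<^sup>2 \<in> S" unfolding S_def using H(2) by auto
  define m where "m = Sup S"
  have r_m: "(norm (r b))\<^sup>2 <= m" if "b \<in> H" "norm b <= 1" for b
   unfolding m_def by (rule cSup_upper[OF _ bdd]) (use that in \<open>auto simp: S_def\<close>)
  have "\<exists>b\<in>H. r b ~= 0"
  proof (rule ccontr)
   assume "\<not> ?thesis"
   then have "cinner (z h) t = 0" for h using r(2)[OF xsH ysH] ysH by (simp add: z_def)
   then have "cinner (average z N) t = 0" for N unfolding cinner_average_left by (simp add: average_def)
   then have "(\<lambda>N. 0) \<longlonglongrightarrow> cinner t t" using tendsto_cinner[OF t tendsto_const, of t] by simp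
   then have "cinner t t = 0" by (rule LIMSEQ_unique[OF _ tendsto_const])
   then show False using t0 by simp
  qed
  then obtain b0 where b0: "b0 \<in> H" "r b0 ~= 0" by auto
  have m0: "m > 0"
  proof -
   have "b0 ~= 0" using b0 r_lin(2)[OF b0(1) b0(1), of 0] by auto
   then have "(norm (r (of_real (1 / norm b0) *\<^sub>C b0)))\<^sup>2 <= m"
    by (intro r_m H(4) b0) (simp add: norm_scaleC norm_divide)
   moreover have "(norm (r (of_real (1 / norm b0) *\<^sub>C b0)))\<^sup>2 > 0"
    using b0 \<open>b0 ~= 0\<close> by (simp add: r_lin(2)[OF b0(1) b0(1)] norm_scaleC)
   ultimately show ?thesis by linarith
  qed
  have "\<exists>b. b \<in> H \<and> norm b <= 1 \<and> m - inverse (real (Suc n)) < (norm (r b))\<^sup>2" for n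
  proof -
   have "m - inverse (real (Suc n)) < Sup S" by (simp add: m_def)
   then show ?thesis using less_cSup_iff[OF _ bdd] S0 by (auto simp: S_def)
  qed
  then obtain b where b: "!!n. b n \<in> H" "!!n. norm (b n) <= 1" "!!n. m - inverse (real (Suc n)) < (norm (r (b n)))\<^sup>2"
   by metis
  obtain f where f: "strict_mono f" "convergent (\<lambda>n. r (b (f n)))" using compact[of b, OF b(1) b(2)] by (elim exE conjE)
  then obtain l where l: "(\<lambda>n. r (b (f n))) \<longlonglongrightarrow> l" by (auto simp: convergent_def)
  have lH: "l \<in> H" by (rule closed_sequentially[OF H(1) _ l]) (rule r(1)[OF b(1)])
  have tend: "(\<lambda>n. g (c n)) \<longlonglongrightarrow> g d"
   if g: "!!u v. u \<in> H ==> v \<in> H ==> g (u - v) = g u - g v" "!!u. u \<in> H ==> norm (g u) <= norm t * norm u"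
   and c: "!!n. c n \<in> H" "d \<in> H" "c \<longlonglongrightarrow> d" for g :: "'h => 'h" and c d
  proof -
   have "norm (g (c n) - g d) <= norm t * norm (c n - d)" for n
    using g(2)[OF H(6)[OF c(1)[of n] c(2)]] g(1)[OF c(1)[of n] c(2)] by simp
   from Lim_null_comparison[OF always_eventually[OF allI[OF this]] tendsto_mult_right_zero[OF tendsto_norm_zero[OF LIM_zero[OF c(3)]]]]
   show ?thesis by (rule LIM_zero_cancel)
  qed
  have sl: "(\<lambda>n. s (r (b (f n)))) \<longlonglongrightarrow> s l" by (rule tend[OF s_diff s_bound r(1)[OF b(1)] lH l])
  \<comment> \<open>A near-maximiser of \<open>norm (r b)\<close> on the unit ball is a
    near-eigenvector: expanding the square and using \<open>norm (s (r (b n))) <= m\<close> leaves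
    an error proportional to \<open>1 / (n + 1)\<close>.\<close>
  have "norm (s (r (b n)) - m *\<^sub>R b n) <= sqrt (2 * m * inverse (real (Suc n)))" for n
  proof -
   have le: "norm (s (r (b n))) <= m"
   proof (cases "s (r (b n)) = 0")
    case False
    define c where "c = s (r (b n))"
    have c: "c \<in> H" "c ~= 0" using False by (simp_all add: c_def s r b)
    define c' where "c' = of_real (1 / norm c) *\<^sub>C c"
    have c': "c' \<in> H" "norm c' <= 1" using c by (simp_all add: c'_def H norm_scaleC norm_divide)
    have "norm (r c') <= sqrt m" "norm (r (b n)) <= sqrt m"
     using r_m[OF c'] r_m[OF b(1,2)] real_le_rsqrt by blast+
    then have "norm (r (b n)) * norm (r c') <= sqrt m * sqrt m" using m0 by (intro mult_mono) auto
    then have "cmod (cinner c' c) <= m"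
     using cinner_cauchy_schwarz[of "r (b n)" "r c'"] m0 sr[OF b(1) c'(1), of n] by (simp add: c_def)
    moreover have "cinner c' c = of_real (norm c)"
     by (simp add: c'_def cinner_simps cinner_self power2_eq_square)
    ultimately show ?thesis by (simp add: c_def)
   qed (use m0 in simp)
   have re: "Re (cinner (s (r (b n))) (b n)) = (norm (r (b n)))\<^sup>2"
    using sr[OF b(1)[of n] b(1)[of n]] Re_cinner_commute[of "b n" "s (r (b n))"] by (simp add: cinner_self)
   have "(norm (s (r (b n)) - m *\<^sub>R b n))\<^sup>2 = (norm (s (r (b n))))\<^sup>2 - 2 * m * (norm (r (b n)))\<^sup>2 + m\<^sup>2 * (norm (b n))\<^sup>2"
    by (simp add: norm_diff_square cinner_simps re power_mult_distrib)
   also have "... <= m\<^sup>2 - 2 * m * (m - inverse (real (Suc n))) + m\<^sup>2 * 1"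
    using le b m0 by (intro add_mono diff_mono mult_left_mono power_mono) (auto simp: power_le_one less_imp_le)
   also have "... = 2 * m * inverse (real (Suc n))" by (simp add: power2_eq_square algebra_simps)
   finally show ?thesis by (rule real_le_rsqrt)
  qed
  moreover have "(\<lambda>n. sqrt (2 * m * inverse (real (Suc n)))) \<longlonglongrightarrow> sqrt 0"
   by (intro tendsto_real_sqrt tendsto_mult_right_zero LIMSEQ_inverse_real_of_nat)
  ultimately have "(\<lambda>n. s (r (b n)) - m *\<^sub>R b n) \<longlonglongrightarrow> 0"
   by (intro Lim_null_comparison[of "\<lambda>n. s (r (b n)) - m *\<^sub>R b n", OF always_eventually]) auto
  from LIMSEQ_subseq_LIMSEQ[OF this f(1)] have "(\<lambda>n. s (r (b (f n))) - m *\<^sub>R b (f n)) \<longlonglongrightarrow> 0" by (simp add: o_def)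
  from tendsto_diff[OF sl this] have "(\<lambda>n. m *\<^sub>R b (f n)) \<longlonglongrightarrow> s l" by simp
  from tendsto_scaleR[OF tendsto_const this, of "inverse m"] have bl: "(\<lambda>n. b (f n)) \<longlonglongrightarrow> inverse m *\<^sub>R s l"
   using m0 by simp
  define e where "e = inverse m *\<^sub>R s l"
  have eH: "e \<in> H" unfolding e_def by (intro H(7) s lH)
  have re: "r e = l"
   by (rule LIMSEQ_unique[OF tend[OF r_diff r_bound b(1) eH bl[folded e_def]] l])
  have e_eig: "s (r e) = of_real m *\<^sub>C e" unfolding re using m0 by (simp add: e_def scaleC_of_real)
  have "(\<lambda>n. (norm (r (b (f n))))\<^sup>2) \<longlonglongrightarrow> (norm l)\<^sup>2" by (intro tendsto_intros l)
  moreover have "(\<lambda>n. (norm (r (b (f n))))\<^sup>2) \<longlonglongrightarrow> m"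
  proof (rule tendsto_sandwich)
   show "(\<lambda>n. m - inverse (real (Suc (f n)))) \<longlonglongrightarrow> m"
    using tendsto_diff[OF tendsto_const[of m] LIMSEQ_subseq_LIMSEQ[OF LIMSEQ_inverse_real_of_nat f(1)]] by simp
   show "(\<lambda>n. m) \<longlonglongrightarrow> m" by simp
   show "eventually (\<lambda>n. m - inverse (real (Suc (f n))) <= (norm (r (b (f n))))\<^sup>2) sequentially"
    by (intro always_eventually allI less_imp_le b)
   show "eventually (\<lambda>n. (norm (r (b (f n))))\<^sup>2 <= m) sequentially"
    by (intro always_eventually allI r_m b)
  qed
  ultimately have "(norm l)\<^sup>2 = m" by (rule LIMSEQ_unique)
  then have e0: "e ~= 0" using m0 re r_lin(2)[OF eH eH, of 0] by auto
  define E where "E = {u \<in> H. s (r u) = of_real m *\<^sub>C u}"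
  have E: "closed_csubspace E"
   unfolding closed_csubspace_def
  proof (intro conjI ballI allI)
   show "closed E"
   proof (rule closed_sequential_limits[THEN iffD2], intro allI impI, elim conjE)
    fix g d assume g: "\<forall>n. g n \<in> E" "g \<longlonglongrightarrow> d"
    have gH: "g n \<in> H" for n using g(1) by (simp add: E_def)
    have d: "d \<in> H" by (rule closed_sequentially[OF H(1) gH g(2)])
    have rg: "(\<lambda>n. r (g n)) \<longlonglongrightarrow> r d" by (rule tend[OF r_diff r_bound gH d g(2)])
    have "(\<lambda>n. s (r (g n))) \<longlonglongrightarrow> s (r d)" by (rule tend[OF s_diff s_bound r(1)[OF gH] r(1)[OF d] rg])
    moreover have "(\<lambda>n. of_real m *\<^sub>C g n) \<longlonglongrightarrow> of_real m *\<^sub>C d" by (rule tendsto_scaleC[OF g(2)])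
    ultimately show "d \<in> E" using g(1) d LIMSEQ_unique by (auto simp: E_def)
   qed
   show "0 \<in> E" using r_lin(2)[OF H(2) H(2), of 0] s_lin(2)[OF H(2) H(2), of 0] by (simp add: E_def H)
  qed (auto simp: E_def H r_lin s_lin r scaleC_add_right scaleC_scaleC mult.commute)
  have EK: "E \<subseteq> continuous_part"
  proof
   fix u assume u: "u \<in> E"
   then have "of_real (inverse m) *\<^sub>C s (r u) = u" using m0 by (simp add: E_def scaleC_scaleC)
   then show "u \<in> continuous_part"
    using closed_csubspaceD(4)[OF continuous_part_closed sK[OF r(1)]] u by (metis (no_types, lifting) E_def mem_Collect_eq)
  qed
  have WE: "W2 u \<in> E" if "u \<in> E" for u
  proof -
   have u: "u \<in> H" "s (r u) = of_real m *\<^sub>C u" using that by (auto simp: E_def)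
   have "W2 (of_real m *\<^sub>C u) = of_real m *\<^sub>C W2 u" using u(1) by (simp add: W2_def upow_linear)
   then show ?thesis using u W2(2)[OF u(1) u(1)] by (simp add: E_def r_W s_W r)
  qed
  have eE: "e \<in> E" using eH e_eig by (simp add: E_def)
  have W2_op: "bounded_op H W2" unfolding W2_def by (rule upow_op)
  \<comment> \<open>For orthonormal \<open>g i\<close> in the eigenspace the vectors
    \<open>r (g i) \<otimes> g i / sqrt m\<close> are orthonormal and have coefficients of modulus
    \<open>sqrt m\<close> against \<open>t\<close>, so Bessel's inequality bounds their number by
    \<open>(norm t)^2 / m\<close>.\<close>
  have bound: "n <= nat \<lceil>(norm t)\<^sup>2 / m\<rceil>"
   if g: "!!i. i < n ==> g i \<in> E" "!!i j. i < n ==> j < n ==> cinner (g i) (g j) = (if i = j then 1 else 0)"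
   for n and g :: "nat => 'h"
  proof -
   have gH: "g i \<in> H" if "i < n" for i using g(1)[OF that] by (simp add: E_def)
   define w where "w i = of_real (1 / sqrt m) *\<^sub>C r (g i)" for i
   have rr: "cinner (r (g i)) (r (g j)) = (if i = j then of_real m else 0)" if ij: "i < n" "j < n" for i j
   proof -
    have "cinner (r (g i)) (r (g j)) = cinner (g j) (s (r (g i)))" using sr gH ij by simp
    also have "s (r (g i)) = of_real m *\<^sub>C g i" using g(1)[OF ij(1)] by (simp add: E_def)
    finally show ?thesis using g(2)[OF ij(2,1)] by (simp add: cinner_simps)
   qed
   have sm: "sqrt m * sqrt m = m" "sqrt m > 0" using m0 by auto
   have "(\<Sum>i<n. (cmod (cinner t (tens (w i) (g i))))\<^sup>2) <= (norm t)\<^sup>2"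
   proof (rule bessel_inequality)
    fix i j assume "i \<in> {..<n}" "j \<in> {..<n}"
    then show "cinner (tens (w i) (g i)) (tens (w j) (g j)) = (if i = j then 1 else 0)"
     using rr[of i j] g(2)[of i j] sm by (simp add: te w_def cinner_simps flip: of_real_mult)
   qed simp
   moreover have "(cmod (cinner t (tens (w i) (g i))))\<^sup>2 = m" if i: "i < n" for i
   proof -
    have "cinner (tens (w i) (g i)) t = of_real (1 / sqrt m) * cinner (r (g i)) (r (g i))"
     using r(2)[OF r(1)[OF gH[OF i]] gH[OF i]] by (simp add: w_def te cinner_simps)
    also have "... = of_real (sqrt m)" using rr[OF i i] sm by (simp add: field_simps flip: of_real_mult)
    finally have "cmod (cinner t (tens (w i) (g i))) = sqrt m"
     using sm by (metis cinner_commute complex_mod_cnj norm_of_real abs_of_pos)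
    then show ?thesis using m0 by simp
   qed
   ultimately have "real n * m <= (norm t)\<^sup>2" by simp
   then have "real n <= (norm t)\<^sup>2 / m" using m0 by (simp add: field_simps)
   then show ?thesis by linarith
  qed
  have pow: "(W2 ^^ n) e \<in> E" for n by (induction n) (simp_all add: eE WE)
  obtain P where P: "P ~= 0" "poly_action W2 P e = 0"
   by (rule krylov_annihilator[OF closed_H W2_op eH pow E bound])
  obtain Q v where Q: "poly_action W2 Q e ~= 0" "W2 (poly_action W2 Q e) = v *\<^sub>C poly_action W2 Q e"
   by (rule poly_action_eigenvector[OF closed_H W2_op eH P e0])
  have "poly_action W2 Q e \<in> E" by (rule poly_action_invariant[OF closed_H W2_op eH E eE WE])
  then have "poly_action W2 Q e = 0"
   using EK Q(2) unfolding W2_def by (intro continuous_part_no_power_eigenvector[OF _ _ q]) auto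
  then show False using Q(1) by simp
 qed
 with t show ?thesis by (simp add: z_def[abs_def] xs_def ys_def)
qed

end

subsection \<open>The ergodic theorem in a fibre\<close>

lemma orthonormal_sum_norm:
 fixes c :: "'i => 'h::complex_hilbert_space"
 assumes F: "finite F" and on: "!!i j. i \<in> F ==> j \<in> F ==> cinner (c i) (c j) = (if i = j then 1 else 0)"
 shows "(norm (\<Sum>i\<in>F. a i *\<^sub>C c i))\<^sup>2 = (\<Sum>i\<in>F. (cmod (a i))\<^sup>2)"
proof -
 have "cinner (\<Sum>i\<in>F. a i *\<^sub>C c i) (\<Sum>i\<in>F. a i *\<^sub>C c i)
   = (\<Sum>i\<in>F. \<Sum>j\<in>F. if i = j then a i * cnj (a i) else 0)"
  unfolding cinner_sum_sum using on by (intro sum.cong refl) (simp add: cinner_simps)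
 also have "... = (\<Sum>i\<in>F. of_real ((cmod (a i))\<^sup>2))" using F by (simp add: complex_norm_square del: of_real_power)
 finally have "of_real ((norm (\<Sum>i\<in>F. a i *\<^sub>C c i))\<^sup>2) = complex_of_real (\<Sum>i\<in>F. (cmod (a i))\<^sup>2)"
  by (simp only: cinner_self of_real_sum)
 then show ?thesis by (simp only: of_real_eq_iff)
qed

context
 fixes R :: "'i set" and b :: "'i => 't::complex_hilbert_space" and c :: "'i => 'h::complex_hilbert_space"
 assumes b: "!!i j. i \<in> R ==> j \<in> R ==> cinner (b i) (b j) = (if i = j then 1 else 0)"
  and c: "!!i j. i \<in> R ==> j \<in> R ==> cinner (c i) (c j) = (if i = j then 1 else 0)"
begin

lemma orthonormal_finite_bound:
 assumes F: "finite F" "F \<subseteq> R"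
 shows "norm (\<Sum>i\<in>F. cinner t (b i) *\<^sub>C c i) <= norm t"
proof -
 have "(norm (\<Sum>i\<in>F. cinner t (b i) *\<^sub>C c i))\<^sup>2 = (\<Sum>i\<in>F. (cmod (cinner t (b i)))\<^sup>2)"
  by (rule orthonormal_sum_norm[OF F(1)]) (intro c subsetD[OF F(2)])
 also have "... <= (norm t)\<^sup>2" by (rule bessel_inequality[OF F(1)]) (intro b subsetD[OF F(2)])
 finally show ?thesis by (rule power2_le_imp_le) simp
qed

text \<open>Bessel's inequality makes the squared coefficients summable, and orthonormality turns
  their tails into squared norms of partial sums, which therefore form a Cauchy filter. Since
  \<open>infsum\<close> is 0 for families that are not summable, linearity of \<open>V_fibre\<close>
  rests on this.\<close>

lemma orthonormal_series_summable: "(\<lambda>i. cinner t (b i) *\<^sub>C c i) summable_on R"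
proof -
 define f where "f i = cinner t (b i) *\<^sub>C c i" for i
 define g where "g i = (cmod (cinner t (b i)))\<^sup>2" for i
 have g_le: "sum g F <= (norm t)\<^sup>2" if "finite F" "F \<subseteq> R" for F
  unfolding g_def by (rule bessel_inequality[OF that(1)]) (intro b subsetD[OF that(2)])
 have g: "g summable_on R"
  by (rule nonneg_bdd_above_summable_on) (use g_le in \<open>auto simp: g_def intro!: bdd_aboveI[of _ "(norm t)\<^sup>2"]\<close>)
 have norm_f: "(norm (sum f D))\<^sup>2 = sum g D" if "finite D" "D \<subseteq> R" for D
  unfolding f_def g_def by (rule orthonormal_sum_norm[OF that(1)]) (intro c subsetD[OF that(2)])
 have "\<exists>P. eventually P (finite_subsets_at_top R) \<and> (\<forall>x y. P x \<and> P y \<longrightarrow> dist (sum f x) (sum f y) < e)"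
  if e: "e > 0" for e
 proof -
  obtain F where F: "finite F" "F \<subseteq> R" "dist (sum g F) (infsum g R) <= e\<^sup>2 / 16"
   using has_sum_finite_approximation[OF has_sum_infsum[OF g], of "e\<^sup>2 / 16"] e by auto
  have small: "norm (sum f D) < e / 2" if D: "finite D" "D \<subseteq> R" "D \<inter> F = {}" for D
  proof -
   have "sum g D + sum g F = sum g (D \<union> F)" using D F by (subst sum.union_disjoint) auto
   also have "... <= infsum g R"
    by (rule finite_sum_le_infsum[OF g]) (use D F in \<open>auto simp: g_def\<close>)
   finally have "sum g D <= e\<^sup>2 / 16" using F(3) unfolding dist_real_def by arith
   also have "... < (e / 2)\<^sup>2" using e by (simp add: power_divide)
   finally have "(norm (sum f D))\<^sup>2 < (e / 2)\<^sup>2" by (simp add: norm_f D)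
   then show ?thesis by (rule power2_less_imp_less) (use e in simp)
  qed
  define P where "P D \<longleftrightarrow> finite D \<and> F \<subseteq> D \<and> D \<subseteq> R" for D
  have "eventually P (finite_subsets_at_top R)"
   using F by (auto simp: P_def eventually_finite_subsets_at_top)
  moreover have "dist (sum f D1) (sum f D2) < e" if "P D1" "P D2" for D1 D2
  proof -
   have fin: "finite D1" "finite D2" using that by (auto simp: P_def)
   have "sum f D1 = sum f (D1 - D2) + sum f (D1 \<inter> D2)" "sum f D2 = sum f (D2 - D1) + sum f (D1 \<inter> D2)"
    using sum.Int_Diff[OF fin(1), of f D2] sum.Int_Diff[OF fin(2), of f D1] by (simp_all add: Int_commute)
   then have "dist (sum f D1) (sum f D2) <= norm (sum f (D1 - D2)) + norm (sum f (D2 - D1))"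
    by (simp add: dist_norm norm_triangle_ineq4)
   also have "... < e / 2 + e / 2" using that by (intro add_strict_mono small) (auto simp: P_def)
   finally show ?thesis by simp
  qed
  ultimately show ?thesis by auto
 qed
 then have "cauchy_filter (filtermap (sum f) (finite_subsets_at_top R))"
  by (simp add: cauchy_filter_metric_filtermap)
 then obtain l where "(sum f \<longlongrightarrow> l) (finite_subsets_at_top R)"
  using complete_uniform[where S="UNIV::'h set", THEN iffD1, OF complete_UNIV] by (force simp: filterlim_def)
 then show ?thesis unfolding summable_on_def has_sum_def f_def[abs_def] by auto
qed

definition orthonormal_map :: "'t => 'h" where
 "orthonormal_map t = (\<Sum>\<^sub>\<infinity>i\<in>R. cinner t (b i) *\<^sub>C c i)"

lemma orthonormal_map_tendsto:
 "((\<lambda>F. \<Sum>i\<in>F. cinner t (b i) *\<^sub>C c i) \<longlongrightarrow> orthonormal_map t) (finite_subsets_at_top R)"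
 unfolding orthonormal_map_def by (rule infsum_tendsto[OF orthonormal_series_summable])

lemma orthonormal_map_bound: "norm (orthonormal_map t) <= norm t"
proof (rule tendsto_upperbound[OF tendsto_norm[OF orthonormal_map_tendsto]])
 show "\<forall>\<^sub>F F in finite_subsets_at_top R. norm (\<Sum>i\<in>F. cinner t (b i) *\<^sub>C c i) <= norm t"
  by (rule eventually_finite_subsets_at_top_weakI) (rule orthonormal_finite_bound)
qed simp

lemma orthonormal_map_add: "orthonormal_map (s + t) = orthonormal_map s + orthonormal_map t"
 unfolding orthonormal_map_def cinner_add_left scaleC_add_left
 by (rule infsum_add) (rule orthonormal_series_summable)+

lemma orthonormal_map_scaleC: "orthonormal_map (a *\<^sub>C t) = a *\<^sub>C orthonormal_map t"
proof -
 have "((\<lambda>i. a *\<^sub>C (cinner t (b i) *\<^sub>C c i)) has_sum (a *\<^sub>C orthonormal_map t)) R"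
  unfolding orthonormal_map_def
  by (rule has_sum_bounded_linear[OF bounded_linear_scaleC has_sum_infsum[OF orthonormal_series_summable]])
 then show ?thesis
  unfolding orthonormal_map_def by (simp add: infsumI cinner_scaleC_left scaleC_scaleC)
qed

end

lemma tendsto_uniform_approximation:
 fixes y :: "nat => 'v::real_normed_vector"
 assumes "!!e. e > 0 ==> \<exists>y' l'. y' \<longlonglongrightarrow> l' \<and> (\<forall>n. norm (y n - y' n) <= e) \<and> norm (l - l') <= e"
 shows "y \<longlonglongrightarrow> l"
proof (rule LIMSEQ_I)
 fix e :: real assume e: "e > 0"
 then obtain y' l' where y': "y' \<longlonglongrightarrow> l'" "!!n. norm (y n - y' n) <= e / 4" "norm (l - l') <= e / 4"
  using assms[of "e / 4"] by auto
 obtain N where N: "!!n. n >= N ==> norm (y' n - l') < e / 4" using LIMSEQ_D[OF y'(1), of "e / 4"] e by auto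
 show "\<exists>N. \<forall>n\<ge>N. norm (y n - l) < e"
 proof (intro exI allI impI)
  fix n assume "N <= n"
  have "y n - l = (y n - y' n) + (y' n - l') - (l - l')" by simp
  also have "norm ... <= norm (y n - y' n) + norm (y' n - l') + norm (l - l')"
   by (intro order_trans[OF norm_triangle_ineq4] add_mono order_refl norm_triangle_ineq)
  also have "... < e" using y'(2)[of n] y'(3) N[OF \<open>N <= n\<close>] e by simp
  finally show "norm (y n - l) < e" .
 qed
qed

lemma bounded_op_average:
 assumes T: "bounded_op H T" and H: "closed_csubspace H" and x: "!!n. x n \<in> H"
 shows "T (average x N) = average (\<lambda>n. T (x n)) N"
proof -
 have "T (\<Sum>n<N. x n) = (\<Sum>n<N. T (x n))" by (rule bounded_op_more(5)[OF T H x])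
 then show ?thesis
  unfolding average_def by (simp add: bounded_op_more(4)[OF T H closed_csubspace_sum[OF H x]])
qed

lemma average_mem:
 assumes H: "closed_csubspace H" and x: "!!n. x n \<in> H"
 shows "average x N \<in> H"
 unfolding average_def by (intro closed_csubspaceD(7)[OF H] closed_csubspace_sum[OF H] x)

lemma unitaryD:
 assumes "unitary_on H V"
 shows "bounded_op H V" "x \<in> H ==> V x \<in> H" "x \<in> H ==> y \<in> H ==> cinner (V x) (V y) = cinner x y"
  "y \<in> H ==> \<exists>x\<in>H. y = V x"
 using assms by (auto simp: unitary_on_def bij_betw_def)

text \<open>The limit is fixed because moving the orbit by one step changes its averages by a
  vanishing amount.\<close>

lemma isometry_average:
 assumes H: "closed_csubspace H" and T: "bounded_op H T"
  and iso: "!!x y. x \<in> H ==> y \<in> H ==> cinner (T x) (T y) = cinner x y"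
  and z: "z 0 \<in> H" "!!n. z (Suc n) = T (z n)"
 obtains l where "average z \<longlonglongrightarrow> l" "T l = l" "l \<in> H"
proof -
 have zH: "z n \<in> H" for n by (induction n) (simp_all add: z bounded_opD(1)[OF T])
 have "norm (T x) = norm x" if "x \<in> H" for x
  using arg_cong[OF iso[OF that that], of Re] by (simp add: cinner_self_Re)
 then have nz: "norm (z n) <= norm (z 0)" for n by (induction n) (simp_all add: z zH)
 have "convergent (average z)" by (rule stationary_mean_ergodic) (simp add: z iso zH)
 then obtain l where l: "average z \<longlonglongrightarrow> l" by (auto simp: convergent_def)
 have aH: "average z N \<in> H" for N by (rule average_mem[OF H zH])
 have "(\<lambda>N. T (average z N)) \<longlonglongrightarrow> T l" by (rule bounded_op_tendsto[OF T H aH l])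
 moreover have "T (average z N) = average (\<lambda>n. z (n + 1)) N" for N by (simp add: bounded_op_average[OF T H zH] z)
 moreover have "(\<lambda>N. (average (\<lambda>n. z (n + 1)) N - average z N) + average z N) \<longlonglongrightarrow> 0 + l"
  by (intro tendsto_add average_shift_tendsto[OF nz] l)
 ultimately have "T l = 0 + l" by (intro LIMSEQ_unique) simp_all
 then show ?thesis using that[OF l] closed_sequentially[OF closed_csubspaceD(1)[OF H] aH l] by simp
qed

context unitary_on_subspace
begin

lemma upow_commute:
 assumes V: "bounded_op H V" "!!x. x \<in> H ==> U (V x) = v *\<^sub>C V (U x)" and v0: "v ~= 0" and x: "x \<in> H"
 shows "Up m (V x) = (v powi m) *\<^sub>C V (Up m x)"
proof (induction m rule: int_induct[where k = 0])
 case (step1 i)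
 note Vx = bounded_opD(1)[OF V(1) x] and ux = upow_mem[OF x, of i]
 have "Up (i + 1) (V x) = U ((v powi i) *\<^sub>C V (Up i x))" by (simp add: upow_succ Vx step1)
 also have "... = (v powi i * v) *\<^sub>C V (Up (i + 1) x)"
  using bounded_opD(1)[OF V(1) ux] by (simp add: bounded_opD(3)[OF U_op] V(2)[OF ux] scaleC_scaleC upow_succ x)
 finally show ?case using v0 by (simp add: power_int_add)
next
 case (step2 i)
 note Vx = bounded_opD(1)[OF V(1) x] and ux = upow_mem[OF x, of "i - 1"]
 have "U ((v powi (i - 1)) *\<^sub>C V (Up (i - 1) x)) = (v powi (i - 1) * v) *\<^sub>C V (Up i x)"
  using bounded_opD(1)[OF V(1) ux] upow_succ[OF x, of "i - 1"]
  by (simp add: bounded_opD(3)[OF U_op] V(2)[OF ux] scaleC_scaleC)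
 also have "v powi (i - 1) * v = v powi i" using v0 by (simp add: power_int_diff)
 finally have "U ((v powi (i - 1)) *\<^sub>C V (Up (i - 1) x)) = Up i (V x)" by (simp add: step2)
 then have "inv_into H U (Up i (V x)) = (v powi (i - 1)) *\<^sub>C V (Up (i - 1) x)"
  using inv_U[OF H(4)[OF bounded_opD(1)[OF V(1) ux], of "v powi (i - 1)"]] by simp
 then show ?case by (simp add: upow_pred Vx)
qed simp

lemma average_upow_fixed:
 assumes x: "x \<in> H"
 obtains l where "average (\<lambda>n. Up (int n) x) \<longlonglongrightarrow> l" "U l = l" "l \<in> H"
proof (rule isometry_average[OF closed_H U_op U_cinner])
 show "Up (int (Suc n)) x = U (Up (int n) x)" for n
  using upow_succ[OF x, of "int n"] by (simp add: add.commute)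
qed (use x in \<open>auto intro: that\<close>)

end

text \<open>The consequences of extremality and central support on which the averages rely. The
  automorphism is present only through \<open>commutant_conj\<close> for all integers
  \<open>m\<close>, so that the inverse unitary satisfies the same interface.\<close>

locale ergodic_fibre = unitary_on_subspace H U
 for H :: "'k::complex_hilbert_space set" and U :: "'k => 'k" +
 fixes \<pi> :: "'a::unital_cstar_algebra => 'k => 'k" and \<Psi> :: 'k
  and Ve We :: "complex => 'k => 'k" and tens :: "'k => 'k => 't::complex_hilbert_space"
 assumes rep: "star_representation H \<pi>" and \<Psi>: "\<Psi> \<in> H" and norm_\<Psi>: "norm \<Psi> = 1" and U_\<Psi>: "U \<Psi> = \<Psi>"
  and fixed: "x \<in> H ==> U x = x ==> \<exists>c. x = c *\<^sub>C \<Psi>"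
  and cyclic: "closure (range (\<lambda>a. \<pi> a \<Psi>)) = H"
  and cyclic': "closure {B \<Psi> |B. B \<in> commutant H (range \<pi>)} = H"
  and commutant_conj: "B \<in> commutant H (range \<pi>) ==>
   (\<lambda>x. Up m (B (Up (- m) x))) \<in> commutant H (range \<pi>)"
  and tens: "hilbert_tensor tens"
  and Ve: "v \<in> eigenvalues_on H U ==> unitary_on H (Ve v)"
   "v \<in> eigenvalues_on H U ==> Ve v \<in> bicommutant H (range \<pi>)"
   "v \<in> eigenvalues_on H U ==> x \<in> H ==> U (Ve v x) = v *\<^sub>C Ve v (U x)"
  and We: "v \<in> eigenvalues_on H U ==> unitary_on H (We v)"
   "v \<in> eigenvalues_on H U ==> We v \<in> commutant H (range \<pi>)"
   "v \<in> eigenvalues_on H U ==> x \<in> H ==> U (We v x) = v *\<^sub>C We v (U x)"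
begin

abbreviation "Mc \<equiv> commutant H (range \<pi>)"

lemmas r = star_representationD[OF rep]
lemmas te = hilbert_tensorD[OF tens]

abbreviation "\<sigma> \<equiv> eigenvalues_on H U"

lemma \<sigma>_norm: "v \<in> \<sigma> ==> cmod v = 1"
 unfolding eigenvalues_on_def using eigenvalue_norm by auto

lemma bicommutant_commutes: "A \<in> bicommutant H (range \<pi>) ==> B \<in> Mc ==> x \<in> H ==> A (B x) = B (A x)"
 unfolding bicommutant_def by (rule commutantD(2))

text \<open>The preimage of \<open>x\<close> under \<open>V\<close> is a fixed vector of
  \<open>U\<close>, by the covariance of \<open>V\<close>, and fixed vectors are multiples of
  \<open>\<Psi>\<close>.\<close>

lemma eigenvector_multiple:
 assumes V: "unitary_on H V" "!!x. x \<in> H ==> U (V x) = v *\<^sub>C V (U x)"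
  and x: "x \<in> H" "U x = v *\<^sub>C x" and v: "cmod v = 1"
 obtains c where "x = c *\<^sub>C V \<Psi>"
proof -
 obtain y where y: "y \<in> H" "x = V y" using unitaryD(4)[OF V(1) x(1)] by auto
 have v0: "v ~= 0" using v by auto
 have "v *\<^sub>C V (U y) = v *\<^sub>C V y" using V(2)[OF y(1)] x(2) y(2) by simp
 then have "inverse v *\<^sub>C v *\<^sub>C V (U y) = inverse v *\<^sub>C v *\<^sub>C V y" by simp
 then have "V (U y) = V y" using v0 by (simp add: scaleC_scaleC)
 then have "U y = y"
  using V(1) y(1) U_H[OF y(1)] unfolding unitary_on_def bij_betw_def by (auto dest: inj_onD)
 then obtain c where "y = c *\<^sub>C \<Psi>" using fixed[OF y(1)] by auto
 then have "x = c *\<^sub>C V \<Psi>" using y(2) by (simp add: bounded_opD(3)[OF unitaryD(1)[OF V(1)] \<Psi>])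
 then show ?thesis by (rule that)
qed

lemma eigenvectors:
 assumes v: "v \<in> \<sigma>"
 shows "Ve v \<Psi> \<in> H" "We v \<Psi> \<in> H" "U (Ve v \<Psi>) = v *\<^sub>C Ve v \<Psi>" "U (We v \<Psi>) = v *\<^sub>C We v \<Psi>"
  "cinner (Ve v \<Psi>) (Ve v \<Psi>) = 1" "cinner (We v \<Psi>) (We v \<Psi>) = 1"
 using unitaryD(2)[OF Ve(1)[OF v] \<Psi>] unitaryD(2)[OF We(1)[OF v] \<Psi>] Ve(3)[OF v \<Psi>] We(3)[OF v \<Psi>]
 unfolding unitaryD(3)[OF Ve(1)[OF v] \<Psi> \<Psi>] unitaryD(3)[OF We(1)[OF v] \<Psi> \<Psi>]
 by (simp_all add: U_\<Psi> cinner_self norm_\<Psi>)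

lemma eigenvectors_orthogonal:
 assumes x: "x \<in> H" "Up m x = v *\<^sub>C x" and y: "y \<in> H" "Up m y = w *\<^sub>C y"
  and v: "cmod v = 1" and vw: "v ~= w"
 shows "cinner x y = 0"
proof -
 have "cinner x y = v * cnj w * cinner x y"
  using upow_cinner[OF x(1) y(1), of m] by (simp add: x y cinner_simps mult_ac)
 then have "(v * cnj w - 1) * cinner x y = 0" by auto
 moreover have "v * cnj w ~= 1"
 proof
  assume *: "v * cnj w = 1"
  then have "cmod w = 1" using v by (metis complex_mod_cnj mult_1 norm_mult norm_one)
  then have "cnj w * w = 1" by (simp add: complex_norm_square[symmetric] mult.commute)
  with * have "v = w" by (metis mult.assoc mult.left_neutral mult.right_neutral)
  then show False using vw by simp
 qed
 ultimately show ?thesis by simp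
qed

lemma Ve_orthonormal: "v \<in> \<sigma> ==> w \<in> \<sigma> ==> cinner (Ve v \<Psi>) (Ve w \<Psi>) = (if v = w then 1 else 0)"
 and We_orthonormal: "v \<in> \<sigma> ==> w \<in> \<sigma> ==> cinner (We v \<Psi>) (We w \<Psi>) = (if v = w then 1 else 0)"
 using eigenvectors_orthogonal[of _ 1 v _ w] eigenvectors[of v] eigenvectors[of w] \<sigma>_norm[of v]
 by (auto simp: upow_1)

lemma product_eigenvector:
 assumes v: "v \<in> \<sigma>" and w: "w \<in> \<sigma>"
 shows "Ve v (We w \<Psi>) \<in> H" "U (Ve v (We w \<Psi>)) = (v * w) *\<^sub>C Ve v (We w \<Psi>)"
  "cinner (Ve v (We w \<Psi>)) (Ve v (We w \<Psi>)) = 1" "v * w \<in> \<sigma>" "Ve v (We w \<Psi>) = We w (Ve v \<Psi>)"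
proof -
 note V = unitaryD[OF Ve(1)[OF v]] and W = unitaryD[OF We(1)[OF w]]
 show 1: "Ve v (We w \<Psi>) \<in> H" by (intro V W \<Psi>)
 show 2: "U (Ve v (We w \<Psi>)) = (v * w) *\<^sub>C Ve v (We w \<Psi>)"
  using eigenvectors(4)[OF w] W(2)[OF \<Psi>] by (simp add: Ve(3)[OF v] bounded_opD(3)[OF V(1)] scaleC_scaleC)
 show 3: "cinner (Ve v (We w \<Psi>)) (Ve v (We w \<Psi>)) = 1"
  using eigenvectors(6)[OF w] by (simp add: V(3) W(2) \<Psi>)
 then have "Ve v (We w \<Psi>) ~= 0" by auto
 then show "v * w \<in> \<sigma>" using 1 2 by (auto simp: eigenvalues_on_def)
 show "Ve v (We w \<Psi>) = We w (Ve v \<Psi>)" by (rule bicommutant_commutes[OF Ve(2)[OF v] We(2)[OF w] \<Psi>])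
qed

definition resonances :: "int => (complex \<times> complex) set" where
 "resonances k = {(v, w). v \<in> \<sigma> \<and> w \<in> \<sigma> \<and> v powi k * w powi (k + 1) = 1}"

text \<open>The product \<open>u = v * w\<close> satisfies \<open>u^k w = 1\<close>, from which both
  members are powers of \<open>u\<close>. A resonant pair is thus determined by its product, and the
  vectors \<open>Ve v (We w \<Psi>)\<close> of different pairs belong to different
  eigenvalues.\<close>

lemma resonance_product:
 fixes v w :: complex
 assumes v: "v ~= 0" and w: "w ~= 0" and res: "v powi k * w powi (k + 1) = 1"
 shows "w = (v * w) powi (- k)" "v = (v * w) powi (k + 1)"
proof -
 have "w powi (k + 1) = w powi k * w" using w power_int_add_1[of w k] by simp
 then have "(v * w) powi k * w = 1" using res by (simp add: power_int_mult_distrib mult.assoc)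
 then show 1: "w = (v * w) powi (- k)" using inverse_unique[of "(v * w) powi k" w] by (simp add: power_int_minus)
 have "(v * w) powi (k + 1) = (v * w) powi k * (v * w)" using v w by (simp add: power_int_add)
 also have "... = ((v * w) powi k * w) * v" by simp
 finally show "v = (v * w) powi (k + 1)" using \<open>(v * w) powi k * w = 1\<close> by simp
qed

lemma resonances_orthonormal:
 assumes "i \<in> resonances k" "j \<in> resonances k"
 shows "cinner (tens (Ve (fst i) \<Psi>) (We (snd i) \<Psi>)) (tens (Ve (fst j) \<Psi>) (We (snd j) \<Psi>)) = (if i = j then 1 else 0)"
  and "cinner (Ve (fst i) (We (snd i) \<Psi>)) (Ve (fst j) (We (snd j) \<Psi>)) = (if i = j then 1 else 0)"
proof -
 obtain v w v' w' where ij: "i = (v, w)" "j = (v', w')" by (cases i, cases j) auto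
 have m: "v \<in> \<sigma>" "w \<in> \<sigma>" "v' \<in> \<sigma>" "w' \<in> \<sigma>" and res: "v powi k * w powi (k + 1) = 1" "v' powi k * w' powi (k + 1) = 1"
  using assms by (auto simp: resonances_def ij)
 have nz: "v ~= 0" "w ~= 0" "v' ~= 0" "w' ~= 0" using m[THEN \<sigma>_norm] by auto
 show "cinner (tens (Ve (fst i) \<Psi>) (We (snd i) \<Psi>)) (tens (Ve (fst j) \<Psi>) (We (snd j) \<Psi>)) = (if i = j then 1 else 0)"
  by (simp add: ij te Ve_orthonormal We_orthonormal m)
 show "cinner (Ve (fst i) (We (snd i) \<Psi>)) (Ve (fst j) (We (snd j) \<Psi>)) = (if i = j then 1 else 0)"
 proof (cases "v * w = v' * w'")
  case True
  have "w = w'" "v = v'"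
   using resonance_product[OF nz(1,2) res(1)] resonance_product[OF nz(3,4) res(2)] unfolding True by auto
  then have "i = j" by (simp add: ij)
  then show ?thesis using product_eigenvector(3)[OF m(1,2)] by (simp add: ij)
 next
  case False
  have "cinner (Ve v (We w \<Psi>)) (Ve v' (We w' \<Psi>)) = 0"
   using product_eigenvector(1,2)[OF m(1,2)] product_eigenvector(1,2)[OF m(3,4)] False
    \<sigma>_norm[OF product_eigenvector(4)[OF m(1,2)]]
   by (intro eigenvectors_orthogonal[of _ 1 "v * w" _ "v' * w'"]) (simp_all add: upow_1)
  then show ?thesis using False by (auto simp: ij)
 qed
qed

definition V_op :: "int => 't => 'k" where
 "V_op k = V_fibre k tens H U \<Psi> Ve We"

lemma V_op_orthonormal_map:
 "V_op k = orthonormal_map (resonances k) (\<lambda>i. tens (Ve (fst i) \<Psi>) (We (snd i) \<Psi>)) (\<lambda>i. Ve (fst i) (We (snd i) \<Psi>))"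
 by (rule ext) (simp only: V_op_def V_fibre_def orthonormal_map_def[OF resonances_orthonormal] resonances_def case_prod_unfold)

lemma V_op_linear: "V_op k (s + t) = V_op k s + V_op k t" "V_op k (c *\<^sub>C t) = c *\<^sub>C V_op k t"
 unfolding V_op_orthonormal_map
 by (rule orthonormal_map_add[OF resonances_orthonormal] orthonormal_map_scaleC[OF resonances_orthonormal]; assumption)+

lemma V_op_bound: "norm (V_op k t) <= norm t"
 unfolding V_op_orthonormal_map by (rule orthonormal_map_bound[OF resonances_orthonormal])

lemma V_op_diff: "V_op k (s - t) = V_op k s - V_op k t"
 using V_op_linear(1)[of k s "- t"] V_op_linear(2)[of k "-1" t] by simp

lemma average_upow:
 assumes x: "x \<in> H"
 shows "average (\<lambda>n. Up (int n) x) \<longlonglongrightarrow> cinner x \<Psi> *\<^sub>C \<Psi>"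
proof -
 define z where "z n = Up (int n) x" for n
 have zH: "z n \<in> H" for n by (simp add: z_def upow_mem x)
 have z_Suc: "z (Suc n) = U (z n)" for n using upow_succ[OF x, of "int n"] by (simp add: z_def add.commute)
 obtain l where l': "average (\<lambda>n. Up (int n) x) \<longlonglongrightarrow> l" and Ul: "U l = l" and lH: "l \<in> H"
  by (rule average_upow_fixed[OF x]) simp
 then have l: "average z \<longlonglongrightarrow> l" "U l = l" by (simp_all add: z_def[abs_def])
 then obtain c where c: "l = c *\<^sub>C \<Psi>" using fixed[OF lH l(2)] by auto
 have "cinner (z n) \<Psi> = cinner x \<Psi>" for n
 proof (induction n)
  case (Suc n)
  then show ?case using U_cinner[OF zH[of n] \<Psi>] by (simp add: z_Suc U_\<Psi>)
 qed (simp add: z_def)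
 then have "(\<lambda>N. cinner (average z N) \<Psi>) = (\<lambda>N. average (\<lambda>n. cinner x \<Psi>) N)"
  by (simp only: cinner_average_left)
 moreover have "average (\<lambda>n. cinner x \<Psi>) N = cinner x \<Psi>" if "N > 0" for N
  using that by (simp add: average_def scaleR_conv_of_real)
 then have "(\<lambda>N. average (\<lambda>n. cinner x \<Psi>) N) \<longlonglongrightarrow> cinner x \<Psi>"
  by (intro tendsto_eventually) (auto simp: eventually_sequentially intro!: exI[of _ 1])
 ultimately have "cinner l \<Psi> = cinner x \<Psi>"
  by (intro LIMSEQ_unique[OF tendsto_cinner[OF l(1) tendsto_const, of \<Psi>]]) simp
 then have "c = cinner x \<Psi>" by (simp add: c cinner_simps cinner_self norm_\<Psi>)
 then show ?thesis using l(1) by (simp add: c z_def[abs_def])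
qed

lemma commutant_approximation:
 assumes x: "x \<in> H" and e: "e > 0"
 obtains B where "B \<in> Mc" "norm (x - B \<Psi>) < e"
proof -
 have "x \<in> closure {B \<Psi> |B. B \<in> Mc}" using x by (simp add: cyclic')
 then obtain y where "y \<in> {B \<Psi> |B. B \<in> Mc}" "dist y x < e"
  using e unfolding closure_approachable by blast
 then show ?thesis using that by (auto simp: dist_norm norm_minus_commute)
qed

lemma representation_approximation:
 assumes x: "x \<in> H" and e: "e > 0"
 obtains a where "norm (x - \<pi> a \<Psi>) < e"
proof -
 have "x \<in> closure (range (\<lambda>a. \<pi> a \<Psi>))" using x by (simp add: cyclic)
 then obtain y where "y \<in> range (\<lambda>a. \<pi> a \<Psi>)" "dist y x < e"
  using e unfolding closure_approachable by blast
 then show ?thesis using that by (auto simp: dist_norm norm_minus_commute)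
qed

text \<open>On \<open>u = \<pi> c \<Psi>\<close> the conjugated operator passes through
  \<open>\<pi> c\<close> and acts on the invariant vector \<open>\<Psi>\<close>, so the mean ergodic
  theorem for the orbit of \<open>G \<Psi>\<close> applies. The conjugates are uniformly bounded,
  which extends this to all \<open>u\<close> by density.\<close>

lemma average_commutant_conj:
 assumes G: "G \<in> Mc" and u: "u \<in> H" and v: "v \<in> H"
 shows "average (\<lambda>n. cinner (Up (int n) (G (Up (- int n) u))) v) \<longlonglongrightarrow> cinner (G \<Psi>) \<Psi> * cinner u v"
proof -
 note Gb = commutantD(1)[OF G]
 obtain K where K: "K > 0" "!!x. x \<in> H ==> norm (G x) <= K * norm x" by (rule bounded_opE[OF Gb]) (rule that)
 define Gn where "Gn n x = Up (int n) (G (Up (- int n) x))" for n x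
 have Gn: "Gn n \<in> Mc" for n unfolding Gn_def by (rule commutant_conj[OF G])
 have Gn_bound: "norm (Gn n x) <= K * norm x" if "x \<in> H" for n x
  using K(2)[OF upow_mem[OF that, of "- int n"]] that
  by (simp add: Gn_def upow_norm upow_mem bounded_opD(1)[OF Gb])
 have U\<Psi>: "Up m \<Psi> = \<Psi>" for m using upow_eigen[OF \<Psi>, of 1 m] by (simp add: U_\<Psi>)
 have dense: "average (\<lambda>n. cinner (Gn n (\<pi> c \<Psi>)) v) \<longlonglongrightarrow> cinner (G \<Psi>) \<Psi> * cinner (\<pi> c \<Psi>) v" for c
 proof -
  have G\<Psi>: "G \<Psi> \<in> H" by (rule bounded_opD(1)[OF Gb \<Psi>])
  have "cinner (Gn n (\<pi> c \<Psi>)) v = cinner (Up (int n) (G \<Psi>)) (\<pi> (star c) v)" for n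
  proof -
   have "Gn n (\<pi> c \<Psi>) = \<pi> c (Gn n \<Psi>)" using commutantD(2)[OF Gn[of n] _ \<Psi>, of "\<pi> c"] by simp
   also have "Gn n \<Psi> = Up (int n) (G \<Psi>)" by (simp add: Gn_def U\<Psi>)
   finally show ?thesis using r(7)[OF upow_mem[OF G\<Psi>] v] by simp
  qed
  then have "average (\<lambda>n. cinner (Gn n (\<pi> c \<Psi>)) v) = (\<lambda>N. cinner (average (\<lambda>n. Up (int n) (G \<Psi>)) N) (\<pi> (star c) v))"
   by (simp add: cinner_average_left)
  also have "... \<longlonglongrightarrow> cinner (cinner (G \<Psi>) \<Psi> *\<^sub>C \<Psi>) (\<pi> (star c) v)"
   by (intro tendsto_cinner tendsto_const average_upow G\<Psi>)
  also have "cinner (cinner (G \<Psi>) \<Psi> *\<^sub>C \<Psi>) (\<pi> (star c) v) = cinner (G \<Psi>) \<Psi> * cinner (\<pi> c \<Psi>) v"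
   using r(7)[OF \<Psi> v, of c] by (simp add: cinner_simps)
  finally show ?thesis .
 qed
 have G1: "cmod (cinner (G \<Psi>) \<Psi>) <= K"
  using order_trans[OF cinner_cauchy_schwarz mult_right_mono[OF K(2)[OF \<Psi>], of "norm \<Psi>"]] by (simp add: norm_\<Psi>)
 have "average (\<lambda>n. cinner (Gn n u) v) \<longlonglongrightarrow> cinner (G \<Psi>) \<Psi> * cinner u v"
 proof (rule tendsto_uniform_approximation)
  fix e :: real assume e: "e > 0"
  define d where "d = e / (K * (norm v + 1))"
  have d: "d > 0" using e K(1) by (simp add: d_def add_nonneg_pos)
  have de: "K * d * norm v <= e"
  proof -
   have "K * d * norm v = e * (norm v / (norm v + 1))" using K(1) by (simp add: d_def)
   also have "... <= e * 1" using e by (intro mult_left_mono) (auto simp: add_nonneg_pos)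
   finally show ?thesis by simp
  qed
  obtain c where c: "norm (u - \<pi> c \<Psi>) < d" by (rule representation_approximation[OF u d])
  define w where "w = u - \<pi> c \<Psi>"
  have wH: "w \<in> H" unfolding w_def by (intro H(6) u r(8) \<Psi>)
  have w: "K * norm w * norm v <= e"
  proof -
   have "K * norm w * norm v <= K * d * norm v" using c K(1) by (intro mult_right_mono mult_left_mono) (auto simp: w_def)
   then show ?thesis using de by simp
  qed
  have "norm (average (\<lambda>n. cinner (Gn n u) v) N - average (\<lambda>n. cinner (Gn n (\<pi> c \<Psi>)) v) N) <= e" for N
  proof -
   have "cinner (Gn n u) v - cinner (Gn n (\<pi> c \<Psi>)) v = cinner (Gn n w) v" for n
    using bounded_op_more(3)[OF commutantD(1)[OF Gn[of n]] closed_H u r(8)[OF \<Psi>, of c]]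
    by (simp add: w_def cinner_diff_left)
   then have "average (\<lambda>n. cinner (Gn n u) v) N - average (\<lambda>n. cinner (Gn n (\<pi> c \<Psi>)) v) N = average (\<lambda>n. cinner (Gn n w) v) N"
    by (simp flip: average_diff)
   also have "norm ... <= e"
   proof (rule norm_average_le)
    show "cmod (cinner (Gn n w) v) <= e" for n
     using order_trans[OF cinner_cauchy_schwarz mult_right_mono[OF Gn_bound[OF wH, of n], of "norm v"]] w by simp
   qed (use e in simp)
   finally show ?thesis .
  qed
  moreover have "norm (cinner (G \<Psi>) \<Psi> * cinner u v - cinner (G \<Psi>) \<Psi> * cinner (\<pi> c \<Psi>) v) <= e"
  proof -
   have "cinner (G \<Psi>) \<Psi> * cinner u v - cinner (G \<Psi>) \<Psi> * cinner (\<pi> c \<Psi>) v = cinner (G \<Psi>) \<Psi> * cinner w v"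
    by (simp add: w_def cinner_simps right_diff_distrib)
   also have "cmod ... <= K * (norm w * norm v)"
    unfolding norm_mult using G1 K(1) by (intro mult_mono cinner_cauchy_schwarz) auto
   finally show ?thesis using w by simp
  qed
  ultimately show "\<exists>y' l'. y' \<longlonglongrightarrow> l' \<and> (\<forall>n. norm (average (\<lambda>n. cinner (Gn n u) v) n - y' n) <= e)
    \<and> norm (cinner (G \<Psi>) \<Psi> * cinner u v - l') <= e" using dense by auto
 qed
 then show ?thesis by (simp add: Gn_def)
qed

end

section \<open>Averages with an element of the represented algebra\<close>

context ergodic_fibre
begin

lemma upow_upow: "x \<in> H ==> Up m (Up n x) = Up (m + n) x"
 by (simp add: upow_add)

lemma upow_\<Psi>: "Up m \<Psi> = \<Psi>"
 using upow_eigen[OF \<Psi>, of 1 m] by (simp add: U_\<Psi>)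

definition twisted :: "int => 'a => 'k => nat => 'k" where
 "twisted k a \<xi> n = Up (int n * k) (\<pi> a (Up (int n) \<xi>))"

lemma twisted_linear: "\<xi> \<in> H ==> \<eta> \<in> H ==> twisted k a (\<xi> + \<eta>) n = twisted k a \<xi> n + twisted k a \<eta> n"
 "\<xi> \<in> H ==> twisted k a (c *\<^sub>C \<xi>) n = c *\<^sub>C twisted k a \<xi> n"
 "\<xi> \<in> H ==> \<eta> \<in> H ==> twisted k a (\<xi> - \<eta>) n = twisted k a \<xi> n - twisted k a \<eta> n"
 by (simp_all add: twisted_def upow_linear upow_mem r(8) bounded_opD(2,3)[OF r(2)] bounded_op_more(3)[OF r(2) closed_H])

lemma twisted_bound:
 obtains K where "K > 0" "!!\<xi> n. \<xi> \<in> H ==> norm (twisted k a \<xi> n) <= K * norm \<xi>"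
proof -
 obtain K where K: "K > 0" "!!x. x \<in> H ==> norm (\<pi> a x) <= K * norm x" by (rule bounded_opE[OF r(2)[of a]]) (rule that)
 have "norm (twisted k a \<xi> n) <= K * norm \<xi>" if "\<xi> \<in> H" for \<xi> n
  using K(2)[OF upow_mem[OF that, of "int n"]] that by (simp add: twisted_def upow_norm upow_mem r(8))
 then show ?thesis by (rule that[OF K(1)])
qed

text \<open>Conjugation by the powers of \<open>U\<close> moves \<open>B\<close> to the left of \<open>\<pi> a\<close>; in the resulting correlations
 the dependence on \<open>n\<close> is that of the commutant ergodic average above.\<close>

lemma twisted_commutant:
 assumes B: "B \<in> Mc"
 shows "twisted k a (B \<Psi>) (n + h) = Up (int n * (k + 1))
  (Up (int h * (k + 1)) (B (Up (- (int h * (k + 1))) (Up (- int n) (Up (int h * k) (\<pi> a \<Psi>))))))"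
proof -
 define m where "m = int (n + h)"
 have \<eta>: "\<pi> a \<Psi> \<in> H" by (rule r(8)[OF \<Psi>])
 note B' = bounded_opD(1)[OF commutantD(1)[OF B]]
 note C = commutant_conj[OF B, of m]
 have "Up m (B \<Psi>) = Up m (B (Up (- m) \<Psi>))" by (simp add: upow_\<Psi>)
 then have "\<pi> a (Up m (B \<Psi>)) = Up m (B (Up (- m) (\<pi> a \<Psi>)))"
  using commutantD(2)[OF C _ \<Psi>, of "\<pi> a"] by simp
 then show ?thesis
  by (simp add: twisted_def flip: m_def) (simp add: m_def upow_upow upow_mem B' \<eta> algebra_simps)
qed

text \<open>After cancellation of the common power of \<open>U\<close>, the correlation is a matrix
  element of a conjugate of \<open>G\<close>, the product of the adjoint of \<open>C h'\<close> with
  \<open>C h\<close>. The scalar \<open>cinner (G \<Psi>) \<Psi>\<close> and the remaining factor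
  are the inner products in the two tensor factors.\<close>

lemma twisted_correlation:
 assumes B: "B \<in> Mc"
 shows "average (\<lambda>n. cinner (twisted k a (B \<Psi>) (n + h)) (twisted k a (B \<Psi>) (n + h'))) \<longlonglongrightarrow>
  cinner (tens (Up (int h * k) (\<pi> a \<Psi>)) (Up (int h * (k + 1)) (B \<Psi>)))
   (tens (Up (int h' * k) (\<pi> a \<Psi>)) (Up (int h' * (k + 1)) (B \<Psi>)))"
proof -
 define \<eta> where "\<eta> h = Up (int h * k) (\<pi> a \<Psi>)" for h :: nat
 define C where "C h x = Up (int h * (k + 1)) (B (Up (- (int h * (k + 1))) x))" for h :: nat and x
 have \<eta>: "\<eta> h \<in> H" for h by (simp add: \<eta>_def upow_mem r(8)[OF \<Psi>])
 have C: "C h \<in> Mc" for h unfolding C_def by (rule commutant_conj[OF B])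
 note CH = bounded_opD(1)[OF commutantD(1)[OF C]]
 have tw: "twisted k a (B \<Psi>) (n + h) = Up (int n * (k + 1)) (C h (Up (- int n) (\<eta> h)))" for n h
  using twisted_commutant[OF B] by (simp add: C_def \<eta>_def)
 obtain S where S: "S \<in> Mc" "!!x y. x \<in> H ==> y \<in> H ==> cinner (C h' x) y = cinner x (S y)"
  by (rule commutant_adjoint_exists[OF rep C[of h']]) (rule that)
 have S': "cinner (S x) y = cinner x (C h' y)" if "x \<in> H" "y \<in> H" for x y
  using S(2)[OF that(2,1)] cinner_commute by metis
 define G where "G x = S (C h x)" for x
 have G: "G \<in> Mc"
  unfolding G_def using commutant_closed(3)[OF closed_H _ S(1) C[of h]] r(2) by auto
 note SH = bounded_opD(1)[OF commutantD(1)[OF S(1)]]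
 have "cinner (twisted k a (B \<Psi>) (n + h)) (twisted k a (B \<Psi>) (n + h'))
   = cinner (Up (int n) (G (Up (- int n) (\<eta> h)))) (\<eta> h')" for n
  by (simp add: tw CH upow_mem \<eta> G_def S' upow_cinner_adjoint upow_inverse SH)
 moreover have "cinner (G \<Psi>) \<Psi> = cinner (Up (int h * (k + 1)) (B \<Psi>)) (Up (int h' * (k + 1)) (B \<Psi>))"
  by (simp add: G_def S' CH \<Psi>) (simp add: C_def upow_\<Psi>)
 ultimately show ?thesis
  using average_commutant_conj[OF G \<eta>[of h] \<eta>[of h']] by (simp add: te \<eta>_def mult.commute)
qed

text \<open>\<open>B \<Psi>\<close> need not be orthogonal to the eigenvectors, so the block length
  \<open>L\<close> is taken from the tensor averages for \<open>\<xi>\<close> itself, which are then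
  compared with those for \<open>B \<Psi>\<close>. The constant \<open>M\<close> controls the errors
  in both comparisons.\<close>

lemma twisted_continuous_part:
 assumes \<xi>: "\<xi> \<in> continuous_part" and k: "k + 1 ~= 0"
 shows "average (twisted k a \<xi>) \<longlonglongrightarrow> 0"
proof (rule tendstoI)
 fix e :: real assume e: "e > 0"
 have \<xi>H: "\<xi> \<in> H" using \<xi> continuous_part_sub by auto
 obtain K where K: "K > 0" "!!\<xi> n. \<xi> \<in> H ==> norm (twisted k a \<xi> n) <= K * norm \<xi>" by (rule twisted_bound) (rule that)
 define M where "M = K + norm (\<pi> a \<Psi>)"
 have M: "M > 0" using K(1) by (simp add: M_def add_pos_nonneg)
 obtain B where B: "B \<in> Mc" "norm (\<xi> - B \<Psi>) < e / (4 * M)"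
  using commutant_approximation[OF \<xi>H, of "e / (4 * M)"] e M by auto
 have B\<Psi>: "B \<Psi> \<in> H" by (rule bounded_opD(1)[OF commutantD(1)[OF B(1)] \<Psi>])
 have \<eta>: "\<pi> a \<Psi> \<in> H" by (rule r(8)[OF \<Psi>])
 have d: "M * norm (\<xi> - B \<Psi>) <= e / 4" using mult_left_mono[OF less_imp_le[OF B(2)], of M] M by simp
 define z where "z \<zeta> h = tens (Up (int h * k) (\<pi> a \<Psi>)) (Up (int h * (k + 1)) \<zeta>)" for \<zeta> and h :: nat
 obtain L where L: "L > 0" "norm (average (z \<xi>) L) < e / 4"
 proof -
  have "average (z \<xi>) \<longlonglongrightarrow> 0" unfolding z_def by (rule tensor_average_tendsto_zero[OF tens \<eta> \<xi> k])
  then obtain N where "!!n. n >= N ==> norm (average (z \<xi>) n) < e / 4" using LIMSEQ_D[of _ 0 "e / 4"] e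
  by auto
  then show ?thesis using that[of "Suc N"] by simp
 qed
 have "norm (average (z (B \<Psi>)) L - average (z \<xi>) L) <= e / 4"
  unfolding average_diff[symmetric]
 proof (rule norm_average_le)
  fix h
  have "z (B \<Psi>) h - z \<xi> h = tens (Up (int h * k) (\<pi> a \<Psi>)) (Up (int h * (k + 1)) (B \<Psi> - \<xi>))"
   by (simp add: z_def te upow_linear B\<Psi> \<xi>H)
  then have "norm (z (B \<Psi>) h - z \<xi> h) = norm (\<pi> a \<Psi>) * norm (\<xi> - B \<Psi>)"
   by (simp add: te upow_norm \<eta> B\<Psi> \<xi>H H(6) norm_minus_commute)
  also have "... <= M * norm (\<xi> - B \<Psi>)" using K(1) by (intro mult_right_mono) (auto simp: M_def)
  finally show "norm (z (B \<Psi>) h - z \<xi> h) <= e / 4" using d by simp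
 qed (use e in simp)
 then have zL: "norm (average (z (B \<Psi>)) L) < e / 2"
  using L(2) norm_triangle_sub[of "average (z (B \<Psi>)) L" "average (z \<xi>) L"] by simp
 have "eventually (\<lambda>N. norm (average (twisted k a (B \<Psi>)) N) < norm (average (z (B \<Psi>)) L) + e / 4) sequentially"
 proof (rule van_der_corput[OF _ _ L(1)])
  show "norm (twisted k a (B \<Psi>) n) <= K * norm (B \<Psi>)" for n by (rule K(2)[OF B\<Psi>])
  show "(\<lambda>N. average (\<lambda>n. cinner (twisted k a (B \<Psi>) (n + h)) (twisted k a (B \<Psi>) (n + h'))) N)
   \<longlonglongrightarrow> cinner (z (B \<Psi>) h) (z (B \<Psi>) h')" for h h' unfolding z_def by (rule twisted_correlation[OF B(1)])
 qed (use e in simp)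
 then show "eventually (\<lambda>N. dist (average (twisted k a \<xi>) N) 0 < e) sequentially"
 proof (rule eventually_mono)
  fix N assume N: "norm (average (twisted k a (B \<Psi>)) N) < norm (average (z (B \<Psi>)) L) + e / 4"
  have "norm (average (twisted k a \<xi>) N - average (twisted k a (B \<Psi>)) N) <= e / 4"
   unfolding average_diff[symmetric]
  proof (rule norm_average_le)
   fix n
   have "norm (twisted k a \<xi> n - twisted k a (B \<Psi>) n) <= K * norm (\<xi> - B \<Psi>)"
    using K(2)[OF H(6)[OF \<xi>H B\<Psi>]] by (simp add: twisted_linear \<xi>H B\<Psi>)
   also have "... <= M * norm (\<xi> - B \<Psi>)" by (intro mult_right_mono) (auto simp: M_def)
   finally show "norm (twisted k a \<xi> n - twisted k a (B \<Psi>) n) <= e / 4" using d by simp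
  qed (use e in simp)
  then have "norm (average (twisted k a \<xi>) N) < e"
   using N zL norm_triangle_sub[of "average (twisted k a \<xi>) N" "average (twisted k a (B \<Psi>)) N"] by simp
  then show "dist (average (twisted k a \<xi>) N) 0 < e" by simp
 qed
qed

lemma finite_power_int_roots:
 assumes "k ~= 0"
 shows "finite {v::complex. v powi k = c}"
proof (cases "k > 0")
 case True
 then have "{v::complex. v powi k = c} = {v. v ^ nat k = c}" by (simp add: power_int_def)
 then show ?thesis using finite_nth_roots[of "nat k" c] True by simp
next
 case False
 then have "{v::complex. v powi k = c} \<subseteq> {v. v ^ nat (- k) = inverse c}" by (auto simp: power_int_def power_inverse)
 then show ?thesis using finite_nth_roots[of "nat (- k)" "inverse c"] False assms by (auto intro: finite_subset)
qed

text \<open>The isometry \<open>T = \<gamma> U^k\<close> gives a \<open>T\<close>-fixed limit. After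
  removal of its components along \<open>Ve v \<Psi>\<close> it is orthogonal to all eigenvectors of
  \<open>U\<close> but still satisfies an eigenvalue equation for \<open>U^k\<close>, hence
  vanishes. \<open>F\<close> is finite since \<open>v^k\<close> is prescribed and \<open>k\<close>
  is nonzero.\<close>

lemma eigen_average:
 assumes \<eta>: "\<eta> \<in> H" and \<gamma>: "cmod \<gamma> = 1" and k: "k ~= 0"
 defines "F \<equiv> {v \<in> \<sigma>. v powi k * \<gamma> = 1}"
 shows "finite F" "average (\<lambda>n. \<gamma> ^ n *\<^sub>C Up (int n * k) \<eta>) \<longlonglongrightarrow> (\<Sum>v\<in>F. cinner \<eta> (Ve v \<Psi>) *\<^sub>C Ve v \<Psi>)"
proof -
 have \<gamma>0: "\<gamma> ~= 0" using \<gamma> by auto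
 have "F \<subseteq> {v. v powi k = inverse \<gamma>}" using \<gamma>0 by (auto simp: F_def field_simps)
 then show F: "finite F" using finite_power_int_roots[OF k] finite_subset by auto
 define T where "T x = \<gamma> *\<^sub>C Up k x" for x
 define z where "z n = \<gamma> ^ n *\<^sub>C Up (int n * k) \<eta>" for n
 have zH: "z n \<in> H" for n by (simp add: z_def H(4) upow_mem \<eta>)
 have z_Suc: "z (Suc n) = T (z n)" for n
  by (simp add: z_def T_def upow_linear upow_mem \<eta> scaleC_scaleC upow_upow algebra_simps)
 have \<gamma>\<gamma>: "cnj \<gamma> * \<gamma> = 1" using \<gamma> by (simp add: mult.commute flip: complex_norm_square)
 have Tc: "cinner (T x) (T y) = cinner x y" if "x \<in> H" "y \<in> H" for x y
  using \<gamma>\<gamma> that by (simp add: T_def cinner_simps upow_cinner)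
 have T: "bounded_op H T"
  by (rule bounded_opI[where K=1])
   (auto simp: T_def H(4) upow_mem upow_linear scaleC_add_right scaleC_scaleC mult.commute norm_scaleC \<gamma> upow_norm)
 obtain l where l: "average z \<longlonglongrightarrow> l" and Tl: "T l = l" and lH: "l \<in> H"
  by (rule isometry_average[where z = z, OF closed_H T Tc zH z_Suc]) (assumption, assumption, rule that)
 define p where "p = l - (\<Sum>v\<in>F. cinner \<eta> (Ve v \<Psi>) *\<^sub>C Ve v \<Psi>)"
 have eH: "v \<in> F ==> Ve v \<Psi> \<in> H" for v using eigenvectors(1) by (auto simp: F_def)
 have F_T: "T (Ve v \<Psi>) = Ve v \<Psi>" if "v \<in> F" for v
  using that upow_eigen[OF eigenvectors(1,3)[of v] \<sigma>_norm[of v], of k] by (simp add: F_def T_def scaleC_scaleC mult.commute)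
 have sH: "(\<Sum>v\<in>F. cinner \<eta> (Ve v \<Psi>) *\<^sub>C Ve v \<Psi>) \<in> H" by (intro closed_csubspace_sum[OF closed_H] H(4) eH)
 have pH: "p \<in> H" unfolding p_def by (intro H(6) lH sH)
 have "T (\<Sum>v\<in>F. cinner \<eta> (Ve v \<Psi>) *\<^sub>C Ve v \<Psi>) = (\<Sum>v\<in>F. cinner \<eta> (Ve v \<Psi>) *\<^sub>C Ve v \<Psi>)"
  using eH by (subst bounded_op_more(5)[OF T closed_H]) (auto simp: H(4) bounded_opD(3)[OF T] F_T)
 then have Tp: "T p = p" by (simp add: p_def bounded_op_more(3)[OF T closed_H lH sH] Tl)
 have "cinner p (Ve v \<Psi>) = 0" if v: "v \<in> \<sigma>" for v
 proof (cases "v \<in> F")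
  case True
  have "cinner (z n) (Ve v \<Psi>) = cinner \<eta> (Ve v \<Psi>)" for n
  proof (induction n)
   case (Suc n)
   then show ?case using Tc[OF zH[of n] eH[OF True]] by (simp add: z_Suc F_T[OF True])
  qed (simp add: z_def)
  then have "cinner (average z N) (Ve v \<Psi>) = cinner \<eta> (Ve v \<Psi>)" if "N > 0" for N
   using that unfolding cinner_average_left by (simp add: average_def scaleR_conv_of_real)
  then have "(\<lambda>N. cinner (average z N) (Ve v \<Psi>)) \<longlonglongrightarrow> cinner \<eta> (Ve v \<Psi>)"
   by (intro tendsto_eventually) (auto simp: eventually_sequentially intro!: exI[of _ 1])
  then have "cinner l (Ve v \<Psi>) = cinner \<eta> (Ve v \<Psi>)"
   by (rule LIMSEQ_unique[OF tendsto_cinner[OF l tendsto_const]])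
  moreover have "cinner (\<Sum>u\<in>F. cinner \<eta> (Ve u \<Psi>) *\<^sub>C Ve u \<Psi>) (Ve v \<Psi>) = cinner \<eta> (Ve v \<Psi>)"
   using F True by (simp add: cinner_sum_left cinner_simps Ve_orthonormal F_def if_distrib cong: if_cong)
  ultimately show ?thesis by (simp add: p_def cinner_simps)
 next
  case False
  have "cinner p (Ve v \<Psi>) = cinner (T p) (T (Ve v \<Psi>))" by (simp add: Tc pH eigenvectors v)
  also have "... = cnj (v powi k * \<gamma>) * cinner p (Ve v \<Psi>)"
   using upow_eigen[OF eigenvectors(1,3)[OF v] \<sigma>_norm[OF v], of k]
   by (simp only: Tp) (simp add: T_def cinner_simps)
  finally have "(1 - cnj (v powi k * \<gamma>)) * cinner p (Ve v \<Psi>) = 0" by auto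
  moreover have "cnj (v powi k * \<gamma>) ~= 1" using False v by (simp only: F_def complex_cnj_one_iff) simp
  ultimately show ?thesis by simp
 qed
 then have "cinner p e = 0" if e: "e \<in> H" "U e = v *\<^sub>C e" for e v
 proof (cases "e = 0")
  case False
  then have v: "v \<in> \<sigma>" using e by (auto simp: eigenvalues_on_def)
  obtain c where "e = c *\<^sub>C Ve v \<Psi>" by (rule eigenvector_multiple[OF Ve(1)[OF v] Ve(3)[OF v] e \<sigma>_norm[OF v]]) auto
  then show ?thesis using \<open>!!v. v \<in> \<sigma> ==> cinner p (Ve v \<Psi>) = 0\<close>[OF v] by (simp add: cinner_simps)
 qed simp
 then have "p \<in> continuous_part" using pH by (auto simp: continuous_part_def)
 moreover have "Up k p = inverse \<gamma> *\<^sub>C p" using Tp \<gamma>0 by (metis T_def scaleC_scaleC left_inverse scaleC_of_real of_real_1 scaleR_one)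
 ultimately have "p = 0" by (rule continuous_part_no_power_eigenvector[OF _ _ k])
 then show "average (\<lambda>n. \<gamma> ^ n *\<^sub>C Up (int n * k) \<eta>) \<longlonglongrightarrow> (\<Sum>v\<in>F. cinner \<eta> (Ve v \<Psi>) *\<^sub>C Ve v \<Psi>)"
  using l by (simp add: p_def z_def[abs_def])
qed

text \<open>\<open>We w\<close> commutes with \<open>\<pi> a\<close> and is covariant under
  \<open>U\<close>, so the terms are \<open>We w\<close> applied to
  \<open>\<gamma>^n U^(nk) \<pi> a \<Psi>\<close> with \<open>\<gamma> = w^(k+1)\<close>: one factor
  \<open>w^n\<close> comes from \<open>U^n\<close>, and \<open>w^(nk)\<close> from moving
  \<open>U^(nk)\<close> past \<open>We w\<close>.\<close>

lemma twisted_eigenvector: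
 assumes w: "w \<in> \<sigma>" and k: "k ~= 0"
 shows "average (twisted k a (We w \<Psi>)) \<longlonglongrightarrow> V_op k (tens (\<pi> a \<Psi>) (We w \<Psi>))"
proof -
 define \<gamma> where "\<gamma> = w powi (k + 1)"
 define F where "F = {v \<in> \<sigma>. v powi k * \<gamma> = 1}"
 define \<eta> where "\<eta> = \<pi> a \<Psi>"
 have \<eta>: "\<eta> \<in> H" by (simp add: \<eta>_def r(8) \<Psi>)
 have w1: "cmod w = 1" and w0: "w ~= 0" using \<sigma>_norm[OF w] by auto
 have \<gamma>1: "cmod \<gamma> = 1" by (simp add: \<gamma>_def norm_power_int w1)
 note W = unitaryD[OF We(1)[OF w]]
 note e = eigen_average[OF \<eta> \<gamma>1 k, folded F_def]
 define z where "z n = \<gamma> ^ n *\<^sub>C Up (int n * k) \<eta>" for n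
 have zH: "z n \<in> H" for n by (simp add: z_def H(4) upow_mem \<eta>)
 have "twisted k a (We w \<Psi>) n = We w (z n)" for n
 proof -
  have "twisted k a (We w \<Psi>) n = Up (int n * k) ((w powi int n) *\<^sub>C \<pi> a (We w \<Psi>))"
   using upow_eigen[OF eigenvectors(2,4)[OF w] w1, of "int n"]
   by (simp only: twisted_def bounded_opD(3)[OF r(2) W(2)[OF \<Psi>]])
  also have "\<pi> a (We w \<Psi>) = We w \<eta>" using commutantD(2)[OF We(2)[OF w] _ \<Psi>, of "\<pi> a"] by (simp add: \<eta>_def)
  also have "Up (int n * k) ((w powi int n) *\<^sub>C We w \<eta>)
    = (w powi int n * w powi (int n * k)) *\<^sub>C We w (Up (int n * k) \<eta>)"
   by (simp only: upow_linear(2)[OF W(2)[OF \<eta>]] upow_commute[OF W(1) We(3)[OF w] w0 \<eta>, simplified] scaleC_scaleC)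
  also have "w powi int n * w powi (int n * k) = \<gamma> ^ n"
   using w0 by (simp add: \<gamma>_def algebra_simps flip: power_int_add power_int_mult power_int_of_nat)
  finally show ?thesis by (simp add: z_def bounded_opD(3)[OF W(1) upow_mem[OF \<eta>]])
 qed
 then have "twisted k a (We w \<Psi>) = (\<lambda>n. We w (z n))" by auto
 then have "average (twisted k a (We w \<Psi>)) = (\<lambda>N. We w (average z N))"
  by (simp add: bounded_op_average[OF W(1) closed_H zH])
 moreover have "(\<lambda>N. We w (average z N)) \<longlonglongrightarrow> We w (\<Sum>v\<in>F. cinner \<eta> (Ve v \<Psi>) *\<^sub>C Ve v \<Psi>)"
  using e(2) by (intro bounded_op_tendsto[OF W(1) closed_H] average_mem[OF closed_H zH]) (simp add: z_def[abs_def])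
 moreover have "We w (\<Sum>v\<in>F. cinner \<eta> (Ve v \<Psi>) *\<^sub>C Ve v \<Psi>) = (\<Sum>v\<in>F. cinner \<eta> (Ve v \<Psi>) *\<^sub>C Ve v (We w \<Psi>))"
  by (subst bounded_op_more(5)[OF W(1) closed_H])
   (auto simp: F_def H(4) eigenvectors bounded_opD(3)[OF W(1)] product_eigenvector(5) w)
 moreover have "V_op k (tens \<eta> (We w \<Psi>)) = (\<Sum>v\<in>F. cinner \<eta> (Ve v \<Psi>) *\<^sub>C Ve v (We w \<Psi>))"
 proof -
  have "V_op k (tens \<eta> (We w \<Psi>)) = infsum (\<lambda>(v, w'). cinner (tens \<eta> (We w \<Psi>)) (tens (Ve v \<Psi>) (We w' \<Psi>)) *\<^sub>C Ve v (We w' \<Psi>)) (F \<times> {w})"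
   unfolding V_op_def V_fibre_def
   by (rule infsum_cong_neutral) (auto simp: F_def \<gamma>_def w te We_orthonormal split: if_splits)
  also have "... = (\<Sum>(v, w')\<in>F \<times> {w}. cinner (tens \<eta> (We w \<Psi>)) (tens (Ve v \<Psi>) (We w' \<Psi>)) *\<^sub>C Ve v (We w' \<Psi>))"
   using e(1) by (intro infsum_finite) simp
  also have "... = (\<Sum>v\<in>F. cinner (tens \<eta> (We w \<Psi>)) (tens (Ve v \<Psi>) (We w \<Psi>)) *\<^sub>C Ve v (We w \<Psi>))"
   by (subst sum.cartesian_product[symmetric]) simp
  finally show ?thesis by (simp add: te We_orthonormal w)
 qed
 ultimately show ?thesis by (simp add: \<eta>_def)
qed

text \<open>The vectors whose averages have the right limit form a closed subspace. A vector
  orthogonal to it is orthogonal to all \<open>We w \<Psi>\<close>, hence to every eigenvector, and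
  then belongs to the subspace itself, both sides being zero.\<close>

theorem fibre_average:
 assumes k: "k ~= 0" "k + 1 ~= 0" and \<xi>: "\<xi> \<in> H"
 shows "average (twisted k a \<xi>) \<longlonglongrightarrow> V_op k (tens (\<pi> a \<Psi>) \<xi>)"
proof -
 define good where "good = {\<xi> \<in> H. average (twisted k a \<xi>) \<longlonglongrightarrow> V_op k (tens (\<pi> a \<Psi>) \<xi>)}"
 obtain K where K: "K > 0" "!!\<xi> n. \<xi> \<in> H ==> norm (twisted k a \<xi> n) <= K * norm \<xi>" by (rule twisted_bound) (rule that)
 define M where "M = K + norm (\<pi> a \<Psi>)"
 have M: "M > 0" using K(1) by (simp add: M_def add_pos_nonneg)
 have "closed_csubspace good"
  unfolding closed_csubspace_def
 proof (intro conjI ballI allI)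
  have V0: "V_op k 0 = 0" using V_op_linear(2)[of k 0 0] by simp
  have "tens (\<pi> a \<Psi>) 0 = 0" using te(8)[of "\<pi> a \<Psi>" 0 0] by simp
  moreover have "twisted k a 0 = (\<lambda>n. 0)" using twisted_linear(2)[OF H(2), of k a 0] by auto
  ultimately show "0 \<in> good" by (simp add: good_def H(2) V0 average_def[abs_def])
  show "\<xi> + \<eta> \<in> good" if "\<xi> \<in> good" "\<eta> \<in> good" for \<xi> \<eta>
  proof -
   have "average (twisted k a (\<xi> + \<eta>)) = (\<lambda>N. average (twisted k a \<xi>) N + average (twisted k a \<eta>) N)"
    using that by (simp add: good_def twisted_linear fun_eq_iff flip: average_add) (simp add: average_def twisted_linear)
   then show ?thesis using that by (auto simp: good_def H(3) te V_op_linear intro!: tendsto_add)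
  qed
  show "c *\<^sub>C \<xi> \<in> good" if "\<xi> \<in> good" for c \<xi>
  proof -
   have "average (twisted k a (c *\<^sub>C \<xi>)) = (\<lambda>N. c *\<^sub>C average (twisted k a \<xi>) N)"
    using that bounded_op_average[of UNIV "scaleC c" "twisted k a \<xi>"] bounded_opI[of UNIV "scaleC c :: 'k => 'k" "cmod c"]
    by (simp add: good_def twisted_linear fun_eq_iff average_def scaleC_add_right scaleC_scaleC norm_scaleC mult.commute closed_csubspace_UNIV)
   then show ?thesis using that by (auto simp: good_def H(4) te V_op_linear intro!: tendsto_scaleC)
  qed
  show "closed good"
  proof (rule closed_sequential_limits[THEN iffD2], intro allI impI, elim conjE)
   fix f l assume f: "\<forall>n. f n \<in> good" "f \<longlonglongrightarrow> l"
   have fH: "f n \<in> H" for n using f by (simp add: good_def)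
   have lH: "l \<in> H" by (rule closed_sequentially[OF H(1) fH f(2)])
   have "average (twisted k a l) \<longlonglongrightarrow> V_op k (tens (\<pi> a \<Psi>) l)"
   proof (rule tendsto_uniform_approximation)
    fix e :: real assume e: "e > 0"
    obtain n where n: "norm (f n - l) < e / M" using LIMSEQ_D[OF f(2), of "e / M"] e M by auto
    have d: "M * norm (l - f n) <= e" using mult_left_mono[OF less_imp_le[OF n], of M] M by (simp add: norm_minus_commute)
    have "norm (average (twisted k a l) N - average (twisted k a (f n)) N) <= e" for N
     unfolding average_diff[symmetric]
    proof (rule norm_average_le)
     fix m
     have "norm (twisted k a l m - twisted k a (f n) m) <= K * norm (l - f n)"
      using K(2)[OF H(6)[OF lH fH[of n]]] by (simp add: twisted_linear lH fH)
     also have "... <= M * norm (l - f n)" by (intro mult_right_mono) (auto simp: M_def)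
     finally show "norm (twisted k a l m - twisted k a (f n) m) <= e" using d by simp
    qed (use e in simp)
    moreover have "norm (V_op k (tens (\<pi> a \<Psi>) l) - V_op k (tens (\<pi> a \<Psi>) (f n))) <= e"
    proof -
     have "norm (V_op k (tens (\<pi> a \<Psi>) l) - V_op k (tens (\<pi> a \<Psi>) (f n))) <= norm (\<pi> a \<Psi>) * norm (l - f n)"
      unfolding V_op_diff[symmetric] te(8)[symmetric] te(6)[symmetric] by (rule V_op_bound)
     also have "... <= M * norm (l - f n)" using K(1) by (intro mult_right_mono) (auto simp: M_def)
     finally show ?thesis using d by simp
    qed
    moreover have "average (twisted k a (f n)) \<longlonglongrightarrow> V_op k (tens (\<pi> a \<Psi>) (f n))" using f(1) by (simp add: good_def)
    ultimately show "\<exists>y' l'. y' \<longlonglongrightarrow> l' \<and> (\<forall>N. norm (average (twisted k a l) N - y' N) <= e)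
      \<and> norm (V_op k (tens (\<pi> a \<Psi>) l) - l') <= e" by auto
   qed
   then show "l \<in> good" using lH by (simp add: good_def)
  qed
 qed
 moreover have "z = 0" if z: "z \<in> H" and orth: "!!e. e \<in> good ==> cinner z e = 0" for z
 proof -
  have zW: "cinner z (We w \<Psi>) = 0" if "w \<in> \<sigma>" for w
   using twisted_eigenvector[OF that k(1), of a] eigenvectors(2)[OF that] by (intro orth) (simp add: good_def)
  have zc: "z' \<in> continuous_part" if z': "z' \<in> H" "!!w. w \<in> \<sigma> ==> cinner z' (We w \<Psi>) = 0" for z'
  proof -
   have "cinner z' e = 0" if e: "e \<in> H" "U e = v *\<^sub>C e" for e v
   proof (cases "e = 0")
    case False
    then have v: "v \<in> \<sigma>" using e by (auto simp: eigenvalues_on_def)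
    obtain c where "e = c *\<^sub>C We v \<Psi>" by (rule eigenvector_multiple[OF We(1)[OF v] We(3)[OF v] e \<sigma>_norm[OF v]]) auto
    then show ?thesis using z'(2)[OF v] by (simp add: cinner_simps)
   qed simp
   then show ?thesis using z' by (auto simp: continuous_part_def)
  qed
  have zcp: "z \<in> continuous_part" by (rule zc[OF z zW])
  have "V_op k (tens (\<pi> a \<Psi>) z) = 0"
  proof -
   have *: "cinner (tens (\<pi> a \<Psi>) z) (tens (Ve v \<Psi>) (We w \<Psi>)) *\<^sub>C Ve v (We w \<Psi>) = 0" if "w \<in> \<sigma>" for v w
    using zW[OF that] by (simp add: te)
   show ?thesis unfolding V_op_def V_fibre_def by (rule infsum_0) (auto simp: *)
  qed
  then have "z \<in> good" using twisted_continuous_part[OF zcp k(2), of a] z by (simp add: good_def)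
  then show "z = 0" using orth[of z] by simp
 qed
 ultimately have "good = H" by (intro closed_csubspace_eqI[OF closed_H]) (auto simp: good_def)
 then show ?thesis using \<xi> by (auto simp: good_def)
qed

end

section \<open>Time reversal and the exchange of the tensor factors\<close>

context unitary_on_subspace
begin

lemma upow_iterate:
 assumes x: "x \<in> H"
 shows "upow H (Up p) m x = Up (m * p) x"
proof -
 interpret I: unitary_on_subspace H "Up p" by (rule unitary_on_subspace_upow)
 show ?thesis
 proof (induction m rule: int_induct[where k = 0])
  case (step1 i)
  show ?case
   unfolding I.upow_succ[OF x] step1(2) upow_add[OF x, symmetric] by (simp add: algebra_simps)
 next
  case (step2 i)
  have "Up (i * p) x = Up p (Up ((i - 1) * p) x)"
   unfolding upow_add[OF x, symmetric] by (simp add: algebra_simps)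
  then show ?case unfolding I.upow_pred[OF x] step2(2) by (simp add: I.inv_U upow_mem x)
 qed simp
qed

end

text \<open>Identities between powers of \<open>U\<close> hold on \<open>H\<close> only; membership
  in a commutant depends on nothing else.\<close>

lemma commutant_cong:
 assumes H: "closed_csubspace H" and T: "T \<in> commutant H S" and S: "!!s x. s \<in> S ==> x \<in> H ==> s x \<in> H"
  and eq: "!!x. x \<in> H ==> T' x = T x"
 shows "T' \<in> commutant H S"
 using T S closed_csubspaceD(3,4)[OF H] unfolding commutant_def bounded_op_def by (auto simp: eq)

context ergodic_fibre
begin

text \<open>A priori the two products agree up to a phase. If both eigenvalues are powers of one
  \<open>u\<close>, then \<open>Ve v \<Psi>\<close> and \<open>Ve w \<Psi>\<close> are multiples of
  \<open>X m \<Psi>\<close> and \<open>X n \<Psi>\<close> for the powers \<open>X\<close> of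
  \<open>Ve u\<close>. Writing \<open>Ve w \<Psi>\<close> as a multiple of
  \<open>We w \<Psi>\<close> lets \<open>Ve v\<close> pass, and both products become the same
  multiple of \<open>X (m + n) \<Psi>\<close>.\<close>

lemma Ve_commute:
 assumes u: "u \<in> \<sigma>" and v: "v \<in> \<sigma>" "v = u powi m" and w: "w \<in> \<sigma>" "w = u powi n"
 shows "Ve v (Ve w \<Psi>) = Ve w (Ve v \<Psi>)"
proof -
 interpret X: unitary_on_subspace H "Ve u" by unfold_locales (rule closed_H, rule Ve(1)[OF u])
 define X where "X = upow H (Ve u)"
 have u0: "u ~= 0" using \<sigma>_norm[OF u] by auto
 have XH: "x \<in> H ==> X i x \<in> H" for i x unfolding X_def by (rule X.upow_mem)
 have XX: "x \<in> H ==> X i (X j x) = X (i + j) x" for i j x unfolding X_def by (simp add: X.upow_add)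
 have X_U: "U (X i \<Psi>) = (u powi i) *\<^sub>C X i \<Psi>" for i
 proof -
  have "Ve u (U x) = inverse u *\<^sub>C U (Ve u x)" if "x \<in> H" for x using u0 Ve(3)[OF u that] by (simp add: scaleC_scaleC)
  then have "X i (U \<Psi>) = (inverse u powi i) *\<^sub>C U (X i \<Psi>)"
   unfolding X_def using u0 \<Psi> by (intro X.upow_commute U_op) auto
  then have "(u powi i) *\<^sub>C X i \<Psi> = (u powi i * inverse u powi i) *\<^sub>C U (X i \<Psi>)" by (simp add: U_\<Psi> flip: scaleC_scaleC)
  then show ?thesis using u0 by (simp add: power_int_inverse)
 qed
 have X_B: "X i (B x) = B (X i x)" if "B \<in> Mc" "x \<in> H" for i B x
 proof -
  have "Ve u (B x) = 1 *\<^sub>C B (Ve u x)" if "x \<in> H" for x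
   using bicommutant_commutes[OF Ve(2)[OF u] \<open>B \<in> Mc\<close> that] by simp
  from X.upow_commute[OF commutantD(1)[OF that(1)] this one_neq_zero that(2), of i]
  show ?thesis by (simp add: X_def)
 qed
 have step: "\<exists>d. \<forall>w\<in>\<sigma>. \<forall>j e. Ve w \<Psi> = e *\<^sub>C X j \<Psi> \<longrightarrow> Ve v (Ve w \<Psi>) = (e * d) *\<^sub>C X (i + j) \<Psi> \<and> Ve v \<Psi> = d *\<^sub>C X i \<Psi>"
  if v: "v \<in> \<sigma>" "v = u powi i" for v i
 proof -
  obtain c where c: "X i \<Psi> = c *\<^sub>C Ve v \<Psi>"
   using eigenvector_multiple[OF Ve(1)[OF v(1)] Ve(3)[OF v(1)] XH[OF \<Psi>, of i] _ \<sigma>_norm[OF v(1)]] X_U[of i] v(2)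
   by auto
  have "c ~= 0"
  proof
   assume "c = 0"
   then have "X i \<Psi> = 0" by (simp add: c)
   then show False using X.upow_norm[OF \<Psi>, of i] by (simp add: X_def norm_\<Psi>)
  qed
  then have d: "Ve v \<Psi> = inverse c *\<^sub>C X i \<Psi>" by (simp add: c scaleC_scaleC)
  have "Ve v (Ve w \<Psi>) = (e * inverse c) *\<^sub>C X (i + j) \<Psi>" if w: "w \<in> \<sigma>" and e: "Ve w \<Psi> = e *\<^sub>C X j \<Psi>" for w e j
  proof -
   obtain f where f: "Ve w \<Psi> = f *\<^sub>C We w \<Psi>"
    by (rule eigenvector_multiple[OF We(1)[OF w] We(3)[OF w] eigenvectors(1,3)[OF w] \<sigma>_norm[OF w]]) auto
   note WH = eigenvectors(2)[OF w] and Wb = commutantD(1)[OF We(2)[OF w]]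
   have "Ve v (Ve w \<Psi>) = f *\<^sub>C We w (Ve v \<Psi>)"
    by (simp add: f bounded_opD(3)[OF unitaryD(1)[OF Ve(1)[OF v(1)]] WH] product_eigenvector(5) v(1) w)
   also have "... = inverse c *\<^sub>C X i (f *\<^sub>C We w \<Psi>)"
    by (simp add: d bounded_opD(3)[OF Wb] bounded_opD(3)[OF X.upow_op, folded X_def] XH \<Psi> WH X_B[OF We(2)[OF w] \<Psi>] scaleC_scaleC mult.commute)
   also have "... = inverse c *\<^sub>C X i (e *\<^sub>C X j \<Psi>)" by (simp add: e flip: f)
   finally show ?thesis
    by (simp add: bounded_opD(3)[OF X.upow_op, folded X_def] XH \<Psi> XX scaleC_scaleC mult.commute)
  qed
  then show ?thesis using d by auto
 qed
 obtain d where d: "!!w j e. w \<in> \<sigma> ==> Ve w \<Psi> = e *\<^sub>C X j \<Psi> ==> Ve v (Ve w \<Psi>) = (e * d) *\<^sub>C X (m + j) \<Psi> \<and> Ve v \<Psi> = d *\<^sub>C X m \<Psi>"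
  using step[OF v] by auto
 obtain d' where d': "!!w' j e. w' \<in> \<sigma> ==> Ve w' \<Psi> = e *\<^sub>C X j \<Psi> ==> Ve w (Ve w' \<Psi>) = (e * d') *\<^sub>C X (n + j) \<Psi> \<and> Ve w \<Psi> = d' *\<^sub>C X n \<Psi>"
  using step[OF w] by auto
 have u1: "Ve u \<Psi> = 1 *\<^sub>C X 1 \<Psi>" by (simp add: X_def X.upow_1 \<Psi>)
 have "Ve v \<Psi> = d *\<^sub>C X m \<Psi>" "Ve w \<Psi> = d' *\<^sub>C X n \<Psi>" using d[OF u u1] d'[OF u u1] by blast+
 then show ?thesis using d[OF w(1)] d'[OF v(1)] by (simp add: mult.commute add.commute)
qed

text \<open>\<open>We v \<Psi>\<close> and \<open>Ve v \<Psi>\<close> differ by a phase, which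
  occurs in the vector and, conjugated, in its coefficient, and so cancels. What remains is the
  commutation of \<open>Ve v\<close> and \<open>Ve w\<close> on \<open>\<Psi>\<close>, available
  because a resonant pair consists of powers of \<open>v * w\<close>.\<close>

lemma Ve_We_symmetric:
 assumes v: "v \<in> \<sigma>" and w: "w \<in> \<sigma>" and res: "v powi k * w powi (k + 1) = 1"
 shows "cinner (tens y x) (tens (Ve w \<Psi>) (We v \<Psi>)) *\<^sub>C Ve w (We v \<Psi>)
  = cinner (tens x y) (tens (Ve v \<Psi>) (We w \<Psi>)) *\<^sub>C Ve v (We w \<Psi>)"
proof -
 have vw: "v ~= 0" "w ~= 0" using \<sigma>_norm[OF v] \<sigma>_norm[OF w] by auto
 have *: "\<exists>c. We v \<Psi> = c *\<^sub>C Ve v \<Psi> \<and> cnj c * c = 1" if v: "v \<in> \<sigma>" for v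
 proof -
  obtain c where c: "We v \<Psi> = c *\<^sub>C Ve v \<Psi>"
   by (rule eigenvector_multiple[OF Ve(1)[OF v] Ve(3)[OF v] eigenvectors(2,4)[OF v] \<sigma>_norm[OF v]]) auto
  then show ?thesis using eigenvectors(5,6)[OF v] by (auto simp: cinner_simps)
 qed
 obtain c where c: "We v \<Psi> = c *\<^sub>C Ve v \<Psi>" "cnj c * c = 1" using *[OF v] by auto
 obtain d where d: "We w \<Psi> = d *\<^sub>C Ve w \<Psi>" "cnj d * d = 1" using *[OF w] by auto
 have swap: "Ve v (Ve w \<Psi>) = Ve w (Ve v \<Psi>)"
  using resonance_product[OF vw res] by (intro Ve_commute[OF product_eigenvector(4)[OF v w] v _ w])
 have cd: "c * (cnj c * z) = z" "d * (cnj d * z) = z" for z using c(2) d(2) by (metis mult.assoc mult.commute mult_1)+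
 show ?thesis
  by (simp add: swap cd te c(1) d(1) cinner_simps bounded_opD(3)[OF unitaryD(1)[OF Ve(1)]] v w eigenvectors scaleC_scaleC mult_ac)
qed

lemma eigenvalues_inverse: "v \<in> eigenvalues_on H (Up (- 1)) \<longleftrightarrow> inverse v \<in> \<sigma>"
proof -
 interpret I: unitary_on_subspace H "Up (- 1)" by (rule unitary_on_subspace_upow)
 have "Up (- 1) x = v *\<^sub>C x \<longleftrightarrow> U x = inverse v *\<^sub>C x" if x: "x \<in> H" "x ~= 0" for x
 proof
  assume e: "Up (- 1) x = v *\<^sub>C x"
  from upow_iterate[OF x(1), of "- 1" "- 1"] I.upow_eigen[OF x(1) e I.eigenvalue_norm[OF x e], of "- 1"]
  show "U x = inverse v *\<^sub>C x" by (simp add: upow_1 x)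
 next
  assume e: "U x = inverse v *\<^sub>C x"
  from upow_eigen[OF x(1) e eigenvalue_norm[OF x e], of "- 1"] show "Up (- 1) x = v *\<^sub>C x" by simp
 qed
 then show ?thesis unfolding eigenvalues_on_def by auto
qed

text \<open>A unitary with eigenvalue \<open>inverse v\<close> under \<open>U\<close> has eigenvalue
  \<open>v\<close> under the inverse of \<open>U\<close>; the other requirements are symmetric in
  time.\<close>

lemma inverse_fibre:
 "ergodic_fibre H (Up (- 1)) \<pi> \<Psi> (\<lambda>v. Ve (inverse v)) (\<lambda>v. We (inverse v)) tens"
proof -
 interpret I: unitary_on_subspace H "Up (- 1)" by (rule unitary_on_subspace_upow)
 have nz: "v ~= 0" if "inverse v \<in> \<sigma>" for v using \<sigma>_norm[OF that] by auto
 have eig: "Up (- 1) (V x) = v *\<^sub>C V (Up (- 1) x)"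
  if V: "unitary_on H V" "!!x. x \<in> H ==> U (V x) = inverse v *\<^sub>C V (U x)" and v: "inverse v \<in> \<sigma>" and x: "x \<in> H" for V v x
  using upow_commute[OF unitaryD(1)[OF V(1)] V(2) _ x, of "- 1"] nz[OF v] by simp
 show ?thesis
 proof (unfold_locales, unfold eigenvalues_inverse)
  show "\<exists>c. x = c *\<^sub>C \<Psi>" if "x \<in> H" "Up (- 1) x = x" for x
   using upow_upow[OF that(1), of 1 "- 1"] that by (intro fixed) (simp_all add: upow_1)
  show "(\<lambda>x. upow H (Up (- 1)) m (B (upow H (Up (- 1)) (- m) x))) \<in> Mc"
   if "B \<in> Mc" for m B
   by (rule commutant_cong[OF closed_H commutant_conj[OF that, of "- m"]])
    (auto simp: upow_iterate upow_mem r(8) bounded_opD(1)[OF commutantD(1)[OF that]])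
  show "Up (- 1) (Ve (inverse v) x) = v *\<^sub>C Ve (inverse v) (Up (- 1) x)" if "inverse v \<in> \<sigma>" "x \<in> H" for v x
   by (rule eig[OF Ve(1)[OF that(1)] Ve(3)[OF that(1)] that])
  show "Up (- 1) (We (inverse v) x) = v *\<^sub>C We (inverse v) (Up (- 1) x)" if "inverse v \<in> \<sigma>" "x \<in> H" for v x
   by (rule eig[OF We(1)[OF that(1)] We(3)[OF that(1)] that])
 qed (fact rep \<Psi> norm_\<Psi> upow_\<Psi> cyclic cyclic' tens Ve(1,2) We(1,2))+
qed

text \<open>This is \<open>fibre_average\<close> for the inverse unitary with
  \<open>k' = -(k + 1)\<close>; then \<open>k' + 1 = -k\<close>, so the two nonvanishing conditions
  only change places.\<close>

theorem fibre_average_commutant: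
 assumes k: "k ~= 0" "k + 1 ~= 0" and \<eta>: "\<eta> \<in> H"
 shows "average (\<lambda>n. Up (int n * (k + 1)) (\<pi> a (Up (- int n) \<eta>))) \<longlonglongrightarrow> V_op k (tens \<eta> (\<pi> a \<Psi>))"
proof -
 interpret I: ergodic_fibre H "Up (- 1)" \<pi> \<Psi> "\<lambda>v. Ve (inverse v)" "\<lambda>v. We (inverse v)" tens by (rule inverse_fibre)
 define R where "R = {(v, w). v \<in> \<sigma> \<and> w \<in> \<sigma> \<and> v powi k * w powi (k + 1) = 1}"
 have "I.twisted (- (k + 1)) a \<eta> = (\<lambda>n. Up (int n * (k + 1)) (\<pi> a (Up (- int n) \<eta>)))"
  by (simp add: fun_eq_iff I.twisted_def upow_iterate upow_mem r(8) \<eta> del: minus_add_distrib)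
 moreover have "I.V_op (- (k + 1)) (tens (\<pi> a \<Psi>) \<eta>) = V_op k (tens \<eta> (\<pi> a \<Psi>))"
 proof -
  have "I.V_op (- (k + 1)) (tens (\<pi> a \<Psi>) \<eta>)
   = (\<Sum>\<^sub>\<infinity>(v, w)\<in>R. cinner (tens (\<pi> a \<Psi>) \<eta>) (tens (Ve w \<Psi>) (We v \<Psi>)) *\<^sub>C Ve w (We v \<Psi>))"
   unfolding I.V_op_def V_fibre_def
   \<comment> \<open>Under \<open>(v, w) \<mapsto> (inverse w, inverse v)\<close> the resonance
     condition for \<open>-(k + 1)\<close> becomes that for \<open>k\<close>, and the eigenvalues of
     the two tensor factors change places.\<close>
   by (rule infsum_reindex_bij_witness[where i = "\<lambda>(v, w). (inverse w, inverse v)" and j = "\<lambda>(v, w). (inverse w, inverse v)"])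
    (auto simp: R_def eigenvalues_inverse power_int_inverse power_int_minus mult.commute add.commute simp flip: power_int_minus)
  also have "... = (\<Sum>\<^sub>\<infinity>(v, w)\<in>R. cinner (tens \<eta> (\<pi> a \<Psi>)) (tens (Ve v \<Psi>) (We w \<Psi>)) *\<^sub>C Ve v (We w \<Psi>))"
   by (rule infsum_cong) (auto simp: R_def Ve_We_symmetric)
  finally show ?thesis by (simp add: V_op_def V_fibre_def R_def)
 qed
 ultimately show ?thesis using I.fibre_average[OF _ _ \<eta>, of "- (k + 1)" a] k by simp
qed

end

section \<open>From extremal invariant states to fibres\<close>

lemma covariant_GNSD:
 assumes "covariant_GNS \<beta> \<psi> H \<pi> U \<Psi>"
 shows "star_representation H \<pi>" "unitary_on_subspace H U" "\<Psi> \<in> H" "closure (range (\<lambda>a. \<pi> a \<Psi>)) = H"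
  "\<psi> a = cinner (\<pi> a \<Psi>) \<Psi>" "U \<Psi> = \<Psi>" "x \<in> H ==> U (\<pi> a x) = \<pi> (\<beta> a) (U x)"
proof -
 note c = assms[unfolded covariant_GNS_def]
 show "star_representation H \<pi>" using c by (simp add: star_representation_def)
 show u: "unitary_on_subspace H U" using c by unfold_locales auto
 interpret unitary_on_subspace H U by (rule u)
 show "x \<in> H ==> U (\<pi> a x) = \<pi> (\<beta> a) (U x)"
  using c U_H inv_U unfolding conj_by_def by metis
qed (use assms[unfolded covariant_GNS_def] in auto)

context
 fixes \<beta> :: "'a::unital_cstar_algebra => 'a" and \<psi> and H :: "'k::complex_hilbert_space set" and \<pi> U \<Psi>
 assumes GNS: "covariant_GNS \<beta> \<psi> H \<pi> U \<Psi>"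
begin

interpretation unitary_on_subspace H U by (rule covariant_GNSD(2)[OF GNS])

lemmas g = covariant_GNSD[OF GNS]
lemmas r = star_representationD[OF g(1)]

lemma GNS_norm:
 assumes "\<psi> 1 = 1"
 shows "norm \<Psi> = 1"
proof -
 have "complex_of_real ((norm \<Psi>)\<^sup>2) = 1" using assms g(5)[of 1] by (simp add: r(6) g(3) cinner_self del: of_real_power)
 then have "(norm \<Psi>)\<^sup>2 = 1" by (simp only: of_real_eq_1_iff)
 then show ?thesis using norm_ge_zero[of \<Psi>] by (auto simp: power2_eq_1_iff)
qed

text \<open>\<open>b\<close> is an image of \<open>a\<close> under the \<open>m\<close>-th power of
  \<open>\<beta>\<close>, where each downward step takes a preimage.\<close>

lemma GNS_upow_representation:
 assumes \<beta>: "surj \<beta>"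
 shows "\<exists>b. \<forall>x\<in>H. Up m (\<pi> a x) = \<pi> b (Up m x)"
proof (induction m rule: int_induct[where k = 0])
 case (step1 i)
 then show ?case using upow_succ r(8) g(7) upow_mem by auto
next
 case (step2 i)
 then obtain b where b: "!!x. x \<in> H ==> Up i (\<pi> a x) = \<pi> b (Up i x)" by auto
 obtain b' where b': "b = \<beta> b'" using \<beta> by auto
 have "Up (i - 1) (\<pi> a x) = \<pi> b' (Up (i - 1) x)" if x: "x \<in> H" for x
 proof -
  define y where "y = Up (i - 1) x"
  have y: "y \<in> H" "Up i x = U y" using x upow_succ[OF x, of "i - 1"] by (auto simp: y_def upow_mem)
  have "Up (i - 1) (\<pi> a x) = inv_into H U (U (\<pi> b' y))" by (simp add: upow_pred r(8) x b y b' g(7))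
  then show ?thesis by (simp add: inv_U r(8) y flip: y_def)
 qed
 then show ?case by auto
qed auto

lemma GNS_commutant_conj:
 assumes \<beta>: "surj \<beta>" and B: "B \<in> commutant H (range \<pi>)"
 shows "(\<lambda>x. Up m (B (Up (- m) x))) \<in> commutant H (range \<pi>)"
proof -
 note Bb = commutantD(1)[OF B]
 have "Up m (B (Up (- m) (\<pi> a x))) = \<pi> a (Up m (B (Up (- m) x)))" if x: "x \<in> H" for a x
 proof -
  obtain b where b: "!!x. x \<in> H ==> Up (- m) (\<pi> a x) = \<pi> b (Up (- m) x)"
   using GNS_upow_representation[OF \<beta>, of "- m" a] by auto
  define z where "z = B (Up (- m) x)"
  have z: "z \<in> H" unfolding z_def by (intro bounded_opD(1)[OF Bb] upow_mem x)
  have "B (Up (- m) (\<pi> a x)) = \<pi> b (Up (- m) (Up m z))"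
   using commutantD(2)[OF B _ upow_mem[OF x], of "\<pi> b"] by (simp add: b x upow_inverse z) (simp add: z_def)
  also have "... = Up (- m) (\<pi> a (Up m z))" by (simp add: b upow_mem z)
  finally show ?thesis
   using upow_inverse[OF r(8)[OF upow_mem[OF z]], of "- m"] by (simp add: z_def)
 qed
 moreover have "bounded_op H (\<lambda>x. Up m (B (Up (- m) x)))"
  by (intro bounded_op_compose[OF upow_op bounded_op_compose[OF Bb upow_op]])
 ultimately show ?thesis by (auto simp: commutant_def)
qed

text \<open>The vector functional of \<open>y\<close> is invariant and dominated by a multiple of
  \<open>\<psi>\<close>, so \<open>\<psi>\<close> is a convex combination of its normalisation and a
  second invariant state; extremality identifies both with \<open>\<psi>\<close>.\<close>

lemma GNS_vector_state:
 assumes \<psi>: "\<psi> \<in> ergodic_states \<beta>" and y: "y \<in> H" "U y = y"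
  and C: "!!a. (norm (\<pi> a y))\<^sup>2 <= C * (norm (\<pi> a \<Psi>))\<^sup>2"
 shows "cinner (\<pi> a y) y = of_real ((norm y)\<^sup>2) * \<psi> a"
proof (cases "y = 0")
 case True
 then show ?thesis by simp
next
 case False
 define m where "m = (norm y)\<^sup>2"
 \<comment> \<open>\<open>c\<close> dominates \<open>C\<close> and exceeds the mass
   \<open>m\<close>, so that the complementary functional \<open>\<phi>2\<close> is positive and can
   be normalised by \<open>c - m > 0\<close>.\<close>
 define c where "c = \<bar>C\<bar> + m + 1"
 have m: "m > 0" "c > m" using False by (auto simp: m_def c_def)
 define \<phi> where "\<phi> a = cinner (\<pi> a y) y" for a
 have sq: "cinner (\<pi> (star a * a) x) x = of_real ((norm (\<pi> a x))\<^sup>2)" if "x \<in> H" for a x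
  using r(7)[OF r(8)[OF that] that, of "star a" a] that by (simp add: r(5) star_star cinner_self)
 have \<psi>': "\<psi> \<in> states" "\<psi> (\<beta> a) = \<psi> a" for a using \<psi> by (auto simp: ergodic_states_def invariant_states_def fun_eq_iff)
 have lin: "functional_linear \<phi>" "functional_linear \<psi>" "\<psi> 1 = 1"
  using \<psi>' by (auto simp: functional_linear_def \<phi>_def r(3,4) y cinner_simps states_def)
 have inv: "\<phi> (\<beta> a) = \<phi> a" for a
  using U_cinner[OF r(8)[OF y(1)] y(1), of a] by (simp add: \<phi>_def g(7) y)
 have \<phi>1: "\<phi> 1 = of_real m" by (simp add: \<phi>_def r(6) y cinner_self m_def)
 define \<phi>1 where "\<phi>1 a = \<phi> a / of_real m" for a
 define \<phi>2 where "\<phi>2 a = (of_real c * \<psi> a - \<phi> a) / of_real (c - m)" for a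
 have "\<phi>1 \<in> states"
  using lin m \<phi>1 by (auto simp: states_def functional_linear_def \<phi>1_def \<phi>_def sq y add_divide_distrib Re_divide_of_real
   simp flip: of_real_divide)
 moreover have "\<phi>2 \<in> states"
 proof -
  have "\<phi>2 (star a * a) = of_real ((c * (norm (\<pi> a \<Psi>))\<^sup>2 - (norm (\<pi> a y))\<^sup>2) / (c - m))" for a
   using sq[OF g(3), of a] sq[OF y(1), of a] by (simp add: \<phi>2_def \<phi>_def g(5))
  moreover have "(norm (\<pi> a y))\<^sup>2 <= c * (norm (\<pi> a \<Psi>))\<^sup>2" for a
   by (rule order_trans[OF C mult_right_mono]) (use m in \<open>auto simp: c_def\<close>)
  moreover have "\<phi>2 1 = 1" using m(2) by (simp add: \<phi>2_def lin \<phi>1 flip: of_real_diff)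
  moreover have "functional_linear \<phi>2"
   using lin by (simp add: functional_linear_def \<phi>2_def algebra_simps add_divide_distrib diff_divide_distrib)
  ultimately show ?thesis using m(2) by (simp add: states_def)
 qed
 moreover have "\<phi>1 \<circ> \<beta> = \<phi>1" "\<phi>2 \<circ> \<beta> = \<phi>2" by (auto simp: \<phi>1_def \<phi>2_def inv \<psi>')
 moreover have "\<psi> = (\<lambda>a. of_real (m / c) * \<phi>1 a + of_real (1 - m / c) * \<phi>2 a)"
 proof
  fix a
  have nz: "complex_of_real c ~= 0" "complex_of_real m ~= 0" "complex_of_real (c - m) ~= 0" using m by auto
  have "of_real (1 - m / c) = complex_of_real (c - m) / of_real c" using m by (simp add: field_simps)
  then have "of_real (m / c) * \<phi>1 a + of_real (1 - m / c) * \<phi>2 a = \<phi> a / of_real c + (of_real c * \<psi> a - \<phi> a) / of_real c"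
   unfolding \<phi>1_def \<phi>2_def using nz by simp
  then show "\<psi> a = of_real (m / c) * \<phi>1 a + of_real (1 - m / c) * \<phi>2 a" using nz by (simp add: field_simps)
 qed
 moreover have "0 < m / c" "m / c < 1" using m by auto
 ultimately have "\<phi>1 = \<psi>" using \<psi> unfolding ergodic_states_def invariant_states_def by blast
 then have "\<phi> a = of_real m * \<psi> a" using m by (auto simp: \<phi>1_def fun_eq_iff field_simps)
 then show ?thesis by (simp add: \<phi>_def m_def)
qed

text \<open>For a fixed vector \<open>y\<close> that is a limit of averages of the orbit of \<open>B \<Psi>\<close>, all vectors
 \<open>y + s \<Psi>\<close> induce multiples of \<open>\<psi>\<close> by extremality; polarisation gives \<open>y \<in> \<complex>\<Psi>\<close>.\<close>

lemma GNS_average_commutant: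
 assumes \<psi>: "\<psi> \<in> ergodic_states \<beta>" and \<beta>: "surj \<beta>" and B: "B \<in> commutant H (range \<pi>)"
  and l: "average (\<lambda>n. Up (int n) (B \<Psi>)) \<longlonglongrightarrow> y" and Uy: "U y = y"
 shows "y = cinner y \<Psi> *\<^sub>C \<Psi>"
proof -
 have \<psi>1: "\<psi> 1 = 1" using \<psi> by (auto simp: ergodic_states_def invariant_states_def states_def)
 note Bb = commutantD(1)[OF B] and \<Psi> = g(3)
 obtain K where K: "K > 0" "!!x. x \<in> H ==> norm (B x) <= K * norm x" by (rule bounded_opE[OF Bb]) (rule that)
 have U\<Psi>: "Up m \<Psi> = \<Psi>" for m using upow_eigen[OF \<Psi>, of 1 m] by (simp add: g(6))
 have aH: "average (\<lambda>n. Up (int n) (B \<Psi>)) N \<in> H" for N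
  by (intro average_mem closed_H upow_mem bounded_opD(1)[OF Bb] \<Psi>)
 have yH: "y \<in> H" by (rule closed_sequentially[OF H(1) aH l])
 \<comment> \<open>Each \<open>U^n B U^(-n)\<close> lies in the commutant and is bounded by
   \<open>K\<close>, so the orbit of \<open>B \<Psi>\<close> is dominated by \<open>\<Psi>\<close>;
   the averages and their limit inherit this.\<close>
 have bound: "norm (\<pi> a y) <= K * norm (\<pi> a \<Psi>)" for a
 proof (rule tendsto_upperbound)
  show "(\<lambda>N. norm (\<pi> a (average (\<lambda>n. Up (int n) (B \<Psi>)) N))) \<longlonglongrightarrow> norm (\<pi> a y)"
   by (intro tendsto_norm bounded_op_tendsto[OF r(2) closed_H aH l])
  have *: "norm (\<pi> a (Up (int n) (B \<Psi>))) <= K * norm (\<pi> a \<Psi>)" for n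
  proof -
   define G where "G x = Up (int n) (B (Up (- int n) x))" for x
   have G: "G \<in> commutant H (range \<pi>)" unfolding G_def by (rule GNS_commutant_conj[OF \<beta> B])
   have "\<pi> a (Up (int n) (B \<Psi>)) = G (\<pi> a \<Psi>)" using commutantD(2)[OF G _ \<Psi>, of "\<pi> a"] by (simp add: G_def U\<Psi>)
   then show ?thesis
    using K(2)[OF upow_mem[OF r(8)[OF \<Psi>]], of "- int n" a]
    by (simp add: G_def upow_norm bounded_opD(1)[OF Bb] upow_mem r(8) \<Psi>)
  qed
  show "\<forall>\<^sub>F N in sequentially. norm (\<pi> a (average (\<lambda>n. Up (int n) (B \<Psi>)) N)) <= K * norm (\<pi> a \<Psi>)"
   using K(1) by (intro always_eventually allI)
    (simp add: bounded_op_average[OF r(2) closed_H] upow_mem bounded_opD(1)[OF Bb \<Psi>] norm_average_le *)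
 qed simp
 have vec: "cinner (\<pi> a (y + s *\<^sub>C \<Psi>)) (y + s *\<^sub>C \<Psi>) = of_real ((norm (y + s *\<^sub>C \<Psi>))\<^sup>2) * \<psi> a" for s a
 proof (rule GNS_vector_state[OF \<psi>])
  show "y + s *\<^sub>C \<Psi> \<in> H" by (intro H(3,4) yH \<Psi>)
  show "U (y + s *\<^sub>C \<Psi>) = y + s *\<^sub>C \<Psi>" by (simp add: bounded_opD(2,3)[OF U_op] yH \<Psi> H(4) Uy g(6))
  fix a
  have "\<pi> a (y + s *\<^sub>C \<Psi>) = \<pi> a y + s *\<^sub>C \<pi> a \<Psi>" by (simp add: bounded_opD(2,3)[OF r(2)] yH \<Psi> H(4))
  then have "norm (\<pi> a (y + s *\<^sub>C \<Psi>)) <= (K + cmod s) * norm (\<pi> a \<Psi>)"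
   using bound[of a] norm_triangle_ineq[of "\<pi> a y" "s *\<^sub>C \<pi> a \<Psi>"] by (simp add: norm_scaleC distrib_right)
  then show "(norm (\<pi> a (y + s *\<^sub>C \<Psi>)))\<^sup>2 <= (K + cmod s)\<^sup>2 * (norm (\<pi> a \<Psi>))\<^sup>2"
   by (metis power_mono norm_ge_zero power_mult_distrib)
 qed
 define p where "p a = cinner (\<pi> a y) \<Psi>" for a
 define q where "q a = cinner (\<pi> a \<Psi>) y" for a
 have ns: "of_real ((norm x)\<^sup>2) = cinner x x" for x :: 'k by (simp add: cinner_self)
 have \<Psi>1: "cinner \<Psi> \<Psi> = 1" using g(5)[of 1] \<psi>1 by (simp add: r(6) \<Psi>)
 have key: "cnj s * p a + s * q a = (cnj s * p 1 + s * q 1) * \<psi> a" for s a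
  using vec[of a s] vec[of a 0] unfolding ns
  by (simp add: bounded_opD(2,3)[OF r(2)] yH \<Psi> H(4) cinner_simps p_def q_def r(6) \<Psi>1 algebra_simps flip: g(5))
 \<comment> \<open>The choices \<open>s = 1\<close> and \<open>s = i\<close> of the polarisation
   parameter separate \<open>p\<close> from \<open>q\<close>.\<close>
 have p: "p a = p 1 * \<psi> a" for a
 proof -
  have 1: "p a + q a = (p 1 + q 1) * \<psi> a" using key[of 1 a] by simp
  have "\<i> * (- p a + q a) = \<i> * ((- p 1 + q 1) * \<psi> a)" using key[of "\<i>" a] by (simp add: algebra_simps)
  then have 2: "- p a + q a = (- p 1 + q 1) * \<psi> a" unfolding mult_cancel_left by simp
  have "p a = ((p a + q a) - (- p a + q a)) / 2" by simp
  also have "... = p 1 * \<psi> a" unfolding 1 2 by (simp add: algebra_simps)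
  finally show ?thesis .
 qed
 define d where "d = y - cinner y \<Psi> *\<^sub>C \<Psi>"
 have dH: "d \<in> H" unfolding d_def by (intro H(6,4) yH \<Psi>)
 have "cinner d (\<pi> a \<Psi>) = 0" for a
 proof -
  have "cinner (\<pi> (star a) d) \<Psi> = 0"
   using p[of "star a"] g(5)[of "star a"]
   by (simp add: d_def bounded_op_more(3)[OF r(2) closed_H] bounded_opD(3)[OF r(2)] yH \<Psi> H(4) cinner_simps p_def r(6))
  then show ?thesis using r(7)[OF dH \<Psi>, of "star a"] by (simp add: star_star)
 qed
 moreover have "d \<in> closure (range (\<lambda>a. \<pi> a \<Psi>))" using dH g(4) by simp
 moreover have "continuous_on (closure (range (\<lambda>a. \<pi> a \<Psi>))) (cinner d)"
  by (intro continuous_on_cinner continuous_on_const continuous_on_id)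
 ultimately have "cinner d d = 0" using continuous_constant_on_closure[of "range (\<lambda>a. \<pi> a \<Psi>)" "cinner d" 0 d]
 by auto
 then show ?thesis by (simp add: d_def)
qed

text \<open>A fixed vector lies within \<open>e\<close> of some \<open>B \<Psi>\<close>, and
  averaging the orbit keeps this distance while moving \<open>B \<Psi>\<close> to a multiple of
  \<open>\<Psi>\<close>. Projecting costs a factor 2, so \<open>e\<close> is a third of the distance
  of \<open>x\<close> from its projection.\<close>

lemma GNS_fixed:
 assumes \<psi>: "\<psi> \<in> ergodic_states \<beta>" and \<beta>: "surj \<beta>"
  and cyc: "closure {B \<Psi> |B. B \<in> commutant H (range \<pi>)} = H" and x: "x \<in> H" "U x = x"
 shows "x = cinner x \<Psi> *\<^sub>C \<Psi>"
proof (rule ccontr)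
 assume "x ~= cinner x \<Psi> *\<^sub>C \<Psi>"
 define e where "e = norm (x - cinner x \<Psi> *\<^sub>C \<Psi>) / 3"
 have e: "e > 0" using \<open>x ~= _\<close> by (simp add: e_def)
 note \<Psi> = g(3)
 have "\<psi> 1 = 1" using \<psi> by (auto simp: ergodic_states_def invariant_states_def states_def)
 then have \<Psi>1: "norm \<Psi> = 1" by (rule GNS_norm)
 have "x \<in> closure {B \<Psi> |B. B \<in> commutant H (range \<pi>)}" using x by (simp add: cyc)
 then obtain b where "b \<in> {B \<Psi> |B. B \<in> commutant H (range \<pi>)}" "dist b x < e"
  using e unfolding closure_approachable by blast
 then obtain B where B: "B \<in> commutant H (range \<pi>)" "norm (x - B \<Psi>) < e" by (auto simp: dist_norm norm_minus_commute)
 define z where "z n = Up (int n) (B \<Psi>)" for n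
 have B\<Psi>: "B \<Psi> \<in> H" by (rule bounded_opD(1)[OF commutantD(1)[OF B(1)] \<Psi>])
 obtain y where y: "average z \<longlonglongrightarrow> y" "U y = y" "y \<in> H"
  using average_upow_fixed[OF B\<Psi>] unfolding z_def[abs_def] by auto
 have yc: "y = cinner y \<Psi> *\<^sub>C \<Psi>" by (rule GNS_average_commutant[OF \<psi> \<beta> B(1) y(1)[unfolded z_def[abs_def]] y(2)])
 have Ux: "Up m x = x" for m using upow_eigen[OF x(1), of 1 m] x(2) by simp
 have "norm (y - x) <= e"
 proof (rule tendsto_upperbound[OF tendsto_norm[OF tendsto_diff[OF y(1) tendsto_const]]])
  have "norm (average z N - x) <= e" if "N > 0" for N
  proof -
   have "average (\<lambda>n. x) N = x" using that by (simp add: average_def sum_constant_scaleR)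
   then have "average z N - x = average (\<lambda>n. z n - x) N" by (simp add: average_diff)
   also have "norm ... <= e"
   proof (rule norm_average_le)
    fix n
    have "z n - x = Up (int n) (B \<Psi> - x)" by (simp add: z_def upow_linear B\<Psi> x Ux)
    then show "norm (z n - x) <= e" using B(2) by (simp add: upow_norm H(6) B\<Psi> x norm_minus_commute)
   qed (use e in simp)
   finally show ?thesis .
  qed
  then show "\<forall>\<^sub>F N in sequentially. norm (average z N - x) <= e" by (auto simp: eventually_sequentially intro!: exI[of _ 1])
 qed simp
 have "x - cinner x \<Psi> *\<^sub>C \<Psi> = (x - y) - cinner (x - y) \<Psi> *\<^sub>C \<Psi>" by (simp add: cinner_simps scaleC_diff_left flip: yc)
 also have "norm ... <= norm (x - y) + cmod (cinner (x - y) \<Psi>)"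
  using norm_triangle_ineq4[of "x - y" "cinner (x - y) \<Psi> *\<^sub>C \<Psi>"] by (simp add: norm_scaleC \<Psi>1)
 also have "... <= 2 * norm (x - y)" using cinner_cauchy_schwarz[of "x - y" \<Psi>] by (simp add: \<Psi>1)
 finally have "3 * e <= 2 * norm (x - y)" by (simp add: e_def)
 then show False using \<open>norm (y - x) <= e\<close> e by (simp add: norm_minus_commute)
qed

lemma ergodic_fibre_GNS:
 assumes \<psi>: "\<psi> \<in> ergodic_states \<beta>" and \<beta>: "surj \<beta>" and central: "state_support \<psi> \<in> bidual_centre"
  and tens: "hilbert_tensor tens" and VW: "eigen_unitaries H \<pi> U Ve We"
 shows "ergodic_fibre H U \<pi> \<Psi> Ve We tens"
proof -
 have \<psi>': "\<psi> \<in> states" "\<psi> 1 = 1" using \<psi> by (auto simp: ergodic_states_def invariant_states_def states_def)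
 have cyc: "closure {B \<Psi> |B. B \<in> commutant H (range \<pi>)} = H"
  by (rule central_support_cyclic_commutant[OF g(1,3,4) \<psi>'(1) g(5) central])
 have \<Psi>1: "norm \<Psi> = 1" by (rule GNS_norm[OF \<psi>'(2)])
 have conj: "U (T x) = v *\<^sub>C T (U x)" if "\<forall>x\<in>H. conj_by H U T x = v *\<^sub>C T x" "x \<in> H" for T v x
  using bspec[OF that(1) U_H[OF that(2)]] by (simp add: conj_by_def inv_U that)
 show ?thesis
  using VW g(6) \<Psi>1 g(1,3,4) cyc tens GNS_fixed[OF \<psi> \<beta> cyc] GNS_commutant_conj[OF \<beta>] conj
  unfolding eigen_unitaries_def by unfold_locales blast+
qed

end

subsection \<open>Direct integrals\<close>

locale hilbert_direct_integral = finite_measure M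
 for M :: "'s measure" +
 fixes H :: "'s => 'k::complex_hilbert_space set" and S :: "('s => 'k) set"
  and J :: "'h::complex_hilbert_space => ('s => 'k) set"
 assumes J_unitary: "unitary_onto_direct_integral M H S J"
begin

lemma J_class: "f \<in> J \<xi> ==> J \<xi> = field_class M H S f"
proof -
 assume f: "f \<in> J \<xi>"
 have "J \<xi> \<in> direct_integral M H S" using J_unitary by (auto simp: unitary_onto_direct_integral_def bij_betw_def)
 then obtain f0 where f0: "J \<xi> = field_class M H S f0" "square_integrable_field M H S f0" by (auto simp: direct_integral_def)
 have 1: "AE s in M. f s = f0 s" using f f0 by (auto simp: field_class_def)
 have "(AE s in M. g s = f s) \<longleftrightarrow> (AE s in M. g s = f0 s)" for g
 proof
  show "AE s in M. g s = f0 s" if "AE s in M. g s = f s" using 1 that by eventually_elim simp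
  show "AE s in M. g s = f s" if "AE s in M. g s = f0 s" using 1 that by eventually_elim simp
 qed
 then show ?thesis by (simp add: f0 field_class_def)
qed

lemma J_AE: "f \<in> J \<xi> ==> g \<in> J \<xi> ==> AE s in M. g s = f s"
 using J_class[of f \<xi>] by (auto simp: field_class_def)

lemma J_sq: "f \<in> J \<xi> ==> square_integrable_field M H S f"
 using J_class[of f \<xi>] by (auto simp: field_class_def)

lemma J_ex: obtains f where "f \<in> J \<xi>"
proof -
 have "J \<xi> \<in> direct_integral M H S" using J_unitary by (auto simp: unitary_onto_direct_integral_def bij_betw_def)
 then obtain f where f: "J \<xi> = field_class M H S f" "square_integrable_field M H S f" by (auto simp: direct_integral_def)
 then show ?thesis using that[of f] by (simp add: field_class_def)
qed

lemma J_surj: "square_integrable_field M H S f ==> \<exists>\<xi>. f \<in> J \<xi>"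
proof -
 assume f: "square_integrable_field M H S f"
 then have "field_class M H S f \<in> direct_integral M H S" by (auto simp: direct_integral_def)
 then obtain \<xi> where "J \<xi> = field_class M H S f"
  using J_unitary by (auto simp: unitary_onto_direct_integral_def bij_betw_def) (metis imageE)
 then show ?thesis using f by (auto simp: field_class_def)
qed

lemma J_inj: "inj J"
 using J_unitary by (auto simp: unitary_onto_direct_integral_def bij_betw_def)

lemma J_add: "f \<in> J \<xi> ==> g \<in> J \<eta> ==> (\<lambda>s. f s + g s) \<in> J (\<xi> + \<eta>)"
 and J_scaleC: "f \<in> J \<xi> ==> (\<lambda>s. c *\<^sub>C f s) \<in> J (c *\<^sub>C \<xi>)"
 and J_cinner: "f \<in> J \<xi> ==> g \<in> J \<eta> ==> cinner \<xi> \<eta> = (\<integral>s. cinner (f s) (g s) \<partial>M)"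
 using J_unitary by (auto simp: unitary_onto_direct_integral_def)

lemma J_diff: "f \<in> J \<xi> ==> g \<in> J \<eta> ==> (\<lambda>s. f s - g s) \<in> J (\<xi> - \<eta>)"
 using J_add[of f \<xi> "\<lambda>s. (- 1) *\<^sub>C g s" "(- 1) *\<^sub>C \<eta>"] J_scaleC[of g \<eta> "- 1"] by simp

lemma J_integrable: "f \<in> J \<xi> ==> integrable M (\<lambda>s. (norm (f s))\<^sup>2)"
 using J_sq by (auto simp: square_integrable_field_def)

lemma J_norm: "f \<in> J \<xi> ==> (norm \<xi>)\<^sup>2 = (\<integral>s. (norm (f s))\<^sup>2 \<partial>M)"
proof -
 assume f: "f \<in> J \<xi>"
 have "of_real ((norm \<xi>)\<^sup>2) = complex_of_real (\<integral>s. (norm (f s))\<^sup>2 \<partial>M)"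
  using J_cinner[OF f f] unfolding cinner_self by (simp del: of_real_power)
 then show ?thesis by (simp only: of_real_eq_iff)
qed

lemma J_average:
 assumes f: "!!n. f n \<in> J (x n)"
 shows "(\<lambda>s. average (\<lambda>n. f n s) N) \<in> J (average x N)"
proof -
 have "(\<lambda>s. \<Sum>n<N. f n s) \<in> J (\<Sum>n<N. x n)" for N
 proof (induction N)
  case 0
  obtain g where "g \<in> J 0" by (rule J_ex)
  from J_scaleC[OF this, of 0] show ?case by simp
 next
  case (Suc N)
  from J_add[OF Suc f[of N]] show ?case by simp
 qed
 from J_scaleC[OF this[of N], of "of_real (1 / real N)"] show ?thesis
  unfolding average_def scaleC_of_real .
qed

text \<open>Convergence in the direct integral means that the integrals of
  \<open>(norm (f n s - h s))^2\<close> tend to zero, and this gives almost everywhere convergence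
  along a subsequence.\<close>

lemma J_tendsto_AE:
 assumes x: "x \<longlonglongrightarrow> \<zeta>" and f: "!!n. f n \<in> J (x n)" and h: "h \<in> J \<zeta>"
 obtains r where "strict_mono r" "AE s in M. (\<lambda>n. f (r n) s) \<longlonglongrightarrow> h s"
proof -
 define u where "u n s = (norm (f n s - h s))\<^sup>2" for n s
 have "integrable M (u n)" for n unfolding u_def by (rule J_integrable[OF J_diff[OF f h]])
 moreover have "(\<lambda>n. \<integral>s. norm (u n s) \<partial>M) \<longlonglongrightarrow> 0"
 proof -
  have "(\<lambda>n. (norm (x n - \<zeta>))\<^sup>2) \<longlonglongrightarrow> 0\<^sup>2"
   by (intro tendsto_power tendsto_norm_zero) (use x in \<open>simp add: LIM_zero\<close>)
  then show ?thesis by (simp add: u_def J_norm[OF J_diff[OF f h]])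
 qed
 ultimately obtain r where r: "strict_mono r" "AE s in M. (\<lambda>n. u (r n) s) \<longlonglongrightarrow> 0"
  using tendsto_L1_AE_subseq[of M u] by auto
 have "AE s in M. (\<lambda>n. f (r n) s) \<longlonglongrightarrow> h s"
  using r(2)
 proof eventually_elim
  case (elim s)
  then have "(\<lambda>n. sqrt (u (r n) s)) \<longlonglongrightarrow> sqrt 0" by (rule tendsto_real_sqrt)
  then have "(\<lambda>n. norm (f (r n) s - h s)) \<longlonglongrightarrow> 0" by (simp add: u_def)
  then show ?case by (simp add: tendsto_norm_zero_iff LIM_zero_iff)
 qed
 with r(1) show ?thesis by (rule that)
qed

text \<open>The pointwise limit \<open>g\<close> is not known to be a measurable field, so dominated
  convergence is applied to differences of members along two index sequences. This makes
  \<open>x\<close> Cauchy, and a subsequence identifies a field of its limit with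
  \<open>g\<close>.\<close>

lemma J_dominated:
 assumes f: "!!N. f N \<in> J (x N)" and w: "integrable M (\<lambda>s. (w s)\<^sup>2)"
  and bound: "AE s in M. \<forall>N. norm (f N s) <= w s" and lim: "AE s in M. (\<lambda>N. f N s) \<longlonglongrightarrow> g s"
 obtains \<zeta> h where "x \<longlonglongrightarrow> \<zeta>" "h \<in> J \<zeta>" "AE s in M. h s = g s"
proof -
 have sub: "(\<lambda>j. x (p j) - x (q j)) \<longlonglongrightarrow> 0" if p: "filterlim p sequentially sequentially" and q: "filterlim q sequentially sequentially" for p q :: "nat => nat"
 proof -
  define u where "u j s = (norm (f (p j) s - f (q j) s))\<^sup>2" for j s
  have "(\<lambda>j. integral\<^sup>L M (u j)) \<longlonglongrightarrow> (\<integral>s. 0 \<partial>M)"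
  proof (rule integral_dominated_convergence[where w = "\<lambda>s. 4 * (w s)\<^sup>2"])
   show "u j \<in> borel_measurable M" for j
    unfolding u_def by (rule borel_measurable_integrable[OF J_integrable[OF J_diff[OF f f]]])
   show "AE s in M. (\<lambda>j. u j s) \<longlonglongrightarrow> 0"
    using lim
   proof eventually_elim
    case (elim s)
    have "(\<lambda>j. (norm (f (p j) s - f (q j) s))\<^sup>2) \<longlonglongrightarrow> (norm (g s - g s))\<^sup>2"
     by (intro tendsto_power tendsto_norm tendsto_diff filterlim_compose[OF elim p] filterlim_compose[OF elim q])
    then show ?case by (simp add: u_def)
   qed
   show "AE s in M. norm (u j s) <= 4 * (w s)\<^sup>2" for j
    using bound
   proof eventually_elim
    case (elim s)
    have "norm (f (p j) s - f (q j) s) <= 2 * w s"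
     using norm_triangle_ineq4[of "f (p j) s" "f (q j) s"] elim[rule_format, of "p j"] elim[rule_format, of "q j"] by simp
    then have "(norm (f (p j) s - f (q j) s))\<^sup>2 <= (2 * w s)\<^sup>2" by (intro power_mono) auto
    then show ?case by (simp add: u_def)
   qed
  qed (use w in auto)
  moreover have "integral\<^sup>L M (u j) = (norm (x (p j) - x (q j)))\<^sup>2" for j
   unfolding u_def by (rule J_norm[OF J_diff[OF f f], symmetric])
  ultimately have "(\<lambda>j. sqrt ((norm (x (p j) - x (q j)))\<^sup>2)) \<longlonglongrightarrow> sqrt 0" by (intro tendsto_real_sqrt) simp
  then show ?thesis by (simp add: tendsto_norm_zero_iff)
 qed
 have "Cauchy x"
 proof (rule ccontr)
  assume "\<not> Cauchy x"
  then obtain e where e: "e > 0" "!!j. \<exists>m\<ge>j. \<exists>n\<ge>j. norm (x m - x n) >= e" unfolding Cauchy_iff by (meson not_le)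
  then obtain p q where pq: "!!j. p j >= j" "!!j. q j >= j" "!!j. norm (x (p j) - x (q j)) >= e" by metis
  have "filterlim p sequentially sequentially" "filterlim q sequentially sequentially"
   using pq(1,2) by (auto intro!: filterlim_at_top_mono[OF filterlim_ident])
  from LIMSEQ_D[OF sub[OF this] e(1)] pq(3) show False by (auto simp: not_less[symmetric])
 qed
 then obtain \<zeta> where \<zeta>: "x \<longlonglongrightarrow> \<zeta>" by (auto simp: Cauchy_convergent_iff convergent_def)
 obtain h where h: "h \<in> J \<zeta>" by (rule J_ex)
 obtain r where r: "strict_mono r" "AE s in M. (\<lambda>n. f (r n) s) \<longlonglongrightarrow> h s" by (rule J_tendsto_AE[OF \<zeta> f h]) simp
 have "AE s in M. h s = g s"
  using r(2) lim
 proof eventually_elim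
  case (elim s)
  from LIMSEQ_subseq_LIMSEQ[OF elim(2) r(1)] elim(1) show ?case by (simp add: o_def LIMSEQ_unique)
 qed
 with \<zeta> h show ?thesis by (rule that)
qed

text \<open>A relation instead of an operation, because the pointwise image of two square integrable
  fields need not be square integrable.\<close>

definition bilinear_graph :: "('s => 'k => 'k => 'k) => 'h => 'h => 'h => bool" where
 "bilinear_graph B \<eta> \<xi> \<zeta> \<longleftrightarrow> (\<exists>f\<in>J \<eta>. \<exists>g\<in>J \<xi>. \<exists>h\<in>J \<zeta>. AE s in M. h s = B s (f s) (g s))"

lemma bilinear_graphD:
 assumes B: "bilinear_graph B \<eta> \<xi> \<zeta>" and "f \<in> J \<eta>" "g \<in> J \<xi>" "h \<in> J \<zeta>"
 shows "AE s in M. h s = B s (f s) (g s)"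
proof -
 obtain f' g' h' where *: "f' \<in> J \<eta>" "g' \<in> J \<xi>" "h' \<in> J \<zeta>" and eq: "AE s in M. h' s = B s (f' s) (g' s)"
  using B by (auto simp: bilinear_graph_def)
 show ?thesis
  using J_AE[OF *(1) assms(2)] J_AE[OF *(2) assms(3)] J_AE[OF *(3) assms(4)] eq by eventually_elim simp
qed

text \<open>Three successive subsequences turn the norm limits into almost everywhere limits of
  representatives, and in almost every fibre \<open>B s\<close> is continuous.\<close>

lemma bilinear_graph_closed:
 assumes B: "AE s in M. bounded_bilinear (B s)" and \<eta>: "\<eta> \<longlonglongrightarrow> \<eta>'" and \<xi>: "\<xi> \<longlonglongrightarrow> \<xi>'" and \<zeta>: "\<zeta> \<longlonglongrightarrow> \<zeta>'"
  and graph: "!!n. bilinear_graph B (\<eta> n) (\<xi> n) (\<zeta> n)"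
 shows "bilinear_graph B \<eta>' \<xi>' \<zeta>'"
proof -
 have "\<forall>n. \<exists>f\<in>J (\<eta> n). \<exists>g\<in>J (\<xi> n). \<exists>h\<in>J (\<zeta> n). AE s in M. h s = B s (f s) (g s)"
  using graph by (simp add: bilinear_graph_def)
 then obtain f g h where fgh: "!!n. f n \<in> J (\<eta> n)" "!!n. g n \<in> J (\<xi> n)" "!!n. h n \<in> J (\<zeta> n)"
  "!!n. AE s in M. h n s = B s (f n s) (g n s)" by metis
 obtain f' where f': "f' \<in> J \<eta>'" by (rule J_ex)
 obtain g' where g': "g' \<in> J \<xi>'" by (rule J_ex)
 obtain h' where h': "h' \<in> J \<zeta>'" by (rule J_ex)
 obtain r1 where r1: "strict_mono r1" "AE s in M. (\<lambda>n. f (r1 n) s) \<longlonglongrightarrow> f' s" by (rule J_tendsto_AE[OF \<eta> fgh(1) f']) simp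
 have \<xi>1: "(\<lambda>n. \<xi> (r1 n)) \<longlonglongrightarrow> \<xi>'" using LIMSEQ_subseq_LIMSEQ[OF \<xi> r1(1)] by (simp add: o_def)
 obtain r2 where r2: "strict_mono r2" "AE s in M. (\<lambda>n. g (r1 (r2 n)) s) \<longlonglongrightarrow> g' s" by (rule J_tendsto_AE[OF \<xi>1 fgh(2) g']) simp
 have \<zeta>1: "(\<lambda>n. \<zeta> (r1 (r2 n))) \<longlonglongrightarrow> \<zeta>'"
  using LIMSEQ_subseq_LIMSEQ[OF \<zeta> strict_mono_o[OF r1(1) r2(1)]] by (simp add: o_def)
 obtain r3 where r3: "strict_mono r3" "AE s in M. (\<lambda>n. h (r1 (r2 (r3 n))) s) \<longlonglongrightarrow> h' s" by (rule J_tendsto_AE[OF \<zeta>1 fgh(3) h']) simp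
 have "AE s in M. \<forall>n. h n s = B s (f n s) (g n s)" using fgh(4) by (simp add: AE_all_countable)
 then have "AE s in M. h' s = B s (f' s) (g' s)"
  using B r1(2) r2(2) r3(2)
 proof eventually_elim
  case (elim s)
  have "(\<lambda>n. f (r1 (r2 (r3 n))) s) \<longlonglongrightarrow> f' s"
   using LIMSEQ_subseq_LIMSEQ[OF elim(3) strict_mono_o[OF r2(1) r3(1)]] by (simp add: o_def)
  moreover have "(\<lambda>n. g (r1 (r2 (r3 n))) s) \<longlonglongrightarrow> g' s" using LIMSEQ_subseq_LIMSEQ[OF elim(4) r3(1)] by (simp add: o_def)
  ultimately have "(\<lambda>n. h (r1 (r2 (r3 n))) s) \<longlonglongrightarrow> B s (f' s) (g' s)"
   using bounded_bilinear.tendsto[OF elim(2)] elim(1) by simp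
  then show ?case using elim(5) by (rule LIMSEQ_unique[rotated])
 qed
 then show ?thesis using f' g' h' by (auto simp: bilinear_graph_def)
qed

definition graph_limit :: "('s => 'k => 'k => 'k) => 'h => 'h => (nat => 'h) => bool" where
 "graph_limit B \<eta> \<xi> y \<longleftrightarrow> (\<exists>\<zeta>. y \<longlonglongrightarrow> \<zeta> \<and> bilinear_graph B \<eta> \<xi> \<zeta>)"

text \<open>The error in the sequence is uniform in \<open>N\<close>, which permits interchanging
  the limit in \<open>N\<close> with that of the approximation.\<close>

definition graph_approx :: "('s => 'k => 'k => 'k) => 'h => 'h => (nat => 'h) => real => bool" where
 "graph_approx B \<eta> \<xi> y e \<longleftrightarrow> (\<exists>\<eta>' \<xi>' y'. norm (\<eta> - \<eta>') <= e \<and> norm (\<xi> - \<xi>') <= e \<and> (\<forall>N. norm (y N - y' N) <= e) \<and> graph_limit B \<eta>' \<xi>' y')"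

text \<open>Uniformity in \<open>N\<close> makes \<open>y\<close> Cauchy, and the limits of the
  approximating sequences converge to its limit; closedness of the graph then applies to the
  limiting triple.\<close>

lemma graph_limit_approximation:
 assumes B: "AE s in M. bounded_bilinear (B s)"
  and approx: "!!e. e > 0 ==> graph_approx B \<eta> \<xi> y e"
 shows "graph_limit B \<eta> \<xi> y"
proof -
 define \<epsilon> where "\<epsilon> j = inverse (real (Suc j))" for j
 have \<epsilon>: "\<epsilon> j > 0" for j by (simp add: \<epsilon>_def)
 have \<epsilon>0: "\<epsilon> \<longlonglongrightarrow> 0" unfolding \<epsilon>_def[abs_def] by (rule LIMSEQ_inverse_real_of_nat)
 have "\<forall>j. \<exists>\<eta>' \<xi>' y' \<zeta>'. norm (\<eta> - \<eta>') <= \<epsilon> j \<and> norm (\<xi> - \<xi>') <= \<epsilon> j \<and> (\<forall>N. norm (y N - y' N) <= \<epsilon> j)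
   \<and> y' \<longlonglongrightarrow> \<zeta>' \<and> bilinear_graph B \<eta>' \<xi>' \<zeta>'"
  using approx[OF \<epsilon>] unfolding graph_approx_def graph_limit_def by simp
 then obtain \<eta>' \<xi>' y' \<zeta>' where j: "!!j. norm (\<eta> - \<eta>' j) <= \<epsilon> j" "!!j. norm (\<xi> - \<xi>' j) <= \<epsilon> j"
  "!!j N. norm (y N - y' j N) <= \<epsilon> j" "!!j. y' j \<longlonglongrightarrow> \<zeta>' j" "!!j. bilinear_graph B (\<eta>' j) (\<xi>' j) (\<zeta>' j)" by metis
 have lim: "u' \<longlonglongrightarrow> u" if "!!j. norm (u - u' j) <= \<epsilon> j" for u :: 'h and u'
 proof -
  have "(\<lambda>j. u' j - u) \<longlonglongrightarrow> 0"
   by (rule Lim_null_comparison[OF _ \<epsilon>0]) (use that in \<open>simp add: norm_minus_commute\<close>)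
  then show ?thesis by (simp add: LIM_zero_iff)
 qed
 have "Cauchy y"
 proof (rule CauchyI)
  fix e :: real assume "e > 0"
  then obtain m where m: "\<epsilon> m < e / 3" using LIMSEQ_D[OF \<epsilon>0, of "e / 3"] \<epsilon> by (auto simp: abs_of_pos)
  obtain N where N: "!!p q. p >= N ==> q >= N ==> norm (y' m p - y' m q) < e / 3"
   using CauchyD[OF LIMSEQ_imp_Cauchy[OF j(4)], of "e / 3" m] \<open>e > 0\<close> by auto
  have "norm (y p - y q) < e" if "p >= N" "q >= N" for p q
  proof -
   have "y p - y q = (y p - y' m p) + (y' m p - y' m q) - (y q - y' m q)" by simp
   also have "norm ... <= norm (y p - y' m p) + norm (y' m p - y' m q) + norm (y q - y' m q)"
    by (intro order_trans[OF norm_triangle_ineq4] add_mono order_refl norm_triangle_ineq)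
   also have "... < e" using j(3)[of p m] j(3)[of q m] N[OF that] m by simp
   finally show ?thesis .
  qed
  then show "\<exists>N. \<forall>p\<ge>N. \<forall>q\<ge>N. norm (y p - y q) < e" by auto
 qed
 then obtain \<zeta> where \<zeta>: "y \<longlonglongrightarrow> \<zeta>" by (auto simp: Cauchy_convergent_iff convergent_def)
 have "norm (\<zeta> - \<zeta>' j) <= \<epsilon> j" for j
  by (rule tendsto_upperbound[OF tendsto_norm[OF tendsto_diff[OF \<zeta> j(4)]]]) (auto simp: j(3))
 with bilinear_graph_closed[OF B lim[OF j(1)] lim[OF j(2)] lim j(5)] \<zeta> show ?thesis
  unfolding graph_limit_def by auto
qed

lemma graph_limit_add:
 assumes B: "AE s in M. bounded_bilinear (B s)" and y: "graph_limit B \<eta> \<xi> y" "graph_limit B \<eta>' \<xi> y'"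
 shows "graph_limit B (\<eta> + \<eta>') \<xi> (\<lambda>N. y N + y' N)"
proof -
 obtain \<zeta> \<zeta>' where \<zeta>: "y \<longlonglongrightarrow> \<zeta>" "bilinear_graph B \<eta> \<xi> \<zeta>" "y' \<longlonglongrightarrow> \<zeta>'" "bilinear_graph B \<eta>' \<xi> \<zeta>'"
  using y by (auto simp: graph_limit_def)
 obtain f where f: "f \<in> J \<eta>" by (rule J_ex)
 obtain f' where f': "f' \<in> J \<eta>'" by (rule J_ex)
 obtain g where g: "g \<in> J \<xi>" by (rule J_ex)
 obtain h where h: "h \<in> J \<zeta>" by (rule J_ex)
 obtain h' where h': "h' \<in> J \<zeta>'" by (rule J_ex)
 have "AE s in M. h s + h' s = B s (f s + f' s) (g s)"
  using B bilinear_graphD[OF \<zeta>(2) f g h] bilinear_graphD[OF \<zeta>(4) f' g h']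
  by eventually_elim (simp add: bounded_bilinear.add_left)
 then have "bilinear_graph B (\<eta> + \<eta>') \<xi> (\<zeta> + \<zeta>')"
  unfolding bilinear_graph_def by (intro bexI[OF _ J_add[OF f f']] bexI[OF _ g] bexI[OF _ J_add[OF h h']])
 then show ?thesis using tendsto_add[OF \<zeta>(1,3)] by (auto simp: graph_limit_def)
qed

lemma graph_limit_dominated:
 assumes f: "!!N. f N \<in> J (y N)" and w: "integrable M (\<lambda>s. (w s)\<^sup>2)"
  and bound: "AE s in M. \<forall>N. norm (f N s) <= w s"
  and u: "u \<in> J \<eta>" and v: "v \<in> J \<xi>" and lim: "AE s in M. (\<lambda>N. f N s) \<longlonglongrightarrow> B s (u s) (v s)"
 shows "graph_limit B \<eta> \<xi> y"
proof -
 obtain \<zeta> h where "y \<longlonglongrightarrow> \<zeta>" "h \<in> J \<zeta>" "AE s in M. h s = B s (u s) (v s)"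
  by (rule J_dominated[OF f w bound lim]) simp
 then show ?thesis using u v by (auto simp: graph_limit_def bilinear_graph_def)
qed

end

section \<open>The decomposed representation\<close>

lemma bounded_op_bounded_linear:
 assumes "bounded_op UNIV T"
 shows "bounded_linear T"
proof -
 obtain K where "!!x. norm (T x) <= K * norm x" using assms by (auto simp: bounded_op_def)
 then show ?thesis
  using bounded_opD(2)[OF assms] bounded_op_more(4)[OF assms closed_csubspace_UNIV]
  by (intro bounded_linear_intro[where K=K]) (auto simp: mult.commute)
qed

lemma (in ergodic_fibre) V_op_bounded_bilinear: "bounded_bilinear (\<lambda>x y. V_op k (tens x y))"
proof
 show "\<exists>K. \<forall>x y. norm (V_op k (tens x y)) <= norm x * norm y * K"
  using V_op_bound[of k] by (intro exI[of _ 1]) (simp flip: te(6))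
qed (simp_all add: te V_op_linear flip: scaleC_of_real)

text \<open>\<open>W\<close> stands for \<open>U^l\<close>, and the points \<open>s\<close> replace
  the extremal states; the fibre property is required almost everywhere. The automorphism enters
  through \<open>W_rep\<close> and \<open>W_commutant\<close>, the hypothesis on the centre through
  \<open>diagonalisable\<close>.\<close>

locale ergodic_decomposition = hilbert_direct_integral M H "GNS_fields \<pi>f \<Psi>" J
 for M :: "'s measure" and H :: "'s => 'k::complex_hilbert_space set"
  and \<pi>f :: "'s => 'a::unital_cstar_algebra => 'k => 'k" and \<Psi> :: "'s => 'k" and J :: "'h::complex_hilbert_space => ('s => 'k) set" +
 fixes \<pi> :: "'a => 'h => 'h" and W :: "'h => 'h" and \<Omega> :: 'h and Uf :: "'s => 'k => 'k" and Ve We :: "'s => complex => 'k => 'k"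
  and tens :: "'k => 'k => 't::complex_hilbert_space" and V :: "'s => 't => 'k" and k :: int
 assumes rep: "star_representation UNIV \<pi>" and W: "unitary_on_subspace UNIV W" and W_\<Omega>: "W \<Omega> = \<Omega>"
  and cyclic: "closure (range (\<lambda>a. \<pi> a \<Omega>)) = UNIV"
  and cyclic': "closure {B \<Omega> |B. B \<in> commutant UNIV (range \<pi>)} = UNIV"
  and W_rep: "\<exists>b. \<forall>x. upow UNIV W m (\<pi> a x) = \<pi> b (upow UNIV W m x)"
  and W_commutant: "B \<in> commutant UNIV (range \<pi>) ==>
   (\<lambda>x. upow UNIV W m (B (upow UNIV W (- m) x))) \<in> commutant UNIV (range \<pi>)"
  and H: "s \<in> space M ==> closed_csubspace (H s)"
  and J_\<pi>: "J (\<pi> a \<xi>) = decomposable_apply M H (GNS_fields \<pi>f \<Psi>) (\<lambda>s. \<pi>f s a) (J \<xi>)"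
  and J_W: "J (W \<xi>) = decomposable_apply M H (GNS_fields \<pi>f \<Psi>) Uf (J \<xi>)"
  and J_\<Omega>: "J \<Omega> = field_class M H (GNS_fields \<pi>f \<Psi>) \<Psi>"
  and fibre: "AE s in M. ergodic_fibre (H s) (Uf s) (\<pi>f s) (\<Psi> s) (Ve s) (We s) tens
   \<and> V s = V_fibre k tens (H s) (Uf s) (\<Psi> s) (Ve s) (We s)"
  and diagonalisable: "diagonalisable_ops M H (GNS_fields \<pi>f \<Psi>) J \<subseteq> bicommutant UNIV (range \<pi>) \<inter> commutant UNIV (range \<pi>)"
  and tens: "hilbert_tensor tens" and k: "k ~= 0" "k + 1 ~= 0"
begin

interpretation W: unitary_on_subspace UNIV W by (rule W)

lemmas r = star_representationD[OF rep, simplified]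
lemmas te = hilbert_tensorD[OF tens]

abbreviation "\<S> \<equiv> GNS_fields \<pi>f \<Psi>"
abbreviation "Wp \<equiv> upow UNIV W"
abbreviation "B s x y \<equiv> V s (tens x y)"

lemma field_mem: "f \<in> J \<xi> ==> s \<in> space M ==> f s \<in> H s"
 using J_sq by (auto simp: square_integrable_field_def)

lemma field_\<Omega>: "f \<in> J \<Omega> ==> AE s in M. f s = \<Psi> s"
 by (simp add: J_\<Omega> field_class_def)

lemma decomposable_field:
 assumes "J \<eta> = decomposable_apply M H \<S> T (J \<xi>)" "f \<in> J \<xi>" "g \<in> J \<eta>"
 shows "AE s in M. g s = T s (f s)"
proof -
 obtain f' where f': "f' \<in> J \<xi>" "AE s in M. g s = T s (f' s)" using assms by (auto simp: decomposable_apply_def)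
 show ?thesis using f'(2) J_AE[OF assms(2) f'(1)] by eventually_elim simp
qed

lemma decomposable_apply_eqI:
 assumes h: "h \<in> J \<zeta>" and t: "t \<in> c" and eq: "!!t. t \<in> c ==> AE s in M. T s (t s) = h s"
 shows "decomposable_apply M H \<S> T c = J \<zeta>"
proof -
 have "(\<exists>f\<in>c. AE s in M. g s = T s (f s)) \<longleftrightarrow> (AE s in M. g s = h s)" for g
 proof
  assume "\<exists>f\<in>c. AE s in M. g s = T s (f s)"
  then obtain f where f: "f \<in> c" "AE s in M. g s = T s (f s)" by auto
  show "AE s in M. g s = h s" using f(2) eq[OF f(1)] by eventually_elim simp
 next
  assume "AE s in M. g s = h s"
  then have "AE s in M. g s = T s (t s)" using eq[OF t] by eventually_elim simp
  then show "\<exists>f\<in>c. AE s in M. g s = T s (f s)" using t by auto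
 qed
 then show ?thesis by (simp add: J_class[OF h] decomposable_apply_def field_class_def)
qed

text \<open>Nonnegative powers follow from the decomposition of \<open>W\<close>; for negative ones
  the relation is read backwards and \<open>Uf s\<close> is inverted in the fibre.\<close>

lemma field_Wp:
 assumes f: "f \<in> J \<xi>" and g: "g \<in> J (Wp m \<xi>)"
 shows "AE s in M. g s = upow (H s) (Uf s) m (f s)"
 using g
proof (induction m arbitrary: g rule: int_induct[where k = 0])
 case base
 then have "g \<in> J \<xi>" by simp
 from J_AE[OF f this] show ?case by eventually_elim (simp add: upow_def)
next
 case (step1 i)
 obtain g0 where g0: "g0 \<in> J (Wp i \<xi>)" by (rule J_ex)
 have "AE s in M. g s = Uf s (g0 s)" using step1(3) by (intro decomposable_field[OF J_W g0]) (simp add: W.upow_succ)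
 then show ?case using step1(2)[OF g0] fibre AE_space
 proof eventually_elim
  case (elim s)
  interpret E: ergodic_fibre "H s" "Uf s" "\<pi>f s" "\<Psi> s" "Ve s" "We s" tens using elim(3) by simp
  show ?case using elim E.upow_succ[OF field_mem[OF f elim(4)]] by simp
 qed
next
 case (step2 i)
 obtain g0 where g0: "g0 \<in> J (Wp i \<xi>)" by (rule J_ex)
 have "AE s in M. g0 s = Uf s (g s)"
  using g0 W.upow_succ[of \<xi> "i - 1"] by (intro decomposable_field[OF J_W step2(3)]) simp
 then show ?case using step2(2)[OF g0] fibre AE_space
 proof eventually_elim
  case (elim s)
  interpret E: ergodic_fibre "H s" "Uf s" "\<pi>f s" "\<Psi> s" "Ve s" "We s" tens using elim(3) by simp
  show ?case using elim E.upow_pred[OF field_mem[OF f elim(4)]] E.inv_U[OF field_mem[OF step2(3) elim(4)]] by simp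
 qed
qed

lemma B_bounded_bilinear: "AE s in M. bounded_bilinear (B s)"
 using fibre
proof eventually_elim
 case (elim s)
 interpret E: ergodic_fibre "H s" "Uf s" "\<pi>f s" "\<Psi> s" "Ve s" "We s" tens using elim by simp
 show ?case using E.V_op_bounded_bilinear[of k] elim by (simp add: E.V_op_def)
qed

text \<open>Both fibre theorems are integrated in the same way, with \<open>(p, q) = (k, 1)\<close> and \<open>(p, q) = (k + 1, -1)\<close>.\<close>

lemma graph_limit_fibres:
 assumes u: "u \<in> J \<eta>" and v: "v \<in> J \<xi>" and g: "g \<in> J \<theta>"
  and lim: "AE s in M. average (\<lambda>n. upow (H s) (Uf s) (int n * p) (\<pi>f s a (upow (H s) (Uf s) (int n * q) (g s)))) \<longlonglongrightarrow> B s (u s) (v s)"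
 shows "graph_limit B \<eta> \<xi> (average (\<lambda>n. Wp (int n * p) (\<pi> a (Wp (int n * q) \<theta>))))"
proof -
 define x where "x n = Wp (int n * p) (\<pi> a (Wp (int n * q) \<theta>))" for n
 have "\<forall>n. \<exists>f. f \<in> J (x n)" using J_ex by auto
 then obtain f where f: "!!n. f n \<in> J (x n)" by metis
 have "AE s in M. f n s = upow (H s) (Uf s) (int n * p) (\<pi>f s a (upow (H s) (Uf s) (int n * q) (g s)))" for n
 proof -
  obtain g1 where g1: "g1 \<in> J (Wp (int n * q) \<theta>)" by (rule J_ex)
  obtain g2 where g2: "g2 \<in> J (\<pi> a (Wp (int n * q) \<theta>))" by (rule J_ex)
  show ?thesis
   using field_Wp[OF g g1] decomposable_field[OF J_\<pi> g1 g2] field_Wp[OF g2 f[of n, unfolded x_def]] by eventually_elim simp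
 qed
 then have all: "AE s in M. \<forall>n. f n s = upow (H s) (Uf s) (int n * p) (\<pi>f s a (upow (H s) (Uf s) (int n * q) (g s)))"
  by (simp add: AE_all_countable)
 show ?thesis
  unfolding x_def[symmetric]
 proof (rule graph_limit_dominated[OF J_average[OF f] _ _ u v])
  \<comment> \<open>The fibre representations are contractive and the powers isometric, so this one
    function dominates the averages for all \<open>N\<close>.\<close>
  show "integrable M (\<lambda>s. (norm a * norm (g s))\<^sup>2)"
   using J_integrable[OF g] by (simp add: power_mult_distrib)
  show "AE s in M. \<forall>N. norm (average (\<lambda>n. f n s) N) <= norm a * norm (g s)"
   using all fibre AE_space
  proof eventually_elim
   case (elim s)
   interpret E: ergodic_fibre "H s" "Uf s" "\<pi>f s" "\<Psi> s" "Ve s" "We s" tens using elim(2) by simp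
   note gs = field_mem[OF g elim(3)]
   have "norm (f n s) <= norm a * norm (g s)" for n
    using elim(1) star_representation_contractive[OF E.rep E.upow_mem[OF gs, of "int n * q"], of a]
    by (simp add: E.upow_norm E.upow_mem E.r(8) gs)
   then show ?case by (auto intro!: norm_average_le)
  qed
  show "AE s in M. (\<lambda>N. average (\<lambda>n. f n s) N) \<longlonglongrightarrow> B s (u s) (v s)"
   using all lim by eventually_elim simp
 qed
qed

lemma graph_limit_\<pi>: "graph_limit B (\<pi> a \<Omega>) \<xi> (average (\<lambda>n. Wp (int n * k) (\<pi> a (Wp (int n) \<xi>))))"
proof -
 obtain u where u: "u \<in> J (\<pi> a \<Omega>)" by (rule J_ex)
 obtain v where v: "v \<in> J \<xi>" by (rule J_ex)
 obtain \<omega> where \<omega>: "\<omega> \<in> J \<Omega>" by (rule J_ex)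
 have "AE s in M. average (\<lambda>n. upow (H s) (Uf s) (int n * k) (\<pi>f s a (upow (H s) (Uf s) (int n * 1) (v s)))) \<longlonglongrightarrow> B s (u s) (v s)"
  using decomposable_field[OF J_\<pi> \<omega> u] field_\<Omega>[OF \<omega>] fibre AE_space
 proof eventually_elim
  case (elim s)
  interpret E: ergodic_fibre "H s" "Uf s" "\<pi>f s" "\<Psi> s" "Ve s" "We s" tens using elim(3) by simp
  from E.fibre_average[OF k field_mem[OF v elim(4)], of a] elim show ?case
   by (simp add: E.twisted_def[abs_def] E.V_op_def)
 qed
 from graph_limit_fibres[OF u v v this] show ?thesis by simp
qed

lemma graph_limit_cyclic: "graph_limit B \<eta> (\<pi> a \<Omega>) (average (\<lambda>n. Wp (int n * (k + 1)) (\<pi> a (Wp (- int n) \<eta>))))"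
proof -
 obtain u where u: "u \<in> J \<eta>" by (rule J_ex)
 obtain v where v: "v \<in> J (\<pi> a \<Omega>)" by (rule J_ex)
 obtain \<omega> where \<omega>: "\<omega> \<in> J \<Omega>" by (rule J_ex)
 have "AE s in M. average (\<lambda>n. upow (H s) (Uf s) (int n * (k + 1)) (\<pi>f s a (upow (H s) (Uf s) (int n * - 1) (u s)))) \<longlonglongrightarrow> B s (u s) (v s)"
  using decomposable_field[OF J_\<pi> \<omega> v] field_\<Omega>[OF \<omega>] fibre AE_space
 proof eventually_elim
  case (elim s)
  interpret E: ergodic_fibre "H s" "Uf s" "\<pi>f s" "\<Psi> s" "Ve s" "We s" tens using elim(3) by simp
  from E.fibre_average_commutant[OF k field_mem[OF u elim(4)], of a] elim show ?case
   by (simp add: E.V_op_def)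
 qed
 from graph_limit_fibres[OF u v u this] show ?thesis by simp
qed

section \<open>Averages with operators in the von Neumann algebra and in its commutant\<close>

definition orbit_average :: "('h => 'h) => 'h => nat => 'h" where
 "orbit_average X \<xi> = average (\<lambda>n. Wp (int n * k) (X (Wp (int n) \<xi>)))"

lemma orbit_average_bound:
 assumes X: "!!n. norm (X (Wp (int n) \<xi>) - Y (Wp (int n) \<eta>)) <= e"
 shows "norm (orbit_average X \<xi> N - orbit_average Y \<eta> N) <= e"
 unfolding orbit_average_def average_diff[symmetric]
proof (rule norm_average_le)
 fix n
 have "Wp (int n * k) (X (Wp (int n) \<xi>)) - Wp (int n * k) (Y (Wp (int n) \<eta>)) = Wp (int n * k) (X (Wp (int n) \<xi>) - Y (Wp (int n) \<eta>))"
  by (simp add: W.upow_linear)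
 then show "norm (Wp (int n * k) (X (Wp (int n) \<xi>)) - Wp (int n * k) (Y (Wp (int n) \<eta>))) <= e"
  using X[of n] by (simp add: W.upow_norm)
qed (rule order_trans[OF norm_ge_zero X])

definition good :: "('h => 'h) => bool" where
 "good X \<longleftrightarrow> (\<forall>\<xi>. graph_limit B (X \<Omega>) \<xi> (orbit_average X \<xi>))"

lemma approximable:
 assumes "closure D = (UNIV :: 'h set)" "e > 0"
 obtains d where "d \<in> D" "norm (x - d) < e"
proof -
 have "x \<in> closure D" using assms by simp
 then obtain d where "d \<in> D" "dist d x < e" using assms(2) unfolding closure_approachable by auto
 then show ?thesis using that by (simp add: dist_norm norm_minus_commute)
qed

text \<open>For bounded \<open>X\<close> the averages are Lipschitz in \<open>\<xi>\<close>
  uniformly in \<open>N\<close>, so a dense set of vectors decides.\<close>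

lemma good_dense:
 assumes X: "bounded_op UNIV X" and D: "closure D = UNIV"
  and lim: "!!\<xi>. \<xi> \<in> D ==> graph_limit B (X \<Omega>) \<xi> (orbit_average X \<xi>)"
 shows "good X"
 unfolding good_def
proof (intro allI graph_limit_approximation[OF B_bounded_bilinear])
 fix \<xi> :: 'h and e :: real assume e: "e > 0"
 obtain K where K: "K > 0" "!!x. norm (X x) <= K * norm x" by (rule bounded_opE[OF X]) auto
 define d where "d = min e (e / K)"
 have d: "d > 0" "d <= e" "K * d <= e" using e K(1) by (auto simp: d_def min_def field_simps)
 obtain \<xi>' where \<xi>': "\<xi>' \<in> D" "norm (\<xi> - \<xi>') < d" by (rule approximable[OF D d(1)]) auto
 have "norm (orbit_average X \<xi> N - orbit_average X \<xi>' N) <= e" for N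
 proof (rule orbit_average_bound)
  fix n
  have "X (Wp (int n) \<xi>) - X (Wp (int n) \<xi>') = X (Wp (int n) (\<xi> - \<xi>'))"
   by (simp add: W.upow_linear bounded_op_more(3)[OF X closed_csubspace_UNIV])
  then have "norm (X (Wp (int n) \<xi>) - X (Wp (int n) \<xi>')) <= K * norm (\<xi> - \<xi>')"
   using K(2)[of "Wp (int n) (\<xi> - \<xi>')"] by (simp add: W.upow_norm)
  also have "... <= e" using mult_left_mono[of "norm (\<xi> - \<xi>')" d K] \<xi>'(2) K(1) d(3) by linarith
  finally show "norm (X (Wp (int n) \<xi>) - X (Wp (int n) \<xi>')) <= e" .
 qed
 then show "graph_approx B (X \<Omega>) \<xi> (orbit_average X \<xi>) e"
   unfolding graph_approx_def
  using lim[OF \<xi>'(1)] \<xi>'(2) d(2) e by (intro exI[of _ "X \<Omega>"] exI[of _ \<xi>'] exI[of _ "orbit_average X \<xi>'"]) auto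
qed

lemma Wp_\<Omega>: "Wp m \<Omega> = \<Omega>"
 using W.upow_eigen[of \<Omega> 1 m] by (simp add: W_\<Omega>)

text \<open>On \<open>\<xi> = C \<Omega>\<close> with \<open>C\<close> in the commutant,
  \<open>X\<close> can be moved to \<open>\<Omega>\<close>: the terms are conjugates of
  \<open>C\<close> applied to \<open>X \<Omega>\<close>, uniformly bounded by \<open>K\<close>.
  Approximating the single vector \<open>X \<Omega>\<close> by \<open>\<pi> a \<Omega>\<close>
  therefore controls all terms at once.\<close>

lemma good_bicommutant:
 assumes X: "X \<in> bicommutant UNIV (range \<pi>)"
 shows "good X"
proof (rule good_dense[OF _ cyclic'])
 show "bounded_op UNIV X" using X unfolding bicommutant_def by (rule commutantD)
 fix \<xi> assume "\<xi> \<in> {B \<Omega> |B. B \<in> commutant UNIV (range \<pi>)}"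
 then obtain C where C: "\<xi> = C \<Omega>" "C \<in> commutant UNIV (range \<pi>)" by auto
 obtain K where K: "K > 0" "!!x. norm (C x) <= K * norm x" by (rule bounded_opE[OF commutantD(1)[OF C(2)]]) auto
 show "graph_limit B (X \<Omega>) \<xi> (orbit_average X \<xi>)"
 proof (rule graph_limit_approximation[OF B_bounded_bilinear])
  fix e :: real assume e: "e > 0"
  define d where "d = min e (e / K)"
  have d: "d > 0" "d <= e" "K * d <= e" using e K(1) by (auto simp: d_def min_def field_simps)
  obtain z where z: "z \<in> range (\<lambda>a. \<pi> a \<Omega>)" "norm (X \<Omega> - z) < d" by (rule approximable[OF cyclic d(1)]) auto
  then obtain a where a: "norm (X \<Omega> - \<pi> a \<Omega>) < d" by auto
  have "norm (orbit_average X \<xi> N - orbit_average (\<pi> a) \<xi> N) <= e" for N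
  proof (rule orbit_average_bound)
   fix n
   define G where "G x = Wp (int n) (C (Wp (- int n) x))" for x
   have G: "G \<in> commutant UNIV (range \<pi>)" unfolding G_def by (rule W_commutant[OF C(2)])
   have \<xi>: "Wp (int n) \<xi> = G \<Omega>" by (simp add: G_def Wp_\<Omega> C(1))
   have "X (G \<Omega>) = G (X \<Omega>)" using X G unfolding bicommutant_def by (intro commutantD(2)) auto
   moreover have "\<pi> a (G \<Omega>) = G (\<pi> a \<Omega>)" using commutantD(2)[OF G, of "\<pi> a" \<Omega>] by simp
   ultimately have "X (Wp (int n) \<xi>) - \<pi> a (Wp (int n) \<xi>) = G (X \<Omega> - \<pi> a \<Omega>)"
    by (simp add: \<xi> bounded_op_more(3)[OF commutantD(1)[OF G] closed_csubspace_UNIV])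
   also have "norm ... <= K * norm (X \<Omega> - \<pi> a \<Omega>)"
    using K(2)[of "Wp (- int n) (X \<Omega> - \<pi> a \<Omega>)"] by (simp add: G_def W.upow_norm)
   also have "... <= e" using mult_left_mono[of "norm (X \<Omega> - \<pi> a \<Omega>)" d K] a K(1) d(3) by linarith
   finally show "norm (X (Wp (int n) \<xi>) - \<pi> a (Wp (int n) \<xi>)) <= e" .
  qed
  then show "graph_approx B (X \<Omega>) \<xi> (orbit_average X \<xi>) e"
   unfolding graph_approx_def
   using a d(2) e graph_limit_\<pi>[of a \<xi>]
   by (intro exI[of _ "\<pi> a \<Omega>"] exI[of _ \<xi>] exI[of _ "orbit_average (\<pi> a) \<xi>"]) (auto simp: orbit_average_def)
 qed
qed

text \<open>For \<open>\<xi> = \<pi> a \<Omega>\<close>, \<open>X\<close> commutes with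
  \<open>W^n \<pi> a W^(-n)\<close>, which acts as some \<open>\<pi> b\<close>. This produces the
  averages of \<open>W^(n(k+1)) \<pi> a W^(-n) X \<Omega>\<close>, the reversed fibre theorem with
  \<open>X \<Omega>\<close> in the first tensor factor.\<close>

lemma good_commutant:
 assumes X: "X \<in> commutant UNIV (range \<pi>)"
 shows "good X"
proof (rule good_dense[OF commutantD(1)[OF X] cyclic])
 fix \<xi> assume "\<xi> \<in> range (\<lambda>a. \<pi> a \<Omega>)"
 then obtain a where a: "\<xi> = \<pi> a \<Omega>" by auto
 have "Wp (int n * k) (X (Wp (int n) \<xi>)) = Wp (int n * (k + 1)) (\<pi> a (Wp (- int n) (X \<Omega>)))" for n
 proof -
  obtain b where b: "!!x. Wp (int n) (\<pi> a x) = \<pi> b (Wp (int n) x)" using W_rep[of "int n" a] by auto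
  have "X (Wp (int n) \<xi>) = \<pi> b (X \<Omega>)" using commutantD(2)[OF X, of "\<pi> b" \<Omega>] by (simp add: a b Wp_\<Omega>)
  also have "... = Wp (int n) (\<pi> a (Wp (- int n) (X \<Omega>)))"
   using W.upow_inverse[of "X \<Omega>" "- int n"] by (simp add: b)
  finally show ?thesis using W.upow_add[of "\<pi> a (Wp (- int n) (X \<Omega>))" "int n * k" "int n"] by (simp add: algebra_simps)
 qed
 then have "orbit_average X \<xi> = average (\<lambda>n. Wp (int n * (k + 1)) (\<pi> a (Wp (- int n) (X \<Omega>))))" by (simp add: orbit_average_def)
 then show "graph_limit B (X \<Omega>) \<xi> (orbit_average X \<xi>)" by (simp add: a graph_limit_cyclic)
qed

lemma good_add:
 assumes "good X" "good Y"
 shows "good (\<lambda>x. X x + Y x)"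
proof -
 have "orbit_average (\<lambda>x. X x + Y x) \<xi> = (\<lambda>N. orbit_average X \<xi> N + orbit_average Y \<xi> N)" for \<xi>
  by (simp add: orbit_average_def W.upow_linear flip: average_add)
 then show ?thesis using assms graph_limit_add[OF B_bounded_bilinear] by (simp add: good_def)
qed

section \<open>Norm limits and the operator \<open>V_X\<close>\<close>

abbreviation "\<XX> \<equiv> norm_closure_ops (op_set_sum (bicommutant UNIV (range \<pi>)) (commutant UNIV (range \<pi>)))"

lemma closure_approximation:
 assumes X: "X \<in> \<XX>" and e: "e > 0"
 obtains A C where "A \<in> bicommutant UNIV (range \<pi>)" "C \<in> commutant UNIV (range \<pi>)"
  "!!x. norm (X x - (A x + C x)) <= e * norm x"
proof -
 obtain A C where AC: "A \<in> bicommutant UNIV (range \<pi>)" "C \<in> commutant UNIV (range \<pi>)" "onorm (\<lambda>x. X x - (A x + C x)) < e"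
  using X e by (auto simp: norm_closure_ops_def op_set_sum_def)
 have "bounded_linear (\<lambda>x. X x - (A x + C x))"
  using X AC(1,2) unfolding bicommutant_def
  by (intro bounded_linear_sub bounded_linear_add bounded_op_bounded_linear) (auto simp: norm_closure_ops_def dest: commutantD(1))
 then have "norm (X x - (A x + C x)) <= e * norm x" for x
  using onorm[of "\<lambda>x. X x - (A x + C x)" x] AC(3) by (meson less_imp_le mult_right_mono norm_ge_zero order_trans)
 with AC(1,2) show ?thesis by (rule that)
qed

lemma good_closure:
 assumes X: "X \<in> \<XX>"
 shows "good X"
 unfolding good_def
proof (intro allI graph_limit_approximation[OF B_bounded_bilinear])
 fix \<xi> :: 'h and e :: real assume e: "e > 0"
 define d where "d = e / (norm \<Omega> + norm \<xi> + 1)"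
 have pos: "norm \<Omega> + norm \<xi> + 1 > 0" by (simp add: add_nonneg_pos)
 then have d: "d > 0" using e by (simp add: d_def)
 obtain A C where AC: "A \<in> bicommutant UNIV (range \<pi>)" "C \<in> commutant UNIV (range \<pi>)"
  "!!x. norm (X x - (A x + C x)) <= d * norm x" by (rule closure_approximation[OF X d]) (rule that)
 have d_le: "d * t <= e" if "t <= norm \<Omega> + norm \<xi> + 1" for t
  using mult_left_mono[OF that less_imp_le[OF d]] pos by (simp add: d_def)
 define Y where "Y x = A x + C x" for x
 have Y: "good Y" unfolding Y_def by (rule good_add[OF good_bicommutant[OF AC(1)] good_commutant[OF AC(2)]])
 have "norm (orbit_average X \<xi> N - orbit_average Y \<xi> N) <= e" for N
  by (rule orbit_average_bound[OF order_trans[OF AC(3)[folded Y_def] d_le]]) (simp add: W.upow_norm)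
 moreover have "norm (X \<Omega> - Y \<Omega>) <= e" by (rule order_trans[OF AC(3)[folded Y_def] d_le]) simp
 ultimately show "graph_approx B (X \<Omega>) \<xi> (orbit_average X \<xi>) e"
   unfolding graph_approx_def
  using Y e by (intro exI[of _ "Y \<Omega>"] exI[of _ \<xi>] exI[of _ "orbit_average Y \<xi>"]) (auto simp: good_def)
qed

text \<open>A central \<open>T\<close> commutes with the algebra and with its commutant, and this
  passes to norm limits. It is applied to diagonalisable operators, which are central.\<close>

lemma closure_commutes:
 assumes X: "X \<in> \<XX>" and T: "T \<in> bicommutant UNIV (range \<pi>)" "T \<in> commutant UNIV (range \<pi>)"
 shows "X (T x) = T (X x)"
proof (rule ccontr)
 assume ne: "X (T x) ~= T (X x)"
 have Tb: "bounded_op UNIV T" using T(2) by (rule commutantD)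
 obtain K where K: "K > 0" "!!x. norm (T x) <= K * norm x" by (rule bounded_opE[OF Tb]) auto
 \<comment> \<open>The approximation of \<open>X\<close> enters twice with the factor
   \<open>K * norm x\<close>; the denominator makes the sum of both errors smaller than the supposed
   difference.\<close>
 define e where "e = norm (X (T x) - T (X x)) / (2 * K * (norm x + 1))"
 have pos: "2 * K * (norm x + 1) > 0" using K(1) by (simp add: add_nonneg_pos)
 then have e: "e > 0" using ne by (simp add: e_def)
 obtain A C where AC: "A \<in> bicommutant UNIV (range \<pi>)" "C \<in> commutant UNIV (range \<pi>)"
  "!!x. norm (X x - (A x + C x)) <= e * norm x" by (rule closure_approximation[OF X e]) (rule that)
 have "A (T x) = T (A x)" using AC(1) T(2) unfolding bicommutant_def by (auto dest: commutantD(2))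
 moreover have "T (C x) = C (T x)" using AC(2) T(1) unfolding bicommutant_def by (auto dest: commutantD(2))
 ultimately have "X (T x) - T (X x) = (X (T x) - (A (T x) + C (T x))) - T (X x - (A x + C x))"
  by (simp add: bounded_op_more(3)[OF Tb closed_csubspace_UNIV] bounded_opD(2)[OF Tb])
 also have "norm ... <= e * norm (T x) + K * (e * norm x)"
  by (intro order_trans[OF norm_triangle_ineq4] add_mono AC(3) order_trans[OF K(2)] mult_left_mono) (use K in auto)
 also have "... <= e * (K * norm x) + K * (e * norm x)" using e K(2)[of x] by simp
 also have "... = e * (2 * K * norm x)" by simp
 also have "... < e * (2 * K * (norm x + 1))" using e K(1) by (intro mult_strict_left_mono) auto
 also have "... = norm (X (T x) - T (X x))" using less_imp_neq[OF pos] unfolding e_def by simp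
 finally show False by simp
qed

text \<open>Cutting a field down to \<open>E\<close> preserves square integrability and respects
  classes, so the operator can be read off through \<open>J\<close>. It localises norm estimates to
  a part of the base.\<close>

lemma indicator_operator:
 assumes E: "E \<in> sets M"
 obtains T where "T \<in> diagonalisable_ops M H \<S> J" "!!\<xi> f. f \<in> J \<xi> ==> (\<lambda>s. indicator E s *\<^sub>C f s) \<in> J (T \<xi>)"
proof -
 have "\<exists>\<eta>. \<forall>f\<in>J \<xi>. (\<lambda>s. indicator E s *\<^sub>C f s) \<in> J \<eta>" for \<xi>
 proof -
  have sq: "square_integrable_field M H \<S> (\<lambda>s. indicator E s *\<^sub>C f s)" if f: "f \<in> J \<xi>" for f
   unfolding square_integrable_field_def
  proof (intro conjI ballI)
   show "indicator E s *\<^sub>C f s \<in> H s" if "s \<in> space M" for s using closed_csubspaceD(4)[OF H[OF that]] field_mem[OF f that]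
   by simp
   show "(\<lambda>s. cinner (indicator E s *\<^sub>C f s) (g s)) \<in> borel_measurable M" if "g \<in> \<S>" for g
    using J_sq[OF f] that E unfolding square_integrable_field_def cinner_scaleC_left by auto
   have "integrable M (\<lambda>s. indicator E s *\<^sub>R (norm (f s))\<^sup>2)" by (rule integrable_mult_indicator[OF E J_integrable[OF f]])
   moreover have "(norm (indicator E s *\<^sub>C f s))\<^sup>2 = indicator E s *\<^sub>R (norm (f s))\<^sup>2" for s
    by (simp add: indicator_def)
   ultimately show "integrable M (\<lambda>s. (norm (indicator E s *\<^sub>C f s))\<^sup>2)" by simp
  qed
  obtain f where f: "f \<in> J \<xi>" by (rule J_ex)
  obtain \<eta> where \<eta>: "(\<lambda>s. indicator E s *\<^sub>C f s) \<in> J \<eta>" using J_surj[OF sq[OF f]]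
  by auto
  have "(\<lambda>s. indicator E s *\<^sub>C g s) \<in> J \<eta>" if g: "g \<in> J \<xi>" for g
  proof -
   have "AE s in M. indicator E s *\<^sub>C g s = indicator E s *\<^sub>C f s" using J_AE[OF f g] by eventually_elim simp
   then show ?thesis using J_class[OF \<eta>] sq[OF g] by (simp add: field_class_def)
  qed
  then show ?thesis by auto
 qed
 then have "\<forall>\<xi>. \<exists>\<eta>. \<forall>f\<in>J \<xi>. (\<lambda>s. indicator E s *\<^sub>C f s) \<in> J \<eta>" by simp
 then obtain T where T: "!!\<xi> f. f \<in> J \<xi> ==> (\<lambda>s. indicator E s *\<^sub>C f s) \<in> J (T \<xi>)" by metis
 have "J (T \<xi>) = decomposable_apply M H \<S> (\<lambda>s x. indicator E s *\<^sub>C x) (J \<xi>)" for \<xi>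
 proof -
  obtain f where f: "f \<in> J \<xi>" by (rule J_ex)
  show ?thesis
  proof (rule decomposable_apply_eqI[symmetric, OF T[OF f] f])
   show "AE s in M. indicator E s *\<^sub>C g s = indicator E s *\<^sub>C f s" if "g \<in> J \<xi>" for g
    using J_AE[OF f that] by eventually_elim simp
  qed
 qed
 moreover have "(indicator E :: 's => complex) \<in> borel_measurable M" using E by simp
 moreover have "AE s in M. cmod (indicator E s) <= 1" by (simp add: indicator_def)
 ultimately have "T \<in> diagonalisable_ops M H \<S> J" unfolding diagonalisable_ops_def by auto
 then show ?thesis using T by (rule that)
qed

text \<open>On the set \<open>E\<close> where \<open>norm (f s) > K\<close>, the indicator operator
  commutes with \<open>X\<close>, and \<open>\<Psi> s\<close> is a unit vector almost everywhere. So
  the integral of \<open>(norm (f s))^2\<close> over \<open>E\<close> is at most \<open>K^2\<close>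
  times the measure of \<open>E\<close>, and \<open>E\<close> is null.\<close>

lemma essentially_bounded:
 assumes X: "X \<in> \<XX>" and f: "f \<in> J (X \<Omega>)" and K: "!!x. norm (X x) <= K * norm x" "K > 0"
 shows "AE s in M. (norm (f s))\<^sup>2 <= K\<^sup>2"
proof -
 define E where "E = {s \<in> space M. (norm (f s))\<^sup>2 > K\<^sup>2}"
 have [measurable]: "(\<lambda>s. (norm (f s))\<^sup>2) \<in> borel_measurable M" by (rule borel_measurable_integrable[OF J_integrable[OF f]])
 have E: "E \<in> sets M" unfolding E_def by simp
 obtain T where T: "T \<in> diagonalisable_ops M H \<S> J" "!!\<xi> f. f \<in> J \<xi> ==> (\<lambda>s. indicator E s *\<^sub>C f s) \<in> J (T \<xi>)"
  by (rule indicator_operator[OF E]) (rule that)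
 obtain \<omega> where \<omega>: "\<omega> \<in> J \<Omega>" by (rule J_ex)
 have int: "integrable M (\<lambda>s. indicator E s * ((norm (f s))\<^sup>2 - K\<^sup>2))"
  using integrable_mult_indicator[OF E, of "\<lambda>s. (norm (f s))\<^sup>2 - K\<^sup>2"] J_integrable[OF f] by simp
 have T\<Omega>: "(norm (T \<Omega>))\<^sup>2 = measure M E"
 proof -
  have "(norm (T \<Omega>))\<^sup>2 = (\<integral>s. (norm (indicator E s *\<^sub>C \<omega> s))\<^sup>2 \<partial>M)" by (rule J_norm[OF T(2)[OF \<omega>]])
  also have "... = (\<integral>s. indicator E s \<partial>M)"
  proof (rule integral_cong_AE)
   show "(\<lambda>s. (norm (indicator E s *\<^sub>C \<omega> s))\<^sup>2) \<in> borel_measurable M"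
    by (rule borel_measurable_integrable[OF J_integrable[OF T(2)[OF \<omega>]]])
   show "AE s in M. (norm (indicator E s *\<^sub>C \<omega> s))\<^sup>2 = indicator E s"
    using field_\<Omega>[OF \<omega>] fibre by eventually_elim (auto simp: norm_scaleC indicator_def ergodic_fibre.norm_\<Psi>)
  qed (use E in simp)
  also have "... = measure M E" using E by simp
  finally show ?thesis .
 qed
 have "(norm (T (X \<Omega>)))\<^sup>2 <= (K * norm (T \<Omega>))\<^sup>2"
  using closure_commutes[OF X, of T \<Omega>] subsetD[OF diagonalisable T(1)] K(1)[of "T \<Omega>"] by (intro power_mono) auto
 then have "(\<integral>s. (norm (indicator E s *\<^sub>C f s))\<^sup>2 \<partial>M) <= K\<^sup>2 * measure M E"
  by (simp add: power_mult_distrib T\<Omega> J_norm[OF T(2)[OF f]])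
 moreover have "(\<integral>s. indicator E s * ((norm (f s))\<^sup>2 - K\<^sup>2) \<partial>M) = (\<integral>s. (norm (indicator E s *\<^sub>C f s))\<^sup>2 \<partial>M) - K\<^sup>2 * measure M E"
 proof -
  have "indicator E s * ((norm (f s))\<^sup>2 - K\<^sup>2) = (norm (indicator E s *\<^sub>C f s))\<^sup>2 - K\<^sup>2 * indicator E s" for s
   by (simp add: indicator_def)
  then show ?thesis using E J_integrable[OF T(2)[OF f]] by (simp add: emeasure_eq_measure)
 qed
 moreover have nonneg: "indicator E s * ((norm (f s))\<^sup>2 - K\<^sup>2) >= 0" for s by (auto simp: E_def indicator_def)
 then have "(\<integral>s. indicator E s * ((norm (f s))\<^sup>2 - K\<^sup>2) \<partial>M) >= 0" by (intro integral_nonneg_AE) auto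
 ultimately have "(\<integral>s. indicator E s * ((norm (f s))\<^sup>2 - K\<^sup>2) \<partial>M) = 0" by simp
 then have "AE s in M. indicator E s * ((norm (f s))\<^sup>2 - K\<^sup>2) = 0"
  using integral_nonneg_eq_0_iff_AE[OF int] nonneg by simp
 then show ?thesis using AE_space
 proof eventually_elim
  case (elim s)
  then show ?case by (cases "s \<in> E") (auto simp: E_def)
 qed
qed

text \<open>Essential boundedness of the field of \<open>X \<Omega>\<close> makes
  \<open>s \<mapsto> f s \<otimes> g s\<close> square integrable. Hence the tensor class is nonempty
  and its image is the class of \<open>\<zeta>\<close>; an empty tensor class would leave
  \<open>inv J\<close> without a meaningful argument.\<close>

lemma V_X_eq:
 assumes X: "X \<in> \<XX>" and \<zeta>: "bilinear_graph B (X \<Omega>) \<xi> \<zeta>"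
 shows "V_X tens M H \<S> J V \<Omega> X \<xi> = \<zeta>"
proof -
 obtain f where f: "f \<in> J (X \<Omega>)" by (rule J_ex)
 obtain g where g: "g \<in> J \<xi>" by (rule J_ex)
 obtain h where h: "h \<in> J \<zeta>" by (rule J_ex)
 have "bounded_op UNIV X" using X by (simp add: norm_closure_ops_def)
 then obtain K where K: "K > 0" "!!x. norm (X x) <= K * norm x" by (rule bounded_opE) auto
 define t where "t s = tens (f s) (g s)" for s
 have "square_integrable_field M (\<lambda>s. tensor_space tens (H s)) (tensor_fields tens \<S>) t"
  unfolding square_integrable_field_def
 proof (intro conjI ballI)
  fix s assume s: "s \<in> space M"
  have "tens (f s) (g s) \<in> cspan {tens x y |x y. x \<in> H s \<and> y \<in> H s}"
   using field_mem[OF f s] field_mem[OF g s]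
   by (force simp: cspan_def intro!: exI[of _ "{tens (f s) (g s)}"] exI[of _ "\<lambda>_. 1"])
  then show "t s \<in> tensor_space tens (H s)" using closure_subset by (auto simp: tensor_space_def t_def)
 next
  fix u assume "u \<in> tensor_fields tens \<S>"
  then obtain x y where "u = (\<lambda>s. tens (x s) (y s))" "x \<in> \<S>" "y \<in> \<S>" by (auto simp: tensor_fields_def)
  then show "(\<lambda>s. cinner (t s) (u s)) \<in> borel_measurable M"
   using J_sq[OF f] J_sq[OF g] by (auto simp: t_def te square_integrable_field_def intro!: borel_measurable_times)
 next
  show "integrable M (\<lambda>s. (norm (t s))\<^sup>2)"
  proof (rule Bochner_Integration.integrable_bound)
   show "integrable M (\<lambda>s. K\<^sup>2 * (norm (g s))\<^sup>2)" using J_integrable[OF g] by simp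
   show "(\<lambda>s. (norm (t s))\<^sup>2) \<in> borel_measurable M"
    using J_integrable[OF f] J_integrable[OF g] by (auto simp: t_def te power_mult_distrib)
   show "AE s in M. norm ((norm (t s))\<^sup>2) <= norm (K\<^sup>2 * (norm (g s))\<^sup>2)"
    using essentially_bounded[OF X f K(2,1)]
    by eventually_elim (simp add: t_def te power_mult_distrib abs_mult mult_right_mono)
  qed
 qed
 then have t: "t \<in> tensor_class tens M H \<S> (J (X \<Omega>)) (J \<xi>)"
  using f g unfolding tensor_class_def by (auto simp: t_def)
 have "decomposable_apply M H \<S> V (tensor_class tens M H \<S> (J (X \<Omega>)) (J \<xi>)) = J \<zeta>"
 proof (rule decomposable_apply_eqI[OF h t])
  fix t' assume "t' \<in> tensor_class tens M H \<S> (J (X \<Omega>)) (J \<xi>)"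
  then obtain f' g' where *: "f' \<in> J (X \<Omega>)" "g' \<in> J \<xi>" "AE s in M. t' s = tens (f' s) (g' s)" by (auto simp: tensor_class_def)
  show "AE s in M. V s (t' s) = h s" using *(3) bilinear_graphD[OF \<zeta> *(1,2) h] by eventually_elim simp
 qed
 then show ?thesis by (simp add: V_X_def J_inj)
qed

theorem orbit_average_tendsto:
 assumes X: "X \<in> \<XX>"
 shows "orbit_average X \<xi> \<longlonglongrightarrow> V_X tens M H \<S> J V \<Omega> X \<xi>"
 using good_closure[OF X] V_X_eq[OF X] by (auto simp: good_def graph_limit_def)

text \<open>Linearity and the norm bound of \<open>X\<close> pass from the averages to their limit,
  as the powers of \<open>W\<close> are linear isometries.\<close>

lemma V_X_bounded_op:
 assumes X: "X \<in> \<XX>"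
 shows "bounded_op UNIV (V_X tens M H \<S> J V \<Omega> X)"
proof -
 define L where "L = V_X tens M H \<S> J V \<Omega> X"
 have Xb: "bounded_op UNIV X" using X by (simp add: norm_closure_ops_def)
 obtain K where K: "K > 0" "!!x. norm (X x) <= K * norm x" by (rule bounded_opE[OF Xb]) auto
 have lim: "orbit_average X \<xi> \<longlonglongrightarrow> L \<xi>" for \<xi> unfolding L_def by (rule orbit_average_tendsto[OF X])
 note lin = W.upow_linear bounded_opD(2,3)[OF Xb]
 have "L (\<xi> + \<eta>) = L \<xi> + L \<eta>" for \<xi> \<eta>
 proof (rule LIMSEQ_unique[OF lim])
  have "orbit_average X (\<xi> + \<eta>) = (\<lambda>N. orbit_average X \<xi> N + orbit_average X \<eta> N)"
   by (simp add: orbit_average_def lin flip: average_add)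
  then show "orbit_average X (\<xi> + \<eta>) \<longlonglongrightarrow> L \<xi> + L \<eta>" using tendsto_add[OF lim lim] by simp
 qed
 moreover have "L (c *\<^sub>C \<xi>) = c *\<^sub>C L \<xi>" for c \<xi>
 proof (rule LIMSEQ_unique[OF lim])
  have "bounded_op (UNIV :: 'h set) (scaleC c)"
   by (rule bounded_opI[where K = "cmod c"]) (auto simp: scaleC_add_right scaleC_scaleC norm_scaleC mult.commute)
  then have "orbit_average X (c *\<^sub>C \<xi>) = (\<lambda>N. c *\<^sub>C orbit_average X \<xi> N)"
   by (simp add: orbit_average_def lin bounded_op_average closed_csubspace_UNIV)
  then show "orbit_average X (c *\<^sub>C \<xi>) \<longlonglongrightarrow> c *\<^sub>C L \<xi>" using tendsto_scaleC[OF lim] by simp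
 qed
 moreover have "norm (L \<xi>) <= K * norm \<xi>" for \<xi>
 proof (rule tendsto_upperbound[OF tendsto_norm[OF lim]])
  have "norm (orbit_average X \<xi> N) <= K * norm \<xi>" for N
   unfolding orbit_average_def using K(2)[of "Wp _ \<xi>"] K(1) by (intro norm_average_le) (simp_all add: W.upow_norm)
  then show "\<forall>\<^sub>F N in sequentially. norm (orbit_average X \<xi> N) <= K * norm \<xi>" by simp
 qed simp
 ultimately show ?thesis unfolding L_def[symmetric] by (intro bounded_opI) auto
qed

end

text \<open>If the restricted set function is not a measure, or its argument is not measurable, the
  left side is 0 by the convention of \<open>measure_of\<close>; otherwise both sides agree. Thus
  \<open>E\<close> may be arbitrary.\<close>

lemma emeasure_restrict_space_le: "emeasure (restrict_space M E) A <= emeasure M A"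
 unfolding restrict_space_def emeasure_measure_of_conv by simp

text \<open>The exceptional set is transferred by the comparison of measures, so that the set of
  extremal states can be used as \<open>E\<close> without a proof of its measurability.\<close>

lemma AE_restrict_spaceI:
 assumes "AE x in M. P x"
 shows "AE x in restrict_space M E. P x"
proof -
 obtain N where N: "{x \<in> space M. \<not> P x} \<subseteq> N" "emeasure M N = 0" "N \<in> sets M" using AE_E[OF assms] .
 have "emeasure M (E \<inter> N) = 0" using emeasure_mono[of "E \<inter> N" N M] N(2,3) by simp
 then have "emeasure (restrict_space M E) (E \<inter> N) = 0" using emeasure_restrict_space_le[of M E "E \<inter> N"] by simp
 then show ?thesis
  by (rule AE_I[rotated]) (use N in \<open>auto simp: space_restrict_space sets_restrict_space\<close>)
qed

lemma finite_measure_restrict_spaceI: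
 assumes "finite_measure M"
 shows "finite_measure (restrict_space M E)"
 using emeasure_restrict_space_le[of M E "space (restrict_space M E)"] finite_measure.emeasure_finite[OF assms]
 by (intro finite_measureI) (auto simp: top_unique)

lemma upow_UNIV: "upow UNIV U = int_iter U"
 by (simp add: fun_eq_iff upow_def int_iter_def)

lemma surj_int_iter:
 assumes "bij f"
 shows "surj (int_iter f m)"
 using bij_fn[OF assms] bij_fn[OF bij_imp_bij_inv[OF assms]] by (auto simp: int_iter_def bij_def)

theorem theorem5p2:
  fixes \<alpha> :: "'a::unital_cstar_algebra \<Rightarrow> 'a" and \<omega> :: "'a \<Rightarrow> complex"
    and k l :: int
    and \<pi> :: "'a \<Rightarrow> 'h::complex_hilbert_space \<Rightarrow> 'h" and U :: "'h \<Rightarrow> 'h" and \<Omega> :: 'h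
    and \<nu> :: "('a \<Rightarrow> complex) measure" and F :: "('a \<Rightarrow> complex) set"
    and Hf :: "('a \<Rightarrow> complex) \<Rightarrow> 'k::complex_hilbert_space set"
    and \<pi>f :: "('a \<Rightarrow> complex) \<Rightarrow> 'a \<Rightarrow> 'k \<Rightarrow> 'k" and Uf :: "('a \<Rightarrow> complex) \<Rightarrow> 'k \<Rightarrow> 'k"
    and \<Psi> :: "('a \<Rightarrow> complex) \<Rightarrow> 'k"
    and J :: "'h \<Rightarrow> (('a \<Rightarrow> complex) \<Rightarrow> 'k) set"
    and Ve We :: "('a \<Rightarrow> complex) \<Rightarrow> complex \<Rightarrow> 'k \<Rightarrow> 'k"
    and tens :: "'k \<Rightarrow> 'k \<Rightarrow> 't::complex_hilbert_space"
    and \<beta> :: "'a \<Rightarrow> 'a" and Ul :: "'h \<Rightarrow> 'h" and Z \<XX> :: "('h \<Rightarrow> 'h) set"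
    and \<mu> :: "('a \<Rightarrow> complex) measure" and V :: "('a \<Rightarrow> complex) \<Rightarrow> 't \<Rightarrow> 'k"
  assumes "\<beta> = int_iter \<alpha> l"
    and "Ul = int_iter U l"
    and "Z = commutant UNIV (range \<pi>) \<inter> commutant UNIV {Ul}"
    and "\<mu> = restrict_space \<nu> (ergodic_states \<beta>)"
    and "V = (\<lambda>\<psi> t. if \<psi> \<in> F then V_fibre k tens (Hf \<psi>) (Uf \<psi>) (\<Psi> \<psi>) (Ve \<psi>) (We \<psi>) t else 0)"
    and "\<XX> = norm_closure_ops
               (op_set_sum (bicommutant UNIV (range \<pi>)) (commutant UNIV (range \<pi>)))"
    and "cstar_dynamical_system \<alpha> \<omega>"
    and "\<exists>D::'a set. countable D \<and> closure D = UNIV"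
    and "state_support \<omega> \<in> bidual_centre"
    and "k \<notin> {-1, 0}" and "l \<noteq> 0"
    and "covariant_GNS \<alpha> \<omega> UNIV \<pi> U \<Omega>"
    and "Z \<subseteq> bicommutant UNIV (range \<pi>) \<inter> commutant UNIV (range \<pi>)"
    and "orthogonal_measure \<omega> \<pi> \<Omega> Z \<nu>"
    and "\<And>\<psi>. \<psi> \<in> ergodic_states \<beta> \<Longrightarrow> covariant_GNS \<beta> \<psi> (Hf \<psi>) (\<pi>f \<psi>) (Uf \<psi>) (\<Psi> \<psi>)"
    and "direct_integral_identification \<pi> Ul \<Omega> Z \<mu> Hf \<pi>f Uf \<Psi> J"
    and "F \<in> sets \<nu>" and "F \<subseteq> ergodic_states \<beta>" and "AE \<psi> in \<nu>. \<psi> \<in> F"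
    and "\<And>\<psi>. \<psi> \<in> F \<Longrightarrow> state_support \<psi> \<in> bidual_centre"
    and "hilbert_tensor tens"
    and "\<And>\<psi>. \<psi> \<in> F \<Longrightarrow> eigen_unitaries (Hf \<psi>) (\<pi>f \<psi>) (Uf \<psi>) (Ve \<psi>) (We \<psi>)"
  shows "\<forall>X \<in> \<XX>.
           bounded_op UNIV (V_X tens \<mu> Hf (GNS_fields \<pi>f \<Psi>) J V \<Omega> X) \<and>
           (\<forall>\<xi>. (\<lambda>N. (1 / real N) *\<^sub>R
                      (\<Sum>n<N. int_iter U (int n * k * l) (X (int_iter U (int n * l) \<xi>))))
                \<longlonglongrightarrow> V_X tens \<mu> Hf (GNS_fields \<pi>f \<Psi>) J V \<Omega> X \<xi>)"
proof -
 note defs = assms(1-6)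
 have \<alpha>: "bij \<alpha>" and \<omega>: "\<omega> \<in> states"
  using assms(7) by (auto simp: cstar_dynamical_system_def star_automorphism_def invariant_states_def)
 note G = covariant_GNSD[OF assms(12)]
 interpret U: unitary_on_subspace UNIV U by (rule G(2))
 have Ul: "Ul = upow UNIV U l" by (simp add: defs(2) upow_UNIV)
 \<comment> \<open>The averages run over powers of \<open>U^l\<close>; this reads them as powers of
   \<open>U\<close> with exponents multiplied by \<open>l\<close>.\<close>
 have Wp: "upow UNIV Ul m = upow UNIV U (m * l)" for m unfolding Ul by (rule ext) (rule U.upow_iterate, simp)
 note D = assms(16)[unfolded direct_integral_identification_def Let_def]
 have \<nu>: "prob_space \<nu>" using assms(14) by (simp add: orthogonal_measure_def)
 interpret ergodic_decomposition \<mu> Hf \<pi>f \<Psi> J \<pi> Ul \<Omega> Uf Ve We tens V k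
 proof (intro ergodic_decomposition.intro hilbert_direct_integral.intro ergodic_decomposition_axioms.intro hilbert_direct_integral_axioms.intro)
  show "finite_measure \<mu>" unfolding defs(4) by (rule finite_measure_restrict_spaceI) (rule prob_space.finite_measure[OF \<nu>])
  show "unitary_onto_direct_integral \<mu> Hf (GNS_fields \<pi>f \<Psi>) J" using D by simp
  show "star_representation UNIV \<pi>" "closure (range (\<lambda>a. \<pi> a \<Omega>)) = UNIV" by (rule G)+
  show "unitary_on_subspace UNIV Ul" unfolding Ul by (rule U.unitary_on_subspace_upow)
  show "Ul \<Omega> = \<Omega>" using U.upow_eigen[of \<Omega> 1 l] by (simp add: Ul G(6))
  show "closure {B \<Omega> |B. B \<in> commutant UNIV (range \<pi>)} = UNIV"
   by (rule central_support_cyclic_commutant[OF G(1,3,4) \<omega> G(5) assms(9)])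
  show "\<exists>b. \<forall>x. upow UNIV Ul m (\<pi> a x) = \<pi> b (upow UNIV Ul m x)" for m a
   using GNS_upow_representation[OF assms(12) bij_is_surj[OF \<alpha>], of "m * l" a] by (simp add: Wp)
  show "(\<lambda>x. upow UNIV Ul m (B (upow UNIV Ul (- m) x))) \<in> commutant UNIV (range \<pi>)" if "B \<in> commutant UNIV (range \<pi>)" for m B
   using GNS_commutant_conj[OF assms(12) bij_is_surj[OF \<alpha>] that, of "m * l"] by (simp add: Wp)
  show "closed_csubspace (Hf s)" if "s \<in> space \<mu>" for s
   using that assms(15)[of s] by (simp add: defs(4) space_restrict_space covariant_GNS_def)
  show "J (\<pi> a \<xi>) = decomposable_apply \<mu> Hf (GNS_fields \<pi>f \<Psi>) (\<lambda>s. \<pi>f s a) (J \<xi>)"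
   "J (Ul \<xi>) = decomposable_apply \<mu> Hf (GNS_fields \<pi>f \<Psi>) Uf (J \<xi>)" for a \<xi> using D by blast+
  show "J \<Omega> = field_class \<mu> Hf (GNS_fields \<pi>f \<Psi>) \<Psi>" using D by blast
  show "diagonalisable_ops \<mu> Hf (GNS_fields \<pi>f \<Psi>) J \<subseteq> bicommutant UNIV (range \<pi>) \<inter> commutant UNIV (range \<pi>)"
   using D assms(13) by simp
  show "k ~= 0" "k + 1 ~= 0" using assms(10) by auto
  show "AE s in \<mu>. ergodic_fibre (Hf s) (Uf s) (\<pi>f s) (\<Psi> s) (Ve s) (We s) tens
   \<and> V s = V_fibre k tens (Hf s) (Uf s) (\<Psi> s) (Ve s) (We s)"
   using AE_restrict_spaceI[OF assms(19), of "ergodic_states \<beta>"] unfolding defs(4)[symmetric]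
  proof eventually_elim
   case (elim s)
   \<comment> \<open>On \<open>F\<close>, which has full measure, \<open>V\<close> is given by
     \<open>V_fibre\<close> and the support is central, so the covariant representation of the
     extremal state is a fibre.\<close>
   then have s: "s \<in> ergodic_states \<beta>" using assms(18) by blast
   show ?case
    using ergodic_fibre_GNS[OF assms(15)[OF s] s _ assms(20)[OF elim] assms(21) assms(22)[OF elim]] surj_int_iter[OF \<alpha>] elim
    by (simp add: defs(1,5) fun_eq_iff)
  qed
 qed (rule assms(21))
 have "orbit_average X \<xi> = (\<lambda>N. (1 / real N) *\<^sub>R (\<Sum>n<N. int_iter U (int n * k * l) (X (int_iter U (int n * l) \<xi>))))" for X \<xi>
  by (simp add: orbit_average_def average_def fun_eq_iff Wp flip: upow_UNIV)
 then show ?thesis unfolding defs(6) using V_X_bounded_op orbit_average_tendsto by metis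
qed

end
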